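(* Let $u$ be a non-negative, locally bounded, local weak solution in $\Omega_T$ to $\partial_t u-\operatorname{div}A(x,t,u,Du)=B(x,t,u,Du)$ under the structure conditions with constants $C_o,C_1>0$, $C\ge 0$, and assume $u\in L^r_{loc}(\Omega_T)$ for some $r>1$. Put $\lambda_{i,r}=N(p_i-2)+pr$. Then there exists a positive constant $\gamma$, depending on the data $\{N,p_i,C_o,C_1\}$, such that for all $t,\rho>0$ with $\mathbb K_{2\rho}\times[0,t]\subset\Omega_T$, setting $\nu_\Sigma=\sum_{k=1}^N\left(\frac t{\rho^p}\right)^{\frac1{2-p_k}}$, either $C^{p_i}\rho^p>\min\{1,\nu_\Sigma^{p_i}\}$ for some $i\in\{1,\dots,N\}$, or $$\sup_{0\le\tau\le t}\int_{\mathbb K_\rho}u^r(x,\tau)\,dx\le\gamma\int_{\mathbb K_{2\rho}}u^r(x,0)\,dx+\gamma\sum_{i=1}^N\left(\frac{t^r}{\rho^{\lambda_{i,r}}}\right)^{\frac1{2-p_i}}.$$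
   Context: Setting. $\Omega\subset\mathbb R^N$ is open and bounded, $T>0$, $\Omega_T=\Omega\times[0,T]$. Exponents $1<p_1\le\dots\le p_N<2$; $p=N/\big(\sum_{i=1}^N 1/p_i\big)$ is their harmonic mean, with $p<N$. Equation. $\partial_t u-\operatorname{div}A(x,t,u,Du)=B(x,t,u,Du)$ in $\Omega_T$, where $A=(A_1,\dots,A_N):\Omega_T\times\mathbb R^{N+1}\to\mathbb R^N$ and $B:\Omega_T\times\mathbb R^{N+1}\to\mathbb R$ are Carathéodory functions satisfying, for a.e. $(x,t)\in\Omega_T$, all $(s,\xi)\in\mathbb R\times\mathbb R^N$ and all $i$, the structure conditions $A_i(x,t,s,\xi)\xi_i\ge C_o|\xi_i|^{p_i}-C^{p_i}$, $|A_i(x,t,s,\xi)|\le C_1|\xi_i|^{p_i-1}+C^{p_i-1}$, $|B(x,t,s,\xi)|\le\sum_{i=1}^N C(|\xi_i|^{p_i-1}+C^{p_i-1})$, with constants $C_o,C_1>0$, $C\ge0$. Function spaces. $W^{1,\mathbf p}_{o}(\Omega)=\{u\in W^{1,1}_o(\Omega):\partial_iu\in L^{p_i}_{loc}(\Omega)\}$ and $W^{1,\mathbf p}_{loc}(\Omega)=\{u\in W^{1,1}_{loc}(\Omega):\partial_iu\in L^{p_i}_{loc}(\Omega)\}$; $L^{\mathbf p}_{loc}(0,T;W^{1,\mathbf p}_{loc}(\Omega))$ (resp. with $W^{1,\mathbf p}_o$) is the set of $u\in L^1_{loc}(0,T;W^{1,1}_{loc}(\Omega))$ (resp. $W^{1,1}_o$)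 with $\partial_iu\in L^{p_i}_{loc}(0,T;L^{p_i}_{loc}(\Omega))$ for all $i$. Weak solutions. A local weak sub(super)-solution is $u\in C(0,T;L^2_{loc}(\Omega))\cap L^{\mathbf p}_{loc}(0,T;W^{1,\mathbf p}_{loc}(\Omega))$ such that for all $0\le t_1\le t_2\le T$ and all compact $K\subset\subset\Omega$, $$\int_K u\varphi\,dx\Big|_{t_1}^{t_2}+\int_{t_1}^{t_2}\!\!\int_K\Big\{-u\,\partial_\tau\varphi+\sum_iA_i(x,\tau,u,Du)\,\partial_i\varphi\Big\}dx\,d\tau\le(\ge)\int_{t_1}^{t_2}\!\!\int_KB(x,\tau,u,Du)\varphi\,dx\,d\tau$$ for all non-negative $\varphi\in W^{1,2}_{loc}(0,T;L^2_{loc}(\Omega))\cap L^{\mathbf p}_{loc}(0,T;W^{1,\mathbf p}_o(\Omega))$. A local weak solution is both a sub- and a super-solution. Standard anisotropic cubes. For $a,\rho>0$, $\mathbb K_{a\rho}=\prod_{i=1}^N\big\{|x_i|<(a\rho)^{\frac p{p_i}}\big\}$.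
   Formalization: The constant γ is allowed to depend on r as well as on {N, p_i, C_o, C_1}; a γ independent of r is impossible, as explicit separable solutions (C_1 t)^{1/(2-p)} c (x_1+a)^{-p/(2-p)} with large C_1 show when r tends to infinity. *)

theory Defs
  imports "HOL-Analysis.Analysis"
begin

text \<open>
  Functions on space-time are functions of pairs \<open>z = (x, t)\<close>, and functions defined on a subset of
  the ambient space are represented by total functions whose values outside it are irrelevant.
  The suffix ``loc'' always refers to compact subsets of the indicated set. The cylinder
  \<open>\<Omega>\<^sub>T = \<Omega> \<times> [0,T]\<close> contains its bottom and its top, so that being local in time means being local
  with respect to the closed interval \<open>[0,T]\<close>.
\<close>

section \<open>Lebesgue spaces and weak derivatives\<close>

definition Lq :: "real \<Rightarrow> 'a::euclidean_space set \<Rightarrow> ('a \<Rightarrow> real) \<Rightarrow> bool" where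
  "Lq q S f \<longleftrightarrow> set_borel_measurable lebesgue S f \<and>
     set_integrable lebesgue S (\<lambda>x. \<bar>f x\<bar> powr q)"

definition Lq_loc :: "real \<Rightarrow> 'a::euclidean_space set \<Rightarrow> ('a \<Rightarrow> real) \<Rightarrow> bool" where
  "Lq_loc q S f \<longleftrightarrow> (\<forall>K. compact K \<and> K \<subseteq> S \<longrightarrow> Lq q K f)"

definition locally_bounded :: "'a::euclidean_space set \<Rightarrow> ('a \<Rightarrow> real) \<Rightarrow> bool" where
  "locally_bounded S f \<longleftrightarrow>
     (\<forall>K. compact K \<and> K \<subseteq> S \<longrightarrow> (\<exists>M. AE x\<in>K in lebesgue. \<bar>f x\<bar> \<le> M))"

abbreviation partial_deriv :: "'a::euclidean_space \<Rightarrow> ('a \<Rightarrow> real) \<Rightarrow> 'a \<Rightarrow> real" where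
  "partial_deriv b f \<equiv> \<lambda>x. frechet_derivative f (at x) b"

primrec Ck :: "nat \<Rightarrow> ('a::euclidean_space \<Rightarrow> real) \<Rightarrow> bool" where
  "Ck 0 f \<longleftrightarrow> continuous_on UNIV f"
| "Ck (Suc k) f \<longleftrightarrow> (\<forall>x. f differentiable (at x)) \<and> (\<forall>b\<in>Basis. Ck k (partial_deriv b f))"

definition Cc_infinity :: "'a::euclidean_space set \<Rightarrow> ('a \<Rightarrow> real) \<Rightarrow> bool" where
  "Cc_infinity S \<eta> \<longleftrightarrow> (\<forall>k. Ck k \<eta>) \<and> (\<exists>K. compact K \<and> K \<subseteq> S \<and> (\<forall>x. x \<notin> K \<longrightarrow> \<eta> x = 0))"

definition has_weak_deriv ::
  "'a::euclidean_space set \<Rightarrow> 'a \<Rightarrow> ('a \<Rightarrow> real) \<Rightarrow> ('a \<Rightarrow> real) \<Rightarrow> bool" where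
  "has_weak_deriv S b f g \<longleftrightarrow> Lq_loc 1 S f \<and> Lq_loc 1 S g \<and>
     (\<forall>\<eta>. Cc_infinity S \<eta> \<longrightarrow>
        (LINT x:S|lebesgue. f x * partial_deriv b \<eta> x) = - (LINT x:S|lebesgue. g x * \<eta> x))"

section \<open>Sobolev spaces\<close>

text \<open>In the following predicates the weak gradient is an additional argument; it is determined by
  the function up to null sets.\<close>

definition W11_loc :: "(real^'n) set \<Rightarrow> (real^'n \<Rightarrow> real) \<Rightarrow> (real^'n \<Rightarrow> real^'n) \<Rightarrow> bool" where
  "W11_loc \<Omega> f Df \<longleftrightarrow> (\<forall>i. has_weak_deriv \<Omega> (axis i 1) f (\<lambda>x. Df x $ i))"

text \<open>\<open>W\<^sup>1\<^sup>,\<^sup>1\<^sub>o(\<Omega>)\<close> is the closure of the test functions in the norm of \<open>W\<^sup>1\<^sup>,\<^sup>1(\<Omega>)\<close>.\<close>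

definition W11_o :: "(real^'n) set \<Rightarrow> (real^'n \<Rightarrow> real) \<Rightarrow> (real^'n \<Rightarrow> real^'n) \<Rightarrow> bool" where
  "W11_o \<Omega> f Df \<longleftrightarrow> W11_loc \<Omega> f Df \<and> Lq 1 \<Omega> f \<and> (\<forall>i. Lq 1 \<Omega> (\<lambda>x. Df x $ i)) \<and>
     (\<exists>\<eta>. (\<forall>m::nat. Cc_infinity \<Omega> (\<eta> m)) \<and>
        (\<lambda>m. LINT x:\<Omega>|lebesgue. \<bar>\<eta> m x - f x\<bar>) \<longlonglongrightarrow> 0 \<and>
        (\<forall>i. (\<lambda>m. LINT x:\<Omega>|lebesgue. \<bar>partial_deriv (axis i 1) (\<eta> m) x - Df x $ i\<bar>) \<longlonglongrightarrow> 0))"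

abbreviation cylinder :: "(real^'n) set \<Rightarrow> real \<Rightarrow> ((real^'n) \<times> real) set" where
  "cylinder \<Omega> T \<equiv> \<Omega> \<times> {0..T}"

text \<open>\<open>L\<^sup>p\<^sub>l\<^sub>o\<^sub>c(0,T; W\<^sup>1\<^sup>,\<^sup>p\<^sub>l\<^sub>o\<^sub>c(\<Omega>))\<close>: almost every time slice lies in \<open>W\<^sup>1\<^sup>,\<^sup>1\<^sub>l\<^sub>o\<^sub>c(\<Omega>)\<close>, and by Tonelli's
  theorem \<open>L\<^sup>q\<^sub>l\<^sub>o\<^sub>c(0,T; L\<^sup>q\<^sub>l\<^sub>o\<^sub>c(\<Omega>))\<close> consists of the locally \<open>q\<close>-integrable functions on \<open>\<Omega>\<^sub>T\<close>.\<close>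

definition Lp_W1p_loc ::
  "(real^'n) set \<Rightarrow> real \<Rightarrow> ('n \<Rightarrow> real) \<Rightarrow> ((real^'n) \<times> real \<Rightarrow> real) \<Rightarrow>
   ((real^'n) \<times> real \<Rightarrow> real^'n) \<Rightarrow> bool" where
  "Lp_W1p_loc \<Omega> T p u Du \<longleftrightarrow>
     Lq_loc 1 (cylinder \<Omega> T) u \<and> (\<forall>i. Lq_loc 1 (cylinder \<Omega> T) (\<lambda>z. Du z $ i)) \<and>
     (AE t\<in>{0..T} in lebesgue. W11_loc \<Omega> (\<lambda>x. u (x, t)) (\<lambda>x. Du (x, t))) \<and>
     (\<forall>i. Lq_loc (p i) (cylinder \<Omega> T) (\<lambda>z. Du z $ i))"

text \<open>\<open>L\<^sup>p\<^sub>l\<^sub>o\<^sub>c(0,T; W\<^sup>1\<^sup>,\<^sup>p\<^sub>o(\<Omega>))\<close>: here integrability of the \<open>W\<^sup>1\<^sup>,\<^sup>1\<close>-norm is global in space.\<close>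

definition Lp_W1p_o ::
  "(real^'n) set \<Rightarrow> real \<Rightarrow> ('n \<Rightarrow> real) \<Rightarrow> ((real^'n) \<times> real \<Rightarrow> real) \<Rightarrow>
   ((real^'n) \<times> real \<Rightarrow> real^'n) \<Rightarrow> bool" where
  "Lp_W1p_o \<Omega> T p u Du \<longleftrightarrow>
     Lq 1 (cylinder \<Omega> T) u \<and> (\<forall>i. Lq 1 (cylinder \<Omega> T) (\<lambda>z. Du z $ i)) \<and>
     (AE t\<in>{0..T} in lebesgue. W11_o \<Omega> (\<lambda>x. u (x, t)) (\<lambda>x. Du (x, t))) \<and>
     (\<forall>i. Lq_loc (p i) (cylinder \<Omega> T) (\<lambda>z. Du z $ i))"

definition C_L2loc :: "(real^'n) set \<Rightarrow> real \<Rightarrow> ((real^'n) \<times> real \<Rightarrow> real) \<Rightarrow> bool" where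
  "C_L2loc \<Omega> T u \<longleftrightarrow>
     (\<forall>t\<in>{0..T}. Lq_loc 2 \<Omega> (\<lambda>x. u (x, t))) \<and>
     (\<forall>K. compact K \<and> K \<subseteq> \<Omega> \<longrightarrow> (\<forall>t\<in>{0..T}.
        ((\<lambda>s. LINT x:K|lebesgue. (u (x, s) - u (x, t))\<^sup>2) \<longlongrightarrow> 0) (at t within {0..T})))"

text \<open>\<open>W\<^sup>1\<^sup>,\<^sup>2\<^sub>l\<^sub>o\<^sub>c(0,T; L\<^sup>2\<^sub>l\<^sub>o\<^sub>c(\<Omega>))\<close> with the weak time derivative as additional argument. Such functions have
  a representative that is continuous in time with values in \<open>L\<^sup>2\<^sub>l\<^sub>o\<^sub>c(\<Omega>)\<close>; it is the one meant here,
  so that time slices are meaningful.\<close>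

definition W12_L2_loc ::
  "(real^'n) set \<Rightarrow> real \<Rightarrow> ((real^'n) \<times> real \<Rightarrow> real) \<Rightarrow> ((real^'n) \<times> real \<Rightarrow> real) \<Rightarrow> bool" where
  "W12_L2_loc \<Omega> T \<phi> d\<phi> \<longleftrightarrow>
     Lq_loc 2 (cylinder \<Omega> T) \<phi> \<and> Lq_loc 2 (cylinder \<Omega> T) d\<phi> \<and>
     has_weak_deriv (\<Omega> \<times> {0<..<T}) (0, 1) \<phi> d\<phi> \<and> C_L2loc \<Omega> T \<phi>"

section \<open>The equation\<close>

definition Caratheodory ::
  "((real^'n) \<times> real) set \<Rightarrow> ((real^'n) \<times> real \<Rightarrow> real \<Rightarrow> real^'n \<Rightarrow> 'b::euclidean_space) \<Rightarrow> bool" where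
  "Caratheodory Q F \<longleftrightarrow>
     (\<forall>s \<xi>. set_borel_measurable lebesgue Q (\<lambda>z. F z s \<xi>)) \<and>
     (AE z\<in>Q in lebesgue. continuous_on UNIV (\<lambda>(s, \<xi>). F z s \<xi>))"

definition structure_conditions ::
  "(real^'n) set \<Rightarrow> real \<Rightarrow> ('n \<Rightarrow> real) \<Rightarrow> real \<Rightarrow> real \<Rightarrow> real \<Rightarrow>
   ((real^'n) \<times> real \<Rightarrow> real \<Rightarrow> real^'n \<Rightarrow> real^'n) \<Rightarrow>
   ((real^'n) \<times> real \<Rightarrow> real \<Rightarrow> real^'n \<Rightarrow> real) \<Rightarrow> bool" where
  "structure_conditions \<Omega> T p C\<^sub>o C\<^sub>1 C A B \<longleftrightarrow>
     Caratheodory (cylinder \<Omega> T) A \<and> Caratheodory (cylinder \<Omega> T) B \<and>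
     (AE z\<in>cylinder \<Omega> T in lebesgue. \<forall>s \<xi>.
        (\<forall>i. A z s \<xi> $ i * \<xi> $ i \<ge> C\<^sub>o * \<bar>\<xi> $ i\<bar> powr p i - C powr p i) \<and>
        (\<forall>i. \<bar>A z s \<xi> $ i\<bar> \<le> C\<^sub>1 * \<bar>\<xi> $ i\<bar> powr (p i - 1) + C powr (p i - 1)) \<and>
        \<bar>B z s \<xi>\<bar> \<le> (\<Sum>i\<in>UNIV. C * (\<bar>\<xi> $ i\<bar> powr (p i - 1) + C powr (p i - 1))))"

text \<open>The test functions for the compact set \<open>K\<close> have to vanish outside \<open>K\<close>: the weak formulation is
  integrated over \<open>K\<close> only and has no boundary terms on \<open>\<partial>K\<close>.\<close>

definition test_function ::
  "(real^'n) set \<Rightarrow> real \<Rightarrow> ('n \<Rightarrow> real) \<Rightarrow> (real^'n) set \<Rightarrow> ((real^'n) \<times> real \<Rightarrow> real) \<Rightarrow>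
   ((real^'n) \<times> real \<Rightarrow> real^'n) \<Rightarrow> ((real^'n) \<times> real \<Rightarrow> real) \<Rightarrow> bool" where
  "test_function \<Omega> T p K \<phi> D\<phi> d\<phi> \<longleftrightarrow>
     W12_L2_loc \<Omega> T \<phi> d\<phi> \<and> Lp_W1p_o \<Omega> T p \<phi> D\<phi> \<and>
     (AE z\<in>cylinder \<Omega> T in lebesgue. 0 \<le> \<phi> z) \<and>
     (AE z\<in>cylinder (\<Omega> - K) T in lebesgue. \<phi> z = 0)"

definition weak_lhs ::
  "((real^'n) \<times> real \<Rightarrow> real \<Rightarrow> real^'n \<Rightarrow> real^'n) \<Rightarrow> (real^'n) set \<Rightarrow> real \<Rightarrow> real \<Rightarrow>
   ((real^'n) \<times> real \<Rightarrow> real) \<Rightarrow> ((real^'n) \<times> real \<Rightarrow> real^'n) \<Rightarrow>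
   ((real^'n) \<times> real \<Rightarrow> real) \<Rightarrow> ((real^'n) \<times> real \<Rightarrow> real^'n) \<Rightarrow> ((real^'n) \<times> real \<Rightarrow> real) \<Rightarrow> real" where
  "weak_lhs A K t\<^sub>1 t\<^sub>2 u Du \<phi> D\<phi> d\<phi> =
     (LINT x:K|lebesgue. u (x, t\<^sub>2) * \<phi> (x, t\<^sub>2)) - (LINT x:K|lebesgue. u (x, t\<^sub>1) * \<phi> (x, t\<^sub>1)) +
     (LINT z:(K \<times> {t\<^sub>1..t\<^sub>2})|lebesgue.
        - u z * d\<phi> z + (\<Sum>i\<in>UNIV. A z (u z) (Du z) $ i * D\<phi> z $ i))"

definition weak_rhs ::
  "((real^'n) \<times> real \<Rightarrow> real \<Rightarrow> real^'n \<Rightarrow> real) \<Rightarrow> (real^'n) set \<Rightarrow> real \<Rightarrow> real \<Rightarrow>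
   ((real^'n) \<times> real \<Rightarrow> real) \<Rightarrow> ((real^'n) \<times> real \<Rightarrow> real^'n) \<Rightarrow> ((real^'n) \<times> real \<Rightarrow> real) \<Rightarrow> real" where
  "weak_rhs B K t\<^sub>1 t\<^sub>2 u Du \<phi> =
     (LINT z:(K \<times> {t\<^sub>1..t\<^sub>2})|lebesgue. B z (u z) (Du z) * \<phi> z)"

definition local_weak_subsolution ::
  "(real^'n) set \<Rightarrow> real \<Rightarrow> ('n \<Rightarrow> real) \<Rightarrow>
   ((real^'n) \<times> real \<Rightarrow> real \<Rightarrow> real^'n \<Rightarrow> real^'n) \<Rightarrow>
   ((real^'n) \<times> real \<Rightarrow> real \<Rightarrow> real^'n \<Rightarrow> real) \<Rightarrow> ((real^'n) \<times> real \<Rightarrow> real) \<Rightarrow> bool" where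
  "local_weak_subsolution \<Omega> T p A B u \<longleftrightarrow> C_L2loc \<Omega> T u \<and>
     (\<exists>Du. Lp_W1p_loc \<Omega> T p u Du \<and>
       (\<forall>t\<^sub>1 t\<^sub>2 K. 0 \<le> t\<^sub>1 \<and> t\<^sub>1 \<le> t\<^sub>2 \<and> t\<^sub>2 \<le> T \<and> compact K \<and> K \<subseteq> \<Omega> \<longrightarrow>
         (\<forall>\<phi> D\<phi> d\<phi>. test_function \<Omega> T p K \<phi> D\<phi> d\<phi> \<longrightarrow>
           weak_lhs A K t\<^sub>1 t\<^sub>2 u Du \<phi> D\<phi> d\<phi> \<le> weak_rhs B K t\<^sub>1 t\<^sub>2 u Du \<phi>)))"

definition local_weak_supersolution ::
  "(real^'n) set \<Rightarrow> real \<Rightarrow> ('n \<Rightarrow> real) \<Rightarrow>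
   ((real^'n) \<times> real \<Rightarrow> real \<Rightarrow> real^'n \<Rightarrow> real^'n) \<Rightarrow>
   ((real^'n) \<times> real \<Rightarrow> real \<Rightarrow> real^'n \<Rightarrow> real) \<Rightarrow> ((real^'n) \<times> real \<Rightarrow> real) \<Rightarrow> bool" where
  "local_weak_supersolution \<Omega> T p A B u \<longleftrightarrow> C_L2loc \<Omega> T u \<and>
     (\<exists>Du. Lp_W1p_loc \<Omega> T p u Du \<and>
       (\<forall>t\<^sub>1 t\<^sub>2 K. 0 \<le> t\<^sub>1 \<and> t\<^sub>1 \<le> t\<^sub>2 \<and> t\<^sub>2 \<le> T \<and> compact K \<and> K \<subseteq> \<Omega> \<longrightarrow>
         (\<forall>\<phi> D\<phi> d\<phi>. test_function \<Omega> T p K \<phi> D\<phi> d\<phi> \<longrightarrow>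
           weak_lhs A K t\<^sub>1 t\<^sub>2 u Du \<phi> D\<phi> d\<phi> \<ge> weak_rhs B K t\<^sub>1 t\<^sub>2 u Du \<phi>)))"

definition local_weak_solution ::
  "(real^'n) set \<Rightarrow> real \<Rightarrow> ('n \<Rightarrow> real) \<Rightarrow>
   ((real^'n) \<times> real \<Rightarrow> real \<Rightarrow> real^'n \<Rightarrow> real^'n) \<Rightarrow>
   ((real^'n) \<times> real \<Rightarrow> real \<Rightarrow> real^'n \<Rightarrow> real) \<Rightarrow> ((real^'n) \<times> real \<Rightarrow> real) \<Rightarrow> bool" where
  "local_weak_solution \<Omega> T p A B u \<longleftrightarrow>
     local_weak_subsolution \<Omega> T p A B u \<and> local_weak_supersolution \<Omega> T p A B u"

section \<open>Anisotropic geometry\<close>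

definition hmean :: "('n::finite \<Rightarrow> real) \<Rightarrow> real" where
  "hmean p = real CARD('n) / (\<Sum>i\<in>UNIV. 1 / p i)"

text \<open>The cube \<open>\<K>\<^sub>a\<^sub>\<rho>\<close> is \<open>aniso_cube p (a * \<rho>)\<close>.\<close>

definition aniso_cube :: "('n::finite \<Rightarrow> real) \<Rightarrow> real \<Rightarrow> (real^'n) set" where
  "aniso_cube p R = {x. \<forall>i. \<bar>x $ i\<bar> < R powr (hmean p / p i)}"

definition lambda_exp :: "('n::finite \<Rightarrow> real) \<Rightarrow> real \<Rightarrow> 'n \<Rightarrow> real" where
  "lambda_exp p r i = real CARD('n) * (p i - 2) + hmean p * r"

definition nu_Sigma :: "('n::finite \<Rightarrow> real) \<Rightarrow> real \<Rightarrow> real \<Rightarrow> real" where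
  "nu_Sigma p t \<rho> = (\<Sum>k\<in>UNIV. (t / \<rho> powr hmean p) powr (1 / (2 - p k)))"

end

theory Submission
  imports Defs
begin

text \<open>
  With \<open>\<nu> = nu_Sigma p t \<rho>\<close> and \<open>v = u + \<nu>\<close> one tests with \<open>v powr (r - 1) * \<zeta> ^ m\<close>. Shifting \<open>u\<close> by \<open>\<nu>\<close>
  is what makes the lower order terms harmless: if the first alternative fails, then
  \<open>C * R\<^sub>i \<le> min 1 \<nu>\<close> for the half axes \<open>R\<^sub>i = \<rho> powr (hmean p / p i)\<close>, so that every term that contains
  \<open>C\<close> is at most \<open>\<rho> powr (- hmean p) * v powr (r + p i - 2)\<close>, which also bounds what remains of the
  flux terms. If the exponent \<open>m\<close> is large, Young's inequality absorbs this quantity, pointwise, into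
  \<open>v powr r * \<zeta> ^ m / t\<close>, and taking the supremum in time closes the estimate without iterating over a
  sequence of cubes.

  A time-dependent test function would need a time derivative of \<open>u\<close>. Instead one freezes it: for
  almost every \<open>\<sigma>\<close> the function \<open>v(\<sigma>) powr (r - 1) * \<zeta> ^ m\<close> does not depend on time, and testing with it on
  \<open>[\<sigma> - h, \<sigma>]\<close> bounds \<open>E \<sigma> - E (\<sigma> - h)\<close> by convexity, where \<open>E\<close> is the integral of \<open>v powr r / r * \<zeta> ^ m\<close>.
  Integrating in \<open>\<sigma>\<close> and letting \<open>h\<close> tend to \<open>0\<close> gives the energy inequality, because translations are
  continuous in Lebesgue spaces.
\<close>

section \<open>Smooth bump functions\<close>

text \<open>The geometry makes the anisotropic terms agree:
  \<open>R\<^sub>i powr p i = \<rho> powr hmean p\<close> in every direction, so each flux component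
  leaves the same factor. Write \<open>e = 2 - p i\<close>, so that \<open>0 < e < 1 < r\<close>,
  and let \<open>N\<close> be the dimension. Absorbing
  \<open>\<rho> powr (- hmean p) * v powr (r - e)\<close> into \<open>v powr r / t\<close> leaves,
  after integration over the cube and over \<open>[0,t]\<close>, a multiple of
  \<open>(t / \<rho> powr hmean p) powr (r / e) * \<rho> powr N\<close>, which is exactly the
  summand with index \<open>i\<close> in the theorem. The shift \<nu> is the sum of the powers with
  exponent \<open>1 / e\<close>, so \<open>\<nu> powr r\<close> times the volume is controlled by
  the same summands. The shift also keeps \<open>v powr (r - 2)\<close> bounded when
  \<open>r < 2\<close>.

  Two features of the function classes shape the rest. Test functions must be \<open>W11_o\<close>
  limits of smooth functions of compact support, hence the mollification. And \<open>u\<close> is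
  bounded and weakly differentiable at almost every time only, while the energy is needed at every
  time; continuity in time with values in \<open>L2\<close> bridges this. The bound of
  \<open>u\<close> serves integrability and never enters \<gamma>.\<close>

lemma Ck_SucD: "Ck (Suc k) f \<Longrightarrow> Ck k f"
proof (induction k arbitrary: f)
  case 0
  then show ?case
    by (auto intro!: continuous_at_imp_continuous_on differentiable_imp_continuous_within)
next
  case (Suc k)
  then show ?case by (metis Ck.simps(2))
qed

lemma Ck_differentiable: "(\<forall>k. Ck k f) \<Longrightarrow> f differentiable (at x)"
  by (metis Ck.simps(2))

lemma Ck_partial: "(\<forall>k. Ck k f) \<Longrightarrow> b \<in> Basis \<Longrightarrow> \<forall>k. Ck k (partial_deriv b f)"
  by (metis Ck.simps(2))

lemma Ck_continuous: "(\<forall>k. Ck k f) \<Longrightarrow> continuous_on UNIV f"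
  by (metis Ck.simps(1))

lemma partial_deriv_const: "partial_deriv b (\<lambda>x. c) = (\<lambda>x. 0)"
  by (auto simp: fun_eq_iff)

lemma partial_deriv_add:
  assumes "\<forall>x. f differentiable (at x)" "\<forall>x. g differentiable (at x)"
  shows "partial_deriv b (\<lambda>x. f x + g x) = (\<lambda>x. partial_deriv b f x + partial_deriv b g x)"
proof
  fix x
  have "((\<lambda>x. f x + g x) has_derivative
      (\<lambda>h. frechet_derivative f (at x) h + frechet_derivative g (at x) h)) (at x)"
    using assms by (intro derivative_intros) (auto simp: frechet_derivative_works)
  from frechet_derivative_at[OF this]
  show "partial_deriv b (\<lambda>x. f x + g x) x = partial_deriv b f x + partial_deriv b g x"
    by metis
qed

lemma partial_deriv_mult:
  fixes f g :: "'a::euclidean_space \<Rightarrow> real"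
  assumes "\<forall>x. f differentiable (at x)" "\<forall>x. g differentiable (at x)"
  shows "partial_deriv b (\<lambda>x. f x * g x) = (\<lambda>x. f x * partial_deriv b g x + partial_deriv b f x * g x)"
proof
  fix x
  have "((\<lambda>x. f x * g x) has_derivative
      (\<lambda>h. f x * frechet_derivative g (at x) h + frechet_derivative f (at x) h * g x)) (at x)"
    using assms by (intro has_derivative_mult) (auto simp: frechet_derivative_works)
  from frechet_derivative_at[OF this]
  show "partial_deriv b (\<lambda>x. f x * g x) x = f x * partial_deriv b g x + partial_deriv b f x * g x"
    by metis
qed

lemma Ck_const: "Ck k (\<lambda>x. c)"
  by (induction k arbitrary: c) (auto simp: partial_deriv_const)

lemma Ck_add: "Ck k f \<Longrightarrow> Ck k g \<Longrightarrow> Ck k (\<lambda>x. f x + g x)"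
proof (induction k arbitrary: f g)
  case 0
  then show ?case by (auto intro: continuous_intros)
next
  case (Suc k)
  then have "partial_deriv b (\<lambda>x. f x + g x) = (\<lambda>x. partial_deriv b f x + partial_deriv b g x)" for b
    by (intro partial_deriv_add) auto
  then show ?case using Suc by (auto simp del: frechet_derivative_works)
qed

lemma Ck_mult: "Ck k f \<Longrightarrow> Ck k g \<Longrightarrow> Ck k (\<lambda>x. f x * g x)"
proof (induction k arbitrary: f g)
  case 0
  then show ?case by (auto intro: continuous_intros)
next
  case (Suc k)
  have fg: "Ck k f" "Ck k g" using Suc.prems Ck_SucD by blast+
  have "partial_deriv b (\<lambda>x. f x * g x) = (\<lambda>x. f x * partial_deriv b g x + partial_deriv b f x * g x)" for b
    using Suc.prems by (intro partial_deriv_mult) auto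
  moreover have "Ck k (\<lambda>x. f x * partial_deriv b g x + partial_deriv b f x * g x)" if "b \<in> Basis" for b
    using Suc fg that by (intro Ck_add Suc.IH) auto
  ultimately show ?case using Suc.prems by simp
qed

lemma Ck_prod:
  assumes "finite I" "\<And>i. i \<in> I \<Longrightarrow> Ck k (f i)"
  shows "Ck k (\<lambda>x. \<Prod>i\<in>I. f i x)"
  using assms by (induction I) (auto intro: Ck_mult Ck_const)

lemma Ck_power: "Ck k f \<Longrightarrow> Ck k (\<lambda>x. f x ^ n)"
  by (induction n) (auto intro: Ck_mult Ck_const)

lemma partial_deriv_compose_real:
  assumes "f differentiable (at x)" "(g has_real_derivative D) (at (f x))"
  shows "partial_deriv b (\<lambda>x. g (f x)) x = D * partial_deriv b f x"
    and "(\<lambda>x. g (f x)) differentiable (at x)"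
proof -
  have *: "((\<lambda>x. g (f x)) has_derivative (\<lambda>h. D * frechet_derivative f (at x) h)) (at x)"
    using has_derivative_compose[of f "frechet_derivative f (at x)" x UNIV g "(*) D"] assms
    by (auto simp: frechet_derivative_works has_field_derivative_def)
  show "partial_deriv b (\<lambda>x. g (f x)) x = D * partial_deriv b f x"
    using frechet_derivative_at[OF *] by metis
  show "(\<lambda>x. g (f x)) differentiable (at x)" using * by (auto simp: differentiable_def)
qed

text \<open>Differentiation lowers the exponent by one, so the induction runs over all exponents
  \<open>a\<close> at once; positivity of \<open>w\<close> keeps every real power
  differentiable.\<close>

lemma Ck_powr:
  fixes w :: "'a::euclidean_space \<Rightarrow> real"
  assumes "\<And>x. 0 < w x" "\<forall>k. Ck k w"
  shows "Ck k (\<lambda>x. w x powr a)"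
proof (induction k arbitrary: a)
  case 0
  have "continuous_on UNIV w" by (rule Ck_continuous[OF assms(2)])
  then show ?case using assms(1) by (auto intro!: continuous_on_powr continuous_intros simp: less_imp_neq[symmetric])
next
  case (Suc k)
  have D: "((\<lambda>s. s powr a) has_real_derivative (a * w x powr (a - 1))) (at (w x))" for x
    by (rule has_real_derivative_powr[OF assms(1)])
  have d: "w differentiable (at x)" for x using Ck_differentiable[OF assms(2)] .
  have "partial_deriv b (\<lambda>x. w x powr a) = (\<lambda>x. a * w x powr (a - 1) * partial_deriv b w x)" for b
    using partial_deriv_compose_real(1)[OF d D] by blast
  moreover have "Ck k (\<lambda>x. a * w x powr (a - 1) * partial_deriv b w x)" if "b \<in> Basis" for b
    using that Suc.IH assms(2) Ck_partial[OF assms(2) that] by (intro Ck_mult Ck_const) auto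
  ultimately show ?case
    using partial_deriv_compose_real(2)[OF d D] by simp
qed

text \<open>The family is closed under differentiation up to linear combinations, which turns
  smoothness of the classical flat function \<open>flat_exp 0\<close> into an induction. The other
  members occur as its derivatives.\<close>

definition flat_exp :: "nat \<Rightarrow> real \<Rightarrow> real" where
  "flat_exp j x = (if 0 < x then exp (- 1 / x) / x ^ j else 0)"

lemma flat_exp_nonneg: "0 \<le> flat_exp j x"
  by (auto simp: flat_exp_def)

text \<open>A single term of the exponential series at \<open>1 / x\<close> lies below its
  sum.\<close>

lemma flat_exp_le: "flat_exp j x \<le> fact j"
proof (cases "0 < x")
  case True
  have s: "(\<lambda>n. (1/x) ^ n /\<^sub>R fact n) sums exp (1/x)" by (rule exp_converges)
  have "(\<Sum>n\<in>{j}. (1/x) ^ n /\<^sub>R fact n) \<le> (\<Sum>n. (1/x) ^ n /\<^sub>R fact n)"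
    by (rule sum_le_suminf[OF sums_summable[OF s]]) (use True in auto)
  also have "\<dots> = exp (1/x)" using sums_unique[OF s] by simp
  finally have "(1/x) ^ j / fact j \<le> exp (1/x)" by (simp add: divide_inverse mult.commute)
  then show ?thesis using True by (simp add: flat_exp_def exp_minus field_simps)
qed (simp add: flat_exp_def)

lemma flat_exp_has_derivative:
  "(flat_exp j has_real_derivative (flat_exp (j + 2) x - real j * flat_exp (j + 1) x)) (at x)"
proof -
  consider "x > 0" | "x < 0" | "x = 0" by linarith
  then show ?thesis
  proof cases
    case 1
    have "((\<lambda>x. exp (- 1 / x) * inverse (x ^ j)) has_real_derivative (flat_exp (j + 2) x - real j * flat_exp (j + 1) x)) (at x)"
      using 1 by (cases j)
        (auto intro!: derivative_eq_intros simp: flat_exp_def field_simps power2_eq_square power_add,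
         case_tac nat, auto)
    then show ?thesis
      by (rule has_field_derivative_transform_within_open[where S = "{0<..}"])
        (use 1 in \<open>auto simp: flat_exp_def divide_inverse\<close>)
  next
    case 2
    have "((\<lambda>x. 0) has_real_derivative (flat_exp (j + 2) x - real j * flat_exp (j + 1) x)) (at x)"
      using 2 by (auto simp: flat_exp_def)
    then show ?thesis
      by (rule has_field_derivative_transform_within_open[where S = "{..<0}"])
        (use 2 in \<open>auto simp: flat_exp_def\<close>)
  next
    case 3
    \<comment> \<open>With \<open>y = 1 / h\<close> the quotient becomes
      \<open>y ^ (j + 1) / exp y\<close>, and the exponential wins against every power.\<close>
    have R: "((\<lambda>h. flat_exp j h / h) \<longlongrightarrow> 0) (at_right 0)"
    proof -
      have "((\<lambda>y::real. y ^ (j+1) / exp y) \<longlongrightarrow> 0) at_top" by (rule tendsto_power_div_exp_0)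
      then have "((\<lambda>h::real. (inverse h) ^ (j+1) / exp (inverse h)) \<longlongrightarrow> 0) (at_right 0)"
        by (rule filterlim_compose[OF _ filterlim_inverse_at_top_right])
      then show ?thesis
      proof (rule Lim_transform_eventually)
        have "inverse h ^ (j + 1) / exp (inverse h) = flat_exp j h / h" if "h \<in> {0<..<1}" for h
          using that by (simp add: flat_exp_def exp_minus divide_inverse mult_ac power_inverse)
        then show "\<forall>\<^sub>F h in at_right 0. inverse h ^ (j + 1) / exp (inverse h) = flat_exp j h / h"
          by (rule eventually_at_rightI[of 0 1]) auto
      qed
    qed
    have L: "((\<lambda>h. flat_exp j h / h) \<longlongrightarrow> 0) (at_left 0)"
    proof (rule Lim_transform_eventually[OF tendsto_const])
      show "\<forall>\<^sub>F h in at_left 0. 0 = flat_exp j h / h"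
        by (rule eventually_at_leftI[of "-1"]) (auto simp: flat_exp_def)
    qed
    have "((\<lambda>h. flat_exp j h / h) \<longlongrightarrow> 0) (at 0)"
      using L R by (simp add: filterlim_split_at)
    then show ?thesis using 3 by (simp add: DERIV_def) (simp add: flat_exp_def)
  qed
qed

text \<open>The index \<open>j\<close> is generalised in the induction, since a derivative raises it
  by one and by two.\<close>

lemma Ck_flat_exp_affine:
  fixes l :: "'a::euclidean_space"
  shows "Ck k (\<lambda>x. flat_exp j (c + l \<bullet> x))"
proof (induction k arbitrary: j)
  case 0
  have "isCont (flat_exp j) x" for x using flat_exp_has_derivative DERIV_isCont by blast
  then have "continuous_on UNIV (flat_exp j)" by (simp add: continuous_at_imp_continuous_on)
  then have "continuous_on UNIV (\<lambda>x. flat_exp j (c + l \<bullet> x))"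
    by (rule continuous_on_compose2) (intro continuous_intros, auto)
  then show ?case by simp
next
  case (Suc k)
  have D: "(flat_exp j has_real_derivative (flat_exp (j + 2) (c + l \<bullet> x) - real j * flat_exp (j + 1) (c + l \<bullet> x))) (at (c + l \<bullet> x))" for x
    by (rule flat_exp_has_derivative)
  have h: "((\<lambda>x. c + l \<bullet> x) has_derivative (\<lambda>h. l \<bullet> h)) (at x)" for x
    by (auto intro!: derivative_eq_intros)
  then have d: "(\<lambda>x. c + l \<bullet> x) differentiable (at x)" for x by (auto simp: differentiable_def)
  have p: "partial_deriv b (\<lambda>x. c + l \<bullet> x) x = l \<bullet> b" for b x
    using frechet_derivative_at[OF h[of x]] by metis
  have "partial_deriv b (\<lambda>x. flat_exp j (c + l \<bullet> x)) =
    (\<lambda>x. (flat_exp (j + 2) (c + l \<bullet> x) + (- real j) * flat_exp (j + 1) (c + l \<bullet> x)) * (l \<bullet> b))" for b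
    using partial_deriv_compose_real(1)[OF d D] p by auto
  moreover have "Ck k (\<lambda>x. (flat_exp (j + 2) (c + l \<bullet> x) + (- real j) * flat_exp (j + 1) (c + l \<bullet> x)) * (l \<bullet> b))" for b
    by (intro Ck_add Ck_mult Ck_const Suc.IH)
  ultimately show ?case
    using partial_deriv_compose_real(2)[OF d D] by simp
qed

text \<open>Two one-sided flat factors per axis: for positive \<open>R i\<close> the function
  vanishes outside the box with half axes \<open>c * R i\<close>, and rescaling an axis only
  rescales the corresponding derivative. No plateau is built in; a lower bound on the inner box
  takes the place of the value 1.\<close>

definition box_bump :: "real \<Rightarrow> ('n::finite \<Rightarrow> real) \<Rightarrow> real^'n \<Rightarrow> real" where
  "box_bump c R x = (\<Prod>i\<in>UNIV. flat_exp 0 (c - x $ i / R i) * flat_exp 0 (c + x $ i / R i))"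

lemma Ck_box_bump: "Ck k (box_bump c R)"
proof -
  have "Ck k (\<lambda>x. flat_exp 0 (c + axis i (s / R i) \<bullet> x))" for s i by (rule Ck_flat_exp_affine)
  from this[of _ "-1"] this[of _ 1]
  have "Ck k (\<lambda>x. flat_exp 0 (c - x $ i / R i))" "Ck k (\<lambda>x. flat_exp 0 (c + x $ i / R i))" for i
    by (simp_all add: inner_axis')
  then show ?thesis unfolding box_bump_def[abs_def] by (intro Ck_prod Ck_mult) auto
qed

lemma flat_exp_0_bounds: "0 \<le> flat_exp 0 x" "flat_exp 0 x \<le> 1"
  using flat_exp_nonneg[of 0 x] flat_exp_le[of 0 x] by auto

lemma box_bump_bounds: "0 \<le> box_bump c R x" "box_bump c R x \<le> 1"
  unfolding box_bump_def
  by (auto intro!: prod_nonneg prod_le_1 mult_nonneg_nonneg mult_le_one flat_exp_0_bounds)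

lemma box_bump_eq_0: "\<And>i. 0 < R i \<Longrightarrow> c * R i \<le> \<bar>x $ i\<bar> \<Longrightarrow> box_bump c R x = 0"
proof -
  fix i assume R: "0 < R i" and x: "c * R i \<le> \<bar>x $ i\<bar>"
  have "c \<le> \<bar>x $ i\<bar> / R i" using R x by (simp add: field_simps)
  then have "c - x $ i / R i \<le> 0 \<or> c + x $ i / R i \<le> 0"
    using R by (auto simp: abs_if split: if_splits)
  then have "flat_exp 0 (c - x $ i / R i) * flat_exp 0 (c + x $ i / R i) = 0"
    by (auto simp: flat_exp_def)
  then show "box_bump c R x = 0" unfolding box_bump_def
    by (metis (mono_tags, lifting) UNIV_I finite prod_zero)
qed

text \<open>On the inner box both arguments belonging to an axis are at least \<open>c - 1\<close>,
  and the flat function is increasing. The bound depends on \<open>c\<close> and the dimension only,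
  so dividing by it later costs an admissible constant.\<close>

lemma box_bump_lower:
  assumes "1 < c" "\<And>i. 0 < R i" "\<And>i. \<bar>x $ i\<bar> \<le> R i"
  shows "exp (- 2 / (c - 1)) ^ CARD('n) \<le> box_bump c R (x::real^'n)"
proof -
  have e: "exp (- 1 / (c - 1)) \<le> flat_exp 0 y" if "c - 1 \<le> y" for y
    using that assms(1) by (auto simp: flat_exp_def field_simps)
  have "exp (- 1 / (c - 1)) * exp (- 1 / (c - 1)) \<le> flat_exp 0 (c - x $ i / R i) * flat_exp 0 (c + x $ i / R i)" for i
    using assms(2)[of i] assms(3)[of i]
    by (intro mult_mono e) (auto simp: field_simps abs_le_iff flat_exp_0_bounds)
  then have "(\<Prod>i\<in>(UNIV::'n set). exp (- 1 / (c - 1)) * exp (- 1 / (c - 1))) \<le> box_bump c R x"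
    unfolding box_bump_def by (intro prod_mono) auto
  then show ?thesis by (simp add: mult_exp_exp flip: power_mult_distrib)
qed

lemma partial_deriv_along_line:
  assumes "f differentiable (at x)"
  shows "((\<lambda>s. f (x + s *\<^sub>R b)) has_real_derivative partial_deriv b f x) (at 0)"
proof -
  have "((\<lambda>s. f (x + s *\<^sub>R b)) has_derivative (\<lambda>s. frechet_derivative f (at x) (s *\<^sub>R b))) (at 0)"
    by (rule has_derivative_compose[of "\<lambda>s. x + s *\<^sub>R b" "\<lambda>s. s *\<^sub>R b" 0 UNIV f])
      (use assms in \<open>auto intro!: derivative_eq_intros simp: frechet_derivative_works\<close>)
  moreover have "(\<lambda>s. frechet_derivative f (at x) (s *\<^sub>R b)) = (*) (partial_deriv b f x)"
    using linear_frechet_derivative[OF assms] by (auto simp: linear_cmul)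
  ultimately show ?thesis by (simp add: has_field_derivative_def)
qed

text \<open>The two factors that contain \<open>x $ j\<close> have derivative at most
  \<open>fact 2 / R j\<close> each, and all other factors are at most 1. Hence neither
  \<open>c\<close> nor the dimension enters.\<close>

lemma box_bump_partial_bound:
  fixes R :: "'n::finite \<Rightarrow> real"
  assumes "\<And>i. 0 < R i"
  shows "\<bar>partial_deriv (axis j 1) (box_bump c R) x\<bar> \<le> 4 / R j"
proof -
  define P where "P = (\<Prod>i\<in>UNIV-{j}. flat_exp 0 (c - x $ i / R i) * flat_exp 0 (c + x $ i / R i))"
  define F where "F = flat_exp 0"
  have P: "0 \<le> P" "P \<le> 1" unfolding P_def
    by (auto intro!: prod_nonneg prod_le_1 mult_nonneg_nonneg mult_le_one flat_exp_0_bounds)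
  have eq: "box_bump c R (x + s *\<^sub>R axis j 1) =
     F (c - (x $ j + s) / R j) * F (c + (x $ j + s) / R j) * P" for s
    unfolding box_bump_def P_def F_def
    by (subst prod.remove[of UNIV j]) (auto intro!: arg_cong2[where f = "(*)"] prod.cong simp: axis_def)
  have dF: "(F has_real_derivative flat_exp 2 y) (at y)" for y
    using flat_exp_has_derivative[of 0 y] by (simp add: F_def numeral_2_eq_2)
  have "((\<lambda>s. F (c - (x $ j + s) / R j) * F (c + (x $ j + s) / R j) * P) has_real_derivative
     (flat_exp 2 (c - x $ j / R j) * (- (1 / R j)) * F (c + x $ j / R j) +
      flat_exp 2 (c + x $ j / R j) * (1 / R j) * F (c - x $ j / R j)) * P) (at 0)"
    using assms[of j]
    by (auto intro!: derivative_eq_intros DERIV_chain2[OF dF] simp: divide_inverse)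
  moreover have "((\<lambda>s. box_bump c R (x + s *\<^sub>R axis j 1)) has_real_derivative
      partial_deriv (axis j 1) (box_bump c R) x) (at 0)"
    using Ck_box_bump by (intro partial_deriv_along_line Ck_differentiable) blast
  ultimately have D: "partial_deriv (axis j 1) (box_bump c R) x =
     (flat_exp 2 (c - x $ j / R j) * (- (1 / R j)) * F (c + x $ j / R j) +
      flat_exp 2 (c + x $ j / R j) * (1 / R j) * F (c - x $ j / R j)) * P"
    unfolding eq using DERIV_unique by blast
  have b: "\<bar>flat_exp 2 y * (1 / R j) * F z\<bar> \<le> 2 / R j" for y z
  proof -
    have "flat_exp 2 y * (1 / R j) * F z \<le> 2 * (1 / R j) * 1"
      using flat_exp_le[of 2 y] assms[of j] flat_exp_0_bounds[of z] flat_exp_nonneg[of 2 y]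
      by (intro mult_mono) (auto simp: F_def)
    then show ?thesis using flat_exp_0_bounds[of z] flat_exp_nonneg[of 2 y] assms[of j]
      by (simp add: F_def abs_mult)
  qed
  have "\<bar>partial_deriv (axis j 1) (box_bump c R) x\<bar> \<le> (2 / R j + 2 / R j) * 1"
    unfolding D abs_mult[of _ P]
    using b[of "c - x $ j / R j" "c + x $ j / R j"] b[of "c + x $ j / R j" "c - x $ j / R j"] P assms[of j]
    by (intro mult_mono) (auto intro: order_trans[OF abs_triangle_ineq4] order_trans[OF abs_triangle_ineq] add_mono)
  then show ?thesis by simp
qed

section \<open>Translations in the Lebesgue space and integration by parts\<close>

lemma integrable_translate:
  fixes f :: "'a::euclidean_space \<Rightarrow> real"
  assumes "integrable lborel f"
  shows "integrable lborel (\<lambda>x. f (x + w))"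
    and "(\<integral>x. f (x + w) \<partial>lborel) = integral\<^sup>L lborel f"
proof -
  have f[measurable]: "f \<in> borel_measurable borel" using assms by auto
  have d: "distr lborel borel (\<lambda>x. x + w) = (lborel :: 'a measure)"
    using lborel_distr_plus[of w] unfolding add.commute[of _ w] .
  have "integrable (distr lborel borel (\<lambda>x. x + w)) f" using assms d by simp
  then show "integrable lborel (\<lambda>x. f (x + w))" by (subst (asm) integrable_distr_eq) auto
  have "integral\<^sup>L (distr lborel borel (\<lambda>x. x + w)) f = (\<integral>x. f (x + w) \<partial>lborel)"
    by (subst integral_distr) auto
  then show "(\<integral>x. f (x + w) \<partial>lborel) = integral\<^sup>L lborel f" using d by simp
qed

lemma nn_integral_translate:
  fixes f :: "'a::euclidean_space \<Rightarrow> ennreal"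
  assumes [measurable]: "f \<in> borel_measurable borel"
  shows "(\<integral>\<^sup>+x. f (x + w) \<partial>lborel) = (\<integral>\<^sup>+x. f x \<partial>lborel)"
proof -
  have d: "distr lborel borel (\<lambda>x. x + w) = (lborel :: 'a measure)"
    using lborel_distr_plus[of w] unfolding add.commute[of _ w] .
  have "integral\<^sup>N (distr lborel borel (\<lambda>x. x + w)) f = (\<integral>\<^sup>+x. f (x + w) \<partial>lborel)"
    by (subst nn_integral_distr) auto
  then show ?thesis using d by simp
qed

text \<open>The modulus of continuity in \<open>L1\<close>.\<close>

definition translation_error :: "('a::euclidean_space \<Rightarrow> real) \<Rightarrow> 'a \<Rightarrow> real" where
  "translation_error f w = (\<integral>x. \<bar>f (x + w) - f x\<bar> \<partial>lborel)"

lemma translation_error_nonneg: "0 \<le> translation_error f w"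
  by (simp add: translation_error_def)

lemma translation_error_0 [simp]: "translation_error f 0 = 0"
  by (simp add: translation_error_def)

text \<open>By translation invariance the distance of \<open>f\<close> and \<open>g\<close> enters
  twice with the same value, once shifted and once unshifted.\<close>

lemma translation_error_triangle:
  assumes f: "integrable lborel f" and g: "integrable lborel g"
  shows "translation_error f w \<le> translation_error g w + 2 * (\<integral>x. \<bar>f x - g x\<bar> \<partial>lborel)"
proof -
  note [simp] = integrable_translate(1)[OF f] integrable_translate(1)[OF g] f g
  have i: "integrable lborel (\<lambda>x. \<bar>f x - g x\<bar>)" by auto
  have i': "integrable lborel (\<lambda>x. \<bar>f (x + w) - g (x + w)\<bar>)"
    "(\<integral>x. \<bar>f (x + w) - g (x + w)\<bar> \<partial>lborel) = (\<integral>x. \<bar>f x - g x\<bar> \<partial>lborel)"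
    using integrable_translate[OF i, of w] by auto
  have "translation_error f w \<le> (\<integral>x. \<bar>g (x + w) - g x\<bar> + (\<bar>f (x + w) - g (x + w)\<bar> + \<bar>f x - g x\<bar>) \<partial>lborel)"
    unfolding translation_error_def by (rule integral_mono) auto
  also have "\<dots> = translation_error g w + 2 * (\<integral>x. \<bar>f x - g x\<bar> \<partial>lborel)"
    unfolding translation_error_def using i'(2) by (subst Bochner_Integration.integral_add; (auto)?)+
  finally show ?thesis .
qed

text \<open>A point of an open set stays inside under small translations, which gives pointwise
  convergence on the set itself. Boundary points, where it may fail, have to be kept out of the
  integral.\<close>

lemma translation_error_open:
  fixes U :: "'a::euclidean_space set"
  assumes U: "open U" "emeasure lborel U < \<infinity>"
  shows "isCont (translation_error (indicator U)) 0"
  unfolding continuous_at_sequentially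
proof (intro allI impI)
  fix X :: "nat \<Rightarrow> 'a" assume X: "X \<longlonglongrightarrow> 0"
  let ?f = "indicator U :: 'a \<Rightarrow> real"
  have [measurable]: "U \<in> sets borel" using U by auto
  have f: "integrable lborel ?f" using U by (auto intro!: integrable_real_indicator)
  \<comment> \<open>Translation invariance rewrites the symmetric difference as twice the part of
    \<open>U\<close> that leaves \<open>U\<close>, so only points of \<open>U\<close>
    matter.\<close>
  have eq: "translation_error ?f w = 2 * (\<integral>x. ?f x - ?f x * ?f (x + w) \<partial>lborel)" for w
  proof -
    have m: "integrable lborel (\<lambda>x. ?f x * ?f (x + w))"
      by (rule Bochner_Integration.integrable_bound[OF f]) (auto split: split_indicator)
    have "translation_error ?f w = (\<integral>x. ?f (x + w) + ?f x - 2 * (?f x * ?f (x + w)) \<partial>lborel)"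
      unfolding translation_error_def by (intro Bochner_Integration.integral_cong) (auto split: split_indicator)
    also have "\<dots> = (\<integral>x. ?f (x + w) \<partial>lborel) + (\<integral>x. ?f x \<partial>lborel) - (\<integral>x. 2 * (?f x * ?f (x + w)) \<partial>lborel)"
      using m f integrable_translate(1)[OF f, of w]
      by (subst Bochner_Integration.integral_diff; (intro Bochner_Integration.integrable_add integrable_mult_right)?;
          (subst Bochner_Integration.integral_add)?) auto
    also have "\<dots> = 2 * (\<integral>x. ?f x - ?f x * ?f (x + w) \<partial>lborel)"
      using m f integrable_translate[OF f, of w]
      by (subst Bochner_Integration.integral_diff) auto
    finally show ?thesis .
  qed
  have "(\<lambda>n. \<integral>x. ?f x - ?f x * ?f (x + X n) \<partial>lborel) \<longlonglongrightarrow> (\<integral>x. 0 \<partial>(lborel::'a measure))"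
  proof (rule integral_dominated_convergence[where w = ?f])
    show "AE x in lborel. (\<lambda>n. ?f x - ?f x * ?f (x + X n)) \<longlonglongrightarrow> 0"
    proof (rule AE_I2)
      fix x
      show "(\<lambda>n. ?f x - ?f x * ?f (x + X n)) \<longlonglongrightarrow> 0"
      proof (cases "x \<in> U")
        case True
        have "(\<lambda>n. x + X n) \<longlonglongrightarrow> x" using tendsto_add[OF tendsto_const X, of x] by simp
        then have "\<forall>\<^sub>F n in sequentially. x + X n \<in> U"
          using U(1) True topological_tendstoD by blast
        then show ?thesis
          by (intro tendsto_eventually) (auto elim!: eventually_mono simp: True)
      qed simp
    qed
  qed (use f in \<open>auto split: split_indicator\<close>)
  then have "(\<lambda>n. translation_error ?f (X n)) \<longlonglongrightarrow> 0"
    unfolding eq using tendsto_mult_right_zero by auto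
  then show "(translation_error ?f \<circ> X) \<longlonglongrightarrow> translation_error ?f 0"
    by (simp add: o_def)
qed

lemma isCont_translation_errorI:
  assumes "\<And>e. 0 < e \<Longrightarrow> \<exists>g. integrable lborel g \<and> isCont (translation_error g) 0 \<and>
      (\<integral>x. \<bar>f x - g x\<bar> \<partial>lborel) < e" and f: "integrable lborel f"
  shows "isCont (translation_error f) 0"
proof -
  have "(translation_error f \<longlongrightarrow> 0) (at 0)"
  proof (rule order_tendstoI)
    fix e :: real assume "0 < e"
    then obtain g where g: "integrable lborel g" "isCont (translation_error g) 0"
      "(\<integral>x. \<bar>f x - g x\<bar> \<partial>lborel) < e / 4" using assms(1)[of "e/4"] by auto
    have "(translation_error g \<longlongrightarrow> 0) (at 0)" using g(2) unfolding isCont_def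
      by simp
    then have "\<forall>\<^sub>F w in at 0. translation_error g w < e / 4" using \<open>0 < e\<close> order_tendstoD(2)
      by (metis zero_less_divide_iff zero_less_numeral)
    then show "\<forall>\<^sub>F w in at 0. translation_error f w < e"
    proof eventually_elim
      case (elim w)
      then show ?case using translation_error_triangle[OF f g(1), of w] g(3) \<open>0 < e\<close> by linarith
    qed
  next
    fix e :: real assume "e < 0"
    then show "\<forall>\<^sub>F w in at 0. e < translation_error f w"
      by (intro always_eventually allI) (rule less_le_trans[OF _ translation_error_nonneg])
  qed
  then show ?thesis by (simp add: isCont_def)
qed

text \<open>Induction over the integrable functions: indicators of Borel sets come from open sets by
  outer regularity, sums from the triangle inequality, and limits from closedness under
  \<open>L1\<close> approximation.\<close>

lemma translation_continuity:
  assumes "integrable lborel f"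
  shows "isCont (translation_error f) 0"
  using assms
proof (induction f rule: integrable_induct)
  case (base A c)
  have A[measurable]: "A \<in> sets borel" using base by simp
  have fA: "integrable lborel (indicator A :: 'a \<Rightarrow> real)"
    using base by (auto intro!: integrable_real_indicator)
  have "isCont (translation_error (indicator A)) 0"
  proof (rule isCont_translation_errorI[OF _ fA])
    fix e :: real assume e: "0 < e"
    obtain U where U: "open U" "A \<subseteq> U" "emeasure lborel (U - A) < ennreal e"
      using outer_regular_lborel[OF A e] by blast
    have [measurable]: "U \<in> sets borel" using U by auto
    have "emeasure lborel U \<le> emeasure lborel A + emeasure lborel (U - A)"
      using U(2) by (subst plus_emeasure) (auto simp: Un_absorb1)
    also have "\<dots> < \<infinity>" using base U(3) by (auto simp: less_top[symmetric] intro!: ennreal_add_less_top) 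
    finally have fin: "emeasure lborel U < \<infinity>" .
    have "(\<integral>x. \<bar>indicator A x - indicator U x\<bar> \<partial>lborel) = (\<integral>x. indicator (U - A) x \<partial>(lborel::'a measure) :: real)"
      using U(2) by (intro Bochner_Integration.integral_cong) (auto split: split_indicator)
    also have "\<dots> = measure lborel (U - A)" by simp
    also have "\<dots> < e" using U(3) e by (simp add: measure_def enn2real_less_iff ennreal_less_iff emeasure_eq_ennreal_measure order_less_trans[OF U(3)] )
    finally have "(\<integral>x. \<bar>indicator A x - indicator U x\<bar> \<partial>lborel) < e" .
    then show "\<exists>g. integrable lborel g \<and> isCont (translation_error g) 0 \<and> (\<integral>x. \<bar>indicator A x - g x\<bar> \<partial>lborel) < e"
      using translation_error_open[OF U(1) fin] fin
      by (intro exI[of _ "indicator U"]) (auto intro!: integrable_real_indicator)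
  qed
  moreover have "translation_error (\<lambda>x. indicator A x *\<^sub>R c) w = \<bar>c\<bar> * translation_error (indicator A) w" for w
    unfolding translation_error_def
    by (simp add: abs_mult flip: left_diff_distrib integral_mult_right_zero)
       (simp add: mult.commute)
  ultimately show ?case by (auto simp: fun_eq_iff[symmetric] intro!: continuous_intros)
next
  case (add f g)
  note [simp] = add.hyps integrable_translate(1)[OF add.hyps(1)] integrable_translate(1)[OF add.hyps(2)]
  have le: "translation_error (\<lambda>x. f x + g x) w \<le> translation_error f w + translation_error g w" for w
  proof -
    have "translation_error (\<lambda>x. f x + g x) w \<le> (\<integral>x. \<bar>f (x + w) - f x\<bar> + \<bar>g (x + w) - g x\<bar> \<partial>lborel)"
      unfolding translation_error_def by (rule integral_mono) auto
    also have "\<dots> = translation_error f w + translation_error g w"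
      unfolding translation_error_def by (rule Bochner_Integration.integral_add) auto
    finally show ?thesis .
  qed
  have "((\<lambda>w. translation_error f w + translation_error g w) \<longlongrightarrow> 0) (at 0)"
    using tendsto_add[OF add.IH[unfolded isCont_def]] by simp
  then have "(translation_error (\<lambda>x. f x + g x) \<longlongrightarrow> 0) (at 0)"
    by (rule tendsto_sandwich[OF _ _ tendsto_const, rotated 2])
       (auto intro!: always_eventually le translation_error_nonneg)
  then show ?case by (simp add: isCont_def)
next
  case (lim f s)
  show ?case
  proof (rule isCont_translation_errorI[OF _ lim.hyps(4)])
    fix e :: real assume e: "0 < e"
    \<comment> \<open>The approximants satisfy
      \<open>\<bar>s i x\<bar> \<le> 2 * \<bar>f x\<bar>\<close>, hence the dominating function
      \<open>3 * \<bar>f x\<bar>\<close>.\<close>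
    have "(\<lambda>i. \<integral>x. \<bar>f x - s i x\<bar> \<partial>lborel) \<longlonglongrightarrow> (\<integral>x. 0 \<partial>(lborel::'a measure))"
    proof (rule integral_dominated_convergence[where w = "\<lambda>x. 3 * \<bar>f x\<bar>"])
      show "AE x in lborel. (\<lambda>i. \<bar>f x - s i x\<bar>) \<longlonglongrightarrow> 0"
        using lim.hyps(2) by (auto intro!: tendsto_eq_intros AE_I2)
      show "AE x in lborel. norm \<bar>f x - s i x\<bar> \<le> 3 * \<bar>f x\<bar>" for i
      proof (rule AE_I2)
        fix x :: 'a
        have "\<bar>s i x\<bar> \<le> 2 * \<bar>f x\<bar>" using lim.hyps(3)[of x i] by simp
        then show "norm \<bar>f x - s i x\<bar> \<le> 3 * \<bar>f x\<bar>" by simp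
      qed
    qed (use lim.hyps(1,4) in auto)
    then have "\<forall>\<^sub>F i in sequentially. (\<integral>x. \<bar>f x - s i x\<bar> \<partial>lborel) < e"
      using order_tendstoD(2)[of _ 0 sequentially e] e by auto
    then obtain i where "(\<integral>x. \<bar>f x - s i x\<bar> \<partial>lborel) < e" by (auto dest: eventually_happens)
    then show "\<exists>g. integrable lborel g \<and> isCont (translation_error g) 0 \<and> (\<integral>x. \<bar>f x - g x\<bar> \<partial>lborel) < e"
      using lim.hyps(1) lim.IH by blast
  qed
qed


section \<open>Smooth functions of compact support\<close>

lemma Cc_infinityD:
  assumes "Cc_infinity S \<eta>"
  shows "\<forall>k. Ck k \<eta>" "continuous_on UNIV \<eta>" "\<eta> differentiable (at x)"
    "\<eta> \<in> borel_measurable borel"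
proof -
  show 1: "\<forall>k. Ck k \<eta>" using assms by (simp add: Cc_infinity_def)
  show 2: "continuous_on UNIV \<eta>" by (rule Ck_continuous[OF 1])
  show "\<eta> differentiable (at x)" by (rule Ck_differentiable[OF 1])
  show "\<eta> \<in> borel_measurable borel" using 2 by (rule borel_measurable_continuous_onI)
qed

lemma Cc_infinityE:
  assumes "Cc_infinity S \<eta>"
  obtains K where "compact K" "K \<subseteq> S" "\<And>x. x \<notin> K \<Longrightarrow> \<eta> x = 0"
  using assms unfolding Cc_infinity_def by blast

lemma Cc_infinity_mono: "Cc_infinity S \<eta> \<Longrightarrow> S \<subseteq> S' \<Longrightarrow> Cc_infinity S' \<eta>"
  unfolding Cc_infinity_def by blast

lemma partial_deriv_eq_0:
  assumes "closed K" "\<And>x. x \<notin> K \<Longrightarrow> \<eta> x = 0" "x \<notin> K"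
  shows "partial_deriv b \<eta> x = 0"
proof -
  have "(\<eta> has_derivative (\<lambda>h. 0)) (at x)"
    by (rule has_derivative_transform_within_open[where s = "- K", OF has_derivative_const])
      (use assms in auto)
  from frechet_derivative_at[OF this] show ?thesis by metis
qed

lemma Cc_infinity_partial:
  assumes "Cc_infinity S \<eta>" "b \<in> Basis"
  shows "Cc_infinity S (partial_deriv b \<eta>)"
proof -
  obtain K where K: "compact K" "K \<subseteq> S" "\<And>x. x \<notin> K \<Longrightarrow> \<eta> x = 0"
    using Cc_infinityE[OF assms(1)] by blast
  have "\<forall>k. Ck k (partial_deriv b \<eta>)" using Ck_partial[OF Cc_infinityD(1)[OF assms(1)] assms(2)] .
  moreover have "\<forall>x. x \<notin> K \<longrightarrow> partial_deriv b \<eta> x = 0"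
    using partial_deriv_eq_0[of K \<eta>, OF compact_imp_closed[OF K(1)] K(3)] by blast
  ultimately show ?thesis unfolding Cc_infinity_def using K by blast
qed

lemma Cc_infinity_bounded:
  assumes "Cc_infinity S \<eta>"
  obtains M where "0 \<le> M" "\<And>x. \<bar>\<eta> x\<bar> \<le> M"
proof -
  obtain K where K: "compact K" "K \<subseteq> S" "\<And>x. x \<notin> K \<Longrightarrow> \<eta> x = 0"
    using Cc_infinityE[OF assms(1)] by blast
  have "compact (\<eta> ` K)"
    using K(1) Cc_infinityD(2)[OF assms] continuous_on_subset by (intro compact_continuous_image) auto
  then obtain M where "\<forall>y\<in>\<eta> ` K. norm y \<le> M" using compact_imp_bounded bounded_iff by metis
  then have "\<bar>\<eta> x\<bar> \<le> max M 0" for x using K(3)[of x] by (cases "x \<in> K") auto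
  then show ?thesis using that[of "max M 0"] by auto
qed

lemma Cc_infinity_integrable:
  assumes "Cc_infinity S \<eta>" shows "integrable lborel \<eta>"
proof -
  obtain K where K: "compact K" "K \<subseteq> S" "\<And>x. x \<notin> K \<Longrightarrow> \<eta> x = 0"
    using Cc_infinityE[OF assms(1)] by blast
  obtain M where M: "0 \<le> M" "\<And>x. \<bar>\<eta> x\<bar> \<le> M" using Cc_infinity_bounded[OF assms] by blast
  have "integrable lborel (\<lambda>x. M * indicator K x)"
    using K(1) emeasure_compact_finite[OF K(1)] borel_compact[OF K(1)]
    by (intro integrable_mult_right integrable_real_indicator) (auto simp: less_top)
  then show ?thesis
    by (rule Bochner_Integration.integrable_bound)
      (use M K(3) Cc_infinityD(4)[OF assms] in \<open>auto split: split_indicator\<close>)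
qed

lemma frechet_derivative_basis:
  fixes f :: "'a::euclidean_space \<Rightarrow> real"
  assumes "f differentiable (at x)"
  shows "frechet_derivative f (at x) h = (\<Sum>b\<in>Basis. (h \<bullet> b) * partial_deriv b f x)"
proof -
  have l: "linear (frechet_derivative f (at x))" using linear_frechet_derivative[OF assms] .
  have "frechet_derivative f (at x) h = frechet_derivative f (at x) (\<Sum>b\<in>Basis. (h \<bullet> b) *\<^sub>R b)"
    by (simp add: euclidean_representation)
  also have "\<dots> = (\<Sum>b\<in>Basis. (h \<bullet> b) * partial_deriv b f x)"
    by (simp add: linear_sum[OF l] linear_cmul[OF l])
  finally show ?thesis .
qed

text \<open>The constant dominates all difference quotients of \<eta>, which is what the limits
  under the integral sign require.\<close>

lemma Cc_infinity_lipschitz: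
  fixes \<eta> :: "'a::euclidean_space \<Rightarrow> real"
  assumes "Cc_infinity S \<eta>"
  obtains L where "0 \<le> L" "\<And>x h. \<bar>frechet_derivative \<eta> (at x) h\<bar> \<le> L * norm h"
    "\<And>x y. \<bar>\<eta> x - \<eta> y\<bar> \<le> L * norm (x - y)"
proof -
  have "\<exists>M. \<forall>x. \<bar>partial_deriv b \<eta> x\<bar> \<le> M" if "b \<in> Basis" for b
    using Cc_infinity_bounded[OF Cc_infinity_partial[OF assms that]] by metis
  then obtain M where M: "\<And>b x. b \<in> Basis \<Longrightarrow> \<bar>partial_deriv b \<eta> x\<bar> \<le> M b" by metis
  define L where "L = (\<Sum>b\<in>(Basis::'a set). M b)"
  have M0: "0 \<le> M b" if "b \<in> Basis" for b using M[OF that, of 0] by linarith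
  then have L0: "0 \<le> L" unfolding L_def by (rule sum_nonneg)
  have F: "\<bar>frechet_derivative \<eta> (at x) h\<bar> \<le> L * norm h" for x h
  proof -
    have "\<bar>frechet_derivative \<eta> (at x) h\<bar> \<le> (\<Sum>b\<in>Basis. \<bar>(h \<bullet> b) * partial_deriv b \<eta> x\<bar>)"
      by (subst frechet_derivative_basis[OF Cc_infinityD(3)[OF assms]]) (rule sum_abs)
    also have "\<dots> \<le> (\<Sum>b\<in>Basis. norm h * M b)"
      unfolding abs_mult by (intro sum_mono mult_mono M Basis_le_norm) auto
    also have "\<dots> = L * norm h" by (simp add: L_def sum_distrib_left mult.commute)
    finally show ?thesis .
  qed
  have "\<bar>\<eta> x - \<eta> y\<bar> \<le> L * norm (x - y)" for x y
  proof -
    have "norm (\<eta> x - \<eta> y) \<le> L * norm (x - y)"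
    proof (rule differentiable_bound[of UNIV \<eta> "\<lambda>x. frechet_derivative \<eta> (at x)"])
      show "(\<eta> has_derivative frechet_derivative \<eta> (at z)) (at z within UNIV)" for z
        using Cc_infinityD(3)[OF assms] by (simp add: frechet_derivative_works)
      show "onorm (frechet_derivative \<eta> (at z)) \<le> L" for z
        using F by (intro onorm_le) simp
    qed auto
    then show ?thesis by simp
  qed
  then show ?thesis using that L0 F by blast
qed

lemma Cc_infinity_mult:
  assumes "Cc_infinity S \<eta>" "\<forall>k. Ck k f" shows "Cc_infinity S (\<lambda>x. f x * \<eta> x)"
  using assms unfolding Cc_infinity_def by (auto intro!: Ck_mult)

text \<open>Integration by parts: the difference quotients of \<open>\<eta>\<close> integrate to zero against a function
  that is invariant in the direction \<open>b\<close>.\<close>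

lemma integral_partial_deriv_eq_0:
  fixes \<eta> \<phi> :: "'a::euclidean_space \<Rightarrow> real"
  assumes \<eta>: "Cc_infinity S \<eta>" and b: "b \<in> Basis"
    and \<phi>: "\<And>r. integrable lborel (\<lambda>z. indicator (cball 0 r) z * \<phi> z)"
    and inv: "\<And>z h. \<phi> (z + h *\<^sub>R b) = \<phi> z"
  shows "(\<integral>z. \<phi> z * partial_deriv b \<eta> z \<partial>lborel) = 0"
proof -
  obtain K where K: "compact K" "\<And>x. x \<notin> K \<Longrightarrow> \<eta> x = 0"
    using Cc_infinityE[OF \<eta>] by metis
  obtain r where "\<forall>x\<in>K. norm x \<le> r" using compact_imp_bounded[OF K(1)] bounded_iff by metis
  then have r: "K \<subseteq> cball 0 r" by auto
  obtain L where L: "0 \<le> L" "\<And>x y. \<bar>\<eta> x - \<eta> y\<bar> \<le> L * norm (x - y)"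
    using Cc_infinity_lipschitz[OF \<eta>] by metis
  obtain M where M: "0 \<le> M" "\<And>x. \<bar>\<eta> x\<bar> \<le> M" using Cc_infinity_bounded[OF \<eta>] by blast
  have [measurable]: "\<eta> \<in> borel_measurable borel" by (rule Cc_infinityD(4)[OF \<eta>])
  have [measurable]: "partial_deriv b \<eta> \<in> borel_measurable borel"
    using Cc_infinityD(4)[OF Cc_infinity_partial[OF \<eta> b]] .
  have zero: "\<eta> z = 0" if "z \<notin> cball 0 r" for z using that r K(2) by blast
  have int: "integrable lborel (\<lambda>z. \<phi> z * \<eta> z)"
  proof -
    have "integrable lborel (\<lambda>z. (indicator (cball 0 r) z * \<phi> z) * \<eta> z)"
      by (rule Bochner_Integration.integrable_bound[OF integrable_mult_left[OF integrable_abs[OF \<phi>[of r]], of M]])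
        (use M \<phi>[of r] in \<open>auto simp: abs_mult intro!: mult_left_mono mult_nonneg_nonneg\<close>)
    moreover have "(\<lambda>z. (indicator (cball 0 r) z * \<phi> z) * \<eta> z) = (\<lambda>z. \<phi> z * \<eta> z)"
      using zero by (auto simp: fun_eq_iff split: split_indicator)
    ultimately show ?thesis by simp
  qed
  \<comment> \<open>Steps of length at most 1: a translate of \<eta> can then differ from zero only
    in the ball of radius \<open>r + 1\<close>, where \<phi> is integrable.\<close>
  define X where "X n = 1 / real (Suc n)" for n
  have X: "X \<longlonglongrightarrow> 0" "\<And>n. 0 < X n" "\<And>n. X n \<le> 1"
    unfolding X_def using LIMSEQ_inverse_real_of_nat by (auto simp: divide_inverse inverse_le_1_iff)
  define q where "q n z = \<phi> z * ((\<eta> (z + X n *\<^sub>R b) - \<eta> z) / X n)" for n z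
  have q0: "(\<integral>z. q n z \<partial>lborel) = 0" for n
  proof -
    have "(\<integral>z. \<phi> (z + X n *\<^sub>R b) * \<eta> (z + X n *\<^sub>R b) \<partial>lborel) = (\<integral>z. \<phi> z * \<eta> z \<partial>lborel)"
      and i: "integrable lborel (\<lambda>z. \<phi> (z + X n *\<^sub>R b) * \<eta> (z + X n *\<^sub>R b))"
      using integrable_translate[OF int, of "X n *\<^sub>R b"] by auto
    then have "(\<integral>z. \<phi> z * \<eta> (z + X n *\<^sub>R b) - \<phi> z * \<eta> z \<partial>lborel) = 0"
      using int by (subst Bochner_Integration.integral_diff) (auto simp: inv)
    moreover have "q n z = (\<phi> z * \<eta> (z + X n *\<^sub>R b) - \<phi> z * \<eta> z) / X n" for z
      by (simp add: q_def algebra_simps)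
    ultimately show ?thesis by simp
  qed
  have "(\<lambda>n. \<integral>z. q n z \<partial>lborel) \<longlonglongrightarrow> (\<integral>z. \<phi> z * partial_deriv b \<eta> z \<partial>lborel)"
  proof (rule integral_dominated_convergence[where w = "\<lambda>z. L * \<bar>indicator (cball 0 (r + 1)) z * \<phi> z\<bar>"])
    have \<phi>m: "(\<lambda>z. indicator (cball 0 R) z * \<phi> z) \<in> borel_measurable borel" for R
      using \<phi>[of R] by auto
    \<comment> \<open>Measurability is known for the truncations to balls; \<phi> is their pointwise
      limit.\<close>
    have \<phi>'[measurable]: "\<phi> \<in> borel_measurable borel"
    proof (rule borel_measurable_LIMSEQ_metric)
      fix x
      show "(\<lambda>n. indicator (cball 0 (real n)) x * \<phi> x) \<longlonglongrightarrow> \<phi> x"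
      proof (rule tendsto_eventually)
        show "\<forall>\<^sub>F n in sequentially. indicator (cball 0 (real n)) x * \<phi> x = \<phi> x"
          using eventually_ge_at_top[of "nat \<lceil>norm x\<rceil>"]
          by eventually_elim (auto split: split_indicator simp: ceiling_le_iff nat_le_iff)
      qed
    qed (use \<phi>m in auto)
    show "(\<lambda>z. \<phi> z * partial_deriv b \<eta> z) \<in> borel_measurable lborel" by measurable
    show "q n \<in> borel_measurable lborel" for n unfolding q_def[abs_def] by measurable
    show "integrable lborel (\<lambda>z. L * \<bar>indicator (cball 0 (r + 1)) z * \<phi> z\<bar>)" using \<phi>[of "r + 1"] by auto
    show "AE z in lborel. (\<lambda>n. q n z) \<longlonglongrightarrow> \<phi> z * partial_deriv b \<eta> z"
    proof (rule AE_I2)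
      fix z
      have "((\<lambda>s. \<eta> (z + s *\<^sub>R b)) has_real_derivative partial_deriv b \<eta> z) (at 0)"
        by (rule partial_deriv_along_line[OF Cc_infinityD(3)[OF \<eta>]])
      then have "((\<lambda>s. (\<eta> (z + s *\<^sub>R b) - \<eta> z) / s) \<longlongrightarrow> partial_deriv b \<eta> z) (at 0)"
        by (simp add: DERIV_def)
      moreover have "X i \<noteq> 0" for i using X(2)[of i] by simp
      then have "\<forall>i. X i \<in> UNIV - {0}" by simp
      ultimately have "((\<lambda>s. (\<eta> (z + s *\<^sub>R b) - \<eta> z) / s) \<circ> X) \<longlonglongrightarrow> partial_deriv b \<eta> z"
        using X(1) unfolding tendsto_at_iff_sequentially by blast
      then show "(\<lambda>n. q n z) \<longlonglongrightarrow> \<phi> z * partial_deriv b \<eta> z"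
        unfolding q_def by (intro tendsto_intros) (simp add: o_def)
    qed
    show "AE z in lborel. norm (q n z) \<le> L * \<bar>indicator (cball 0 (r + 1)) z * \<phi> z\<bar>" for n
    proof (rule AE_I2)
      fix z
      have nb: "norm b = 1" using b by simp
      have 1: "\<bar>\<eta> (z + X n *\<^sub>R b) - \<eta> z\<bar> / X n \<le> L"
        using L(2)[of "z + X n *\<^sub>R b" z] X(2)[of n] nb by (simp add: field_simps)
      show "norm (q n z) \<le> L * \<bar>indicator (cball 0 (r + 1)) z * \<phi> z\<bar>"
      proof (cases "z \<in> cball 0 (r + 1)")
        case True
        have "norm (q n z) = \<bar>\<phi> z\<bar> * (\<bar>\<eta> (z + X n *\<^sub>R b) - \<eta> z\<bar> / X n)"
          using X(2)[of n] by (simp add: q_def abs_mult)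
        also have "\<dots> \<le> \<bar>\<phi> z\<bar> * L" using 1 by (intro mult_left_mono) auto
        finally show ?thesis using True by (simp add: mult.commute)
      next
        case False
        then have n: "r + 1 < norm z" by simp
        have "norm z \<le> norm (z + X n *\<^sub>R b) + norm (X n *\<^sub>R b)"
          using norm_triangle_ineq4[of "z + X n *\<^sub>R b" "X n *\<^sub>R b"] by simp
        then have "r < norm (z + X n *\<^sub>R b)" using n X(2,3)[of n] nb by simp
        then have "\<eta> (z + X n *\<^sub>R b) = 0" "\<eta> z = 0" using n by (auto intro!: zero)
        then show ?thesis using L(1) by (simp add: q_def)
      qed
    qed
  qed
  then have "(\<lambda>n::nat. 0) \<longlonglongrightarrow> (\<integral>z. \<phi> z * partial_deriv b \<eta> z \<partial>lborel)" by (simp only: q0)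
  from LIMSEQ_unique[OF this tendsto_const] show ?thesis .
qed

text \<open>The constant function 1 is invariant in every direction, so the derivative of the
  product \<open>g * \<eta>\<close> integrates to zero; the product rule does the rest.\<close>

lemma integration_by_parts_Cc:
  fixes \<eta> g :: "'a::euclidean_space \<Rightarrow> real"
  assumes \<eta>: "Cc_infinity S \<eta>" and g: "\<forall>k. Ck k g" and b: "b \<in> Basis"
  shows "(\<integral>x. g x * partial_deriv b \<eta> x \<partial>lborel) = - (\<integral>x. partial_deriv b g x * \<eta> x \<partial>lborel)"
proof -
  have g\<eta>: "Cc_infinity S (\<lambda>x. g x * \<eta> x)" using Cc_infinity_mult[OF \<eta> g] .
  have "(\<integral>z. 1 * partial_deriv b (\<lambda>x. g x * \<eta> x) z \<partial>lborel) = 0"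
    by (rule integral_partial_deriv_eq_0[OF g\<eta> b])
      (auto intro!: integrable_real_indicator emeasure_compact_finite[OF compact_cball, unfolded infinity_ennreal_def])
  moreover have "partial_deriv b (\<lambda>x. g x * \<eta> x) = (\<lambda>x. g x * partial_deriv b \<eta> x + partial_deriv b g x * \<eta> x)"
    using Ck_differentiable[OF g] Cc_infinityD(3)[OF \<eta>] by (intro partial_deriv_mult) auto
  moreover have "integrable lborel (\<lambda>x. g x * partial_deriv b \<eta> x)"
    using Cc_infinity_integrable[OF Cc_infinity_mult[OF Cc_infinity_partial[OF \<eta> b] g]] .
  moreover have "integrable lborel (\<lambda>x. partial_deriv b g x * \<eta> x)"
    using Cc_infinity_integrable[OF Cc_infinity_mult[OF \<eta> Ck_partial[OF g b]]] .
  ultimately show ?thesis by simp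
qed

section \<open>Mollification\<close>

lemma lborel_distr_reflect:
  "distr lborel borel (\<lambda>x. t - x) = (lborel :: 'a::euclidean_space measure)"
proof -
  have "lborel = density (distr lborel borel (\<lambda>x::'a. t + (-1) *\<^sub>R x)) (\<lambda>_. ennreal (\<bar>-1\<bar> ^ DIM('a)))"
    by (rule lborel_affine) auto
  then show ?thesis by (simp add: density_1)
qed

lemma integrable_reflect:
  fixes f :: "'a::euclidean_space \<Rightarrow> real"
  assumes "integrable lborel f"
  shows "integrable lborel (\<lambda>x. f (t - x))"
proof -
  have "integrable (distr lborel borel (\<lambda>x. t - x)) f" using assms by (simp add: lborel_distr_reflect)
  then show ?thesis by (subst (asm) integrable_distr_eq) (use assms in auto)
qed

lemma integral_reflect:
  fixes f :: "'a::euclidean_space \<Rightarrow> real"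
  assumes [measurable]: "f \<in> borel_measurable borel"
  shows "(\<integral>x. f (t - x) \<partial>lborel) = integral\<^sup>L lborel f"
proof -
  have "integral\<^sup>L (distr lborel borel (\<lambda>x. t - x)) f = (\<integral>x. f (t - x) \<partial>lborel)"
    by (subst integral_distr) auto
  then show ?thesis by (simp add: lborel_distr_reflect)
qed

definition convolve :: "('a::euclidean_space \<Rightarrow> real) \<Rightarrow> ('a \<Rightarrow> real) \<Rightarrow> 'a \<Rightarrow> real" where
  "convolve f J x = (\<integral>y. f y * J (x - y) \<partial>lborel)"

lemma integrable_convolve:
  fixes f J :: "'a::euclidean_space \<Rightarrow> real"
  assumes f: "integrable lborel f" and J[measurable]: "J \<in> borel_measurable borel" and M: "\<And>x. \<bar>J x\<bar> \<le> M"
  shows "integrable lborel (\<lambda>y. f y * J (x - y))"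
proof -
  have "integrable lborel (\<lambda>y. \<bar>f y\<bar> * M)" by (intro integrable_mult_left integrable_abs f)
  then show ?thesis
    by (rule Bochner_Integration.integrable_bound)
      (use f M in \<open>auto simp: abs_mult intro!: mult_left_mono order_trans[OF M abs_ge_self]\<close>)
qed

text \<open>The kernel is Lipschitz, so the normalised Taylor remainder is at most
  \<open>2 * L\<close> and dominated convergence applies along every sequence tending to
  \<open>x\<close>.\<close>

lemma convolve_has_derivative:
  fixes f :: "'a::euclidean_space \<Rightarrow> real"
  assumes f: "integrable lborel f" and J: "Cc_infinity S J"
  shows "(convolve f J has_derivative (\<lambda>h. \<integral>y. f y * frechet_derivative J (at (x - y)) h \<partial>lborel)) (at x)"
proof -
  obtain L where L: "0 \<le> L" "\<And>x h. \<bar>frechet_derivative J (at x) h\<bar> \<le> L * norm h"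
    "\<And>x y. \<bar>J x - J y\<bar> \<le> L * norm (x - y)"
    using Cc_infinity_lipschitz[OF J] by blast
  obtain M where M: "\<And>x. \<bar>J x\<bar> \<le> M" using Cc_infinity_bounded[OF J] by blast
  have fm[measurable]: "f \<in> borel_measurable borel" using f by auto
  have Jm[measurable]: "J \<in> borel_measurable borel" by (rule Cc_infinityD(4)[OF J])
  have dJ: "J differentiable (at z)" for z by (rule Cc_infinityD(3)[OF J])
  have Fm[measurable]: "(\<lambda>y. frechet_derivative J (at y) h) \<in> borel_measurable borel" for h
  proof -
    have "(\<lambda>y. \<Sum>b\<in>Basis. (h \<bullet> b) * partial_deriv b J y) \<in> borel_measurable borel"
      by (intro borel_measurable_sum borel_measurable_times borel_measurable_const
          Cc_infinityD(4)[OF Cc_infinity_partial[OF J]])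
    moreover have "(\<lambda>y. frechet_derivative J (at y) h) = (\<lambda>y. \<Sum>b\<in>Basis. (h \<bullet> b) * partial_deriv b J y)"
      by (rule ext) (rule frechet_derivative_basis[OF dJ])
    ultimately show ?thesis by simp
  qed
  have Fi: "integrable lborel (\<lambda>y. f y * frechet_derivative J (at (x - y)) h)" for h x
    by (rule integrable_convolve[OF f Fm L(2)])
  have Ji: "integrable lborel (\<lambda>y. f y * J (x - y))" for x
    by (rule integrable_convolve[OF f Jm M])
  have lin: "linear (frechet_derivative J (at z))" for z by (rule linear_frechet_derivative[OF dJ])
  define D where "D h = (\<integral>y. f y * frechet_derivative J (at (x - y)) h \<partial>lborel)" for h
  have "linear D"
  proof
    show "D (h + h') = D h + D h'" for h h'
      unfolding D_def using Fi[of x h] Fi[of x h']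
      by (subst Bochner_Integration.integral_add[symmetric]) (auto simp: linear_add[OF lin] distrib_left)
    show "D (c *\<^sub>R h) = c *\<^sub>R D h" for c h
      unfolding D_def by (simp add: linear_cmul[OF lin] mult.left_commute)
  qed
  then have bl: "bounded_linear D" by (rule linear_conv_bounded_linear[THEN iffD1])
  have "((\<lambda>y. norm ((convolve f J y - convolve f J x) - D (y - x)) / norm (y - x)) \<longlongrightarrow> 0) (at x)"
    unfolding tendsto_at_iff_sequentially
  proof (intro allI impI)
    fix X assume X: "\<forall>i. X i \<in> UNIV - {x}" "X \<longlonglongrightarrow> x"
    define q where "q n y = f y * ((J (X n - y) - J (x - y) - frechet_derivative J (at (x - y)) (X n - x)) / norm (X n - x))" for n y
    have nz: "0 < norm (X n - x)" for n using X(1) by auto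
    have eq: "((convolve f J (X n) - convolve f J x) - D (X n - x)) / norm (X n - x) = (\<integral>y. q n y \<partial>lborel)" for n
    proof -
      have "(convolve f J (X n) - convolve f J x) - D (X n - x) =
        (\<integral>y. f y * J (X n - y) - f y * J (x - y) - f y * frechet_derivative J (at (x - y)) (X n - x) \<partial>lborel)"
        unfolding convolve_def D_def using Ji Fi by auto
      also have "\<dots> = (\<integral>y. q n y * norm (X n - x) \<partial>lborel)"
        using nz[of n] by (intro Bochner_Integration.integral_cong) (simp_all add: q_def right_diff_distrib)
      finally show ?thesis using nz[of n] by simp
    qed
    have "(\<lambda>n. \<integral>y. q n y \<partial>lborel) \<longlonglongrightarrow> (\<integral>y. 0 \<partial>(lborel::'a measure))"
    proof (rule integral_dominated_convergence[where w = "\<lambda>y. \<bar>f y\<bar> * (2 * L)"])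
      show "integrable lborel (\<lambda>y. \<bar>f y\<bar> * (2 * L))" using f by auto
      show "q n \<in> borel_measurable lborel" for n unfolding q_def[abs_def] by measurable
      show "AE y in lborel. (\<lambda>n. q n y) \<longlonglongrightarrow> 0"
      proof (rule AE_I2)
        fix y
        have "(J has_derivative frechet_derivative J (at (x - y))) (at (x - y))"
          using dJ frechet_derivative_works by blast
        then have lim: "((\<lambda>z. norm (J z - J (x - y) - frechet_derivative J (at (x - y)) (z - (x - y))) / norm (z - (x - y))) \<longlongrightarrow> 0) (at (x - y))"
          unfolding has_derivative_iff_norm by blast
        have "filterlim (\<lambda>n. X n - y) (at (x - y)) sequentially"
        proof (rule filterlim_atI)
          show "(\<lambda>n. X n - y) \<longlonglongrightarrow> x - y" using X(2) by (intro tendsto_intros)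
          show "\<forall>\<^sub>F n in sequentially. X n - y \<noteq> x - y" using X(1) by simp
        qed
        from filterlim_compose[OF lim this] have "(\<lambda>n. norm ((J (X n - y) - J (x - y) - frechet_derivative J (at (x - y)) (X n - x)) / norm (X n - x))) \<longlonglongrightarrow> 0"
          by simp
        from tendsto_mult_right_zero[OF tendsto_norm_zero_cancel[OF this], of "f y"]
        show "(\<lambda>n. q n y) \<longlonglongrightarrow> 0"
          by (simp only: q_def)
      qed
      show "AE y in lborel. norm (q n y) \<le> \<bar>f y\<bar> * (2 * L)" for n
      proof (rule AE_I2)
        fix y
        have "\<bar>J (X n - y) - J (x - y) - frechet_derivative J (at (x - y)) (X n - x)\<bar> \<le> 2 * L * norm (X n - x)"
          using L(3)[of "X n - y" "x - y"] L(2)[of "x - y" "X n - x"] by simp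
        then have "\<bar>J (X n - y) - J (x - y) - frechet_derivative J (at (x - y)) (X n - x)\<bar> / norm (X n - x) \<le> 2 * L"
          using nz[of n] by (simp add: field_simps)
        from mult_left_mono[OF this abs_ge_zero, of "f y"]
        show "norm (q n y) \<le> \<bar>f y\<bar> * (2 * L)"
          unfolding q_def by (simp add: abs_mult)
      qed
    qed auto
    then have "(\<lambda>n. norm (((convolve f J (X n) - convolve f J x) - D (X n - x)) / norm (X n - x))) \<longlonglongrightarrow> 0"
      unfolding eq by (intro tendsto_norm_zero) simp
    then show "((\<lambda>y. norm ((convolve f J y - convolve f J x) - D (y - x)) / norm (y - x)) \<circ> X) \<longlonglongrightarrow> 0"
      by (simp add: o_def)
  qed
  then show ?thesis using bl unfolding has_derivative_iff_norm D_def[abs_def] by blast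
qed

lemma convolve_partial_deriv:
  assumes "integrable lborel f" "Cc_infinity S J"
  shows "partial_deriv b (convolve f J) = convolve f (partial_deriv b J)"
  by (rule ext) (simp only: frechet_derivative_at[OF convolve_has_derivative[OF assms], symmetric] convolve_def)

text \<open>All derivatives fall on the kernel, and partial derivatives of a test function are test
  functions: the induction varies \<open>J\<close> and keeps \<open>f\<close>.\<close>

lemma Ck_convolve:
  assumes "integrable lborel f" "Cc_infinity S J"
  shows "Ck k (convolve f J)"
  using assms(2)
proof (induction k arbitrary: J)
  case 0
  have "convolve f J differentiable (at x)" for x
    using convolve_has_derivative[OF assms(1) 0] differentiable_def by blast
  then show ?case
    by (simp add: continuous_at_imp_continuous_on differentiable_imp_continuous_within)
next
  case (Suc k)
  have "convolve f J differentiable (at x)" for x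
    using convolve_has_derivative[OF assms(1) Suc.prems] differentiable_def by blast
  moreover have "Ck k (partial_deriv b (convolve f J))" if "b \<in> Basis" for b
    unfolding convolve_partial_deriv[OF assms(1) Suc.prems]
    using Suc.IH[OF Cc_infinity_partial[OF Suc.prems that]] .
  ultimately show ?case by simp
qed

text \<open>As \<open>J\<close> has mass one, the error at \<open>x\<close> is the
  \<open>J\<close>-average of \<open>f (x - z) - f x\<close>; exchanging the integrals leaves
  translation errors with \<open>norm z \<le> d\<close> only. The integral is taken in
  \<open>ennreal\<close> because integrability of the error is drawn from this bound
  afterwards.\<close>

lemma convolve_L1_error:
  fixes f :: "'a::euclidean_space \<Rightarrow> real"
  assumes f: "integrable lborel f" and J: "integrable lborel J" "\<And>x. 0 \<le> J x" "integral\<^sup>L lborel J = 1"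
    and M: "\<And>x. J x \<le> M"
    and supp: "\<And>x. d < norm x \<Longrightarrow> J x = 0"
    and e: "\<And>w. norm w \<le> d \<Longrightarrow> translation_error f w \<le> e"
  shows "(\<integral>\<^sup>+x. ennreal \<bar>convolve f J x - f x\<bar> \<partial>lborel) \<le> ennreal e"
proof -
  have fm[measurable]: "f \<in> borel_measurable borel" using f by auto
  have Jm[measurable]: "J \<in> borel_measurable borel" using J by auto
  have J': "\<bar>J x\<bar> \<le> M" for x using J(2)[of x] M[of x] by simp
  have i1: "integrable lborel (\<lambda>z. f (x - z) * J z)" for x
    using integrable_reflect[OF integrable_convolve[OF f Jm J', of x], of x] by simp
  have diff: "convolve f J x - f x = (\<integral>z. (f (x - z) - f x) * J z \<partial>lborel)" for x
  proof -
    have "convolve f J x = (\<integral>z. f (x - z) * J z \<partial>lborel)"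
      unfolding convolve_def using integral_reflect[of "\<lambda>y. f y * J (x - y)" x] by simp
    moreover have "f x = (\<integral>z. f x * J z \<partial>lborel)" using J(3) by simp
    moreover have "integrable lborel (\<lambda>z. f x * J z)" using J(1) by simp
    ultimately show ?thesis using i1[of x]
      by (simp add: left_diff_distrib Bochner_Integration.integral_diff)
  qed
  have "(\<integral>\<^sup>+x. ennreal \<bar>convolve f J x - f x\<bar> \<partial>lborel)
      \<le> (\<integral>\<^sup>+x. (\<integral>\<^sup>+z. ennreal (\<bar>f (x - z) - f x\<bar> * J z) \<partial>lborel) \<partial>lborel)"
  proof (rule nn_integral_mono)
    fix x
    have i2: "integrable lborel (\<lambda>z. (f (x - z) - f x) * J z)"
      using i1[of x] J(1) by (simp add: left_diff_distrib)
    then have i3: "integrable lborel (\<lambda>z. \<bar>f (x - z) - f x\<bar> * J z)"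
      using integrable_abs[OF i2] J(2) by (simp add: abs_mult)
    have "\<bar>convolve f J x - f x\<bar> \<le> (\<integral>z. \<bar>f (x - z) - f x\<bar> * J z \<partial>lborel)"
      unfolding diff using integral_abs_bound[of lborel "\<lambda>z. (f (x - z) - f x) * J z"] J(2)
      by (simp add: abs_mult)
    then have "ennreal \<bar>convolve f J x - f x\<bar> \<le> ennreal (\<integral>z. \<bar>f (x - z) - f x\<bar> * J z \<partial>lborel)"
      by (rule ennreal_leI)
    also have "\<dots> = (\<integral>\<^sup>+z. ennreal (\<bar>f (x - z) - f x\<bar> * J z) \<partial>lborel)"
      using i3 J(2) by (intro nn_integral_eq_integral[symmetric]) auto
    finally show "ennreal \<bar>convolve f J x - f x\<bar> \<le> (\<integral>\<^sup>+z. ennreal (\<bar>f (x - z) - f x\<bar> * J z) \<partial>lborel)" .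
  qed
  also have "\<dots> = (\<integral>\<^sup>+z. (\<integral>\<^sup>+x. ennreal (\<bar>f (x - z) - f x\<bar> * J z) \<partial>lborel) \<partial>lborel)"
    by (rule lborel_pair.Fubini') measurable
  also have "\<dots> \<le> (\<integral>\<^sup>+z. ennreal (e * J z) \<partial>(lborel::'a measure))"
  proof (rule nn_integral_mono)
    fix z
    show "(\<integral>\<^sup>+x. ennreal (\<bar>f (x - z) - f x\<bar> * J z) \<partial>lborel) \<le> ennreal (e * J z)"
    proof (cases "norm z \<le> d")
      case True
      have "integrable lborel (\<lambda>x. f (x + (-z)) - f x)"
        using f integrable_translate(1)[OF f, of "-z"] by (rule Bochner_Integration.integrable_diff[rotated])
      then have i: "integrable lborel (\<lambda>x. \<bar>f (x - z) - f x\<bar> * J z)" by simp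
      have "(\<integral>\<^sup>+x. ennreal (\<bar>f (x - z) - f x\<bar> * J z) \<partial>lborel) = ennreal (\<integral>x. \<bar>f (x - z) - f x\<bar> * J z \<partial>lborel)"
        using i J(2) by (intro nn_integral_eq_integral) auto
      also have "(\<integral>x. \<bar>f (x - z) - f x\<bar> * J z \<partial>lborel) = translation_error f (- z) * J z"
        by (simp add: translation_error_def)
      also have "\<dots> \<le> e * J z" using e[of "-z"] True J(2) by (intro mult_right_mono) auto
      finally show ?thesis using ennreal_leI by simp
    next
      case False
      then show ?thesis using supp[of z] by simp
    qed
  qed
  \<comment> \<open>For \<open>0 \<le> d\<close> the translation by 0 shows
    \<open>0 \<le> e\<close>. For negative \<open>d\<close> the support condition forces
    \<open>J = 0\<close>, and both sides vanish whatever the sign of \<open>e\<close>.\<close>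
  also have "\<dots> = ennreal (\<integral>z. e * J z \<partial>lborel)"
  proof (cases "0 \<le> d")
    case True
    have "0 \<le> e" using e[of 0] True by simp
    then show ?thesis using J by (intro nn_integral_eq_integral) auto
  next
    case False
    then have "J z = 0" for z using supp[of z] norm_ge_zero[of z] by linarith
    then show ?thesis by simp
  qed
  finally show ?thesis using J(3) by simp
qed

lemma mollifier_exists:
  fixes d :: real
  assumes d: "0 < d"
  obtains J :: "real^'n \<Rightarrow> real" where "Cc_infinity (cball 0 d) J" "\<And>x. 0 \<le> J x" "integral\<^sup>L lborel J = 1"
proof -
  \<comment> \<open>The bump vanishes outside the cube of half width
    \<open>2 * s = d / CARD('n)\<close>: by the bound of the norm through the sum of the
    coordinates, a point of norm above \<open>d\<close> has a coordinate of at least that size. On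
    the ball of radius \<open>s\<close> the bump is bounded below, so its integral is positive and
    can be normalised.\<close>
  define s where "s = d / (2 * real CARD('n))"
  have s: "0 < s" using d by (simp add: s_def)
  let ?B = "box_bump 2 (\<lambda>_::'n. s)"
  have supp: "?B x = 0" if "x \<notin> cball 0 d" for x
  proof -
    have "d < norm x" using that by simp
    also have "norm x \<le> (\<Sum>i\<in>UNIV. \<bar>x $ i\<bar>)" by (rule norm_le_l1_cart)
    finally have "(\<Sum>i\<in>(UNIV::'n set). d / real CARD('n)) < (\<Sum>i\<in>UNIV. \<bar>x $ i\<bar>)" by simp
    then obtain i where "d / real CARD('n) \<le> \<bar>x $ i\<bar>"
      by (metis (mono_tags, lifting) less_eq_real_def not_less sum_mono)
    then show ?thesis using s by (intro box_bump_eq_0[of _ i]) (auto simp: s_def)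
  qed
  then have B: "Cc_infinity (cball 0 d) ?B"
    unfolding Cc_infinity_def
    by (intro conjI allI exI[of _ "cball 0 d"] impI Ck_box_bump compact_cball supp subset_refl)
  define c where "c = exp (- 2 / (2 - 1 :: real)) ^ CARD('n)"
  have c: "0 < c" by (simp add: c_def)
  have low: "c * indicator (ball 0 s) x \<le> ?B x" for x
  proof (cases "x \<in> ball 0 s")
    case True
    then have "\<bar>x $ i\<bar> \<le> s" for i using component_le_norm_cart[of x i] by simp
    then show ?thesis using box_bump_lower[of 2 "\<lambda>_. s" x] s True by (simp add: c_def)
  qed (simp add: box_bump_bounds)
  have Bi: "integrable lborel ?B" by (rule Cc_infinity_integrable[OF B])
  have bi: "integrable lborel (\<lambda>x::real^'n. c * indicator (ball 0 s) x)"
    using emeasure_bounded_finite[OF bounded_ball, of "0::real^'n" s]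
    by (intro integrable_mult_right integrable_real_indicator) auto
  have "0 < c * measure lborel (ball (0::real^'n) s)"
    using c content_ball_pos[OF s, of "0::real^'n"] by simp
  also have "\<dots> = (\<integral>x. c * indicator (ball 0 s) (x::real^'n) \<partial>lborel)" by simp
  also have "\<dots> \<le> integral\<^sup>L lborel ?B" using Bi bi low by (intro integral_mono) auto
  finally have pos: "0 < integral\<^sup>L lborel ?B" .
  let ?J = "\<lambda>x. (1 / integral\<^sup>L lborel ?B) * ?B x"
  have "Cc_infinity (cball 0 d) ?J" by (intro Cc_infinity_mult[OF B] allI Ck_const)
  moreover have "0 \<le> ?J x" for x
    by (rule mult_nonneg_nonneg) (use pos in \<open>auto simp: box_bump_bounds\<close>)
  moreover have "integral\<^sup>L lborel ?J = 1" using pos by (subst integral_mult_right_zero) simp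
  ultimately show ?thesis by (rule that)
qed

section \<open>The chain rule in Sobolev spaces\<close>

text \<open>The function spaces are stated over the completed measure, while the analysis is done
  with Borel functions over \<open>lborel\<close>; this lemma and its neighbours cross from one to
  the other.\<close>

lemma LqI:
  fixes h :: "'a::euclidean_space \<Rightarrow> real"
  assumes "S \<in> sets lebesgue" "h \<in> borel_measurable borel" "integrable lborel (\<lambda>x. \<bar>h x\<bar> powr q)"
  shows "Lq q S h"
  unfolding Lq_def
proof
  have h: "h \<in> borel_measurable lebesgue" by (rule measurable_completion) (use assms(2) in simp)
  show "set_borel_measurable lebesgue S h"
    unfolding set_borel_measurable_def using assms(1) h by (intro borel_measurable_scaleR borel_measurable_indicator) auto
  have "integrable lebesgue (\<lambda>x. \<bar>h x\<bar> powr q)"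
    using assms(2,3) by (subst integrable_completion) auto
  then show "set_integrable lebesgue S (\<lambda>x. \<bar>h x\<bar> powr q)"
    unfolding set_integrable_def using assms(1) by (intro integrable_mult_indicator)
qed

lemma compact_sets_lebesgue: "compact (K::'a::euclidean_space set) \<Longrightarrow> K \<in> sets lebesgue"
  by (rule sets_completionI_sets) (simp add: borel_compact)

lemma Lq_locI:
  fixes h :: "'a::euclidean_space \<Rightarrow> real"
  assumes "h \<in> borel_measurable borel" "integrable lborel (\<lambda>x. \<bar>h x\<bar> powr q)"
  shows "Lq_loc q S h"
  unfolding Lq_loc_def using LqI[OF compact_sets_lebesgue assms] by blast

lemma set_integral_lebesgue_eq_lborel:
  fixes h :: "'a::euclidean_space \<Rightarrow> real"
  assumes "h \<in> borel_measurable borel" "\<And>x. x \<notin> S \<Longrightarrow> h x = 0"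
  shows "(LINT x:S|lebesgue. h x) = (\<integral>x. h x \<partial>lborel)"
proof -
  have "(LINT x:S|lebesgue. h x) = (\<integral>x. h x \<partial>lebesgue)"
    unfolding set_lebesgue_integral_def
    by (intro Bochner_Integration.integral_cong) (auto simp: assms(2) indicator_def)
  then show ?thesis using assms(1) by (simp add: integral_completion)
qed

lemma L1_tendsto_integral:
  fixes u w :: "'a \<Rightarrow> real"
  assumes "integrable M u" "\<And>m. integrable M (U m)" "(\<lambda>m::nat. \<integral>x. \<bar>U m x - u x\<bar> \<partial>M) \<longlonglongrightarrow> 0"
    "w \<in> borel_measurable M" "\<And>x. \<bar>w x\<bar> \<le> C"
  shows "(\<lambda>m. \<integral>x. U m x * w x \<partial>M) \<longlonglongrightarrow> (\<integral>x. u x * w x \<partial>M)"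
proof -
  have i: "integrable M (\<lambda>x. g x * w x)" if "integrable M g" for g
    using integrable_mult_left[OF integrable_abs[OF that], of C]
    by (rule Bochner_Integration.integrable_bound)
      (use that assms(4,5) in \<open>auto simp: abs_mult intro!: mult_left_mono order_trans[OF assms(5) abs_ge_self]\<close>)
  have le: "\<bar>(\<integral>x. U m x * w x \<partial>M) - (\<integral>x. u x * w x \<partial>M)\<bar> \<le> (\<integral>x. \<bar>U m x - u x\<bar> \<partial>M) * C" for m
  proof -
    have d: "integrable M (\<lambda>x. U m x - u x)" using assms(1,2) by auto
    have "(\<integral>x. U m x * w x \<partial>M) - (\<integral>x. u x * w x \<partial>M) = (\<integral>x. (U m x - u x) * w x \<partial>M)"
      using i[OF assms(1)] i[OF assms(2)[of m]] by (simp add: left_diff_distrib)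
    also have "\<bar>\<dots>\<bar> \<le> (\<integral>x. \<bar>(U m x - u x) * w x\<bar> \<partial>M)" by (rule integral_abs_bound)
    also have "\<dots> \<le> (\<integral>x. \<bar>U m x - u x\<bar> * C \<partial>M)"
      using integrable_abs[OF i[OF d]] integrable_mult_left[OF integrable_abs[OF d], of C] assms(5)
      by (intro integral_mono) (auto simp: abs_mult intro!: mult_left_mono)
    also have "\<dots> = (\<integral>x. \<bar>U m x - u x\<bar> \<partial>M) * C" by simp
    finally show ?thesis .
  qed
  have "(\<lambda>m. (\<integral>x. U m x * w x \<partial>M) - (\<integral>x. u x * w x \<partial>M)) \<longlonglongrightarrow> 0"
    by (rule Lim_null_comparison[OF _ tendsto_mult_left_zero[OF assms(3), of C]])
      (intro always_eventually allI, use le in simp)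
  then show ?thesis by (rule LIM_zero_cancel)
qed

lemma has_weak_derivI:
  fixes f g :: "'a::euclidean_space \<Rightarrow> real"
  assumes "integrable lborel f" "integrable lborel g" "\<And>x. x \<notin> S \<Longrightarrow> f x = 0" "\<And>x. x \<notin> S \<Longrightarrow> g x = 0"
    and b: "b \<in> Basis"
    and ibp: "\<And>\<eta>. Cc_infinity S \<eta> \<Longrightarrow>
      (\<integral>x. f x * partial_deriv b \<eta> x \<partial>lborel) = - (\<integral>x. g x * \<eta> x \<partial>lborel)"
  shows "has_weak_deriv S b f g"
  unfolding has_weak_deriv_def
proof (intro conjI allI impI)
  show "Lq_loc 1 S f" by (rule Lq_locI) (use assms(1) in auto)
  show "Lq_loc 1 S g" by (rule Lq_locI) (use assms(2) in auto)
  fix \<eta> assume \<eta>: "Cc_infinity S \<eta>"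
  have [measurable]: "\<eta> \<in> borel_measurable borel" "partial_deriv b \<eta> \<in> borel_measurable borel"
    "f \<in> borel_measurable borel" "g \<in> borel_measurable borel"
    using Cc_infinityD(4)[OF \<eta>] Cc_infinityD(4)[OF Cc_infinity_partial[OF \<eta> b]] assms(1,2) by auto
  have "(LINT x:S|lebesgue. f x * partial_deriv b \<eta> x) = (\<integral>x. f x * partial_deriv b \<eta> x \<partial>lborel)"
    by (rule set_integral_lebesgue_eq_lborel) (simp_all add: assms(3))
  moreover have "(LINT x:S|lebesgue. g x * \<eta> x) = (\<integral>x. g x * \<eta> x \<partial>lborel)"
    by (rule set_integral_lebesgue_eq_lborel) (simp_all add: assms(4))
  ultimately show "(LINT x:S|lebesgue. f x * partial_deriv b \<eta> x) = - (LINT x:S|lebesgue. g x * \<eta> x)"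
    using ibp[OF \<eta>] by simp
qed

text \<open>Integration by parts holds for every approximant and survives \<open>L1\<close>
  convergence against bounded functions, so the weak derivatives demanded by \<open>W11_loc\<close>
  follow from the approximation itself.\<close>

lemma W11_oI:
  fixes \<phi> :: "real^'n \<Rightarrow> real" and D :: "real^'n \<Rightarrow> real^'n"
  assumes \<Omega>: "open \<Omega>"
    and \<phi>: "integrable lborel \<phi>" "\<And>x. x \<notin> \<Omega> \<Longrightarrow> \<phi> x = 0"
    and D: "\<And>i. integrable lborel (\<lambda>x. D x $ i)" "\<And>x i. x \<notin> \<Omega> \<Longrightarrow> D x $ i = 0"
    and \<eta>: "\<And>m::nat. Cc_infinity \<Omega> (\<eta> m)"
    and lim: "(\<lambda>m. \<integral>x. \<bar>\<eta> m x - \<phi> x\<bar> \<partial>lborel) \<longlonglongrightarrow> 0"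
    and limD: "\<And>i. (\<lambda>m. \<integral>x. \<bar>partial_deriv (axis i 1) (\<eta> m) x - D x $ i\<bar> \<partial>lborel) \<longlonglongrightarrow> 0"
  shows "W11_o \<Omega> \<phi> D"
  unfolding W11_o_def W11_loc_def
proof (intro conjI allI exI[of _ \<eta>])
  have \<Omega>m: "\<Omega> \<in> sets lebesgue" using \<Omega> by (intro sets_completionI_sets) simp
  have ax: "axis i 1 \<in> (Basis :: (real^'n) set)" for i by (simp add: axis_in_Basis_iff)
  have \<eta>0: "\<eta> m x = 0" "partial_deriv b (\<eta> m) x = 0" if "x \<notin> \<Omega>" for m x b
  proof -
    obtain K where K: "compact K" "K \<subseteq> \<Omega>" "\<And>x. x \<notin> K \<Longrightarrow> \<eta> m x = 0" using Cc_infinityE[OF \<eta>[of m]] by metis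
    then have x: "x \<notin> K" using that by blast
    show "\<eta> m x = 0" by (rule K(3)[OF x])
    show "partial_deriv b (\<eta> m) x = 0" by (rule partial_deriv_eq_0[OF compact_imp_closed[OF K(1)] K(3) x])
  qed
  have i\<eta>: "integrable lborel (\<eta> m)" for m by (rule Cc_infinity_integrable[OF \<eta>])
  have iD\<eta>: "integrable lborel (partial_deriv (axis i 1) (\<eta> m))" for m i
    by (rule Cc_infinity_integrable[OF Cc_infinity_partial[OF \<eta> ax]])
  show "has_weak_deriv \<Omega> (axis i 1) \<phi> (\<lambda>x. D x $ i)" for i
  proof (rule has_weak_derivI[OF \<phi>(1) D(1) \<phi>(2) D(2) ax])
    fix \<theta> :: "real^'n \<Rightarrow> real" assume \<theta>: "Cc_infinity \<Omega> \<theta>"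
    note \<theta>' = Cc_infinity_partial[OF \<theta> ax[of i]]
    obtain C where C: "\<And>x. \<bar>\<theta> x\<bar> \<le> C" using Cc_infinity_bounded[OF \<theta>] by metis
    obtain C' where C': "\<And>x. \<bar>partial_deriv (axis i 1) \<theta> x\<bar> \<le> C'" using Cc_infinity_bounded[OF \<theta>'] by metis
    have "(\<lambda>m. \<integral>x. \<eta> m x * partial_deriv (axis i 1) \<theta> x \<partial>lborel) \<longlonglongrightarrow> (\<integral>x. \<phi> x * partial_deriv (axis i 1) \<theta> x \<partial>lborel)"
      using Cc_infinityD(4)[OF \<theta>'] by (intro L1_tendsto_integral[OF \<phi>(1) i\<eta> lim _ C']) simp
    moreover have "(\<lambda>m. - (\<integral>x. partial_deriv (axis i 1) (\<eta> m) x * \<theta> x \<partial>lborel)) \<longlonglongrightarrow> - (\<integral>x. D x $ i * \<theta> x \<partial>lborel)"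
      using Cc_infinityD(4)[OF \<theta>] by (intro tendsto_minus L1_tendsto_integral[OF D(1) iD\<eta> limD _ C]) simp
    moreover have "(\<integral>x. \<eta> m x * partial_deriv (axis i 1) \<theta> x \<partial>lborel) = - (\<integral>x. partial_deriv (axis i 1) (\<eta> m) x * \<theta> x \<partial>lborel)" for m
      by (rule integration_by_parts_Cc[OF \<theta> Cc_infinityD(1)[OF \<eta>] ax])
    ultimately show "(\<integral>x. \<phi> x * partial_deriv (axis i 1) \<theta> x \<partial>lborel) = - (\<integral>x. D x $ i * \<theta> x \<partial>lborel)"
      by (simp only:) (rule LIMSEQ_unique)
  qed
  show "Lq 1 \<Omega> \<phi>" by (rule LqI[OF \<Omega>m]) (use \<phi>(1) in auto)
  show "Lq 1 \<Omega> (\<lambda>x. D x $ i)" for i by (rule LqI[OF \<Omega>m]) (use D(1)[of i] in auto)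
  show "Cc_infinity \<Omega> (\<eta> m)" for m by (rule \<eta>)
  have "(LINT x:\<Omega>|lebesgue. \<bar>\<eta> m x - \<phi> x\<bar>) = (\<integral>x. \<bar>\<eta> m x - \<phi> x\<bar> \<partial>lborel)" for m
    by (rule set_integral_lebesgue_eq_lborel) (use i\<eta>[of m] \<phi> \<eta>0 in auto)
  then show "(\<lambda>m. LINT x:\<Omega>|lebesgue. \<bar>\<eta> m x - \<phi> x\<bar>) \<longlonglongrightarrow> 0" using lim by simp
  have "(LINT x:\<Omega>|lebesgue. \<bar>partial_deriv (axis i 1) (\<eta> m) x - D x $ i\<bar>) = (\<integral>x. \<bar>partial_deriv (axis i 1) (\<eta> m) x - D x $ i\<bar> \<partial>lborel)" for m i
  proof (rule set_integral_lebesgue_eq_lborel)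
    show "(\<lambda>x. \<bar>partial_deriv (axis i 1) (\<eta> m) x - D x $ i\<bar>) \<in> borel_measurable borel"
      using iD\<eta>[of m i] D(1)[of i] by (intro borel_measurable_abs borel_measurable_diff) (auto dest!: borel_measurable_integrable)
  qed (use D(2) \<eta>0 in auto)
  then show "(\<lambda>m. LINT x:\<Omega>|lebesgue. \<bar>partial_deriv (axis i 1) (\<eta> m) x - D x $ i\<bar>) \<longlonglongrightarrow> 0" for i
    using limD[of i] by simp
qed

section \<open>Mollification of weak derivatives\<close>

lemma Ck_reflect:
  fixes J :: "'a::euclidean_space \<Rightarrow> real"
  assumes "\<forall>k. Ck k J"
  shows "Ck k (\<lambda>y. J (x - y))" and "partial_deriv b (\<lambda>y. J (x - y)) y = - partial_deriv b J (x - y)"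
proof -
  have D: "((\<lambda>y. J (x - y)) has_derivative (\<lambda>h. - frechet_derivative J (at (x - y)) h)) (at y)"
    if "J differentiable (at (x - y))" for y and J :: "'a \<Rightarrow> real"
  proof -
    have "((\<lambda>y. J (x - y)) has_derivative (\<lambda>h. frechet_derivative J (at (x - y)) (- h))) (at y)"
      by (rule has_derivative_compose[of "\<lambda>y. x - y" "\<lambda>h. - h" y UNIV J])
        (use that in \<open>auto intro!: derivative_eq_intros simp: frechet_derivative_works\<close>)
    then show ?thesis using linear_neg[OF linear_frechet_derivative[OF that]] by simp
  qed
  have P: "partial_deriv b (\<lambda>y. J (x - y)) y = - partial_deriv b J (x - y)"
    if "J differentiable (at (x - y))" for y b and J :: "'a \<Rightarrow> real"
    using frechet_derivative_at[OF D[OF that]] by metis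
  show "partial_deriv b (\<lambda>y. J (x - y)) y = - partial_deriv b J (x - y)"
    by (rule P[OF Ck_differentiable[OF assms]])
  have "Ck k (\<lambda>y. J (x - y))" if "Ck k J" for J :: "'a \<Rightarrow> real"
    using that
  proof (induction k arbitrary: J)
    case 0
    then have "continuous_on UNIV (\<lambda>y. J (x - y))"
      by (intro continuous_on_compose2[of UNIV J UNIV "\<lambda>y. x - y"] continuous_intros) auto
    then show ?case by simp
  next
    case (Suc k)
    then have d: "J differentiable (at y)" for y by simp
    have "partial_deriv b (\<lambda>y. J (x - y)) = (\<lambda>y. (-1) * partial_deriv b J (x - y))" for b
      using P[OF d] by (intro ext) (simp only: mult_minus1)
    moreover have "Ck k (\<lambda>y. (-1) * partial_deriv b J (x - y))" if "b \<in> Basis" for b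
      using Suc that by (intro Ck_mult Ck_const Suc.IH) auto
    moreover have "(\<lambda>y. J (x - y)) differentiable (at y)" for y
      using D[OF d] differentiable_def by blast
    ultimately show ?case by simp
  qed
  then show "Ck k (\<lambda>y. J (x - y))" using assms by blast
qed

text \<open>The reflected kernel centred at \<open>x\<close> is itself a test function, supported in
  \<open>cball x d\<close>. The minus sign of the weak derivative cancels the one that comes from
  the reflection.\<close>

lemma convolve_weak_deriv:
  fixes f g :: "'a::euclidean_space \<Rightarrow> real"
  assumes weak: "\<And>\<eta>. Cc_infinity S \<eta> \<Longrightarrow> (\<integral>x. f x * partial_deriv b \<eta> x \<partial>lborel) = - (\<integral>x. g x * \<eta> x \<partial>lborel)"
    and J: "Cc_infinity (cball 0 d) J" and x: "cball x d \<subseteq> S"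
  shows "convolve f (partial_deriv b J) x = convolve g J x"
proof -
  note J1 = Cc_infinityD(1)[OF J]
  obtain K where K: "K \<subseteq> cball 0 d" "\<And>x. x \<notin> K \<Longrightarrow> J x = 0" using Cc_infinityE[OF J] by metis
  have "J (x - y) = 0" if "y \<notin> cball x d" for y
  proof (rule K(2), rule notI)
    assume "x - y \<in> K"
    then have "x - y \<in> cball 0 d" using K(1) by blast
    then show False using that by (simp add: dist_norm norm_minus_commute)
  qed
  then have "Cc_infinity S (\<lambda>y. J (x - y))"
    unfolding Cc_infinity_def using x
    by (intro conjI allI exI[of _ "cball x d"] impI Ck_reflect(1)[OF J1]) auto
  from weak[OF this] show ?thesis
    unfolding convolve_def Ck_reflect(2)[OF J1] by simp
qed

text \<open>An average of values in \<open>[0, M]\<close> stays there, so powers of the shifted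
  mollification obey the same bounds as those of the shifted function.\<close>

lemma convolve_bounds:
  fixes f :: "'a::euclidean_space \<Rightarrow> real"
  assumes f: "integrable lborel f" "\<And>x. 0 \<le> f x" "\<And>x. f x \<le> M"
    and J: "Cc_infinity S J" "\<And>x. 0 \<le> J x" "integral\<^sup>L lborel J = 1"
  shows "0 \<le> convolve f J x" "convolve f J x \<le> M"
proof -
  have Ji: "integrable lborel J" by (rule Cc_infinity_integrable[OF J(1)])
  obtain C where C: "\<And>x. \<bar>J x\<bar> \<le> C" using Cc_infinity_bounded[OF J(1)] by metis
  show "0 \<le> convolve f J x" unfolding convolve_def by (intro integral_nonneg_AE AE_I2 mult_nonneg_nonneg f J)
  have "convolve f J x \<le> (\<integral>y. M * J (x - y) \<partial>lborel)"
    unfolding convolve_def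
    using integrable_convolve[OF f(1) Cc_infinityD(4)[OF J(1)] C, of x] integrable_reflect[OF Ji, of x] f(3) J(2)
    by (intro integral_mono) (auto intro!: mult_right_mono)
  also have "\<dots> = M" using integral_reflect[OF Cc_infinityD(4)[OF J(1)], of x] J(3) by simp
  finally show "convolve f J x \<le> M" .
qed


text \<open>One bound for both signs of the exponent: the power is monotone in one direction or the
  other. It is applied to exponents such as \<open>r - 2\<close>, whose sign is not known.\<close>

lemma powr_le_sum_endpoints:
  assumes "0 < (\<nu>::real)" "\<nu> \<le> y" "y \<le> Y"
  shows "y powr c \<le> \<nu> powr c + Y powr c"
proof (cases "0 \<le> c")
  case True
  then have "y powr c \<le> Y powr c" using assms by (intro powr_mono2) auto
  then show ?thesis using powr_ge_zero[of \<nu> c] by linarith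
next
  case False
  then have "y powr c \<le> \<nu> powr c" using assms by (intro powr_mono2') auto
  then show ?thesis using powr_ge_zero[of Y c] by linarith
qed

text \<open>Chain rule: the mollified functions, composed with the power and cut off, approximate in
  \<open>W\<^sup>1\<^sup>,\<^sup>1\<close>.\<close>

lemma W11_o_powr_cutoff:
  fixes f \<zeta> :: "real^'n \<Rightarrow> real" and D :: "real^'n \<Rightarrow> real^'n"
  assumes \<Omega>: "open \<Omega>"
    and f: "integrable lborel f" "\<And>x. 0 \<le> f x" "\<And>x. f x \<le> M"
    and D: "\<And>i. integrable lborel (\<lambda>x. D x $ i)"
    and weak: "\<And>i \<eta>. Cc_infinity K1 \<eta> \<Longrightarrow>
      (\<integral>x. f x * partial_deriv (axis i 1) \<eta> x \<partial>lborel) = - (\<integral>x. D x $ i * \<eta> x \<partial>lborel)"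
    and \<zeta>: "Cc_infinity K0 \<zeta>" "K0 \<subseteq> \<Omega>"
    and d: "0 < d" "\<And>x. x \<in> K0 \<Longrightarrow> cball x d \<subseteq> K1"
    and \<nu>: "0 < \<nu>"
  shows "W11_o \<Omega> (\<lambda>x. (f x + \<nu>) powr a * \<zeta> x)
    (\<lambda>x. \<chi> i. a * (f x + \<nu>) powr (a - 1) * D x $ i * \<zeta> x + (f x + \<nu>) powr a * partial_deriv (axis i 1) \<zeta> x)"
proof -
  \<comment> \<open>Radii of at most \<open>d\<close> keep the balls around points of
    \<open>K0\<close> inside \<open>K1\<close>, where the weak derivative is available.\<close>
  define \<epsilon> where "\<epsilon> n = d / real (Suc n)" for n
  have \<epsilon>0: "0 < \<epsilon> n" and \<epsilon>d: "\<epsilon> n \<le> d" for n using d(1) by (auto simp: \<epsilon>_def field_simps)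
  have \<epsilon>lim: "\<epsilon> \<longlonglongrightarrow> 0"
    unfolding \<epsilon>_def using tendsto_mult_right_zero[OF LIMSEQ_inverse_real_of_nat, of d] by (simp add: divide_inverse)
  have "\<exists>J :: real^'n \<Rightarrow> real. Cc_infinity (cball 0 (\<epsilon> n)) J \<and> (\<forall>x. 0 \<le> J x) \<and> integral\<^sup>L lborel J = 1" for n
    using mollifier_exists[OF \<epsilon>0] by metis
  then obtain J :: "nat \<Rightarrow> real^'n \<Rightarrow> real" where J: "\<And>n. Cc_infinity (cball 0 (\<epsilon> n)) (J n)"
    "\<And>n x. 0 \<le> J n x" "\<And>n. integral\<^sup>L lborel (J n) = 1" by metis
  have ax: "axis i 1 \<in> (Basis :: (real^'n) set)" for i by (simp add: axis_in_Basis_iff)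
  have J0: "J n x = 0" if "\<epsilon> n < norm x" for n x
  proof -
    obtain K where K: "K \<subseteq> cball 0 (\<epsilon> n)" "\<And>x. x \<notin> K \<Longrightarrow> J n x = 0" using Cc_infinityE[OF J(1)[of n]] by metis
    then show ?thesis using that by (intro K(2)) auto
  qed
  have err: "(\<integral>\<^sup>+x. ennreal \<bar>convolve g (J n) x - g x\<bar> \<partial>lborel) \<le> ennreal e"
    if g: "integrable lborel g" and e: "\<And>w. norm w \<le> \<epsilon> n \<Longrightarrow> translation_error g w \<le> e" for g n e
  proof -
    obtain C where "\<And>x. \<bar>J n x\<bar> \<le> C" using Cc_infinity_bounded[OF J(1)[of n]] by metis
    then have C: "J n x \<le> C" for x using abs_le_D1 by blast
    show ?thesis by (rule convolve_L1_error[OF g Cc_infinity_integrable[OF J(1)] J(2,3) C J0 e])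
  qed
  have cm[measurable]: "convolve g (J n) \<in> borel_measurable borel" if "integrable lborel g" for g n
    using Ck_convolve[OF that J(1), of 0] by (simp add: borel_measurable_continuous_onI)
  have ci: "integrable lborel (\<lambda>x. convolve g (J n) x - g x)" if g: "integrable lborel g" for g n
  proof -
    have "translation_error g w \<le> 2 * (\<integral>x. \<bar>g x\<bar> \<partial>lborel)" for w
      using translation_error_triangle[OF g, of "\<lambda>_. 0"] by (simp add: translation_error_def)
    from err[OF g this] have "(\<integral>\<^sup>+x. ennreal \<bar>convolve g (J n) x - g x\<bar> \<partial>lborel) < \<infinity>"
      by (rule le_less_trans) simp
    then show ?thesis using g cm[OF g] by (intro integrableI_bounded) auto
  qed
  have cl: "(\<lambda>n. \<integral>x. \<bar>convolve g (J n) x - g x\<bar> \<partial>lborel) \<longlonglongrightarrow> 0" if g: "integrable lborel g" for g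
  proof (rule LIMSEQ_I)
    fix e :: real assume e: "0 < e"
    have "\<forall>\<^sub>F w in nhds 0. translation_error g w < e / 2"
    proof (rule order_tendstoD(2))
      have "(translation_error g \<longlongrightarrow> translation_error g 0) (nhds 0)"
        using translation_continuity[OF g] unfolding isCont_def tendsto_at_iff_tendsto_nhds .
      then show "(translation_error g \<longlongrightarrow> 0) (nhds 0)" by simp
    qed (use e in simp)
    then obtain \<delta> where \<delta>: "0 < \<delta>" "\<And>w. norm w < \<delta> \<Longrightarrow> translation_error g w < e / 2"
      unfolding eventually_nhds_metric dist_0_norm dist_norm by auto
    have "\<forall>\<^sub>F n in sequentially. \<epsilon> n < \<delta>" using order_tendstoD(2)[OF \<epsilon>lim \<delta>(1)] .
    then obtain N where N: "\<And>n. N \<le> n \<Longrightarrow> \<epsilon> n < \<delta>" unfolding eventually_sequentially by blast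
    have "norm ((\<integral>x. \<bar>convolve g (J n) x - g x\<bar> \<partial>lborel) - 0) < e" if n: "N \<le> n" for n
    proof -
      have "translation_error g w \<le> e / 2" if "norm w \<le> \<epsilon> n" for w
        using \<delta>(2)[of w] N[OF n] that by simp
      from err[OF g this] have "(\<integral>\<^sup>+x. ennreal \<bar>convolve g (J n) x - g x\<bar> \<partial>lborel) \<le> ennreal (e / 2)" .
      then have "(\<integral>x. \<bar>convolve g (J n) x - g x\<bar> \<partial>lborel) \<le> e / 2"
        using nn_integral_eq_integral[OF integrable_abs[OF ci[OF g, of n]]] e by simp
      moreover have "0 \<le> (\<integral>x. \<bar>convolve g (J n) x - g x\<bar> \<partial>lborel)" by simp
      ultimately show ?thesis using e by simp
    qed
    then show "\<exists>no. \<forall>n\<ge>no. norm ((\<integral>x. \<bar>convolve g (J n) x - g x\<bar> \<partial>lborel) - 0) < e" by blast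
  qed
  define F where "F n = convolve f (J n)" for n
  \<comment> \<open>The nonlinear powers need pointwise convergence, which \<open>L1\<close>
    convergence provides along a subsequence only.\<close>
  have "\<exists>r::nat\<Rightarrow>nat. strict_mono r \<and> (AE x in lborel. (\<lambda>n. F (r n) x - f x) \<longlonglongrightarrow> 0)"
    using tendsto_L1_AE_subseq[of lborel "\<lambda>n x. F n x - f x"] ci[OF f(1)] cl[OF f(1)] unfolding F_def by auto
  then obtain r where r: "strict_mono r" "AE x in lborel. (\<lambda>n. F (r n) x - f x) \<longlonglongrightarrow> 0" by blast
  have F0: "0 \<le> F n x" and FM: "F n x \<le> M" for n x
    unfolding F_def by (rule convolve_bounds[OF f J])+
  have FCk: "\<forall>k. Ck k (F n)" for n unfolding F_def using Ck_convolve[OF f(1) J(1)] by blast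
  have FCk': "\<forall>k. Ck k (\<lambda>x. F n x + \<nu>)" for n by (intro allI Ck_add FCk[rule_format] Ck_const)
  have pos: "0 < F n x + \<nu>" for n x using F0[of n x] \<nu> by simp
  have Fm[measurable]: "F n \<in> borel_measurable borel" for n unfolding F_def by (rule cm[OF f(1)])
  have fm[measurable]: "f \<in> borel_measurable borel" using f(1) by auto
  have \<zeta>m[measurable]: "\<zeta> \<in> borel_measurable borel" by (rule Cc_infinityD(4)[OF \<zeta>(1)])
  have Dm[measurable]: "(\<lambda>x. D x $ i) \<in> borel_measurable borel" for i using D[of i] by auto
  define B where "B c = \<nu> powr c + (M + \<nu>) powr c" for c
  have B: "0 \<le> (s + \<nu>) powr c" "(s + \<nu>) powr c \<le> B c" if "0 \<le> s" "s \<le> M" for s c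
    unfolding B_def using that \<nu> by (auto intro!: powr_le_sum_endpoints)
  have B0: "0 \<le> B c" for c by (simp add: B_def)
  \<comment> \<open>Powers that are uniformly bounded and converge almost everywhere, against a
    fixed integrable \<open>g\<close>: this covers all error terms in which the gradient is not
    mollified.\<close>
  have lim: "(\<lambda>m. \<integral>x. \<bar>((F (r m) x + \<nu>) powr c - (f x + \<nu>) powr c) * g x\<bar> \<partial>lborel) \<longlonglongrightarrow> 0"
    and limi: "integrable lborel (\<lambda>x. ((F m x + \<nu>) powr c - (f x + \<nu>) powr c) * g x)"
    if g: "integrable lborel g" for c g m
  proof -
    have [measurable]: "g \<in> borel_measurable borel" using g by auto
    have dom: "\<bar>((F m x + \<nu>) powr c - (f x + \<nu>) powr c) * g x\<bar> \<le> B c * \<bar>g x\<bar>" for m x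
    proof -
      have "\<bar>(F m x + \<nu>) powr c - (f x + \<nu>) powr c\<bar> \<le> B c"
        using B[OF F0 FM, of m x c] B[OF f(2,3), of x c] by linarith
      then show ?thesis unfolding abs_mult by (rule mult_right_mono) simp
    qed
    have i: "integrable lborel (\<lambda>x. B c * \<bar>g x\<bar>)" using g by auto
    show "integrable lborel (\<lambda>x. ((F m x + \<nu>) powr c - (f x + \<nu>) powr c) * g x)"
      by (rule Bochner_Integration.integrable_bound[OF i]) (use dom B0 in \<open>auto simp: abs_mult\<close>)
    have "(\<lambda>m. \<integral>x. \<bar>((F (r m) x + \<nu>) powr c - (f x + \<nu>) powr c) * g x\<bar> \<partial>lborel) \<longlonglongrightarrow> (\<integral>x. 0 \<partial>(lborel :: (real^'n) measure))"
    proof (rule integral_dominated_convergence[OF _ _ i])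
      show "AE x in lborel. (\<lambda>m. \<bar>((F (r m) x + \<nu>) powr c - (f x + \<nu>) powr c) * g x\<bar>) \<longlonglongrightarrow> 0"
        using r(2)
      proof eventually_elim
        case (elim x)
        have "(\<lambda>m. F (r m) x) \<longlonglongrightarrow> f x" using LIM_zero_cancel[OF elim] .
        then have "(\<lambda>m. (F (r m) x + \<nu>) powr c) \<longlonglongrightarrow> (f x + \<nu>) powr c"
          using f(2)[of x] \<nu> by (intro tendsto_intros) auto
        then have "(\<lambda>m. (F (r m) x + \<nu>) powr c - (f x + \<nu>) powr c) \<longlonglongrightarrow> 0" by (rule LIM_zero)
        then show ?case by (rule tendsto_rabs_zero[OF tendsto_mult_left_zero])
      qed
    qed (use dom in auto)
    then show "(\<lambda>m. \<integral>x. \<bar>((F (r m) x + \<nu>) powr c - (f x + \<nu>) powr c) * g x\<bar> \<partial>lborel) \<longlonglongrightarrow> 0" by simp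
  qed
  obtain C where C: "0 \<le> C" "\<And>x. \<bar>\<zeta> x\<bar> \<le> C" using Cc_infinity_bounded[OF \<zeta>(1)] by metis
  have \<zeta>i: "integrable lborel \<zeta>" by (rule Cc_infinity_integrable[OF \<zeta>(1)])
  have \<zeta>'i: "integrable lborel (partial_deriv (axis i 1) \<zeta>)" for i
    by (rule Cc_infinity_integrable[OF Cc_infinity_partial[OF \<zeta>(1) ax]])
  have aD: "integrable lborel (\<lambda>x. a * D x $ i * \<zeta> x)" for i
  proof (rule Bochner_Integration.integrable_bound[OF integrable_mult_left[OF integrable_abs[OF integrable_mult_right[OF D[of i], of a]], of C]])
    show "AE x in lborel. norm (a * D x $ i * \<zeta> x) \<le> norm (\<bar>a * D x $ i\<bar> * C)"
      using C by (intro AE_I2) (auto simp: abs_mult intro!: mult_left_mono)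
  qed measurable
  define \<eta> where "\<eta> m x = (F (r m) x + \<nu>) powr a * \<zeta> x" for m x
  have \<eta>: "Cc_infinity \<Omega> (\<eta> m)" for m
    unfolding \<eta>_def[abs_def]
    by (intro Cc_infinity_mult[OF Cc_infinity_mono[OF \<zeta>]] allI Ck_powr[OF pos FCk'])
  have \<zeta>0: "\<zeta> x = 0" "partial_deriv b \<zeta> x = 0" if "x \<notin> K0" for x b
  proof -
    obtain K where K: "compact K" "K \<subseteq> K0" "\<And>x. x \<notin> K \<Longrightarrow> \<zeta> x = 0" using Cc_infinityE[OF \<zeta>(1)] by metis
    then have x: "x \<notin> K" using that by blast
    show "\<zeta> x = 0" by (rule K(3)[OF x])
    show "partial_deriv b \<zeta> x = 0" by (rule partial_deriv_eq_0[OF compact_imp_closed[OF K(1)] K(3) x])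
  qed
  have \<eta>': "partial_deriv b (\<eta> m) x =
      a * (F (r m) x + \<nu>) powr (a - 1) * partial_deriv b (F (r m)) x * \<zeta> x + (F (r m) x + \<nu>) powr a * partial_deriv b \<zeta> x" for b m x
  proof -
    have d1: "\<forall>x. F (r m) differentiable (at x)" using Ck_differentiable[OF FCk] by blast
    have d2: "(\<lambda>x. F (r m) x + \<nu>) differentiable (at x)" for x by (rule Ck_differentiable[OF FCk'])
    have D2: "((\<lambda>s. s powr a) has_real_derivative a * (F (r m) x + \<nu>) powr (a - 1)) (at (F (r m) x + \<nu>))" for x
      by (rule has_real_derivative_powr[OF pos])
    have p1: "partial_deriv b (\<eta> m) = (\<lambda>x. (F (r m) x + \<nu>) powr a * partial_deriv b \<zeta> x + partial_deriv b (\<lambda>x. (F (r m) x + \<nu>) powr a) x * \<zeta> x)"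
      unfolding \<eta>_def[abs_def]
      using partial_deriv_compose_real(2)[OF d2 D2] Cc_infinityD(3)[OF \<zeta>(1)] by (intro partial_deriv_mult) auto
    have p2: "partial_deriv b (\<lambda>x. (F (r m) x + \<nu>) powr a) x = a * (F (r m) x + \<nu>) powr (a - 1) * partial_deriv b (\<lambda>x. F (r m) x + \<nu>) x"
      by (rule partial_deriv_compose_real(1)[OF d2 D2])
    have p3: "partial_deriv b (\<lambda>x. F (r m) x + \<nu>) = (\<lambda>x. partial_deriv b (F (r m)) x + partial_deriv b (\<lambda>x. \<nu>) x)"
      by (rule partial_deriv_add[OF d1]) simp
    show ?thesis using fun_cong[OF p1, of x] p2 fun_cong[OF p3, of x] by simp
  qed
  \<comment> \<open>On \<open>K0\<close> the derivative of the mollification is the mollification of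
    the derivative. Off \<open>K0\<close> both \<zeta> and its gradient vanish.\<close>
  have F': "partial_deriv (axis i 1) (F n) x = convolve (\<lambda>x. D x $ i) (J n) x" if "x \<in> K0" for n x i
  proof -
    have "partial_deriv (axis i 1) (F n) x = convolve f (partial_deriv (axis i 1) (J n)) x"
      unfolding F_def by (rule fun_cong[OF convolve_partial_deriv[OF f(1) J(1)]])
    moreover have "cball x (\<epsilon> n) \<subseteq> K1" using d(2)[OF that] \<epsilon>d[of n] by auto
    ultimately show ?thesis using convolve_weak_deriv[OF weak J(1)] by metis
  qed
  let ?D = "\<lambda>x. \<chi> i. a * (f x + \<nu>) powr (a - 1) * D x $ i * \<zeta> x + (f x + \<nu>) powr a * partial_deriv (axis i 1) \<zeta> x"
  have bnd: "integrable lborel (\<lambda>x. (f x + \<nu>) powr c * g x)" if g: "integrable lborel g" for c g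
    by (rule Bochner_Integration.integrable_bound[OF integrable_mult_right[OF integrable_abs[OF g], of "B c"]])
      (use g B[OF f(2,3)] B0 in \<open>auto simp: abs_mult intro!: mult_right_mono\<close>)
  show ?thesis
  proof (rule W11_oI[OF \<Omega> _ _ _ _ \<eta>])
    show "integrable lborel (\<lambda>x. (f x + \<nu>) powr a * \<zeta> x)" by (rule bnd[OF \<zeta>i])
    show "(f x + \<nu>) powr a * \<zeta> x = 0" if "x \<notin> \<Omega>" for x
      using \<zeta>0(1)[of x] \<zeta>(2) that by auto
    show "?D x $ i = 0" if "x \<notin> \<Omega>" for x i
    proof -
      have "x \<notin> K0" using \<zeta>(2) that by blast
      then show ?thesis by (simp add: \<zeta>0)
    qed
    have "integrable lborel (\<lambda>x. (f x + \<nu>) powr (a - 1) * (a * D x $ i * \<zeta> x) + (f x + \<nu>) powr a * partial_deriv (axis i 1) \<zeta> x)" for i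
      by (intro Bochner_Integration.integrable_add bnd aD \<zeta>'i)
    then show "integrable lborel (\<lambda>x. ?D x $ i)" for i by (simp add: mult_ac)
    show "(\<lambda>m. \<integral>x. \<bar>\<eta> m x - (f x + \<nu>) powr a * \<zeta> x\<bar> \<partial>lborel) \<longlonglongrightarrow> 0"
      using lim[OF \<zeta>i, of a] by (simp add: \<eta>_def left_diff_distrib)
    show "(\<lambda>m. \<integral>x. \<bar>partial_deriv (axis i 1) (\<eta> m) x - ?D x $ i\<bar> \<partial>lborel) \<longlonglongrightarrow> 0" for i
    proof -
      \<comment> \<open>Three errors of the product rule. In the first, the mollified gradient is
        compared with \<open>D\<close> and the cofactor is uniformly bounded; in the other two,
        powers are compared and the cofactor is a fixed integrable function.\<close>
      define E where "E m x = (\<bar>a\<bar> * B (a - 1) * C) * \<bar>convolve (\<lambda>x. D x $ i) (J (r m)) x - D x $ i\<bar> +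
          (\<bar>((F (r m) x + \<nu>) powr (a - 1) - (f x + \<nu>) powr (a - 1)) * (a * D x $ i * \<zeta> x)\<bar> +
          \<bar>((F (r m) x + \<nu>) powr a - (f x + \<nu>) powr a) * partial_deriv (axis i 1) \<zeta> x\<bar>)" for m x
      have le: "\<bar>partial_deriv (axis i 1) (\<eta> m) x - ?D x $ i\<bar> \<le> E m x" for m x
      proof (cases "x \<in> K0")
        case True
        have "partial_deriv (axis i 1) (\<eta> m) x - ?D x $ i =
          (a * (F (r m) x + \<nu>) powr (a - 1) * \<zeta> x) * (convolve (\<lambda>x. D x $ i) (J (r m)) x - D x $ i) +
          (((F (r m) x + \<nu>) powr (a - 1) - (f x + \<nu>) powr (a - 1)) * (a * D x $ i * \<zeta> x) +
          ((F (r m) x + \<nu>) powr a - (f x + \<nu>) powr a) * partial_deriv (axis i 1) \<zeta> x)"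
          unfolding \<eta>' F'[OF True] by (simp add: algebra_simps)
        moreover have "\<bar>(a * (F (r m) x + \<nu>) powr (a - 1) * \<zeta> x) * (convolve (\<lambda>x. D x $ i) (J (r m)) x - D x $ i)\<bar>
           \<le> (\<bar>a\<bar> * B (a - 1) * C) * \<bar>convolve (\<lambda>x. D x $ i) (J (r m)) x - D x $ i\<bar>"
          unfolding abs_mult using B[OF F0 FM, of "r m" x "a - 1"] C B0
          by (intro mult_right_mono mult_mono mult_left_mono mult_nonneg_nonneg) auto
        ultimately show ?thesis unfolding E_def by linarith
      next
        case False
        then show ?thesis unfolding \<eta>' E_def using C(1) B0 by (simp add: \<zeta>0)
      qed
      have Ei: "integrable lborel (E m)" for m
        unfolding E_def[abs_def]
        by (intro Bochner_Integration.integrable_add integrable_mult_right integrable_abs ci[OF D] limi[OF aD] limi[OF \<zeta>'i])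
      have "(\<lambda>m. \<integral>x. E m x \<partial>lborel) \<longlonglongrightarrow> (\<bar>a\<bar> * B (a - 1) * C) * 0 + (0 + 0)"
      proof -
        have "(\<integral>x. E m x \<partial>lborel) = (\<bar>a\<bar> * B (a - 1) * C) * (\<integral>x. \<bar>convolve (\<lambda>x. D x $ i) (J (r m)) x - D x $ i\<bar> \<partial>lborel) +
          ((\<integral>x. \<bar>((F (r m) x + \<nu>) powr (a - 1) - (f x + \<nu>) powr (a - 1)) * (a * D x $ i * \<zeta> x)\<bar> \<partial>lborel) +
          (\<integral>x. \<bar>((F (r m) x + \<nu>) powr a - (f x + \<nu>) powr a) * partial_deriv (axis i 1) \<zeta> x\<bar> \<partial>lborel))" for m
          unfolding E_def
          by (subst Bochner_Integration.integral_add,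
              intro integrable_mult_right integrable_abs ci[OF D],
              intro Bochner_Integration.integrable_add integrable_abs limi[OF aD] limi[OF \<zeta>'i],
              subst Bochner_Integration.integral_add,
              intro integrable_abs limi[OF aD], intro integrable_abs limi[OF \<zeta>'i],
              subst integral_mult_right_zero, rule refl)
        moreover have "(\<lambda>m. \<integral>x. \<bar>convolve (\<lambda>x. D x $ i) (J (r m)) x - D x $ i\<bar> \<partial>lborel) \<longlonglongrightarrow> 0"
          using LIMSEQ_subseq_LIMSEQ[OF cl[OF D] r(1)] by (simp add: o_def)
        ultimately show ?thesis
          by (simp only:) (intro tendsto_add tendsto_mult tendsto_const lim[OF aD] lim[OF \<zeta>'i])
      qed
      then have Elim: "(\<lambda>m. \<integral>x. E m x \<partial>lborel) \<longlonglongrightarrow> 0" by simp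
      show ?thesis
      proof (rule tendsto_sandwich[OF _ _ tendsto_const Elim])
        show "\<forall>\<^sub>F m in sequentially. 0 \<le> (\<integral>x. \<bar>partial_deriv (axis i 1) (\<eta> m) x - ?D x $ i\<bar> \<partial>lborel)"
          by (intro always_eventually allI integral_nonneg_AE AE_I2) simp
        show "\<forall>\<^sub>F m in sequentially. (\<integral>x. \<bar>partial_deriv (axis i 1) (\<eta> m) x - ?D x $ i\<bar> \<partial>lborel) \<le> (\<integral>x. E m x \<partial>lborel)"
          using Ei le by (intro always_eventually allI integral_mono') (auto intro: order_trans[OF abs_ge_zero])
      qed
    qed
  qed
qed

section \<open>Vanishing time lags\<close>

lemma Young_powr:
  fixes a b :: real
  assumes pq: "1 < p" "1 < q" "1 / p + 1 / q = 1"
  shows "\<bar>a * b\<bar> \<le> \<bar>a\<bar> powr p + \<bar>b\<bar> powr q"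
proof -
  have "\<bar>a\<bar> * \<bar>b\<bar> \<le> \<bar>a\<bar> powr p / p + \<bar>b\<bar> powr q / q"
    using Youngs_inequality[of p q "\<bar>a\<bar>" "\<bar>b\<bar>"] assms by simp
  also have "\<dots> \<le> \<bar>a\<bar> powr p + \<bar>b\<bar> powr q"
    using pq frac_le[of "\<bar>a\<bar> powr p" "\<bar>a\<bar> powr p" 1 p] frac_le[of "\<bar>b\<bar> powr q" "\<bar>b\<bar> powr q" 1 q]
    by simp
  finally show ?thesis by (simp add: abs_mult)
qed

lemma integrable_mult_Lp_Lq:
  fixes a b :: "'a \<Rightarrow> real"
  assumes pq: "1 < p" "1 < q" "1 / p + 1 / q = 1"
    and "a \<in> borel_measurable M" "integrable M (\<lambda>x. \<bar>a x\<bar> powr p)"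
    and "b \<in> borel_measurable M" "integrable M (\<lambda>x. \<bar>b x\<bar> powr q)"
  shows "integrable M (\<lambda>x. a x * b x)"
  by (rule Bochner_Integration.integrable_bound[OF Bochner_Integration.integrable_add[OF assms(5,7)]])
    (use assms(4,6) Young_powr[OF pq] in auto)

lemma integral_translate_measurable:
  fixes f :: "'a::euclidean_space \<Rightarrow> real"
  assumes [measurable]: "f \<in> borel_measurable borel"
  shows "(\<integral>x. f (x + w) \<partial>lborel) = integral\<^sup>L lborel f"
proof -
  have d: "distr lborel borel (\<lambda>x. x + w) = (lborel :: 'a measure)"
    using lborel_distr_plus[of w] unfolding add.commute[of _ w] .
  have "integral\<^sup>L (distr lborel borel (\<lambda>x. x + w)) f = (\<integral>x. f (x + w) \<partial>lborel)"
    by (subst integral_distr) auto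
  then show ?thesis using d by simp
qed

text \<open>Continuity of translations is at hand in \<open>L1\<close> only. Truncating
  \<open>a\<close> at height \<open>k\<close> gives a bounded main part, for which \<open>L1\<close>
  continuity of \<open>d\<close> suffices; the remainder is small in \<open>Lp\<close>, and the
  \<open>Lq\<close> norm of \<open>d\<close> is the same for all translates.\<close>

lemma translation_pairing_continuous:
  fixes a d :: "'a::euclidean_space \<Rightarrow> real"
  assumes pq: "1 < p" "1 < q" "1 / p + 1 / q = 1"
    and am[measurable]: "a \<in> borel_measurable borel" and a: "integrable lborel (\<lambda>x. \<bar>a x\<bar> powr p)"
    and d: "integrable lborel d" "integrable lborel (\<lambda>x. \<bar>d x\<bar> powr q)"
    and \<epsilon>: "0 < \<epsilon>"
  obtains \<delta> where "0 < \<delta>"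
    "\<And>w. norm w < \<delta> \<Longrightarrow> \<bar>(\<integral>x. a x * d (x + w) \<partial>lborel) - (\<integral>x. a x * d x \<partial>lborel)\<bar> < \<epsilon>"
proof -
  have dm[measurable]: "d \<in> borel_measurable borel" using d by auto
  define b where "b k x = (if \<bar>a x\<bar> \<le> real k then a x else 0)" for k x
  have bm[measurable]: "b k \<in> borel_measurable borel" for k unfolding b_def[abs_def] by measurable
  have bk: "\<bar>b k x\<bar> \<le> real k" for k x by (auto simp: b_def)
  define N where "N = (\<integral>x. \<bar>d x\<bar> powr q \<partial>lborel)"
  have N: "0 \<le> N" by (simp add: N_def)
  \<comment> \<open>The weight in Young's inequality. First \<open>s\<close> is taken so small that
    the part with exponent \<open>q\<close> is below \<open>\<epsilon> / 8\<close>, then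
    \<open>k\<close> so large that the part with exponent \<open>p\<close> is. The remainder enters
    twice and the main part once, each below \<open>\<epsilon> / 4\<close>.\<close>
  define s where "s = (\<epsilon> / (8 * (N + 1))) powr (1 / q)"
  have s: "0 < s" "s powr q * N < \<epsilon> / 8"
  proof -
    show "0 < s" using \<epsilon> N by (simp add: s_def)
    have "s powr q = \<epsilon> / (8 * (N + 1))" using \<epsilon> N pq(2) by (simp add: s_def powr_powr)
    then have "s powr q * (N + 1) = \<epsilon> / 8" using N by (simp add: field_simps)
    moreover have "0 < s powr q" using \<open>0 < s\<close> by simp
    ultimately show "s powr q * N < \<epsilon> / 8" unfolding distrib_left by linarith
  qed
  have rest_le: "\<bar>a x - b k x\<bar> powr p \<le> \<bar>a x\<bar> powr p" for k x by (auto simp: b_def)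
  have rest_i: "integrable lborel (\<lambda>x. \<bar>a x - b k x\<bar> powr p)" for k
    by (rule Bochner_Integration.integrable_bound[OF a]) (use rest_le in auto)
  have "(\<lambda>k. \<integral>x. \<bar>a x - b k x\<bar> powr p \<partial>lborel) \<longlonglongrightarrow> (\<integral>x. 0 \<partial>(lborel :: 'a measure))"
  proof (rule integral_dominated_convergence[OF _ _ a])
    show "AE x in lborel. (\<lambda>k. \<bar>a x - b k x\<bar> powr p) \<longlonglongrightarrow> 0"
    proof (rule AE_I2, rule tendsto_eventually)
      fix x
      obtain n :: nat where "\<bar>a x\<bar> \<le> real n" using real_arch_simple by blast
      then show "\<forall>\<^sub>F k in sequentially. \<bar>a x - b k x\<bar> powr p = 0"
        by (intro eventually_sequentiallyI[of n]) (auto simp: b_def)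
    qed
  qed (use rest_le in auto)
  then have "(\<lambda>k. (1 / s) powr p * (\<integral>x. \<bar>a x - b k x\<bar> powr p \<partial>lborel)) \<longlonglongrightarrow> (1 / s) powr p * 0"
    by (intro tendsto_mult tendsto_const) simp
  then have "\<forall>\<^sub>F k in sequentially. (1 / s) powr p * (\<integral>x. \<bar>a x - b k x\<bar> powr p \<partial>lborel) < \<epsilon> / 8"
    using \<epsilon> by (intro order_tendstoD(2)) auto
  then obtain k where k: "(1 / s) powr p * (\<integral>x. \<bar>a x - b k x\<bar> powr p \<partial>lborel) < \<epsilon> / 8"
    using eventually_happens by fastforce
  have "(translation_error d \<longlongrightarrow> translation_error d 0) (nhds 0)"
    using translation_continuity[OF d(1)] unfolding isCont_def tendsto_at_iff_tendsto_nhds .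
  then have "((\<lambda>w. real k * translation_error d w) \<longlongrightarrow> real k * 0) (nhds 0)"
    by (intro tendsto_mult tendsto_const) simp
  then have "\<forall>\<^sub>F w in nhds 0. real k * translation_error d w < \<epsilon> / 4"
    using \<epsilon> by (intro order_tendstoD(2)) auto
  then obtain \<delta> where \<delta>: "0 < \<delta>" "\<And>w. norm w < \<delta> \<Longrightarrow> real k * translation_error d w < \<epsilon> / 4"
    unfolding eventually_nhds_metric dist_norm by auto
  have di: "integrable lborel (\<lambda>x. \<bar>d (x + w)\<bar> powr q)" "(\<integral>x. \<bar>d (x + w)\<bar> powr q \<partial>lborel) = N" for w
    using integrable_translate[OF d(2), of w] by (auto simp: N_def)
  have rest: "integrable lborel (\<lambda>x. (a x - b k x) * d (x + w))"
    "\<bar>\<integral>x. (a x - b k x) * d (x + w) \<partial>lborel\<bar> < \<epsilon> / 4" for w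
  proof -
    have pt: "\<bar>(a x - b k x) * d (x + w)\<bar> \<le> (1 / s) powr p * \<bar>a x - b k x\<bar> powr p + s powr q * \<bar>d (x + w)\<bar> powr q" for x
      using Young_powr[OF pq, of "(1 / s) * (a x - b k x)" "s * d (x + w)"] s(1)
      by (simp add: abs_mult powr_mult powr_divide)
    have i: "integrable lborel (\<lambda>x. (1 / s) powr p * \<bar>a x - b k x\<bar> powr p + s powr q * \<bar>d (x + w)\<bar> powr q)"
      by (intro Bochner_Integration.integrable_add integrable_mult_right rest_i di)
    show i': "integrable lborel (\<lambda>x. (a x - b k x) * d (x + w))"
      by (rule Bochner_Integration.integrable_bound[OF i]) (use order_trans[OF pt abs_ge_self] in auto)
    have "\<bar>\<integral>x. (a x - b k x) * d (x + w) \<partial>lborel\<bar> \<le> (\<integral>x. \<bar>(a x - b k x) * d (x + w)\<bar> \<partial>lborel)"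
      by (rule integral_abs_bound)
    also have "\<dots> \<le> (\<integral>x. (1 / s) powr p * \<bar>a x - b k x\<bar> powr p + s powr q * \<bar>d (x + w)\<bar> powr q \<partial>lborel)"
      by (rule integral_mono[OF integrable_abs[OF i'] i pt])
    also have "\<dots> = (1 / s) powr p * (\<integral>x. \<bar>a x - b k x\<bar> powr p \<partial>lborel) + s powr q * N"
      using rest_i[of k] di[of w] by simp
    also have "\<dots> < \<epsilon> / 4" using k s(2) by simp
    finally show "\<bar>\<integral>x. (a x - b k x) * d (x + w) \<partial>lborel\<bar> < \<epsilon> / 4" .
  qed
  have bi: "integrable lborel (\<lambda>x. b k x * d (x + w))" for w
    by (rule Bochner_Integration.integrable_bound[OF integrable_mult_right[OF integrable_abs[OF integrable_translate(1)[OF d(1), of w]], of "real k"]])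
      (use bk in \<open>auto simp: abs_mult intro!: mult_right_mono\<close>)
  have split: "(\<integral>x. a x * d (x + w) \<partial>lborel) = (\<integral>x. b k x * d (x + w) \<partial>lborel) + (\<integral>x. (a x - b k x) * d (x + w) \<partial>lborel)" for w
    by (subst Bochner_Integration.integral_add[OF bi rest(1), symmetric]) (simp add: algebra_simps)
  have "\<bar>(\<integral>x. a x * d (x + w) \<partial>lborel) - (\<integral>x. a x * d x \<partial>lborel)\<bar> < \<epsilon>" if w: "norm w < \<delta>" for w
  proof -
    have td: "integrable lborel (\<lambda>x. \<bar>d (x + w) - d x\<bar>)" using d(1) integrable_translate(1)[OF d(1), of w] by auto
    have "(\<integral>x. b k x * d (x + w) \<partial>lborel) - (\<integral>x. b k x * d x \<partial>lborel) = (\<integral>x. b k x * (d (x + w) - d x) \<partial>lborel)"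
      using bi[of w] bi[of 0] by (simp add: right_diff_distrib)
    also have "\<bar>\<dots>\<bar> \<le> (\<integral>x. \<bar>b k x * (d (x + w) - d x)\<bar> \<partial>lborel)" by (rule integral_abs_bound)
    also have "\<dots> \<le> (\<integral>x. real k * \<bar>d (x + w) - d x\<bar> \<partial>lborel)"
    proof (rule integral_mono)
      have "integrable lborel (\<lambda>x. b k x * d (x + w) - b k x * d (x + 0))"
        by (rule Bochner_Integration.integrable_diff[OF bi bi])
      then show "integrable lborel (\<lambda>x. \<bar>b k x * (d (x + w) - d x)\<bar>)" by (simp add: right_diff_distrib)
      show "integrable lborel (\<lambda>x. real k * \<bar>d (x + w) - d x\<bar>)" using td by simp
      show "\<bar>b k x * (d (x + w) - d x)\<bar> \<le> real k * \<bar>d (x + w) - d x\<bar>" for x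
        using bk[of k x] by (auto simp: abs_mult intro!: mult_right_mono)
    qed
    also have "\<dots> = real k * translation_error d w" by (simp add: translation_error_def)
    also have "\<dots> < \<epsilon> / 4" by (rule \<delta>(2)[OF w])
    finally show ?thesis
      using split[of w] split[of 0, simplified] rest(2)[of w] rest(2)[of 0, simplified] \<epsilon> by linarith
  qed
  then show ?thesis using that \<delta>(1) by blast
qed

text \<open>The substitution \<open>\<sigma> = \<theta> + \<eta>\<close> turns a double integral over \<open>\<sigma> - h \<le> \<theta> \<le> \<sigma>\<close> into an average of
  time translates.\<close>

lemma integral_time_lag:
  fixes a d :: "('a::euclidean_space) \<times> real \<Rightarrow> real"
  assumes pq: "1 < p" "1 < q" "1 / p + 1 / q = 1"
    and am[measurable]: "a \<in> borel_measurable borel" and a: "integrable lborel (\<lambda>x. \<bar>a x\<bar> powr p)"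
    and dm[measurable]: "d \<in> borel_measurable borel" and d: "integrable lborel (\<lambda>x. \<bar>d x\<bar> powr q)"
    and h: "0 \<le> h"
  shows "(\<integral>\<sigma>. (\<integral>z. indicator {\<sigma> - h..\<sigma>} (snd z) * (a z * d (fst z, \<sigma>)) \<partial>lborel) \<partial>lborel)
      = (\<integral>\<eta>. indicator {0..h} \<eta> * (\<integral>z. a z * d (z + (0, \<eta>)) \<partial>lborel) \<partial>lborel)"
    and "integrable lborel (\<lambda>\<sigma>. \<integral>z. indicator {\<sigma> - h..\<sigma>} (snd z) * (a z * d (fst z, \<sigma>)) \<partial>lborel)"
    and "integrable lborel (\<lambda>\<eta>. indicator {0..h} \<eta> * (\<integral>z. a z * d (z + (0, \<eta>)) \<partial>lborel))"
proof -
  define P where "P z \<sigma> = indicator {\<sigma> - h..\<sigma>} (snd z) * (a z * d (fst z, \<sigma>))" for z \<sigma>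
  define P' where "P' z \<eta> = indicator {0..h} \<eta> * (a z * d (z + (0, \<eta>)))" for z and \<eta> :: real
  have am': "a \<in> borel_measurable (borel \<Otimes>\<^sub>M borel)" and dm': "d \<in> borel_measurable (borel \<Otimes>\<^sub>M borel)"
    using am dm by (simp_all only: borel_prod)
  note [measurable del] = am dm
  note [measurable] = am' dm'
  have P_eq: "P z \<sigma> = (if \<sigma> - h \<le> snd z \<and> snd z \<le> \<sigma> then a z * d (fst z, \<sigma>) else 0)"
    and P'_eq: "P' z \<eta> = (if 0 \<le> \<eta> \<and> \<eta> \<le> h then a z * d (fst z, snd z + \<eta>) else 0)" for z \<sigma> \<eta>
    by (auto simp: P_def P'_def indicator_def plus_prod_def)
  have Pm0: "(\<lambda>(z, \<sigma>). P z \<sigma>) \<in> borel_measurable ((borel \<Otimes>\<^sub>M borel) \<Otimes>\<^sub>M borel)"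
    unfolding P_eq by measurable
  have P'm0: "(\<lambda>(z, \<sigma>). P' z \<sigma>) \<in> borel_measurable ((borel \<Otimes>\<^sub>M borel) \<Otimes>\<^sub>M borel)"
    unfolding P'_eq by measurable
  have sets_eq: "sets ((lborel :: ('a \<times> real) measure) \<Otimes>\<^sub>M (lborel :: real measure)) = sets ((borel \<Otimes>\<^sub>M borel) \<Otimes>\<^sub>M borel)"
    by (intro sets_pair_measure_cong) (simp_all only: sets_lborel borel_prod)
  have Pm[measurable]: "(\<lambda>(z, \<sigma>). P z \<sigma>) \<in> borel_measurable (lborel \<Otimes>\<^sub>M lborel)"
    using Pm0 unfolding measurable_cong_sets[OF sets_eq refl] .
  have P'm[measurable]: "(\<lambda>(z, \<sigma>). P' z \<sigma>) \<in> borel_measurable (lborel \<Otimes>\<^sub>M lborel)"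
    using P'm0 unfolding measurable_cong_sets[OF sets_eq refl] .
  have Pz[measurable]: "P z \<in> borel_measurable borel" for z
    using measurable_Pair2[OF Pm, of z] by simp
  have shift: "P' z \<eta> = P z (\<eta> + snd z)" for z \<eta>
    by (auto simp: P_eq P'_eq add.commute)
  define A where "A = (\<integral>z. \<bar>a z\<bar> powr p \<partial>lborel)"
  define D where "D = (\<integral>z. \<bar>d z\<bar> powr q \<partial>lborel)"
  have bound: "(\<integral>\<^sup>+z. ennreal \<bar>P' z \<eta>\<bar> \<partial>lborel) \<le> ennreal (A + D) * indicator {0..h} \<eta>" for \<eta>
  proof (cases "\<eta> \<in> {0..h}")
    case True
    have i: "integrable lborel (\<lambda>z. \<bar>a z\<bar> powr p + \<bar>d (z + (0, \<eta>))\<bar> powr q)"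
      by (intro Bochner_Integration.integrable_add a integrable_translate(1)[OF d])
    have "(\<integral>\<^sup>+z. ennreal \<bar>P' z \<eta>\<bar> \<partial>lborel) \<le> (\<integral>\<^sup>+z. ennreal (\<bar>a z\<bar> powr p + \<bar>d (z + (0, \<eta>))\<bar> powr q) \<partial>lborel)"
      using True by (intro nn_integral_mono ennreal_leI) (simp add: P'_def Young_powr[OF pq])
    also have "\<dots> = ennreal (\<integral>z. \<bar>a z\<bar> powr p + \<bar>d (z + (0, \<eta>))\<bar> powr q \<partial>lborel)"
      by (rule nn_integral_eq_integral[OF i]) simp
    also have "(\<integral>z. \<bar>a z\<bar> powr p + \<bar>d (z + (0, \<eta>))\<bar> powr q \<partial>lborel) = A + D"
      unfolding A_def D_def
      by (subst Bochner_Integration.integral_add[OF a integrable_translate(1)[OF d]])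
        (simp add: integrable_translate(2)[OF d])
    finally show ?thesis using True by simp
  qed (simp add: P'_def)
  \<comment> \<open>With the lag as the outer variable, Young's inequality bounds the inner integral
    uniformly by \<open>A + D\<close>, so the total mass is at most \<open>(A + D) * h\<close>.
    Integrability of \<open>P\<close> is then inherited through the substitution.\<close>
  have fin: "(\<integral>\<^sup>+w. ennreal (norm (case w of (z, \<eta>) \<Rightarrow> P' z \<eta>)) \<partial>(lborel \<Otimes>\<^sub>M lborel)) < \<infinity>"
  proof -
    have "(\<integral>\<^sup>+w. ennreal (norm (case w of (z, \<eta>) \<Rightarrow> P' z \<eta>)) \<partial>(lborel \<Otimes>\<^sub>M lborel)) =
        (\<integral>\<^sup>+\<eta>. (\<integral>\<^sup>+z. ennreal (norm (case (z, \<eta>) of (z, \<eta>) \<Rightarrow> P' z \<eta>)) \<partial>lborel) \<partial>lborel)"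
      by (rule lborel_pair.nn_integral_snd[symmetric]) measurable
    also have "\<dots> \<le> (\<integral>\<^sup>+\<eta>. ennreal (A + D) * indicator {0..h} \<eta> \<partial>lborel)"
      using bound by (intro nn_integral_mono) simp
    also have "\<dots> = ennreal (A + D) * ennreal h" using h by (simp add: nn_integral_cmult_indicator)
    also have "\<dots> < \<infinity>" by (simp add: ennreal_mult_less_top)
    finally show ?thesis .
  qed
  have P'i: "integrable (lborel \<Otimes>\<^sub>M lborel) (\<lambda>(z, \<eta>). P' z \<eta>)"
    by (rule integrableI_bounded[OF P'm fin])
  have Pi: "integrable (lborel \<Otimes>\<^sub>M lborel) (\<lambda>(z, \<sigma>). P z \<sigma>)"
  proof (rule integrableI_bounded[OF Pm])
    have "(\<integral>\<^sup>+w. ennreal (norm (case w of (z, \<eta>) \<Rightarrow> P z \<eta>)) \<partial>(lborel \<Otimes>\<^sub>M lborel)) =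
        (\<integral>\<^sup>+z. (\<integral>\<^sup>+\<sigma>. ennreal (norm (case (z, \<sigma>) of (z, \<eta>) \<Rightarrow> P z \<eta>)) \<partial>lborel) \<partial>lborel)"
      by (rule lborel.nn_integral_fst[where f = "\<lambda>w. ennreal (norm (case w of (z, \<eta>) \<Rightarrow> P z \<eta>))", symmetric]) measurable
    also have "\<dots> = (\<integral>\<^sup>+z. (\<integral>\<^sup>+\<eta>. ennreal (norm (case (z, \<eta>) of (z, \<eta>) \<Rightarrow> P' z \<eta>)) \<partial>lborel) \<partial>lborel)"
      unfolding shift prod.case by (intro nn_integral_cong nn_integral_translate[symmetric]) measurable
    also have "\<dots> = (\<integral>\<^sup>+w. ennreal (norm (case w of (z, \<eta>) \<Rightarrow> P' z \<eta>)) \<partial>(lborel \<Otimes>\<^sub>M lborel))"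
      by (rule lborel.nn_integral_fst[where f = "\<lambda>w. ennreal (norm (case w of (z, \<eta>) \<Rightarrow> P' z \<eta>))"]) measurable
    finally show "(\<integral>\<^sup>+w. ennreal (norm (case w of (z, \<eta>) \<Rightarrow> P z \<eta>)) \<partial>(lborel \<Otimes>\<^sub>M lborel)) < \<infinity>"
      using fin by simp
  qed
  have inner: "(\<integral>z. P' z \<eta> \<partial>lborel) = indicator {0..h} \<eta> * (\<integral>z. a z * d (z + (0, \<eta>)) \<partial>lborel)" for \<eta>
    by (simp add: P'_def)
  have "(\<integral>\<sigma>. (\<integral>z. P z \<sigma> \<partial>lborel) \<partial>lborel) = (\<integral>z. (\<integral>\<sigma>. P z \<sigma> \<partial>lborel) \<partial>lborel)"
    by (rule lborel_pair.Fubini_integral[OF Pi])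
  also have "\<dots> = (\<integral>z. (\<integral>\<eta>. P' z \<eta> \<partial>lborel) \<partial>lborel)"
    unfolding shift by (intro Bochner_Integration.integral_cong refl integral_translate_measurable[symmetric] Pz)
  also have "\<dots> = (\<integral>\<eta>. (\<integral>z. P' z \<eta> \<partial>lborel) \<partial>lborel)"
    by (rule lborel_pair.Fubini_integral[OF P'i, symmetric])
  finally show "(\<integral>\<sigma>. (\<integral>z. indicator {\<sigma> - h..\<sigma>} (snd z) * (a z * d (fst z, \<sigma>)) \<partial>lborel) \<partial>lborel)
      = (\<integral>\<eta>. indicator {0..h} \<eta> * (\<integral>z. a z * d (z + (0, \<eta>)) \<partial>lborel) \<partial>lborel)"
    unfolding inner by (simp only: P_def)
  show "integrable lborel (\<lambda>\<sigma>. \<integral>z. indicator {\<sigma> - h..\<sigma>} (snd z) * (a z * d (fst z, \<sigma>)) \<partial>lborel)"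
    using lborel_pair.integrable_snd[OF Pi] by (simp only: P_def)
  show "integrable lborel (\<lambda>\<eta>. indicator {0..h} \<eta> * (\<integral>z. a z * d (z + (0, \<eta>)) \<partial>lborel))"
    using lborel_pair.integrable_snd[OF P'i] by (simp only: inner)
qed

text \<open>With \<open>s = \<sigma> - h\<close>, integrate the hypothesis over \<sigma> in
  \<open>[\<alpha>, \<beta>]\<close> and divide by \<open>h\<close>. On the left all but two
  averages of \<open>E\<close>, over intervals of length \<open>h\<close> that end at \<beta> and at
  \<alpha>, cancel. On the right stands the average over lags in \<open>[0, h]\<close> of pairings
  of \<open>a j\<close> with time translates of \<open>d j\<close>. Continuity of \<open>E\<close>
  and of the pairing removes the averages.\<close>

lemma frozen_energy_inequality:
  fixes a d :: "'j \<Rightarrow> ('a::euclidean_space) \<times> real \<Rightarrow> real" and E :: "real \<Rightarrow> real"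
  assumes J: "finite J"
    and pq: "\<And>j. j \<in> J \<Longrightarrow> 1 < p j" "\<And>j. j \<in> J \<Longrightarrow> 1 < q j" "\<And>j. j \<in> J \<Longrightarrow> 1 / p j + 1 / q j = 1"
    and am: "\<And>j. j \<in> J \<Longrightarrow> a j \<in> borel_measurable borel"
    and a: "\<And>j. j \<in> J \<Longrightarrow> integrable lborel (\<lambda>x. \<bar>a j x\<bar> powr p j)"
    and d: "\<And>j. j \<in> J \<Longrightarrow> integrable lborel (d j)" "\<And>j. j \<in> J \<Longrightarrow> integrable lborel (\<lambda>x. \<bar>d j x\<bar> powr q j)"
    and E: "continuous_on {0..T} E"
    and ineq: "AE \<sigma> in lborel. \<sigma> \<in> {0..T} \<longrightarrow> (\<forall>s\<in>{0..\<sigma>}. E \<sigma> - E s \<le>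
      (\<Sum>j\<in>J. \<integral>z. indicator {s..\<sigma>} (snd z) * (a j z * d j (fst z, \<sigma>)) \<partial>lborel))"
    and \<alpha>\<beta>: "0 < \<alpha>" "\<alpha> < \<beta>" "\<beta> \<le> T"
  shows "E \<beta> - E \<alpha> \<le> (\<Sum>j\<in>J. \<integral>z. indicator {\<alpha>..\<beta>} (snd z) * (a j z * d j z) \<partial>lborel)"
proof (rule field_le_epsilon)
  fix \<epsilon> :: real assume \<epsilon>: "0 < \<epsilon>"
  \<comment> \<open>Restricting \<sigma> to \<open>[\<alpha>, \<beta>]\<close> is built into the
    second factor, since that is where \<sigma> is the time argument; the first factor then lives on
    times slightly before \<alpha> as well.\<close>
  define d' where "d' j z = indicator {\<alpha>..\<beta>} (snd z) * d j z" for j z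
  \<comment> \<open>Half of \<epsilon> is reserved for the pairings, \<kappa> for each of them; the
    other half replaces averages of \<open>E\<close> by its values at the end points.\<close>
  define \<kappa> where "\<kappa> = \<epsilon> / (2 * (real (card J) + 1))"
  have \<kappa>: "0 < \<kappa>" "real (card J) * \<kappa> \<le> \<epsilon> / 2"
    using \<epsilon> by (auto simp: \<kappa>_def field_simps)
  have sm[measurable]: "(snd :: 'a \<times> real \<Rightarrow> real) \<in> borel_measurable borel"
    by (intro borel_measurable_continuous_onI continuous_intros)
  have dm[measurable]: "d j \<in> borel_measurable borel" if "j \<in> J" for j using d(1)[OF that] by auto
  have im: "(\<lambda>z::'a \<times> real. indicator {\<alpha>..\<beta>} (snd z) :: real) \<in> borel_measurable borel"
    by measurable
  have d'm: "d' j \<in> borel_measurable borel" if "j \<in> J" for j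
    unfolding d'_def[abs_def] by (intro borel_measurable_times im dm that)
  have d'i: "integrable lborel (d' j)" if "j \<in> J" for j
    by (rule Bochner_Integration.integrable_bound[OF d(1)[OF that]])
      (use d'm[OF that] in \<open>auto simp: d'_def indicator_def\<close>)
  have d'q: "integrable lborel (\<lambda>x. \<bar>d' j x\<bar> powr q j)" if j: "j \<in> J" for j
  proof (rule Bochner_Integration.integrable_bound[OF d(2)[OF j]])
    show "(\<lambda>x. \<bar>d' j x\<bar> powr q j) \<in> borel_measurable lborel"
      using d'm[OF j] by measurable
    show "AE x in lborel. norm (\<bar>d' j x\<bar> powr q j) \<le> norm (\<bar>d j x\<bar> powr q j)"
      by (rule AE_I2) (simp add: d'_def indicator_def)
  qed
  define I where "I j w = (\<integral>z. a j z * d' j (z + w) \<partial>lborel)" for j w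
  have "\<forall>j\<in>J. \<exists>\<delta>. 0 < \<delta> \<and> (\<forall>w. norm w < \<delta> \<longrightarrow> \<bar>I j w - I j 0\<bar> < \<kappa>)"
  proof
    fix j assume j: "j \<in> J"
    obtain \<delta> where "0 < \<delta>"
      "\<And>w. norm w < \<delta> \<Longrightarrow> \<bar>(\<integral>x. a j x * d' j (x + w) \<partial>lborel) - (\<integral>x. a j x * d' j x \<partial>lborel)\<bar> < \<kappa>"
      by (rule translation_pairing_continuous[OF pq[OF j] am[OF j] a[OF j] d'i[OF j] d'q[OF j] \<kappa>(1)]) (rule that)
    then show "\<exists>\<delta>. 0 < \<delta> \<and> (\<forall>w. norm w < \<delta> \<longrightarrow> \<bar>I j w - I j 0\<bar> < \<kappa>)" unfolding I_def by auto
  qed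
  from bchoice[OF this] obtain \<delta> where
    "\<forall>j\<in>J. 0 < \<delta> j \<and> (\<forall>w. norm w < \<delta> j \<longrightarrow> \<bar>I j w - I j 0\<bar> < \<kappa>)" ..
  then have \<delta>: "\<And>j. j \<in> J \<Longrightarrow> 0 < \<delta> j" "\<And>j w. j \<in> J \<Longrightarrow> norm w < \<delta> j \<Longrightarrow> \<bar>I j w - I j 0\<bar> < \<kappa>"
    by blast+
  have "\<forall>e>0. \<exists>\<delta>>0. \<forall>s\<in>{0..T}. \<bar>s - \<tau>\<bar> < \<delta> \<longrightarrow> \<bar>E s - E \<tau>\<bar> < e" if "\<tau> \<in> {0..T}" for \<tau>
    using E that unfolding continuous_on_iff dist_real_def by blast
  from this[of \<alpha>, rule_format, of "\<epsilon> / 4"] this[of \<beta>, rule_format, of "\<epsilon> / 4"]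
  obtain \<delta>\<^sub>1 \<delta>\<^sub>2 where E1: "0 < \<delta>\<^sub>1" "\<And>s. s \<in> {0..T} \<Longrightarrow> \<bar>s - \<alpha>\<bar> < \<delta>\<^sub>1 \<Longrightarrow> \<bar>E s - E \<alpha>\<bar> < \<epsilon> / 4"
    and E2: "0 < \<delta>\<^sub>2" "\<And>s. s \<in> {0..T} \<Longrightarrow> \<bar>s - \<beta>\<bar> < \<delta>\<^sub>2 \<Longrightarrow> \<bar>E s - E \<beta>\<bar> < \<epsilon> / 4"
    using \<epsilon> \<alpha>\<beta> by auto
  \<comment> \<open>\<open>h < \<alpha>\<close> keeps \<open>\<sigma> - h\<close> in the time
    interval, \<open>h < \<beta> - \<alpha>\<close> keeps the two end intervals disjoint, and the
    remaining bounds activate the moduli of continuity. Halving the minimum makes all inequalities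
    strict.\<close>
  define h where "h = Min (insert \<alpha> (insert (\<beta> - \<alpha>) (insert \<delta>\<^sub>1 (insert \<delta>\<^sub>2 (\<delta> ` J))))) / 2"
  have hpos: "0 < Min (insert \<alpha> (insert (\<beta> - \<alpha>) (insert \<delta>\<^sub>1 (insert \<delta>\<^sub>2 (\<delta> ` J)))))"
    using J \<alpha>\<beta> E1(1) E2(1) \<delta>(1) by (subst Min_gr_iff) auto
  have h: "0 < h" using hpos by (simp add: h_def)
  have hlt: "h < x" if "x \<in> insert \<alpha> (insert (\<beta> - \<alpha>) (insert \<delta>\<^sub>1 (insert \<delta>\<^sub>2 (\<delta> ` J))))" for x
  proof -
    have "Min (insert \<alpha> (insert (\<beta> - \<alpha>) (insert \<delta>\<^sub>1 (insert \<delta>\<^sub>2 (\<delta> ` J))))) \<le> x"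
      using J that by (intro Min_le) auto
    then show ?thesis using hpos unfolding h_def by linarith
  qed
  \<comment> \<open>Extension by zero allows translations on the whole line; only genuine values of
    \<open>E\<close> are met, because \<open>h < \<alpha>\<close>.\<close>
  define E' where "E' s = indicator {0..T} s * E s" for s
  have E'm[measurable]: "E' \<in> borel_measurable borel"
    using borel_measurable_continuous_on_indicator[OF _ E] unfolding E'_def[abs_def] by (simp add: mult.commute)
  obtain C where "\<forall>x\<in>E ` {0..T}. norm x \<le> C"
    using compact_imp_bounded[OF compact_continuous_image[OF E compact_Icc]] unfolding bounded_iff by blast
  then have C: "\<And>s. s \<in> {0..T} \<Longrightarrow> \<bar>E s\<bar> \<le> C" by simp
  have ind_i: "integrable lborel (\<lambda>s. indicator S s * E' s)"
    if S: "S \<in> sets borel" "emeasure lborel S < \<infinity>" for S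
  proof -
    have "integrable lborel (\<lambda>s. indicator S s * C)"
      using S by (intro integrable_mult_left integrable_real_indicator) auto
    then show ?thesis
    proof (rule Bochner_Integration.integrable_bound)
      show "(\<lambda>s. indicator S s * E' s) \<in> borel_measurable lborel" using S(1) by measurable
      show "AE s in lborel. norm (indicator S s * E' s) \<le> norm (indicator S s * C)"
        by (intro AE_I2) (auto simp: E'_def indicator_def intro!: order_trans[OF C abs_ge_self])
    qed
  qed
  have lhs_i1: "integrable lborel (\<lambda>\<sigma>. indicator {\<alpha>..\<beta>} \<sigma> * E' \<sigma>)" by (rule ind_i) (use \<alpha>\<beta> in auto)
  have lhs_i2: "integrable lborel (\<lambda>\<sigma>. indicator {\<alpha> - h..\<beta> - h} \<sigma> * E' \<sigma>)" by (rule ind_i) (use \<alpha>\<beta> in auto)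
  have sh: "(\<lambda>\<sigma>. indicator {\<alpha> - h..\<beta> - h} (\<sigma> + (-h)) * E' (\<sigma> + (-h))) = (\<lambda>\<sigma>. indicator {\<alpha>..\<beta>} \<sigma> * E' (\<sigma> - h))"
    by (auto simp: fun_eq_iff indicator_def)
  have lhs_i3: "integrable lborel (\<lambda>\<sigma>. indicator {\<alpha>..\<beta>} \<sigma> * E' (\<sigma> - h))"
    and lhs_e3: "(\<integral>\<sigma>. indicator {\<alpha>..\<beta>} \<sigma> * E' (\<sigma> - h) \<partial>lborel) = (\<integral>\<sigma>. indicator {\<alpha> - h..\<beta> - h} \<sigma> * E' \<sigma> \<partial>lborel)"
    using integrable_translate[OF lhs_i2, of "-h"] unfolding sh by auto
  \<comment> \<open>After translating the second integral the contributions of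
    \<open>[\<alpha>, \<beta> - h]\<close> cancel, and only the intervals next to \<alpha> and
    \<beta> remain.\<close>
  have lower: "h * (E \<beta> - E \<alpha> - \<epsilon> / 2) \<le> (\<integral>\<sigma>. indicator {\<alpha>..\<beta>} \<sigma> * E' \<sigma> - indicator {\<alpha>..\<beta>} \<sigma> * E' (\<sigma> - h) \<partial>lborel)"
  proof -
    have "(\<integral>\<sigma>. indicator {\<alpha>..\<beta>} \<sigma> * E' \<sigma> - indicator {\<alpha>..\<beta>} \<sigma> * E' (\<sigma> - h) \<partial>lborel) =
      (\<integral>\<sigma>. indicator {\<alpha>..\<beta>} \<sigma> * E' \<sigma> - indicator {\<alpha> - h..\<beta> - h} \<sigma> * E' \<sigma> \<partial>lborel)"
      using lhs_i1 lhs_i2 lhs_i3 lhs_e3 by simp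
    also have "\<dots> \<ge> (\<integral>\<sigma>. indicator {\<beta> - h<..\<beta>} \<sigma> * (E \<beta> - \<epsilon> / 4) - indicator {\<alpha> - h..<\<alpha>} \<sigma> * (E \<alpha> + \<epsilon> / 4) \<partial>lborel)"
    proof (rule integral_mono)
      show "integrable lborel (\<lambda>\<sigma>. indicator {\<beta> - h<..\<beta>} \<sigma> * (E \<beta> - \<epsilon> / 4) - indicator {\<alpha> - h..<\<alpha>} \<sigma> * (E \<alpha> + \<epsilon> / 4))"
        using h by (intro Bochner_Integration.integrable_diff integrable_mult_left integrable_real_indicator) auto
      show "integrable lborel (\<lambda>\<sigma>. indicator {\<alpha>..\<beta>} \<sigma> * E' \<sigma> - indicator {\<alpha> - h..\<beta> - h} \<sigma> * E' \<sigma>)"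
        by (intro Bochner_Integration.integrable_diff lhs_i1 lhs_i2)
      fix \<sigma>
      have h1: "h < \<alpha>" "h < \<beta> - \<alpha>" "h < \<delta>\<^sub>1" "h < \<delta>\<^sub>2" using hlt by auto
      consider "\<sigma> < \<alpha> - h" | "\<alpha> - h \<le> \<sigma>" "\<sigma> < \<alpha>" | "\<alpha> \<le> \<sigma>" "\<sigma> \<le> \<beta> - h" | "\<beta> - h < \<sigma>" "\<sigma> \<le> \<beta>" | "\<beta> < \<sigma>" by linarith
      then show "indicator {\<beta> - h<..\<beta>} \<sigma> * (E \<beta> - \<epsilon> / 4) - indicator {\<alpha> - h..<\<alpha>} \<sigma> * (E \<alpha> + \<epsilon> / 4)
          \<le> indicator {\<alpha>..\<beta>} \<sigma> * E' \<sigma> - indicator {\<alpha> - h..\<beta> - h} \<sigma> * E' \<sigma>"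
      proof cases
        case 2
        have "\<bar>E \<sigma> - E \<alpha>\<bar> < \<epsilon> / 4" using 2 h1 \<alpha>\<beta> by (intro E1(2)) auto
        then have "E \<sigma> \<le> E \<alpha> + \<epsilon> / 4" by linarith
        then show ?thesis using 2 h1 \<alpha>\<beta> h by (simp add: E'_def)
      next
        case 4
        have "\<bar>E \<sigma> - E \<beta>\<bar> < \<epsilon> / 4" using 4 h1 \<alpha>\<beta> by (intro E2(2)) auto
        then have "E \<beta> - \<epsilon> / 4 \<le> E \<sigma>" by linarith
        then show ?thesis using 4 h1 \<alpha>\<beta> h by (simp add: E'_def)
      qed (use h1 \<alpha>\<beta> h in auto)
    qed
    also have "(\<integral>\<sigma>. indicator {\<beta> - h<..\<beta>} \<sigma> * (E \<beta> - \<epsilon> / 4) - indicator {\<alpha> - h..<\<alpha>} \<sigma> * (E \<alpha> + \<epsilon> / 4) \<partial>lborel)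
        = h * (E \<beta> - E \<alpha> - \<epsilon> / 2)"
      using h by (subst Bochner_Integration.integral_diff)
        (auto intro!: integrable_mult_left integrable_real_indicator simp: field_simps)
    finally show ?thesis .
  qed
  define R where "R j \<sigma> = (\<integral>z. indicator {\<sigma> - h..\<sigma>} (snd z) * (a j z * d' j (fst z, \<sigma>)) \<partial>lborel)" for j \<sigma>
  note lag = integral_time_lag[OF pq am a d'm d'q less_imp_le[OF h]]
  have upper: "(\<integral>\<sigma>. indicator {\<alpha>..\<beta>} \<sigma> * E' \<sigma> - indicator {\<alpha>..\<beta>} \<sigma> * E' (\<sigma> - h) \<partial>lborel)
      \<le> (\<integral>\<sigma>. (\<Sum>j\<in>J. R j \<sigma>) \<partial>lborel)"
  proof (rule integral_mono_AE)
    show "integrable lborel (\<lambda>\<sigma>. indicator {\<alpha>..\<beta>} \<sigma> * E' \<sigma> - indicator {\<alpha>..\<beta>} \<sigma> * E' (\<sigma> - h))"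
      by (intro Bochner_Integration.integrable_diff lhs_i1 lhs_i3)
    show "integrable lborel (\<lambda>\<sigma>. \<Sum>j\<in>J. R j \<sigma>)" unfolding R_def by (intro Bochner_Integration.integrable_sum lag(2))
    show "AE \<sigma> in lborel. indicator {\<alpha>..\<beta>} \<sigma> * E' \<sigma> - indicator {\<alpha>..\<beta>} \<sigma> * E' (\<sigma> - h) \<le> (\<Sum>j\<in>J. R j \<sigma>)"
      using ineq
    proof eventually_elim
      case (elim \<sigma>)
      show ?case
      proof (cases "\<sigma> \<in> {\<alpha>..\<beta>}")
        case True
        have h1: "h < \<alpha>" using hlt by auto
        then have "E \<sigma> - E (\<sigma> - h) \<le> (\<Sum>j\<in>J. \<integral>z. indicator {\<sigma> - h..\<sigma>} (snd z) * (a j z * d j (fst z, \<sigma>)) \<partial>lborel)"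
          using elim True \<alpha>\<beta> h by auto
        also have "\<dots> = (\<Sum>j\<in>J. R j \<sigma>)" unfolding R_def d'_def using True by simp
        finally show ?thesis using True \<alpha>\<beta> h1 h by (simp add: E'_def)
      next
        case False
        then show ?thesis by (simp add: R_def d'_def)
      qed
    qed
  qed
  have "(\<integral>\<sigma>. (\<Sum>j\<in>J. R j \<sigma>) \<partial>lborel) = (\<Sum>j\<in>J. \<integral>\<sigma>. R j \<sigma> \<partial>lborel)"
    unfolding R_def by (intro Bochner_Integration.integral_sum lag(2))
  also have "\<dots> = (\<Sum>j\<in>J. \<integral>\<eta>. indicator {0..h} \<eta> * I j (0, \<eta>) \<partial>lborel)"
    unfolding R_def I_def by (intro sum.cong refl lag(1))
  also have "\<dots> \<le> (\<Sum>j\<in>J. h * (I j 0 + \<kappa>))"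
  proof (rule sum_mono)
    fix j assume j: "j \<in> J"
    have "(\<integral>\<eta>. indicator {0..h} \<eta> * I j (0, \<eta>) \<partial>lborel) \<le> (\<integral>\<eta>. indicator {0..h} \<eta> * (I j 0 + \<kappa>) \<partial>lborel)"
    proof (rule integral_mono)
      show "integrable lborel (\<lambda>\<eta>. indicator {0..h} \<eta> * I j (0, \<eta>))" unfolding I_def by (rule lag(3)[OF j j j j j j j])
      show "integrable lborel (\<lambda>\<eta>. indicator {0..h} \<eta> * (I j 0 + \<kappa>))"
        using h by (intro integrable_mult_left integrable_real_indicator) auto
      fix \<eta> :: real
      have "I j (0, \<eta>) \<le> I j 0 + \<kappa>" if "\<eta> \<in> {0..h}"
      proof -
        have "h < \<delta> j" using hlt j by auto
        then have "norm ((0, \<eta>) :: 'a \<times> real) < \<delta> j" using that by (simp add: norm_Pair)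
        from \<delta>(2)[OF j this] show ?thesis by linarith
      qed
      then show "indicator {0..h} \<eta> * I j (0, \<eta>) \<le> indicator {0..h} \<eta> * (I j 0 + \<kappa>)"
        by (auto simp: indicator_def)
    qed
    also have "\<dots> = h * (I j 0 + \<kappa>)" using h by simp
    finally show "(\<integral>\<eta>. indicator {0..h} \<eta> * I j (0, \<eta>) \<partial>lborel) \<le> h * (I j 0 + \<kappa>)" .
  qed
  also have "\<dots> = h * ((\<Sum>j\<in>J. I j 0) + real (card J) * \<kappa>)"
    by (simp add: sum.distrib flip: sum_distrib_left)
  also have "\<dots> \<le> h * ((\<Sum>j\<in>J. I j 0) + \<epsilon> / 2)" using \<kappa>(2) h by (intro mult_left_mono) auto
  finally have "h * (E \<beta> - E \<alpha> - \<epsilon> / 2) \<le> h * ((\<Sum>j\<in>J. I j 0) + \<epsilon> / 2)"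
    using lower upper by linarith
  then have "E \<beta> - E \<alpha> - \<epsilon> / 2 \<le> (\<Sum>j\<in>J. I j 0) + \<epsilon> / 2" using h by simp
  moreover have "I j 0 = (\<integral>z. indicator {\<alpha>..\<beta>} (snd z) * (a j z * d j z) \<partial>lborel)" for j
    by (simp add: I_def d'_def mult.left_commute)
  ultimately show "E \<beta> - E \<alpha> \<le> (\<Sum>j\<in>J. \<integral>z. indicator {\<alpha>..\<beta>} (snd z) * (a j z * d j z) \<partial>lborel) + \<epsilon>" by simp
qed

section \<open>Time-independent test functions\<close>

lemma borel_measurable_lebesgue_AE:
  fixes f g :: "'a::euclidean_space \<Rightarrow> real"
  assumes g: "g \<in> borel_measurable borel" and eq: "AE x in lborel. f x = g x"
  shows "f \<in> borel_measurable lebesgue"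
proof (rule measurableI)
  fix S :: "real set" assume S: "S \<in> sets borel"
  have "AE x in lborel. \<not> (f x \<noteq> g x)" using eq by simp
  from sets_completion_AE[OF this] have 1: "{x. f x \<noteq> g x} \<in> sets lebesgue" by (simp add: pred_def)
  have "(\<lambda>x. g x) \<in> borel_measurable lebesgue" by (rule measurable_completion) (use g in simp)
  then have 2: "g -` S \<in> sets lebesgue" using measurable_sets[OF _ S, of g lebesgue] by simp
  have "AE x in lborel. \<not> (f x \<noteq> g x \<and> f x \<in> S)" using eq by (auto elim: eventually_mono)
  from sets_completion_AE[OF this] have 3: "{x. f x \<noteq> g x \<and> f x \<in> S} \<in> sets lebesgue" by (simp add: pred_def)
  have "(g -` S - {x. f x \<noteq> g x}) \<union> {x. f x \<noteq> g x \<and> f x \<in> S} \<in> sets lebesgue"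
    by (intro sets.Un sets.Diff 1 2 3)
  moreover have "f -` S \<inter> space lebesgue = (g -` S - {x. f x \<noteq> g x}) \<union> {x. f x \<noteq> g x \<and> f x \<in> S}" by auto
  ultimately show "f -` S \<inter> space lebesgue \<in> sets lebesgue" by simp
qed simp

lemma integral_lebesgue_AE_lborel:
  fixes f g :: "'a::euclidean_space \<Rightarrow> real"
  assumes g: "g \<in> borel_measurable borel" and eq: "AE x in lborel. f x = g x"
  shows "integral\<^sup>L lebesgue f = integral\<^sup>L lborel g"
proof -
  have "integral\<^sup>L lebesgue f = integral\<^sup>L lebesgue g"
    by (rule integral_cong_AE[OF borel_measurable_lebesgue_AE[OF assms]])
      (use measurable_completion[of g lborel borel] g AE_completion[OF eq] in auto)
  then show ?thesis using g by (simp add: integral_completion)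
qed

lemma AE_lborel_prodD:
  assumes "AE z in (lborel :: ('a::euclidean_space \<times> 'b::euclidean_space) measure). P z"
  shows "AE y in lborel. AE x in lborel. P (x, y)"
proof -
  obtain N where N: "{z. \<not> P z} \<subseteq> N" "emeasure lborel N = 0" "N \<in> sets (lborel :: ('a \<times> 'b) measure)"
    using AE_E[OF assms] by (auto simp: space_lborel)
  have N': "N \<in> sets (lborel \<Otimes>\<^sub>M lborel :: ('a \<times> 'b) measure)" using N(3) by (simp only: lborel_prod)
  have "AE z in lborel \<Otimes>\<^sub>M (lborel :: 'b measure). z \<notin> (N :: ('a \<times> 'b) set)"
    using N by (intro AE_not_in) (simp add: lborel_prod null_sets_def)
  then have "AE x in (lborel :: 'a measure). AE y in (lborel :: 'b measure). (x, y) \<notin> N" by (rule lborel_pair.AE_pair)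
  moreover have "{z \<in> space (lborel \<Otimes>\<^sub>M lborel). (fst z, snd z) \<notin> N} \<in> sets (lborel \<Otimes>\<^sub>M lborel :: ('a \<times> 'b) measure)"
    using sets.compl_sets[OF N'] by (simp add: set_diff_eq)
  ultimately have "AE y in (lborel :: 'b measure). AE x in (lborel :: 'a measure). (x, y) \<notin> N"
    using lborel_pair.AE_commute[of "\<lambda>x y. (x, y) \<notin> N"] by simp
  then show ?thesis using N(1) by (auto elim!: eventually_mono)
qed

lemma borel_measurable_slice:
  fixes h :: "'a::euclidean_space \<times> real \<Rightarrow> real"
  assumes "h \<in> borel_measurable borel" shows "(\<lambda>x. h (x, t)) \<in> borel_measurable borel"
  by (rule measurable_compose[OF _ assms]) (intro borel_measurable_continuous_onI continuous_intros)

lemma borel_measurable_fst: "h \<in> borel_measurable borel \<Longrightarrow>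
    (\<lambda>z::'a::euclidean_space \<times> real. h (fst z) :: real) \<in> borel_measurable borel"
  by (rule measurable_compose[where N = borel]) (auto intro!: borel_measurable_continuous_onI continuous_intros)

lemma borel_measurable_indicator_snd:
  "S \<in> sets borel \<Longrightarrow> (\<lambda>z::'a::euclidean_space \<times> real. indicator S (snd z) :: real) \<in> borel_measurable borel"
  by (rule measurable_compose[of snd _ borel])
    (auto intro!: borel_measurable_continuous_onI continuous_intros)

section \<open>Functions that are constant in time\<close>

lemma integrable_time_constant:
  fixes f :: "'a::euclidean_space \<Rightarrow> real"
  assumes f: "integrable lborel f"
  shows "integrable lborel (\<lambda>z. indicator {0..T::real} (snd z) * f (fst z))"
proof -
  have [measurable]: "f \<in> borel_measurable borel" using f by auto
  have "integrable (lborel \<Otimes>\<^sub>M lborel) (\<lambda>z. indicator {0..T::real} (snd z) * f (fst z))"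
  proof (rule lborel_pair.Fubini_integrable)
    show "(\<lambda>z. indicator {0..T} (snd z) * f (fst z)) \<in> borel_measurable (lborel \<Otimes>\<^sub>M lborel)" by measurable
    show "integrable lborel (\<lambda>x. \<integral>y. norm (indicator {0..T} (snd (x, y)) * f (fst (x, y))) \<partial>lborel)"
      using f by (simp add: abs_mult)
    show "AE x in lborel. integrable lborel (\<lambda>y. indicator {0..T} (snd (x, y)) * f (fst (x, y)))"
      by (intro AE_I2) (auto intro!: integrable_mult_left integrable_real_indicator simp: emeasure_lborel_Icc_eq)
  qed
  then show ?thesis by (simp add: lborel_prod)
qed

lemma Lq_time_constant:
  fixes h :: "'a::euclidean_space \<Rightarrow> real"
  assumes S: "S \<in> sets lebesgue" "S \<subseteq> UNIV \<times> {0..T::real}"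
    and h: "h \<in> borel_measurable borel" "integrable lborel (\<lambda>x. \<bar>h x\<bar> powr q)"
  shows "Lq q S (\<lambda>z. h (fst z))"
proof -
  have hm: "(\<lambda>z::'a \<times> real. h (fst z)) \<in> borel_measurable lebesgue"
    by (rule measurable_completion) (use borel_measurable_fst[OF h(1)] in simp)
  have "(\<lambda>x. \<bar>h x\<bar> powr q) \<in> borel_measurable borel" using h(1) by measurable
  then have hm': "(\<lambda>z::'a \<times> real. \<bar>h (fst z)\<bar> powr q) \<in> borel_measurable lebesgue"
    by (intro measurable_completion) (use borel_measurable_fst in simp)
  have i: "integrable lebesgue (\<lambda>z::'a \<times> real. indicator {0..T} (snd z) * \<bar>h (fst z)\<bar> powr q)"
    using integrable_time_constant[OF h(2), of T] by (subst integrable_completion) auto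
  show ?thesis unfolding Lq_def set_borel_measurable_def set_integrable_def
  proof
    show "(\<lambda>z. indicator S z *\<^sub>R h (fst z)) \<in> borel_measurable lebesgue"
      using S(1) hm by (intro borel_measurable_scaleR borel_measurable_indicator)
    show "integrable lebesgue (\<lambda>z. indicator S z *\<^sub>R \<bar>h (fst z)\<bar> powr q)"
    proof (rule Bochner_Integration.integrable_bound[OF i])
      show "(\<lambda>z. indicator S z *\<^sub>R \<bar>h (fst z)\<bar> powr q) \<in> borel_measurable lebesgue"
        using S(1) hm' by (intro borel_measurable_scaleR borel_measurable_indicator)
      show "AE z in lebesgue. norm (indicator S z *\<^sub>R \<bar>h (fst z)\<bar> powr q) \<le> norm (indicator {0..T} (snd z) * \<bar>h (fst z)\<bar> powr q)"
        using S(2) by (intro AE_I2) (auto simp: indicator_def)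
    qed
  qed
qed

lemma integrable_bounded_compact_support:
  fixes h :: "'a::euclidean_space \<Rightarrow> real"
  assumes "h \<in> borel_measurable borel" "compact K" "\<And>x. x \<notin> K \<Longrightarrow> h x = 0" "\<And>x. \<bar>h x\<bar> \<le> C"
  shows "integrable lborel h"
proof -
  have "integrable lborel (\<lambda>x. indicator K x * C)"
    using emeasure_compact_finite[OF assms(2)] borel_compact[OF assms(2)]
    by (intro integrable_mult_left integrable_real_indicator) auto
  then show ?thesis
    by (rule Bochner_Integration.integrable_bound)
      (use assms in \<open>auto simp: indicator_def intro!: order_trans[OF assms(4) abs_ge_self]\<close>)
qed

text \<open>This is the tangent inequality for the convex function \<open>s powr r / r\<close>. It
  is Young's inequality with exponents \<open>r\<close> and \<open>r / (r - 1)\<close>, which avoids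
  derivatives and includes the value 0.\<close>

lemma powr_convex_tangent:
  fixes X Y r :: real
  assumes "0 \<le> X" "0 \<le> Y" "1 < r"
  shows "X powr r / r - Y powr r / r \<le> (X - Y) * X powr (r - 1)"
proof -
  define q where "q = r / (r - 1)"
  have q: "1 < q" "1 / r + 1 / q = 1" using assms(3) by (auto simp: q_def field_simps)
  have "Y * X powr (r - 1) \<le> Y powr r / r + (X powr (r - 1)) powr q / q"
    using Youngs_inequality[OF assms(3) q, of Y "X powr (r - 1)"] assms by simp
  also have "(X powr (r - 1)) powr q = X powr r" using assms(3) by (simp add: powr_powr q_def)
  finally have 1: "Y * X powr (r - 1) \<le> Y powr r / r + X powr r / q" .
  have 2: "X * X powr (r - 1) = X powr r"
    using assms(1,3) by (cases "X = 0") (auto simp: powr_mult_base)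
  have "X powr r / r + X powr r / q = X powr r * (1 / r + 1 / q)" by (simp add: distrib_left)
  then have "X powr r / r + X powr r / q = X powr r" using q(2) by simp
  then show ?thesis using 1 2 by (simp add: left_diff_distrib)
qed

text \<open>\<open>U\<close>, \<open>V\<close>, \<open>a\<close>, \<open>b\<close> are Borel representatives of \<open>u\<close>, \<open>Du\<close> and of the two nonlinearities on
  \<open>K \<times> {0..T}\<close>, extended by zero. They determine only almost every time slice, so every single
  slice has its own representative \<open>w t\<close>.\<close>

locale cutoff_energy =
  fixes \<Omega> :: "(real^'n) set" and T :: real and p :: "'n \<Rightarrow> real"
    and A :: "(real^'n) \<times> real \<Rightarrow> real \<Rightarrow> real^'n \<Rightarrow> real^'n"
    and B :: "(real^'n) \<times> real \<Rightarrow> real \<Rightarrow> real^'n \<Rightarrow> real"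
    and u :: "(real^'n) \<times> real \<Rightarrow> real" and Du :: "(real^'n) \<times> real \<Rightarrow> real^'n"
    and K :: "(real^'n) set" and M :: real
    and U :: "(real^'n) \<times> real \<Rightarrow> real" and V a :: "(real^'n) \<times> real \<Rightarrow> real^'n"
    and b :: "(real^'n) \<times> real \<Rightarrow> real" and w :: "real \<Rightarrow> real^'n \<Rightarrow> real"
    and K0 :: "(real^'n) set" and \<zeta> :: "real^'n \<Rightarrow> real" and \<delta> \<nu> r :: real
  assumes \<Omega>: "open \<Omega>" and T: "0 < T" and p: "\<And>i. 1 < p i" "\<And>i. p i < 2"
    and K: "compact K" "K \<subseteq> \<Omega>"
    and W11: "AE t\<in>{0..T} in lebesgue. W11_loc \<Omega> (\<lambda>x. u (x, t)) (\<lambda>x. Du (x, t))"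
    and sub: "\<And>t\<^sub>1 t\<^sub>2 \<phi> D\<phi> d\<phi>. 0 \<le> t\<^sub>1 \<Longrightarrow> t\<^sub>1 \<le> t\<^sub>2 \<Longrightarrow> t\<^sub>2 \<le> T \<Longrightarrow> test_function \<Omega> T p K \<phi> D\<phi> d\<phi> \<Longrightarrow>
      weak_lhs A K t\<^sub>1 t\<^sub>2 u Du \<phi> D\<phi> d\<phi> \<le> weak_rhs B K t\<^sub>1 t\<^sub>2 u Du \<phi>"
    and U: "U \<in> borel_measurable borel" "\<And>z. 0 \<le> U z" "\<And>z. U z \<le> M" "\<And>z. z \<notin> K \<times> {0..T} \<Longrightarrow> U z = 0"
    and V: "\<And>i. (\<lambda>z. V z $ i) \<in> borel_measurable borel" "\<And>z. z \<notin> K \<times> {0..T} \<Longrightarrow> V z = 0"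
      "\<And>i. integrable lborel (\<lambda>z. \<bar>V z $ i\<bar> powr p i)"
    and a: "\<And>i. (\<lambda>z. a z $ i) \<in> borel_measurable borel" "\<And>z. z \<notin> K \<times> {0..T} \<Longrightarrow> a z = 0"
      "\<And>i. integrable lborel (\<lambda>z. \<bar>a z $ i\<bar> powr (p i / (p i - 1)))"
    and b: "b \<in> borel_measurable borel" "\<And>z. z \<notin> K \<times> {0..T} \<Longrightarrow> b z = 0"
      "integrable lborel (\<lambda>z. \<bar>b z\<bar> powr 2)"
    and rep: "AE z in lborel. z \<in> K \<times> {0..T} \<longrightarrow>
      U z = u z \<and> V z = Du z \<and> a z = A z (u z) (Du z) \<and> b z = B z (u z) (Du z)"
    and w: "\<And>t. t \<in> {0..T} \<Longrightarrow> w t \<in> borel_measurable borel" "\<And>t x. 0 \<le> w t x" "\<And>t x. w t x \<le> M"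
      "\<And>t. t \<in> {0..T} \<Longrightarrow> AE x in lborel. x \<in> K \<longrightarrow> u (x, t) = w t x"
    and w_cont: "\<And>t. t \<in> {0..T} \<Longrightarrow>
      ((\<lambda>s. \<integral>x. indicator K x * (w s x - w t x)\<^sup>2 \<partial>lborel) \<longlongrightarrow> 0) (at t within {0..T})"
    and \<zeta>: "Cc_infinity K0 \<zeta>" "\<And>x. 0 \<le> \<zeta> x" "K0 \<subseteq> K"
    and \<delta>: "0 < \<delta>" "\<And>x. x \<in> K0 \<Longrightarrow> cball x \<delta> \<subseteq> K"
    and \<nu>: "0 < \<nu>" and r: "1 < r"
begin

definition \<phi> :: "(real^'n) \<times> real \<Rightarrow> real" where
  "\<phi> z = (U z + \<nu>) powr (r - 1) * \<zeta> (fst z)"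

text \<open>The spatial derivative of \<phi> in direction \<open>i\<close>, as the chain rule
  predicts it.\<close>

definition d :: "'n \<Rightarrow> (real^'n) \<times> real \<Rightarrow> real" where
  "d i z = (r - 1) * (U z + \<nu>) powr (r - 1 - 1) * V z $ i * \<zeta> (fst z) +
    (U z + \<nu>) powr (r - 1) * partial_deriv (axis i 1) \<zeta> (fst z)"

text \<open>The individual slices \<open>w t\<close> are used instead of \<open>U\<close>, because
  the energy must have its true value at every time and be continuous.\<close>

definition E :: "real \<Rightarrow> real" where
  "E t = (\<integral>x. (w t x + \<nu>) powr r / r * \<zeta> x \<partial>lborel)"

text \<open>What a single time needs in order that its slice may be frozen and used as a test
  function.\<close>

definition good :: "real \<Rightarrow> bool" where
  "good \<sigma> \<longleftrightarrow> W11_loc \<Omega> (\<lambda>x. u (x, \<sigma>)) (\<lambda>x. Du (x, \<sigma>)) \<and>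
    (AE x in lborel. x \<in> K \<longrightarrow> U (x, \<sigma>) = u (x, \<sigma>) \<and> V (x, \<sigma>) = Du (x, \<sigma>)) \<and>
    (\<forall>i. integrable lborel (\<lambda>x. \<bar>V (x, \<sigma>) $ i\<bar> powr p i))"

lemma AE_good: "AE \<sigma> in lborel. \<sigma> \<in> {0..T} \<longrightarrow> good \<sigma>"
proof -
  have 1: "AE \<sigma> in lborel. \<sigma> \<in> {0..T} \<longrightarrow> W11_loc \<Omega> (\<lambda>x. u (x, \<sigma>)) (\<lambda>x. Du (x, \<sigma>))"
    using W11 by (simp add: AE_completion_iff)
  have 2: "AE \<sigma> in lborel. AE x in lborel. (x, \<sigma>) \<in> K \<times> {0..T} \<longrightarrow> U (x, \<sigma>) = u (x, \<sigma>) \<and> V (x, \<sigma>) = Du (x, \<sigma>)"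
    using AE_lborel_prodD[OF rep] by (auto elim!: eventually_mono)
  have 3: "AE \<sigma> in lborel. integrable lborel (\<lambda>x. \<bar>V (x, \<sigma>) $ i\<bar> powr p i)" for i
  proof (rule lborel_pair.AE_integrable_snd)
    show "integrable (lborel \<Otimes>\<^sub>M lborel) (\<lambda>(x, \<sigma>). \<bar>V (x, \<sigma>) $ i\<bar> powr p i)"
    proof -
      have "(\<lambda>(x, \<sigma>). \<bar>V (x, \<sigma>) $ i\<bar> powr p i) = (\<lambda>z. \<bar>V z $ i\<bar> powr p i)" by auto
      then show ?thesis using V(3)[of i] by (simp only: lborel_prod)
    qed
  qed
  have 3: "AE \<sigma> in lborel. \<forall>i. integrable lborel (\<lambda>x. \<bar>V (x, \<sigma>) $ i\<bar> powr p i)"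
    unfolding AE_all_countable using 3 by blast
  show ?thesis using 1 2 3 by eventually_elim (auto simp: good_def)
qed

section \<open>Bounds for the test function and its gradient\<close>

lemma \<zeta>_outside: "x \<notin> K \<Longrightarrow> \<zeta> x = 0" "x \<notin> K \<Longrightarrow> partial_deriv c \<zeta> x = 0"
proof -
  obtain K' where K': "compact K'" "K' \<subseteq> K0" "\<And>x. x \<notin> K' \<Longrightarrow> \<zeta> x = 0" using Cc_infinityE[OF \<zeta>(1)] by metis
  show "\<zeta> x = 0" if "x \<notin> K" using K'(2,3) \<zeta>(3) that by blast
  show "partial_deriv c \<zeta> x = 0" if x: "x \<notin> K"
  proof (rule partial_deriv_eq_0[OF compact_imp_closed[OF K'(1)] K'(3)])
    show "x \<notin> K'" using K'(2) \<zeta>(3) x by blast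
  qed
qed

lemma axis_Basis: "axis i 1 \<in> (Basis :: (real^'n) set)"
  by (simp add: axis_in_Basis_iff)

lemma \<zeta>_measurable [measurable]: "\<zeta> \<in> borel_measurable borel"
    "partial_deriv (axis i 1) \<zeta> \<in> borel_measurable borel"
  using Cc_infinityD(4)[OF \<zeta>(1)] Cc_infinityD(4)[OF Cc_infinity_partial[OF \<zeta>(1) axis_Basis]] by auto

definition H :: "real \<Rightarrow> real" where "H c = \<nu> powr c + (M + \<nu>) powr c"

lemma H_bound: "0 \<le> y \<Longrightarrow> y \<le> M \<Longrightarrow> (y + \<nu>) powr c \<le> H c" and H_nonneg: "0 \<le> H c"
  unfolding H_def using \<nu> by (auto intro!: powr_le_sum_endpoints)

lemma \<zeta>_bounded: obtains C where "0 \<le> C" "\<And>x. \<zeta> x \<le> C" "\<And>i x. \<bar>partial_deriv (axis i 1) \<zeta> x\<bar> \<le> C"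
proof -
  obtain L where L: "0 \<le> L" "\<And>x h. \<bar>frechet_derivative \<zeta> (at x) h\<bar> \<le> L * norm h"
    using Cc_infinity_lipschitz[OF \<zeta>(1)] by metis
  obtain C where C: "0 \<le> C" "\<And>x. \<bar>\<zeta> x\<bar> \<le> C" using Cc_infinity_bounded[OF \<zeta>(1)] by metis
  have "\<zeta> x \<le> C + L" for x using abs_le_D1[OF C(2)[of x]] L(1) by linarith
  moreover have "\<bar>partial_deriv (axis i 1) \<zeta> x\<bar> \<le> C + L" for i x
    using L(2)[of x "axis i 1"] C(1) by simp
  ultimately show ?thesis using that[of "C + L"] C(1) L(1) by simp
qed

lemma \<phi>_facts:
  shows \<phi>_measurable: "\<phi> \<in> borel_measurable borel" and \<phi>_nonneg: "0 \<le> \<phi> z"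
    and \<phi>_outside: "fst z \<notin> K \<Longrightarrow> \<phi> z = 0"
proof -
  have [measurable]: "U \<in> borel_measurable borel" "(\<lambda>z::(real^'n) \<times> real. \<zeta> (fst z)) \<in> borel_measurable borel"
    using U(1) borel_measurable_fst[OF \<zeta>_measurable(1)] by auto
  show "\<phi> \<in> borel_measurable borel" unfolding \<phi>_def[abs_def] by measurable
  show "0 \<le> \<phi> z" unfolding \<phi>_def using \<zeta>(2) by simp
  show "fst z \<notin> K \<Longrightarrow> \<phi> z = 0" by (simp add: \<phi>_def \<zeta>_outside)
qed

lemma \<phi>_bounded: obtains C where "0 \<le> C" "\<And>z. \<bar>\<phi> z\<bar> \<le> C"
proof -
  obtain C where C: "0 \<le> C" "\<And>x. \<zeta> x \<le> C" using \<zeta>_bounded by metis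
  have "\<bar>\<phi> z\<bar> \<le> H (r - 1) * C" for z
    using \<phi>_nonneg[of z] H_bound[OF U(2,3), of z "r - 1"] C \<zeta>(2) H_nonneg
    by (simp add: \<phi>_def mult_mono)
  then show ?thesis using that[of "H (r - 1) * C"] C(1) H_nonneg by simp
qed

lemma d_facts:
  shows d_measurable: "d i \<in> borel_measurable borel" and d_outside: "fst z \<notin> K \<Longrightarrow> d i z = 0"
proof -
  have [measurable]: "U \<in> borel_measurable borel" "(\<lambda>z::(real^'n) \<times> real. \<zeta> (fst z)) \<in> borel_measurable borel"
    "(\<lambda>z. V z $ i) \<in> borel_measurable borel"
    "(\<lambda>z::(real^'n) \<times> real. partial_deriv (axis i 1) \<zeta> (fst z)) \<in> borel_measurable borel"
    using U(1) V(1) borel_measurable_fst[OF \<zeta>_measurable(1)] borel_measurable_fst[OF \<zeta>_measurable(2)] by auto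
  show "d i \<in> borel_measurable borel" unfolding d_def[abs_def] by measurable
  show "fst z \<notin> K \<Longrightarrow> d i z = 0" by (simp add: d_def \<zeta>_outside)
qed

lemma d_bound: obtains C where "0 \<le> C" "\<And>i z. \<bar>d i z\<bar> \<le> C * (\<bar>V z $ i\<bar> + 1)"
proof -
  obtain C where C: "0 \<le> C" "\<And>x. \<zeta> x \<le> C" "\<And>i x. \<bar>partial_deriv (axis i 1) \<zeta> x\<bar> \<le> C" using \<zeta>_bounded by metis
  let ?C = "(r - 1) * H (r - 1 - 1) * C + H (r - 1) * C"
  have "\<bar>d i z\<bar> \<le> ?C * (\<bar>V z $ i\<bar> + 1)" for i z
  proof -
    have "\<bar>d i z\<bar> \<le> \<bar>(r - 1) * (U z + \<nu>) powr (r - 1 - 1) * V z $ i * \<zeta> (fst z)\<bar> +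
      \<bar>(U z + \<nu>) powr (r - 1) * partial_deriv (axis i 1) \<zeta> (fst z)\<bar>" unfolding d_def by (rule abs_triangle_ineq)
    also have "\<dots> \<le> (r - 1) * H (r - 1 - 1) * \<bar>V z $ i\<bar> * C + H (r - 1) * C"
      unfolding abs_mult using r \<zeta>(2)[of "fst z"] C H_nonneg H_bound[OF U(2,3)]
      by (intro add_mono mult_mono) auto
    also have "\<dots> \<le> ?C * (\<bar>V z $ i\<bar> + 1)"
      using r C(1) H_nonneg by (simp add: distrib_left distrib_right mult_ac)
    finally show ?thesis .
  qed
  moreover have "0 \<le> ?C" using r C(1) H_nonneg by simp
  ultimately show ?thesis using that by blast
qed

lemma d_powr_bound: obtains C where "0 \<le> C"
  "\<And>i z. \<bar>d i z\<bar> powr p i \<le> C * (\<bar>V z $ i\<bar> powr p i + 1)"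
proof -
  obtain C where C: "0 \<le> C" "\<And>i z. \<bar>d i z\<bar> \<le> C * (\<bar>V z $ i\<bar> + 1)" using d_bound by metis
  \<comment> \<open>The base \<open>2 * (C + 1)\<close> is at least 1 and \<open>p i < 2\<close>, so
    raising the exponent to 2 gives a constant that is the same for all \<open>i\<close>.\<close>
  define C' where "C' = (2 * (C + 1))\<^sup>2"
  have "\<bar>d i z\<bar> powr p i \<le> C' * (\<bar>V z $ i\<bar> powr p i + 1)" for i z
  proof -
    define v where "v = \<bar>V z $ i\<bar>"
    have v: "0 \<le> v" by (simp add: v_def)
    have "\<bar>d i z\<bar> \<le> (2 * (C + 1)) * max v 1"
    proof -
      have "C * (v + 1) \<le> C * (2 * max v 1)" using C(1) by (intro mult_left_mono) auto
      also have "\<dots> \<le> (2 * (C + 1)) * max v 1" using v by (simp add: algebra_simps)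
      finally show ?thesis using C(2)[of i z] by (simp add: v_def)
    qed
    then have "\<bar>d i z\<bar> powr p i \<le> ((2 * (C + 1)) * max v 1) powr p i"
      using p(1)[of i] by (intro powr_mono2) auto
    also have "\<dots> = (2 * (C + 1)) powr p i * max v 1 powr p i" by (rule powr_mult)
    also have "\<dots> \<le> C' * (v powr p i + 1)"
    proof (rule mult_mono)
      have "(2 * (C + 1)) powr p i \<le> (2 * (C + 1)) powr 2" using C(1) p(2)[of i] by (intro powr_mono) auto
      then show "(2 * (C + 1)) powr p i \<le> C'" using C(1) by (simp add: C'_def powr_numeral)
      show "max v 1 powr p i \<le> v powr p i + 1" by (auto simp: max_def)
    qed (auto simp: C'_def)
    finally show ?thesis by (simp add: v_def)
  qed
  then show ?thesis using that[of C'] by (simp add: C'_def)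
qed

lemma abs_le_1_powr: "1 < q \<Longrightarrow> \<bar>x::real\<bar> \<le> 1 + \<bar>x\<bar> powr q"
proof (cases "\<bar>x\<bar> \<le> 1")
  case False
  assume "1 < q"
  then have "\<bar>x\<bar> powr 1 \<le> \<bar>x\<bar> powr q" using False by (intro powr_mono) auto
  then show ?thesis using False by simp
qed (simp add: add_increasing2)


lemma indicator_K_integrable: "integrable lborel (\<lambda>x. indicator K x * (c::real))"
  using emeasure_compact_finite[OF K(1)] borel_compact[OF K(1)]
  by (intro integrable_mult_left integrable_real_indicator) auto

section \<open>Integrability and weak derivatives of single slices\<close>

lemma slice_measurable [measurable]:
  "(\<lambda>x. U (x, \<sigma>)) \<in> borel_measurable borel" "(\<lambda>x. V (x, \<sigma>) $ i) \<in> borel_measurable borel"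
  "(\<lambda>x. \<phi> (x, \<sigma>)) \<in> borel_measurable borel" "(\<lambda>x. d i (x, \<sigma>)) \<in> borel_measurable borel"
  using borel_measurable_slice[OF U(1)] borel_measurable_slice[OF V(1)] borel_measurable_slice[OF \<phi>_measurable]
    borel_measurable_slice[OF d_measurable] by auto

lemma slice_integrable_U: "integrable lborel (\<lambda>x. U (x, \<sigma>))"
  by (rule integrable_bounded_compact_support[OF _ K(1), of _ M]) (use U(2-4) in auto)

lemma slice_integrable_\<phi>: "0 < q \<Longrightarrow> integrable lborel (\<lambda>x. \<bar>\<phi> (x, \<sigma>)\<bar> powr q)"
proof -
  assume q: "0 < q"
  obtain C where C: "0 \<le> C" "\<And>z. \<bar>\<phi> z\<bar> \<le> C" using \<phi>_bounded by metis
  show ?thesis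
  proof (rule integrable_bounded_compact_support[OF _ K(1), of _ "C powr q"])
    show "(\<lambda>x. \<bar>\<phi> (x, \<sigma>)\<bar> powr q) \<in> borel_measurable borel" by measurable
    show "\<bar>\<phi> (x, \<sigma>)\<bar> powr q = 0" if "x \<notin> K" for x using \<phi>_outside[of "(x, \<sigma>)"] that by simp
    show "\<bar>\<bar>\<phi> (x, \<sigma>)\<bar> powr q\<bar> \<le> C powr q" for x using C(2)[of "(x, \<sigma>)"] q by (simp add: powr_mono2)
  qed
qed

lemma slice_integrable:
  assumes g: "\<And>i. integrable lborel (\<lambda>x. \<bar>V (x, \<sigma>) $ i\<bar> powr p i)"
  shows "integrable lborel (\<lambda>x. V (x, \<sigma>) $ i)"
    "integrable lborel (\<lambda>x. \<bar>d i (x, \<sigma>)\<bar> powr p i)" "integrable lborel (\<lambda>x. d i (x, \<sigma>))"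
proof -
  show "integrable lborel (\<lambda>x. V (x, \<sigma>) $ i)"
  proof (rule Bochner_Integration.integrable_bound[OF Bochner_Integration.integrable_add[OF indicator_K_integrable[of 1] g[of i]]])
    show "AE x in lborel. norm (V (x, \<sigma>) $ i) \<le> norm (indicator K x * 1 + \<bar>V (x, \<sigma>) $ i\<bar> powr p i)"
    proof (rule AE_I2)
      fix x
      show "norm (V (x, \<sigma>) $ i) \<le> norm (indicator K x * 1 + \<bar>V (x, \<sigma>) $ i\<bar> powr p i)"
      proof (cases "x \<in> K")
        case True
        then show ?thesis using abs_le_1_powr[OF p(1)[of i], of "V (x, \<sigma>) $ i"] by simp
      qed (simp add: V(2))
    qed
  qed measurable
  obtain C where C: "0 \<le> C" "\<And>i z. \<bar>d i z\<bar> powr p i \<le> C * (\<bar>V z $ i\<bar> powr p i + 1)" using d_powr_bound by metis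
  have i1: "integrable lborel (\<lambda>x. C * (\<bar>V (x, \<sigma>) $ i\<bar> powr p i + indicator K x * 1))"
    by (intro integrable_mult_right Bochner_Integration.integrable_add g indicator_K_integrable)
  show i2: "integrable lborel (\<lambda>x. \<bar>d i (x, \<sigma>)\<bar> powr p i)"
  proof (rule Bochner_Integration.integrable_bound[OF i1])
    show "AE x in lborel. norm (\<bar>d i (x, \<sigma>)\<bar> powr p i) \<le> norm (C * (\<bar>V (x, \<sigma>) $ i\<bar> powr p i + indicator K x * 1))"
    proof (rule AE_I2)
      fix x
      show "norm (\<bar>d i (x, \<sigma>)\<bar> powr p i) \<le> norm (C * (\<bar>V (x, \<sigma>) $ i\<bar> powr p i + indicator K x * 1))"
      proof (cases "x \<in> K")
        case True
        then show ?thesis using C(2)[of i "(x, \<sigma>)"] C(1) by simp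
      qed (simp add: d_outside)
    qed
  qed measurable
  show "integrable lborel (\<lambda>x. d i (x, \<sigma>))"
  proof (rule Bochner_Integration.integrable_bound[OF Bochner_Integration.integrable_add[OF indicator_K_integrable[of 1] i2]])
    show "AE x in lborel. norm (d i (x, \<sigma>)) \<le> norm (indicator K x * 1 + \<bar>d i (x, \<sigma>)\<bar> powr p i)"
    proof (rule AE_I2)
      fix x
      show "norm (d i (x, \<sigma>)) \<le> norm (indicator K x * 1 + \<bar>d i (x, \<sigma>)\<bar> powr p i)"
      proof (cases "x \<in> K")
        case True
        then show ?thesis using abs_le_1_powr[OF p(1)[of i], of "d i (x, \<sigma>)"] by simp
      qed (simp add: d_outside)
    qed
  qed measurable
qed

text \<open>The equation for \<open>u\<close> is tested with functions supported in
  \<open>K\<close>, so cutting the representatives off outside \<open>K\<close> creates no boundary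
  terms.\<close>

lemma slice_weak_deriv:
  assumes g: "good \<sigma>" and \<eta>: "Cc_infinity K \<eta>"
  shows "(\<integral>x. U (x, \<sigma>) * partial_deriv (axis i 1) \<eta> x \<partial>lborel) = - (\<integral>x. V (x, \<sigma>) $ i * \<eta> x \<partial>lborel)"
proof -
  have \<eta>\<Omega>: "Cc_infinity \<Omega> \<eta>" using Cc_infinity_mono[OF \<eta> K(2)] .
  have [measurable]: "\<eta> \<in> borel_measurable borel" "partial_deriv (axis i 1) \<eta> \<in> borel_measurable borel"
    using Cc_infinityD(4)[OF \<eta>] Cc_infinityD(4)[OF Cc_infinity_partial[OF \<eta> axis_Basis]] by auto
  have \<eta>0: "\<eta> x = 0" "partial_deriv (axis i 1) \<eta> x = 0" if "x \<notin> K" for x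
  proof -
    obtain K' where K': "compact K'" "K' \<subseteq> K" "\<And>x. x \<notin> K' \<Longrightarrow> \<eta> x = 0" using Cc_infinityE[OF \<eta>] by metis
    have x: "x \<notin> K'" using K'(2) that by blast
    show "\<eta> x = 0" by (rule K'(3)[OF x])
    show "partial_deriv (axis i 1) \<eta> x = 0" by (rule partial_deriv_eq_0[OF compact_imp_closed[OF K'(1)] K'(3) x])
  qed
  have eq: "AE x in lborel. x \<in> K \<longrightarrow> U (x, \<sigma>) = u (x, \<sigma>) \<and> V (x, \<sigma>) = Du (x, \<sigma>)"
    using g by (simp add: good_def)
  have "has_weak_deriv \<Omega> (axis i 1) (\<lambda>x. u (x, \<sigma>)) (\<lambda>x. Du (x, \<sigma>) $ i)"
    using g by (simp add: good_def W11_loc_def)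
  then have "(LINT x:\<Omega>|lebesgue. u (x, \<sigma>) * partial_deriv (axis i 1) \<eta> x) = - (LINT x:\<Omega>|lebesgue. Du (x, \<sigma>) $ i * \<eta> x)"
    using \<eta>\<Omega> unfolding has_weak_deriv_def by blast
  moreover have "(LINT x:\<Omega>|lebesgue. u (x, \<sigma>) * partial_deriv (axis i 1) \<eta> x) = (\<integral>x. U (x, \<sigma>) * partial_deriv (axis i 1) \<eta> x \<partial>lborel)"
    unfolding set_lebesgue_integral_def
  proof (rule integral_lebesgue_AE_lborel)
    show "AE x in lborel. indicator \<Omega> x *\<^sub>R (u (x, \<sigma>) * partial_deriv (axis i 1) \<eta> x) = U (x, \<sigma>) * partial_deriv (axis i 1) \<eta> x"
      using eq
    proof eventually_elim
      case (elim x)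
      show ?case using elim \<eta>0[of x] K(2) by (cases "x \<in> K") (auto simp: subset_iff)
    qed
  qed measurable
  moreover have "(LINT x:\<Omega>|lebesgue. Du (x, \<sigma>) $ i * \<eta> x) = (\<integral>x. V (x, \<sigma>) $ i * \<eta> x \<partial>lborel)"
    unfolding set_lebesgue_integral_def
  proof (rule integral_lebesgue_AE_lborel)
    show "AE x in lborel. indicator \<Omega> x *\<^sub>R (Du (x, \<sigma>) $ i * \<eta> x) = V (x, \<sigma>) $ i * \<eta> x"
      using eq
    proof eventually_elim
      case (elim x)
      show ?case using elim \<eta>0[of x] K(2) by (cases "x \<in> K") (auto simp: subset_iff)
    qed
  qed measurable
  ultimately show ?thesis by simp
qed

lemma slice_W11_o:
  assumes g: "good \<sigma>"
  shows "W11_o \<Omega> (\<lambda>x. \<phi> (x, \<sigma>)) (\<lambda>x. \<chi> i. d i (x, \<sigma>))"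
proof -
  have i: "integrable lborel (\<lambda>x. V (x, \<sigma>) $ i)" for i
    by (rule slice_integrable(1)) (use g in \<open>simp add: good_def\<close>)
  have "K0 \<subseteq> \<Omega>" using \<zeta>(3) K(2) by blast
  from W11_o_powr_cutoff[OF \<Omega> slice_integrable_U U(2,3) i slice_weak_deriv[OF g] \<zeta>(1) this \<delta> \<nu>, of "r - 1"]
  show ?thesis by (simp add: \<phi>_def d_def)
qed

lemma cylinder_sets: "cylinder \<Omega> T \<in> sets lebesgue"
proof -
  have "cylinder \<Omega> T \<in> sets (borel \<Otimes>\<^sub>M borel)" using \<Omega> by (intro pair_measureI) auto
  then show ?thesis by (intro sets_completionI_sets) (simp only: borel_prod sets_lborel)
qed

text \<open>Freezing pays off here: a function that does not depend on time is invariant in the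
  direction \<open>(0, 1)\<close>, so its weak time derivative is 0 and continuity in time is
  trivial. No regularity of \<open>u\<close> in time is used beyond the slice itself.\<close>

lemma test_function_frozen:
  assumes g: "good \<sigma>"
  shows "test_function \<Omega> T p K (\<lambda>z. \<phi> (fst z, \<sigma>)) (\<lambda>z. \<chi> i. d i (fst z, \<sigma>)) (\<lambda>z. 0)"
proof -
  let ?f = "\<lambda>x. \<phi> (x, \<sigma>)"
  have gi: "integrable lborel (\<lambda>x. \<bar>V (x, \<sigma>) $ i\<bar> powr p i)" for i using g by (simp add: good_def)
  have cyl: "S \<in> sets lebesgue \<Longrightarrow> S \<subseteq> cylinder \<Omega> T \<Longrightarrow> Lq q S (\<lambda>z. h (fst z))"
    if "h \<in> borel_measurable borel" "integrable lborel (\<lambda>x. \<bar>h x\<bar> powr q)" for h :: "real^'n \<Rightarrow> real" and q S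
    by (rule Lq_time_constant[OF _ _ that]) auto
  have loc: "Lq_loc q (cylinder \<Omega> T) (\<lambda>z. h (fst z))"
    if "h \<in> borel_measurable borel" "integrable lborel (\<lambda>x. \<bar>h x\<bar> powr q)" for h :: "real^'n \<Rightarrow> real" and q
    unfolding Lq_loc_def using cyl[OF that] compact_sets_lebesgue by blast
  have zero: "Lq_loc q S (\<lambda>z. 0)" for q and S :: "((real^'n) \<times> real) set" by (rule Lq_locI) auto
  have 1: "has_weak_deriv (\<Omega> \<times> {0<..<T}) (0, 1) (\<lambda>z. ?f (fst z)) (\<lambda>z. 0)"
    unfolding has_weak_deriv_def
  proof (intro conjI allI impI zero)
    have "Lq_loc 1 (cylinder \<Omega> T) (\<lambda>z. ?f (fst z))" by (rule loc[OF _ slice_integrable_\<phi>]) auto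
    then show "Lq_loc 1 (\<Omega> \<times> {0<..<T}) (\<lambda>z. ?f (fst z))" unfolding Lq_loc_def by fastforce
    fix \<eta> :: "(real^'n) \<times> real \<Rightarrow> real" assume \<eta>: "Cc_infinity (\<Omega> \<times> {0<..<T}) \<eta>"
    have B: "(0, 1) \<in> (Basis :: ((real^'n) \<times> real) set)" by (simp add: Basis_prod_def)
    obtain K' where K': "compact K'" "K' \<subseteq> \<Omega> \<times> {0<..<T}" "\<And>x. x \<notin> K' \<Longrightarrow> \<eta> x = 0" using Cc_infinityE[OF \<eta>] by metis
    have [measurable]: "partial_deriv (0, 1) \<eta> \<in> borel_measurable borel"
      using Cc_infinityD(4)[OF Cc_infinity_partial[OF \<eta> B]] .
    have fm: "(\<lambda>z. ?f (fst z)) \<in> borel_measurable (borel :: ((real^'n) \<times> real) measure)"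
      by (rule borel_measurable_fst) measurable
    have "(LINT z:\<Omega> \<times> {0<..<T}|lebesgue. ?f (fst z) * partial_deriv (0, 1) \<eta> z) = (\<integral>z. ?f (fst z) * partial_deriv (0, 1) \<eta> z \<partial>lborel)"
    proof (rule set_integral_lebesgue_eq_lborel)
      show "(\<lambda>z. ?f (fst z) * partial_deriv (0, 1) \<eta> z) \<in> borel_measurable borel" using fm by measurable
      fix z assume z: "z \<notin> \<Omega> \<times> {0<..<T}"
      have "z \<notin> K'" using K'(2) z by blast
      from partial_deriv_eq_0[OF compact_imp_closed[OF K'(1)] K'(3) this]
      show "?f (fst z) * partial_deriv (0, 1) \<eta> z = 0" by simp
    qed
    also have "\<dots> = 0"
    proof (rule integral_partial_deriv_eq_0[OF \<eta> B])
      obtain C where C: "0 \<le> C" "\<And>z. \<bar>\<phi> z\<bar> \<le> C" using \<phi>_bounded by metis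
      show "integrable lborel (\<lambda>z::(real^'n) \<times> real. indicator (cball 0 R) z * ?f (fst z))" for R
      proof (rule integrable_bounded_compact_support[OF _ compact_cball, of _ 0 R C])
        show "(\<lambda>z::(real^'n) \<times> real. indicator (cball 0 R) z * ?f (fst z)) \<in> borel_measurable borel"
          using fm by (intro borel_measurable_times borel_measurable_indicator) auto
      qed (use C in \<open>auto simp: indicator_def\<close>)
      show "?f (fst (z + h *\<^sub>R (0, 1))) = ?f (fst z)" for z :: "(real^'n) \<times> real" and h by simp
    qed
    finally show "(LINT z:\<Omega> \<times> {0<..<T}|lebesgue. ?f (fst z) * partial_deriv (0, 1) \<eta> z) =
       - (LINT z:\<Omega> \<times> {0<..<T}|lebesgue. 0 * \<eta> z)" by simp
  qed
  have 2: "C_L2loc \<Omega> T (\<lambda>z. ?f (fst z))"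
    unfolding C_L2loc_def
    using Lq_locI[OF slice_measurable(3) slice_integrable_\<phi>, of 2 \<Omega>] by simp
  have 3: "Lp_W1p_o \<Omega> T p (\<lambda>z. ?f (fst z)) (\<lambda>z. \<chi> i. d i (fst z, \<sigma>))"
    unfolding Lp_W1p_o_def
  proof (intro conjI allI)
    show "Lq 1 (cylinder \<Omega> T) (\<lambda>z. ?f (fst z))"
      by (rule cyl[OF _ slice_integrable_\<phi> cylinder_sets]) auto
    show "Lq 1 (cylinder \<Omega> T) (\<lambda>z. (\<chi> i. d i (fst z, \<sigma>)) $ i)" for i
    proof -
      have "integrable lborel (\<lambda>x. \<bar>d i (x, \<sigma>)\<bar> powr 1)" using slice_integrable(3)[OF gi] by simp
      from cyl[OF slice_measurable(4) this cylinder_sets] show ?thesis by simp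
    qed
    show "AE t\<in>{0..T} in lebesgue. W11_o \<Omega> (\<lambda>x. ?f (fst (x, t))) (\<lambda>x. \<chi> i. d i (fst (x, t), \<sigma>))"
      using slice_W11_o[OF g] by simp
    show "Lq_loc (p i) (cylinder \<Omega> T) (\<lambda>z. (\<chi> i. d i (fst z, \<sigma>)) $ i)" for i
      using loc[OF slice_measurable(4) slice_integrable(2)[OF gi]] by simp
  qed
  show ?thesis
    unfolding test_function_def W12_L2_loc_def
    using 1 2 3 zero loc[OF slice_measurable(3) slice_integrable_\<phi>, of 2]
    by (auto simp: \<phi>_nonneg \<phi>_outside)
qed

end

section \<open>The energy inequality\<close>

context cutoff_energy
begin

lemma sliced_w: "good \<sigma> \<Longrightarrow> \<sigma> \<in> {0..T} \<Longrightarrow> AE x in lborel. x \<in> K \<longrightarrow> w \<sigma> x = U (x, \<sigma>)"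
proof -
  assume g: "good \<sigma>" and \<sigma>: "\<sigma> \<in> {0..T}"
  have "AE x in lborel. x \<in> K \<longrightarrow> U (x, \<sigma>) = u (x, \<sigma>) \<and> V (x, \<sigma>) = Du (x, \<sigma>)"
    using g by (simp add: good_def)
  then show ?thesis using w(4)[OF \<sigma>] by eventually_elim auto
qed

lemma \<zeta>_integral_bounded:
  assumes "h \<in> borel_measurable borel" "\<And>x. \<bar>h x\<bar> \<le> c"
  shows "integrable lborel (\<lambda>x. h x * \<zeta> x)"
proof -
  obtain C where C: "0 \<le> C" "\<And>x. \<zeta> x \<le> C" using \<zeta>_bounded by metis
  show ?thesis
  proof (rule integrable_bounded_compact_support[OF _ K(1), of _ "c * C"])
    show "(\<lambda>x. h x * \<zeta> x) \<in> borel_measurable borel" using assms(1) by measurable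
    show "h x * \<zeta> x = 0" if "x \<notin> K" for x using \<zeta>_outside(1)[OF that] by simp
    show "\<bar>h x * \<zeta> x\<bar> \<le> c * C" for x
      unfolding abs_mult using C \<zeta>(2) assms(2)[of x] order_trans[OF abs_ge_zero assms(2)]
      by (intro mult_mono) auto
  qed
qed

lemma G_bounds: "0 \<le> y \<Longrightarrow> y \<le> M \<Longrightarrow> \<bar>(y + \<nu>) powr r / r\<bar> \<le> H r / r"
  using H_bound[of y r] r by (simp add: divide_right_mono)

lemma E_integrable: "t \<in> {0..T} \<Longrightarrow> integrable lborel (\<lambda>x. (w t x + \<nu>) powr r / r * \<zeta> x)"
proof (rule \<zeta>_integral_bounded)
  assume t: "t \<in> {0..T}"
  show "(\<lambda>x. (w t x + \<nu>) powr r / r) \<in> borel_measurable borel" using w(1)[OF t] by measurable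
  show "\<bar>(w t x + \<nu>) powr r / r\<bar> \<le> H r / r" for x by (rule G_bounds[OF w(2,3)])
qed

lemma E_nonneg: "0 \<le> E t"
  unfolding E_def using \<zeta>(2) r by (intro integral_nonneg_AE AE_I2) simp

lemma E_increment:
  assumes g: "good \<sigma>" and \<sigma>: "\<sigma> \<in> {0..T}" and s: "s \<in> {0..T}"
  shows "E \<sigma> - E s \<le> (LINT x:K|lebesgue. u (x, \<sigma>) * \<phi> (x, \<sigma>)) - (LINT x:K|lebesgue. u (x, s) * \<phi> (x, \<sigma>))"
proof -
  have i: "integrable lborel (\<lambda>x. w t x * \<phi> (x, \<sigma>))" if t: "t \<in> {0..T}" for t
  proof -
    have "integrable lborel (\<lambda>x. (w t x * (U (x, \<sigma>) + \<nu>) powr (r - 1)) * \<zeta> x)"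
    proof (rule \<zeta>_integral_bounded)
      show "(\<lambda>x. w t x * (U (x, \<sigma>) + \<nu>) powr (r - 1)) \<in> borel_measurable borel" using w(1)[OF t] by measurable
      show "\<bar>w t x * (U (x, \<sigma>) + \<nu>) powr (r - 1)\<bar> \<le> M * H (r - 1)" for x
        unfolding abs_mult using w(2,3)[of t x] H_bound[OF U(2,3)] order_trans[OF w(2,3)] by (intro mult_mono) auto
    qed
    then show ?thesis by (simp add: \<phi>_def mult.assoc)
  qed
  have eq: "(LINT x:K|lebesgue. u (x, t) * \<phi> (x, \<sigma>)) = (\<integral>x. w t x * \<phi> (x, \<sigma>) \<partial>lborel)" if t: "t \<in> {0..T}" for t
    unfolding set_lebesgue_integral_def
  proof (rule integral_lebesgue_AE_lborel)
    show "(\<lambda>x. w t x * \<phi> (x, \<sigma>)) \<in> borel_measurable borel" using i[OF t] by auto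
    show "AE x in lborel. indicator K x *\<^sub>R (u (x, t) * \<phi> (x, \<sigma>)) = w t x * \<phi> (x, \<sigma>)"
      using w(4)[OF t]
    proof eventually_elim
      case (elim x)
      then show ?case using \<phi>_outside[of "(x, \<sigma>)"] by (cases "x \<in> K") auto
    qed
  qed
  have "E \<sigma> - E s = (\<integral>x. (w \<sigma> x + \<nu>) powr r / r * \<zeta> x - (w s x + \<nu>) powr r / r * \<zeta> x \<partial>lborel)"
    unfolding E_def by (rule Bochner_Integration.integral_diff[symmetric]) (use E_integrable \<sigma> s in blast)+
  also have "\<dots> \<le> (\<integral>x. w \<sigma> x * \<phi> (x, \<sigma>) - w s x * \<phi> (x, \<sigma>) \<partial>lborel)"
  proof (rule integral_mono_AE)
    show "integrable lborel (\<lambda>x. (w \<sigma> x + \<nu>) powr r / r * \<zeta> x - (w s x + \<nu>) powr r / r * \<zeta> x)"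
      by (intro Bochner_Integration.integrable_diff E_integrable \<sigma> s)
    show "integrable lborel (\<lambda>x. w \<sigma> x * \<phi> (x, \<sigma>) - w s x * \<phi> (x, \<sigma>))"
      by (intro Bochner_Integration.integrable_diff i \<sigma> s)
    show "AE x in lborel. (w \<sigma> x + \<nu>) powr r / r * \<zeta> x - (w s x + \<nu>) powr r / r * \<zeta> x
        \<le> w \<sigma> x * \<phi> (x, \<sigma>) - w s x * \<phi> (x, \<sigma>)"
      using sliced_w[OF g \<sigma>]
    proof eventually_elim
      case (elim x)
      show ?case
      proof (cases "x \<in> K")
        case True
        have "(w \<sigma> x + \<nu>) powr r / r - (w s x + \<nu>) powr r / r
           \<le> ((w \<sigma> x + \<nu>) - (w s x + \<nu>)) * (w \<sigma> x + \<nu>) powr (r - 1)"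
          using w(2)[of \<sigma> x] w(2)[of s x] \<nu> r by (intro powr_convex_tangent) auto
        from mult_right_mono[OF this \<zeta>(2)[of x]] show ?thesis
          using elim True by (simp add: \<phi>_def left_diff_distrib algebra_simps)
      qed (simp add: \<zeta>_outside \<phi>_outside)
    qed
  qed
  also have "\<dots> = (\<integral>x. w \<sigma> x * \<phi> (x, \<sigma>) \<partial>lborel) - (\<integral>x. w s x * \<phi> (x, \<sigma>) \<partial>lborel)"
    by (rule Bochner_Integration.integral_diff[OF i[OF \<sigma>] i[OF s]])
  finally show ?thesis unfolding eq[OF \<sigma>] eq[OF s] .
qed

text \<open>The index \<open>None\<close> stands for the source term, \<open>Some i\<close> for the \<open>i\<close>-th component of the flux.\<close>

definition flux :: "'n option \<Rightarrow> (real^'n) \<times> real \<Rightarrow> real" where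
  "flux j z = (case j of None \<Rightarrow> b z | Some i \<Rightarrow> - a z $ i)"

text \<open>The indicator is needed because \<open>U + \<nu>\<close> equals \<nu> outside the time
  interval: without it the test function would be constant in time there and in general not
  integrable.\<close>

definition test :: "'n option \<Rightarrow> (real^'n) \<times> real \<Rightarrow> real" where
  "test j z = indicator {0..T} (snd z) * (case j of None \<Rightarrow> \<phi> z | Some i \<Rightarrow> d i z)"

text \<open>Flux and gradient are paired in conjugate spaces. The source is paired in
  \<open>L2\<close>: its growth exponent satisfies \<open>2 * (p i - 1) < p i\<close>, and \<phi> is
  bounded.\<close>

definition test_exponent :: "'n option \<Rightarrow> real" where
  "test_exponent j = (case j of None \<Rightarrow> 2 | Some i \<Rightarrow> p i)"

definition flux_exponent :: "'n option \<Rightarrow> real" where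
  "flux_exponent j = (case j of None \<Rightarrow> 2 | Some i \<Rightarrow> p i / (p i - 1))"

lemma exponent_facts: "1 < flux_exponent j" "1 < test_exponent j" "1 / flux_exponent j + 1 / test_exponent j = 1"
proof -
  have "1 < flux_exponent j \<and> 1 < test_exponent j \<and> 1 / flux_exponent j + 1 / test_exponent j = 1"
  proof (cases j)
    case (Some i)
    then show ?thesis using p(1)[of i] by (auto simp: test_exponent_def flux_exponent_def field_simps)
  qed (simp add: test_exponent_def flux_exponent_def)
  then show "1 < flux_exponent j" "1 < test_exponent j" "1 / flux_exponent j + 1 / test_exponent j = 1" by auto
qed

lemma flux_facts: "flux j \<in> borel_measurable borel" "integrable lborel (\<lambda>z. \<bar>flux j z\<bar> powr flux_exponent j)"
  using a(1,3) b(1,3) by (cases j; simp add: flux_def[abs_def] flux_exponent_def)+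

lemma sum_option: "(\<Sum>j\<in>(UNIV :: 'n option set). f j) = f None + (\<Sum>i\<in>UNIV. f (Some i) :: real)"
  by (simp add: UNIV_option_conv sum.reindex)

lemma test_measurable: "test j \<in> borel_measurable borel"
proof -
  have i: "(\<lambda>z::(real^'n) \<times> real. indicator {0..T} (snd z) :: real) \<in> borel_measurable borel"
    by (rule borel_measurable_indicator_snd) simp
  show ?thesis
    by (cases j) (use i \<phi>_measurable d_measurable in \<open>auto simp: test_def[abs_def] intro!: borel_measurable_times\<close>)
qed

lemma frozen_term:
  assumes g: "good \<sigma>" and \<sigma>: "\<sigma> \<in> {0..T}" and s: "0 \<le> s"
  shows "integrable lborel (\<lambda>z. indicator {s..\<sigma>} (snd z) * (flux j z * test j (fst z, \<sigma>)))"
proof -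
  have gi: "integrable lborel (\<lambda>x. \<bar>V (x, \<sigma>) $ i\<bar> powr p i)" for i using g by (simp add: good_def)
  have tm: "(\<lambda>x. test j (x, \<sigma>)) \<in> borel_measurable borel" by (rule borel_measurable_slice[OF test_measurable])
  have "integrable lborel (\<lambda>x. \<bar>test j (x, \<sigma>)\<bar> powr test_exponent j)"
    using slice_integrable_\<phi>[of 2 \<sigma>] slice_integrable(2)[OF gi] \<sigma> by (cases j) (auto simp: test_def test_exponent_def)
  from integrable_time_constant[OF this, of T]
  have "integrable lborel (\<lambda>z. \<bar>indicator {0..T} (snd z) * test j (fst z, \<sigma>)\<bar> powr test_exponent j)"
    by (rule Bochner_Integration.integrable_cong[THEN iffD1, rotated 2]) (auto simp: indicator_def)
  moreover have "(\<lambda>z::(real^'n) \<times> real. indicator {0..T} (snd z) * test j (fst z, \<sigma>)) \<in> borel_measurable borel"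
    by (intro borel_measurable_times borel_measurable_indicator_snd borel_measurable_fst tm) simp
  ultimately have "integrable lborel (\<lambda>z. flux j z * (indicator {0..T} (snd z) * test j (fst z, \<sigma>)))"
    by (intro integrable_mult_Lp_Lq[OF exponent_facts(1,2,3)[of j]]) (use flux_facts[of j] in auto)
  then show ?thesis
  proof (rule Bochner_Integration.integrable_bound)
    have "(\<lambda>z. indicator {s..\<sigma>} (snd z) * (flux j z * test j (fst z, \<sigma>))) \<in> borel_measurable borel"
      by (intro borel_measurable_times flux_facts(1) borel_measurable_fst[OF tm] borel_measurable_indicator_snd) simp
    then show "(\<lambda>z. indicator {s..\<sigma>} (snd z) * (flux j z * test j (fst z, \<sigma>))) \<in> borel_measurable lborel" by simp
    show "AE z in lborel. norm (indicator {s..\<sigma>} (snd z) * (flux j z * test j (fst z, \<sigma>))) \<le>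
        norm (flux j z * (indicator {0..T} (snd z) * test j (fst z, \<sigma>)))"
      using \<sigma> s by (intro AE_I2) (auto simp: indicator_def)
  qed
qed

text \<open>The term with the time derivative drops out of the weak formulation, and the boundary
  terms that remain are the ones that dominate the energy increment.\<close>

lemma frozen_inequality:
  assumes g: "good \<sigma>" and \<sigma>: "\<sigma> \<in> {0..T}" and s: "s \<in> {0..\<sigma>}"
  shows "E \<sigma> - E s \<le> (\<Sum>j\<in>UNIV. \<integral>z. indicator {s..\<sigma>} (snd z) * (flux j z * test j (fst z, \<sigma>)) \<partial>lborel)"
proof -
  let ?I = "\<lambda>j. \<integral>z. indicator {s..\<sigma>} (snd z) * (flux j z * test j (fst z, \<sigma>)) \<partial>lborel"
  have s0: "0 \<le> s" and sT: "s \<in> {0..T}" using s \<sigma> by auto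
  note ft = frozen_term[OF g \<sigma> s0]
  have weak: "weak_lhs A K s \<sigma> u Du (\<lambda>z. \<phi> (fst z, \<sigma>)) (\<lambda>z. \<chi> i. d i (fst z, \<sigma>)) (\<lambda>z. 0)
      \<le> weak_rhs B K s \<sigma> u Du (\<lambda>z. \<phi> (fst z, \<sigma>))"
    by (rule sub[OF _ _ _ test_function_frozen[OF g]]) (use s \<sigma> in auto)
  have rhs: "weak_rhs B K s \<sigma> u Du (\<lambda>z. \<phi> (fst z, \<sigma>)) = ?I None"
    unfolding weak_rhs_def set_lebesgue_integral_def
  proof (rule integral_lebesgue_AE_lborel)
    show "(\<lambda>z. indicator {s..\<sigma>} (snd z) * (flux None z * test None (fst z, \<sigma>))) \<in> borel_measurable borel"
      using ft[of None] by auto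
    show "AE z in lborel. indicator (K \<times> {s..\<sigma>}) z *\<^sub>R (B z (u z) (Du z) * \<phi> (fst z, \<sigma>)) =
        indicator {s..\<sigma>} (snd z) * (flux None z * test None (fst z, \<sigma>))"
      using rep
    proof eventually_elim
      case (elim z)
      show ?case
      proof (cases "z \<in> K \<times> {0..T}")
        case True
        then show ?thesis using elim \<sigma> by (auto simp: flux_def test_def indicator_def)
      next
        case False
        then have "z \<notin> K \<times> {s..\<sigma>}" using s \<sigma> by auto
        then show ?thesis using b(2)[OF False] by (simp add: flux_def)
      qed
    qed
  qed
  have lhs: "(LINT z:(K \<times> {s..\<sigma>})|lebesgue. - u z * 0 + (\<Sum>i\<in>UNIV. A z (u z) (Du z) $ i * (\<chi> i. d i (fst z, \<sigma>)) $ i))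
      = (\<integral>z. (\<Sum>i\<in>UNIV. - (indicator {s..\<sigma>} (snd z) * (flux (Some i) z * test (Some i) (fst z, \<sigma>)))) \<partial>lborel)"
    unfolding set_lebesgue_integral_def
  proof (rule integral_lebesgue_AE_lborel)
    show "(\<lambda>z. \<Sum>i\<in>UNIV. - (indicator {s..\<sigma>} (snd z) * (flux (Some i) z * test (Some i) (fst z, \<sigma>)))) \<in> borel_measurable borel"
      using borel_measurable_integrable[OF ft] by (intro borel_measurable_sum borel_measurable_uminus) simp
    show "AE z in lborel. indicator (K \<times> {s..\<sigma>}) z *\<^sub>R (- u z * 0 + (\<Sum>i\<in>UNIV. A z (u z) (Du z) $ i * (\<chi> i. d i (fst z, \<sigma>)) $ i))
       = (\<Sum>i\<in>UNIV. - (indicator {s..\<sigma>} (snd z) * (flux (Some i) z * test (Some i) (fst z, \<sigma>))))"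
      using rep
    proof eventually_elim
      case (elim z)
      show ?case
      proof (cases "z \<in> K \<times> {0..T}")
        case True
        then show ?thesis using elim \<sigma> by (auto simp: flux_def test_def indicator_def)
      next
        case False
        then have "z \<notin> K \<times> {s..\<sigma>}" using s \<sigma> by auto
        then show ?thesis using a(2)[OF False] by (simp add: flux_def)
      qed
    qed
  qed
  also have "\<dots> = (\<Sum>i\<in>UNIV. - ?I (Some i))"
    using ft by (subst Bochner_Integration.integral_sum) auto
  finally have lhs': "weak_lhs A K s \<sigma> u Du (\<lambda>z. \<phi> (fst z, \<sigma>)) (\<lambda>z. \<chi> i. d i (fst z, \<sigma>)) (\<lambda>z. 0) =
    (LINT x:K|lebesgue. u (x, \<sigma>) * \<phi> (x, \<sigma>)) - (LINT x:K|lebesgue. u (x, s) * \<phi> (x, \<sigma>)) + (\<Sum>i\<in>UNIV. - ?I (Some i))"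
    unfolding weak_lhs_def by (simp only: fst_conv)
  show ?thesis using E_increment[OF g \<sigma> sT] weak unfolding lhs' rhs sum_option by (simp add: sum_negf)
qed

lemma test_integrable:
  "integrable lborel (test j)" "integrable lborel (\<lambda>z. \<bar>test j z\<bar> powr test_exponent j)"
proof -
  have cQ: "compact (K \<times> {0..T})" by (intro compact_Times K(1) compact_Icc)
  have Qi: "integrable lborel (\<lambda>z. indicator (K \<times> {0..T}) z * (c::real))" for c
    using emeasure_compact_finite[OF cQ] borel_compact[OF cQ]
    by (intro integrable_mult_left integrable_real_indicator) auto
  show 2: "integrable lborel (\<lambda>z. \<bar>test j z\<bar> powr test_exponent j)"
  proof (cases j)
    case None
    obtain C where C: "0 \<le> C" "\<And>z. \<bar>\<phi> z\<bar> \<le> C" using \<phi>_bounded by metis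
    show ?thesis
    proof (rule integrable_bounded_compact_support[OF _ cQ, of _ "C powr 2"])
      show "(\<lambda>z. \<bar>test j z\<bar> powr test_exponent j) \<in> borel_measurable borel" using test_measurable[of j] by measurable
      show "\<bar>test j z\<bar> powr test_exponent j = 0" if "z \<notin> K \<times> {0..T}" for z
        using that \<phi>_outside[of z] None by (cases z) (auto simp: test_def)
      show "\<bar>\<bar>test j z\<bar> powr test_exponent j\<bar> \<le> C powr 2" for z
      proof -
        have "\<bar>test j z\<bar> \<le> C" using C(1) C(2)[of z] None by (simp add: test_def indicator_def)
        then have "\<bar>test j z\<bar> powr 2 \<le> C powr 2" by (intro powr_mono2) auto
        then show ?thesis using None by (simp add: test_exponent_def)
      qed
    qed
  next
    case (Some i)
    obtain C where C: "0 \<le> C" "\<And>i z. \<bar>d i z\<bar> powr p i \<le> C * (\<bar>V z $ i\<bar> powr p i + 1)" using d_powr_bound by metis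
    have "integrable lborel (\<lambda>z. C * (\<bar>V z $ i\<bar> powr p i + indicator (K \<times> {0..T}) z * 1))"
      by (intro integrable_mult_right Bochner_Integration.integrable_add V(3) Qi)
    then show ?thesis
    proof (rule Bochner_Integration.integrable_bound)
      show "(\<lambda>z. \<bar>test j z\<bar> powr test_exponent j) \<in> borel_measurable lborel" using test_measurable[of j] by measurable
      show "AE z in lborel. norm (\<bar>test j z\<bar> powr test_exponent j) \<le> norm (C * (\<bar>V z $ i\<bar> powr p i + indicator (K \<times> {0..T}) z * 1))"
      proof (rule AE_I2)
        fix z
        show "norm (\<bar>test j z\<bar> powr test_exponent j) \<le> norm (C * (\<bar>V z $ i\<bar> powr p i + indicator (K \<times> {0..T}) z * 1))"
        proof (cases "z \<in> K \<times> {0..T}")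
          case True
          then show ?thesis using C(2)[of i z] C(1) Some by (auto simp: test_def test_exponent_def indicator_def)
        next
          case False
          then have "test j z = 0" using d_outside[of z i] Some by (cases z) (auto simp: test_def)
          then show ?thesis by simp
        qed
      qed
    qed
  qed
  show "integrable lborel (test j)"
  proof (rule Bochner_Integration.integrable_bound[OF Bochner_Integration.integrable_add[OF Qi[of 1] 2]])
    show "test j \<in> borel_measurable lborel" using test_measurable[of j] by simp
    show "AE z in lborel. norm (test j z) \<le> norm (indicator (K \<times> {0..T}) z * 1 + \<bar>test j z\<bar> powr test_exponent j)"
    proof (rule AE_I2)
      fix z
      show "norm (test j z) \<le> norm (indicator (K \<times> {0..T}) z * 1 + \<bar>test j z\<bar> powr test_exponent j)"
      proof (cases "z \<in> K \<times> {0..T}")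
        case True
        then show ?thesis using abs_le_1_powr[OF exponent_facts(2)[of j], of "test j z"] by simp
      next
        case False
        then have "test j z = 0" using d_outside[of z] \<phi>_outside[of z] by (cases z; cases j) (auto simp: test_def)
        then show ?thesis by simp
      qed
    qed
  qed
qed

text \<open>On bounded values the density is Lipschitz, and
  \<open>\<bar>X - Y\<bar> \<le> \<eta> + (X - Y)\<^sup>2 / \<eta>\<close> with a free parameter
  \<eta> reduces the claim to \<open>L2\<close> continuity of the slices, in place of the
  Cauchy-Schwarz inequality.\<close>

lemma E_continuous: "continuous_on {0..T} E"
  unfolding continuous_on_def
proof
  fix t assume t: "t \<in> {0..T}"
  obtain C where C: "0 \<le> C" "\<And>x. \<zeta> x \<le> C" using \<zeta>_bounded by metis
  define c where "c = C * H (r - 1)"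
  have c: "0 \<le> c" using C(1) H_nonneg by (simp add: c_def)
  define k where "k = measure lborel K"
  define I where "I s = (\<integral>x. indicator K x * (w s x - w t x)\<^sup>2 \<partial>lborel)" for s
  have Km: "K \<in> sets borel" using K(1) by (rule borel_compact)
  have est: "\<bar>E s - E t\<bar> \<le> c * (\<eta> * k + I s / \<eta>)" if s: "s \<in> {0..T}" and \<eta>: "0 < \<eta>" for s \<eta>
  proof -
    note [measurable] = w(1)[OF s] w(1)[OF t] Km
    have i: "integrable lborel (\<lambda>x. indicator K x * (w s x - w t x)\<^sup>2)"
    proof (rule integrable_bounded_compact_support[OF _ K(1), of _ "M\<^sup>2"])
      show "\<bar>indicator K x * (w s x - w t x)\<^sup>2\<bar> \<le> M\<^sup>2" for x
      proof -
        have "\<bar>w s x - w t x\<bar> \<le> M" using w(2,3)[of s x] w(2,3)[of t x] by linarith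
        then have "(w s x - w t x)\<^sup>2 \<le> M\<^sup>2" by (metis abs_ge_zero power2_abs power_mono)
        then show ?thesis by (simp add: indicator_def)
      qed
    qed auto
    have ii: "integrable lborel (\<lambda>x. c * (indicator K x * \<eta> + indicator K x * (w s x - w t x)\<^sup>2 / \<eta>))"
      by (intro integrable_mult_right Bochner_Integration.integrable_add indicator_K_integrable integrable_divide i)
    have di: "integrable lborel (\<lambda>x. (w s x + \<nu>) powr r / r * \<zeta> x - (w t x + \<nu>) powr r / r * \<zeta> x)"
      by (intro Bochner_Integration.integrable_diff E_integrable s t)
    have eq: "E s - E t = (\<integral>x. (w s x + \<nu>) powr r / r * \<zeta> x - (w t x + \<nu>) powr r / r * \<zeta> x \<partial>lborel)"
      unfolding E_def by (rule Bochner_Integration.integral_diff[symmetric, OF E_integrable[OF s] E_integrable[OF t]])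
    have "\<bar>E s - E t\<bar> \<le> (\<integral>x. \<bar>(w s x + \<nu>) powr r / r * \<zeta> x - (w t x + \<nu>) powr r / r * \<zeta> x\<bar> \<partial>lborel)"
      unfolding eq by (rule integral_abs_bound)
    also have "\<dots> \<le> (\<integral>x. c * (indicator K x * \<eta> + indicator K x * (w s x - w t x)\<^sup>2 / \<eta>) \<partial>lborel)"
    proof (rule integral_mono[OF integrable_abs[OF di] ii])
      fix x
      show "\<bar>(w s x + \<nu>) powr r / r * \<zeta> x - (w t x + \<nu>) powr r / r * \<zeta> x\<bar> \<le>
          c * (indicator K x * \<eta> + indicator K x * (w s x - w t x)\<^sup>2 / \<eta>)"
      proof (cases "x \<in> K")
        case True
        define X where "X = w s x + \<nu>"
        define Y where "Y = w t x + \<nu>"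
        have XY: "0 \<le> X" "0 \<le> Y" "X powr (r - 1) \<le> H (r - 1)" "Y powr (r - 1) \<le> H (r - 1)"
          using w(2)[of s x] w(2)[of t x] \<nu> H_bound[OF w(2,3), of s x "r - 1"] H_bound[OF w(2,3), of t x "r - 1"]
          by (simp_all add: X_def Y_def)
        \<comment> \<open>The tangent inequality is needed in both orders to control the absolute
          value; \<open>P\<close> and \<open>Q\<close> stand for \<open>X\<close> and
          \<open>Y\<close> in either order.\<close>
        have one: "P powr r / r - Q powr r / r \<le> \<bar>X - Y\<bar> * H (r - 1)"
          if "P = X \<and> Q = Y \<or> P = Y \<and> Q = X" for P Q
        proof -
          have "P powr r / r - Q powr r / r \<le> (P - Q) * P powr (r - 1)"
            using that XY r by (intro powr_convex_tangent) auto
          also have "\<dots> \<le> \<bar>X - Y\<bar> * P powr (r - 1)" using that by (intro mult_right_mono) auto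
          also have "\<dots> \<le> \<bar>X - Y\<bar> * H (r - 1)" using that XY by (intro mult_left_mono) auto
          finally show ?thesis .
        qed
        have G: "\<bar>X powr r / r - Y powr r / r\<bar> \<le> \<bar>X - Y\<bar> * H (r - 1)"
          using one[of X Y] one[of Y X] by (simp add: abs_le_iff)
        have "\<bar>X - Y\<bar> \<le> \<eta> + (X - Y)\<^sup>2 / \<eta>"
        proof (cases "\<bar>X - Y\<bar> \<le> \<eta>")
          case False
          then have "\<bar>X - Y\<bar> * \<eta> \<le> \<bar>X - Y\<bar> * \<bar>X - Y\<bar>" by (intro mult_left_mono) auto
          then have "\<bar>X - Y\<bar> \<le> (X - Y)\<^sup>2 / \<eta>" using \<eta> by (simp add: pos_le_divide_eq power2_eq_square)
          then show ?thesis using \<eta> by simp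
        qed (use \<eta> in \<open>simp add: add_increasing2\<close>)
        then have "\<bar>X - Y\<bar> * H (r - 1) * C \<le> (\<eta> + (X - Y)\<^sup>2 / \<eta>) * H (r - 1) * C"
          using C(1) H_nonneg by (intro mult_right_mono) auto
        moreover have "\<bar>X powr r / r - Y powr r / r\<bar> * \<zeta> x \<le> (\<bar>X - Y\<bar> * H (r - 1)) * C"
          using G \<zeta>(2)[of x] C(2)[of x] H_nonneg by (intro mult_mono) auto
        moreover have "\<bar>X powr r / r * \<zeta> x - Y powr r / r * \<zeta> x\<bar> = \<bar>X powr r / r - Y powr r / r\<bar> * \<zeta> x"
          using \<zeta>(2)[of x] unfolding left_diff_distrib[symmetric] abs_mult by simp
        ultimately have "\<bar>X powr r / r * \<zeta> x - Y powr r / r * \<zeta> x\<bar> \<le> (\<eta> + (X - Y)\<^sup>2 / \<eta>) * H (r - 1) * C"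
          by linarith
        moreover have "X - Y = w s x - w t x" by (simp add: X_def Y_def)
        ultimately show ?thesis using True unfolding X_def Y_def c_def by (simp add: mult_ac)
      qed (simp add: \<zeta>_outside)
    qed
    also have "\<dots> = c * (\<eta> * k + I s / \<eta>)"
      using i indicator_K_integrable[of \<eta>] Km unfolding I_def k_def by simp
    finally show ?thesis .
  qed
  show "(E \<longlongrightarrow> E t) (at t within {0..T})"
  proof (rule tendstoI)
    fix e :: real assume e: "0 < e"
    define \<eta> where "\<eta> = e / (4 * (c * k + 1))"
    have k: "0 \<le> k" by (simp add: k_def)
    have ck: "0 < c * k + 1" using c k by (simp add: add_nonneg_pos)
    have \<eta>: "0 < \<eta>" "c * (\<eta> * k) < e / 2"
    proof -
      show "0 < \<eta>" using e ck by (simp add: \<eta>_def)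
      have "c * (\<eta> * k) = (e / 4) * ((c * k) / (c * k + 1))" by (simp add: \<eta>_def)
      also have "\<dots> \<le> (e / 4) * 1" using e ck by (intro mult_left_mono) (auto simp: field_simps)
      finally show "c * (\<eta> * k) < e / 2" using e by simp
    qed
    have "((\<lambda>s. c * (I s / \<eta>)) \<longlongrightarrow> c * (0 / \<eta>)) (at t within {0..T})"
      using w_cont[OF t] unfolding I_def by (intro tendsto_intros) (use \<eta> in auto)
    then have "\<forall>\<^sub>F s in at t within {0..T}. c * (I s / \<eta>) < e / 2"
      using e by (intro order_tendstoD(2)) auto
    moreover have "\<forall>\<^sub>F s in at t within {0..T}. s \<in> {0..T}" by (simp add: eventually_at_filter)
    ultimately show "\<forall>\<^sub>F s in at t within {0..T}. dist (E s) (E t) < e"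
    proof eventually_elim
      case (elim s)
      have "\<bar>E s - E t\<bar> \<le> c * (\<eta> * k) + c * (I s / \<eta>)" using est[OF elim(2) \<eta>(1)] by (simp only: distrib_left)
      then show ?case using elim(1) \<eta>(2) unfolding dist_real_def by linarith
    qed
  qed
qed

lemma energy_inequality:
  assumes "0 < \<alpha>" "\<alpha> < \<beta>" "\<beta> \<le> T"
  shows "E \<beta> - E \<alpha> \<le> (\<Sum>j\<in>UNIV. \<integral>z. indicator {\<alpha>..\<beta>} (snd z) * (flux j z * test j z) \<partial>lborel)"
proof (rule frozen_energy_inequality[OF finite exponent_facts flux_facts test_integrable E_continuous _ assms])
  show "AE \<sigma> in lborel. \<sigma> \<in> {0..T} \<longrightarrow> (\<forall>s\<in>{0..\<sigma>}. E \<sigma> - E s \<le>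
      (\<Sum>j\<in>UNIV. \<integral>z. indicator {s..\<sigma>} (snd z) * (flux j z * test j (fst z, \<sigma>)) \<partial>lborel))"
    using AE_good
  proof eventually_elim
    case (elim \<sigma>)
    then show ?case using frozen_inequality by blast
  qed
qed

text \<open>The pointwise bound of the flux is stated with \<open>U\<close> on space-time, the
  energy with the slices \<open>w\<close>. They agree at good times, that is at almost every time,
  and Fubini's theorem joins them.\<close>

lemma time_integral_energy:
  assumes \<alpha>\<beta>: "0 \<le> \<alpha>" "\<alpha> \<le> \<beta>" "\<beta> \<le> T" and S: "\<And>\<theta>. \<theta> \<in> {\<alpha>..\<beta>} \<Longrightarrow> E \<theta> \<le> S"
  shows "integrable lborel (\<lambda>z. indicator {\<alpha>..\<beta>} (snd z) * ((U z + \<nu>) powr r / r * \<zeta> (fst z)))"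
    "(\<integral>z. indicator {\<alpha>..\<beta>} (snd z) * ((U z + \<nu>) powr r / r * \<zeta> (fst z)) \<partial>lborel) \<le> (\<beta> - \<alpha>) * S"
proof -
  let ?f = "\<lambda>z. indicator {\<alpha>..\<beta>} (snd z) * ((U z + \<nu>) powr r / r * \<zeta> (fst z))"
  obtain C where C: "0 \<le> C" "\<And>x. \<zeta> x \<le> C" using \<zeta>_bounded by metis
  have Ub: "(U z + \<nu>) powr r / r \<le> H r / r" for z by (rule abs_le_D1[OF G_bounds[OF U(2,3)]])
  have Hr: "0 \<le> H r / r" using H_nonneg r by simp
  show i: "integrable lborel ?f"
  proof (rule integrable_bounded_compact_support[of _ "K \<times> {\<alpha>..\<beta>}" "H r / r * C"])
    have [measurable]: "U \<in> borel_measurable borel" by (rule U(1))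
    have "(\<lambda>z. (U z + \<nu>) powr r / r) \<in> borel_measurable borel" by measurable
    then show "?f \<in> borel_measurable borel"
      by (intro borel_measurable_times borel_measurable_indicator_snd borel_measurable_fst \<zeta>_measurable) auto
    show "compact (K \<times> {\<alpha>..\<beta>})" by (intro compact_Times K(1) compact_Icc)
    show "?f z = 0" if "z \<notin> K \<times> {\<alpha>..\<beta>}" for z using that by (cases z) (auto simp: \<zeta>_outside)
    have "(U z + \<nu>) powr r / r * \<zeta> (fst z) \<le> H r / r * C" for z
      using Ub C \<zeta>(2) Hr by (intro mult_mono) auto
    moreover have "0 \<le> (U z + \<nu>) powr r / r * \<zeta> (fst z)" for z using \<zeta>(2) r by simp
    ultimately have "\<bar>(U z + \<nu>) powr r / r * \<zeta> (fst z)\<bar> \<le> H r / r * C" for z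
      by (metis abs_of_nonneg)
    moreover have "0 \<le> H r / r * C" using Hr C(1) by (rule mult_nonneg_nonneg)
    ultimately show "\<bar>?f z\<bar> \<le> H r / r * C" for z
      unfolding abs_mult[of "indicator {\<alpha>..\<beta>} (snd z)"] by (simp only: indicator_def split: split_of_bool) simp
  qed
  have eqf: "?f = (\<lambda>(x, \<theta>). indicator {\<alpha>..\<beta>} \<theta> * ((U (x, \<theta>) + \<nu>) powr r / r * \<zeta> x))" by auto
  have i': "integrable (lborel \<Otimes>\<^sub>M lborel) (\<lambda>(x, \<theta>). indicator {\<alpha>..\<beta>} \<theta> * ((U (x, \<theta>) + \<nu>) powr r / r * \<zeta> x))"
    using i unfolding eqf by (simp only: lborel_prod)
  have "(\<integral>z. ?f z \<partial>lborel) = (\<integral>\<theta>. (\<integral>x. indicator {\<alpha>..\<beta>} \<theta> * ((U (x, \<theta>) + \<nu>) powr r / r * \<zeta> x) \<partial>lborel) \<partial>lborel)"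
    unfolding eqf using lborel_pair.integral_snd[OF i'] by (simp only: lborel_prod)
  also have "\<dots> \<le> (\<integral>\<theta>. indicator {\<alpha>..\<beta>} \<theta> * S \<partial>lborel)"
  proof (rule integral_mono_AE)
    show "integrable lborel (\<lambda>\<theta>. \<integral>x. indicator {\<alpha>..\<beta>} \<theta> * ((U (x, \<theta>) + \<nu>) powr r / r * \<zeta> x) \<partial>lborel)"
      by (rule lborel_pair.integrable_snd[OF i'])
    show "integrable lborel (\<lambda>\<theta>. indicator {\<alpha>..\<beta>} \<theta> * S)"
      using \<alpha>\<beta> by (intro integrable_mult_left integrable_real_indicator) auto
    show "AE \<theta> in lborel. (\<integral>x. indicator {\<alpha>..\<beta>} \<theta> * ((U (x, \<theta>) + \<nu>) powr r / r * \<zeta> x) \<partial>lborel) \<le> indicator {\<alpha>..\<beta>} \<theta> * S"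
      using AE_good
    proof eventually_elim
      case (elim \<theta>)
      show ?case
      proof (cases "\<theta> \<in> {\<alpha>..\<beta>}")
        case True
        then have \<theta>: "\<theta> \<in> {0..T}" using \<alpha>\<beta> by auto
        note [measurable] = w(1)[OF \<theta>]
        have "(\<integral>x. (U (x, \<theta>) + \<nu>) powr r / r * \<zeta> x \<partial>lborel) = E \<theta>"
          unfolding E_def
        proof (rule integral_cong_AE)
          show "AE x in lborel. (U (x, \<theta>) + \<nu>) powr r / r * \<zeta> x = (w \<theta> x + \<nu>) powr r / r * \<zeta> x"
            using sliced_w[OF elim[rule_format, OF \<theta>] \<theta>]
          proof eventually_elim
            case (elim x)
            then show ?case by (cases "x \<in> K") (auto simp: \<zeta>_outside)
          qed
        qed measurable
        then show ?thesis using True S[OF True] by simp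
      qed simp
    qed
  qed
  also have "\<dots> = (\<beta> - \<alpha>) * S" using \<alpha>\<beta> by simp
  finally show "(\<integral>z. ?f z \<partial>lborel) \<le> (\<beta> - \<alpha>) * S" .
qed

text \<open>The estimate is applied up to the time \<open>m\<close> of maximal energy. There the
  second term of the density integrates to at most half of \<open>E m\<close> and is absorbed on the
  left, which is where the factor 2 comes from.\<close>

lemma energy_bound:
  assumes t: "0 < t" "t \<le> T" and c0: "0 \<le> c0"
    and pt: "AE z in lborel. z \<in> K \<times> {0..t} \<longrightarrow>
      b z * \<phi> z - (\<Sum>i\<in>UNIV. a z $ i * d i z) \<le> c0 + 1 / (2 * t) * ((U z + \<nu>) powr r / r * \<zeta> (fst z))"
    and \<tau>: "\<tau> \<in> {0..t}"
  shows "E \<tau> \<le> 2 * (E 0 + t * c0 * measure lborel K)"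
proof -
  have cE: "continuous_on {0..t} E" by (rule continuous_on_subset[OF E_continuous]) (use t in auto)
  obtain m where m: "m \<in> {0..t}" "\<And>s. s \<in> {0..t} \<Longrightarrow> E s \<le> E m"
    using continuous_attains_sup[OF compact_Icc _ cE] t by (metis atLeastAtMost_iff empty_iff less_imp_le order_refl)
  have k: "0 \<le> t * c0 * measure lborel K" using t c0 by simp
  have Km: "K \<in> sets borel" using K(1) by (rule borel_compact)
  have step: "E m - E \<alpha> \<le> t * c0 * measure lborel K + E m / 2" if \<alpha>: "0 < \<alpha>" "\<alpha> < m" for \<alpha>
  proof -
    have mT: "m \<le> T" using m(1) t by auto
    let ?g = "\<lambda>z. indicator {\<alpha>..m} (snd z) * ((U z + \<nu>) powr r / r * \<zeta> (fst z))"
    let ?k = "\<lambda>z::(real^'n) \<times> real. indicator (K \<times> {\<alpha>..m}) z * c0"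
    have g: "integrable lborel ?g" "(\<integral>z. ?g z \<partial>lborel) \<le> (m - \<alpha>) * E m"
      using time_integral_energy[of \<alpha> m "E m"] \<alpha> m mT by auto
    have cKm: "compact (K \<times> {\<alpha>..m})" by (intro compact_Times K(1) compact_Icc)
    have ki: "integrable lborel ?k"
      using emeasure_compact_finite[OF cKm] borel_compact[OF cKm]
      by (intro integrable_mult_left integrable_real_indicator) auto
    have kint: "(\<integral>z. ?k z \<partial>lborel) = measure lborel K * (m - \<alpha>) * c0"
    proof -
      have "emeasure (lborel :: ((real^'n) \<times> real) measure) (K \<times> {\<alpha>..m}) = emeasure lborel K * emeasure lborel {\<alpha>..m}"
        using Km by (subst lborel_prod[symmetric]) (simp add: lborel.emeasure_pair_measure_Times)
      then have "measure (lborel :: ((real^'n) \<times> real) measure) (K \<times> {\<alpha>..m}) = measure lborel K * (m - \<alpha>)"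
        using \<alpha> by (simp add: measure_def enn2real_mult)
      then show ?thesis using borel_compact[OF cKm] by simp
    qed
    have ji: "integrable lborel (\<lambda>z. indicator {\<alpha>..m} (snd z) * (flux j z * test j z))" for j
    proof -
      have "integrable lborel (\<lambda>z. flux j z * test j z)"
        by (intro integrable_mult_Lp_Lq[OF exponent_facts(1,2,3)[of j]])
          (use flux_facts[of j] test_measurable[of j] test_integrable(2)[of j] in auto)
      then show ?thesis
      proof (rule Bochner_Integration.integrable_bound)
        have "(\<lambda>z. indicator {\<alpha>..m} (snd z) * (flux j z * test j z)) \<in> borel_measurable borel"
          by (intro borel_measurable_times flux_facts(1) test_measurable borel_measurable_indicator_snd) simp
        then show "(\<lambda>z. indicator {\<alpha>..m} (snd z) * (flux j z * test j z)) \<in> borel_measurable lborel" by simp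
      qed (auto simp: indicator_def)
    qed
    have "E m - E \<alpha> \<le> (\<Sum>j\<in>UNIV. \<integral>z. indicator {\<alpha>..m} (snd z) * (flux j z * test j z) \<partial>lborel)"
      by (rule energy_inequality[OF \<alpha> mT])
    also have "\<dots> = (\<integral>z. (\<Sum>j\<in>UNIV. indicator {\<alpha>..m} (snd z) * (flux j z * test j z)) \<partial>lborel)"
      by (rule Bochner_Integration.integral_sum[symmetric]) (rule ji)
    also have "\<dots> \<le> (\<integral>z. ?k z + 1 / (2 * t) * ?g z \<partial>lborel)"
    proof (rule integral_mono_AE)
      show "integrable lborel (\<lambda>z. \<Sum>j\<in>UNIV. indicator {\<alpha>..m} (snd z) * (flux j z * test j z))"
        by (rule Bochner_Integration.integrable_sum) (rule ji)
      show "integrable lborel (\<lambda>z. ?k z + 1 / (2 * t) * ?g z)"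
        by (intro Bochner_Integration.integrable_add ki integrable_mult_right g(1))
      show "AE z in lborel. (\<Sum>j\<in>UNIV. indicator {\<alpha>..m} (snd z) * (flux j z * test j z)) \<le> ?k z + 1 / (2 * t) * ?g z"
        using pt
      proof eventually_elim
        case (elim z)
        show ?case
        proof (cases "z \<in> K \<times> {\<alpha>..m}")
          case True
          then have "z \<in> K \<times> {0..t}" "snd z \<in> {0..T}" "snd z \<in> {\<alpha>..m}" using \<alpha> m(1) t by auto
          then show ?thesis using elim True
            by (simp add: sum_option flux_def test_def sum_negf)
        next
          case False
          show ?thesis
          proof (cases "snd z \<in> {\<alpha>..m}")
            case s: True
            then have "fst z \<notin> K" using False by (cases z) auto
            then show ?thesis using False
              by (simp add: sum_option test_def \<phi>_outside d_outside \<zeta>_outside)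
          qed (use False in simp)
        qed
      qed
    qed
    also have "\<dots> = measure lborel K * (m - \<alpha>) * c0 + 1 / (2 * t) * (\<integral>z. ?g z \<partial>lborel)"
      unfolding kint[symmetric]
      by (subst Bochner_Integration.integral_add[OF ki integrable_mult_right[OF g(1)]])
        (simp only: integral_mult_right_zero)
    also have "\<dots> \<le> t * c0 * measure lborel K + E m / 2"
    proof (rule add_mono)
      have "measure lborel K * c0 * (m - \<alpha>) \<le> measure lborel K * c0 * t"
        using m(1) \<alpha> c0 by (intro mult_left_mono) auto
      then show "measure lborel K * (m - \<alpha>) * c0 \<le> t * c0 * measure lborel K" by (simp add: mult_ac)
      have "1 / (2 * t) * (\<integral>z. ?g z \<partial>lborel) \<le> 1 / (2 * t) * (t * E m)"
      proof (rule mult_left_mono)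
        have "(m - \<alpha>) * E m \<le> t * E m" using m(1) \<alpha> E_nonneg by (intro mult_right_mono) auto
        then show "(\<integral>z. ?g z \<partial>lborel) \<le> t * E m" using g(2) by linarith
      qed (use t in simp)
      then show "1 / (2 * t) * (\<integral>z. ?g z \<partial>lborel) \<le> E m / 2" using t by simp
    qed
    finally show ?thesis .
  qed
  have "E m \<le> 2 * (E 0 + t * c0 * measure lborel K)"
  proof (cases "m = 0")
    case True
    then show ?thesis using k E_nonneg[of 0] by simp
  next
    case False
    then have m0: "0 < m" using m(1) by simp
    \<comment> \<open>The energy inequality starts at positive times, because the lag must stay
      inside the time interval; continuity of \<open>E\<close> moves the initial time to 0.\<close>
    have "E m / 2 - t * c0 * measure lborel K \<le> E 0"
    proof (rule field_le_epsilon)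
      fix e :: real assume e: "0 < e"
      obtain \<epsilon> where \<epsilon>: "0 < \<epsilon>" "\<And>s. s \<in> {0..t} \<Longrightarrow> dist s 0 < \<epsilon> \<Longrightarrow> dist (E s) (E 0) < e"
        using cE t e unfolding continuous_on_iff by (metis atLeastAtMost_iff less_imp_le order_refl)
      define \<alpha> where "\<alpha> = min (m / 2) (\<epsilon> / 2)"
      have \<alpha>: "0 < \<alpha>" "\<alpha> < m" "\<alpha> < \<epsilon>" using m0 \<epsilon>(1) by (auto simp: \<alpha>_def min_def)
      have "dist (E \<alpha>) (E 0) < e" using \<alpha> m(1) by (intro \<epsilon>(2)) (auto simp: dist_real_def)
      then have "E \<alpha> \<le> E 0 + e" by (simp add: dist_real_def abs_less_iff)
      then show "E m / 2 - t * c0 * measure lborel K \<le> E 0 + e" using step[OF \<alpha>(1,2)] by linarith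
    qed
    then show ?thesis by simp
  qed
  then show ?thesis using m(2)[OF \<tau>] by linarith
qed

end

section \<open>Measurable representatives\<close>

lemma lebesgue_borel_representative:
  fixes f :: "'a::euclidean_space \<Rightarrow> real"
  assumes "(\<lambda>x. indicator S x *\<^sub>R f x) \<in> borel_measurable lebesgue" "S \<in> sets borel"
  obtains g where "g \<in> borel_measurable borel" "AE x in lborel. x \<in> S \<longrightarrow> f x = g x" "\<And>x. x \<notin> S \<Longrightarrow> g x = 0"
proof -
  obtain g0 where g0: "g0 \<in> borel_measurable lborel" "AE x in lborel. indicator S x *\<^sub>R f x = g0 x"
    using completion_ex_borel_measurable_real[OF assms(1)] by blast
  show ?thesis
  proof (rule that[of "\<lambda>x. indicator S x * g0 x"])
    show "(\<lambda>x. indicator S x * g0 x) \<in> borel_measurable borel"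
      using g0(1) assms(2) by (intro borel_measurable_times borel_measurable_indicator) auto
    show "AE x in lborel. x \<in> S \<longrightarrow> f x = indicator S x * g0 x"
      using g0(2) by eventually_elim auto
  qed auto
qed

lemma integrable_lebesgue_AE_lborel:
  fixes f g :: "'a::euclidean_space \<Rightarrow> real"
  assumes "integrable lebesgue f" "g \<in> borel_measurable borel" "AE x in lborel. f x = g x"
  shows "integrable lborel g"
proof -
  have gm: "g \<in> borel_measurable lebesgue" by (rule measurable_completion) (use assms(2) in simp)
  have "integrable lebesgue g"
    using integrable_cong_AE[OF borel_measurable_integrable[OF assms(1)] gm AE_completion[OF assms(3)]] assms(1)
    by simp
  then show ?thesis using assms(2) by (subst (asm) integrable_completion) auto
qed

text \<open>For simple arguments the composition is a finite sum of measurable pieces. Continuity in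
  the arguments off the null set \<open>N\<close> carries this to the limit, and completeness of the
  measure disposes of the values on \<open>N\<close>.\<close>

lemma Caratheodory_composition_measurable:
  fixes F :: "'z::euclidean_space \<Rightarrow> real \<Rightarrow> 'x::euclidean_space \<Rightarrow> real"
  assumes Q: "Q \<in> sets borel"
    and Fm: "\<And>s \<xi>. (\<lambda>z. indicator Q z *\<^sub>R F z s \<xi>) \<in> borel_measurable lebesgue"
    and Fc: "AE z in lborel. z \<in> Q \<longrightarrow> continuous_on UNIV (\<lambda>(s, \<xi>). F z s \<xi>)"
    and g: "g \<in> borel_measurable borel" "h \<in> borel_measurable borel"
  shows "(\<lambda>z. indicator Q z *\<^sub>R F z (g z) (h z)) \<in> borel_measurable lebesgue"
proof -
  define W where "W z = (g z, h z)" for z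
  have Wm: "W \<in> borel_measurable borel" unfolding W_def by (intro borel_measurable_Pair g)
  from borel_measurable_implies_sequence_metric[OF this, of undefined] obtain Y where
    "\<forall>n::nat. simple_function borel (Y n)" "\<forall>z\<in>space borel. (\<lambda>n. Y n z) \<longlonglongrightarrow> W z" by blast
  then have Y: "\<And>n::nat. simple_function borel (Y n)" "\<And>z. (\<lambda>n. Y n z) \<longlonglongrightarrow> W z" by simp_all
  define G where "G n z = indicator Q z *\<^sub>R F z (fst (Y n z)) (snd (Y n z))" for n z
  have Gm: "G n \<in> borel_measurable lebesgue" for n
  proof -
    have fin: "finite (range (Y n))" using simple_functionD(1)[OF Y(1)[of n]] by simp
    have eq: "G n = (\<lambda>z. \<Sum>v\<in>range (Y n). indicator (Y n -` {v}) z * (indicator Q z *\<^sub>R F z (fst v) (snd v)))"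
    proof
      fix z
      have "(\<Sum>v\<in>range (Y n). indicator (Y n -` {v}) z * (indicator Q z *\<^sub>R F z (fst v) (snd v))) =
        (\<Sum>v\<in>range (Y n). if v = Y n z then indicator Q z *\<^sub>R F z (fst v) (snd v) else 0)"
        by (intro sum.cong) (auto simp: indicator_def)
      also have "\<dots> = G n z" using fin by (simp add: G_def)
      finally show "G n z = (\<Sum>v\<in>range (Y n). indicator (Y n -` {v}) z * (indicator Q z *\<^sub>R F z (fst v) (snd v)))" by simp
    qed
    have "Y n -` {v} \<in> sets lebesgue" for v
      using simple_functionD(2)[OF Y(1)[of n], of "{v}"] by (intro sets_completionI_sets) simp
    then show ?thesis unfolding eq by (intro borel_measurable_sum borel_measurable_times borel_measurable_indicator Fm)
  qed
  define N where "N = {z. \<not> (z \<in> Q \<longrightarrow> continuous_on UNIV (\<lambda>(s, \<xi>). F z s \<xi>))}"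
  have "AE z in lborel. \<not> (z \<in> N)" using Fc by (simp add: N_def)
  from sets_completion_AE[OF this] have N: "N \<in> sets lebesgue" by (simp add: pred_def)
  let ?f = "\<lambda>z. indicator Q z *\<^sub>R F z (g z) (h z)"
  have m: "(\<lambda>z. indicator (- N) z * ?f z) \<in> borel_measurable lebesgue"
  proof (rule borel_measurable_LIMSEQ_metric)
    have "- N \<in> sets lebesgue" using sets.compl_sets[OF N] by (simp add: Compl_eq_Diff_UNIV)
    then show "(\<lambda>z. indicator (- N) z * G n z) \<in> borel_measurable lebesgue" for n
      by (intro borel_measurable_times borel_measurable_indicator Gm)
    fix z
    show "(\<lambda>n. indicator (- N) z * G n z) \<longlonglongrightarrow> indicator (- N) z * ?f z"
    proof (cases "z \<in> - N \<and> z \<in> Q")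
      case True
      then have "continuous_on UNIV (\<lambda>(s, \<xi>). F z s \<xi>)" by (simp add: N_def)
      then have "isCont (\<lambda>(s, \<xi>). F z s \<xi>) (W z)"
        by (rule continuous_on_eq_continuous_at[OF open_UNIV, THEN iffD1, rule_format]) simp
      from isCont_tendsto_compose[OF this Y(2)[of z]]
      have "(\<lambda>n. F z (fst (Y n z)) (snd (Y n z))) \<longlonglongrightarrow> F z (g z) (h z)" by (simp add: case_prod_beta W_def)
      then show ?thesis using True by (simp add: G_def)
    next
      case False
      then show ?thesis by (auto simp: G_def)
    qed
  qed
  from completion_ex_borel_measurable_real[OF m] obtain k where
    k: "k \<in> borel_measurable lborel" "AE z in lborel. indicator (- N) z * ?f z = k z" by blast
  have "AE z in lborel. ?f z = k z"
    using k(2) Fc by eventually_elim (auto simp: N_def indicator_def)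
  then show ?thesis using k(1) by (intro borel_measurable_lebesgue_AE[of k]) auto
qed

lemma add_powr_le:
  fixes x y q :: real
  assumes "0 \<le> x" "0 \<le> y" "0 < q"
  shows "(x + y) powr q \<le> 2 powr q * (x powr q + y powr q)"
proof -
  have "(x + y) powr q \<le> (2 * max x y) powr q" using assms by (intro powr_mono2) auto
  also have "\<dots> = 2 powr q * max x y powr q" by (rule powr_mult)
  also have "\<dots> \<le> 2 powr q * (x powr q + y powr q)" by (intro mult_left_mono) (auto simp: max_def)
  finally show ?thesis .
qed

text \<open>A punctured limit within the time interval only sees times different from
  \<open>t\<close>, so such times with the almost sure property must exist arbitrarily close to
  every \<open>t\<close>, the end points included.\<close>

lemma AE_accumulation:
  fixes T t e :: real
  assumes "AE s in lborel. s \<in> {0..T} \<longrightarrow> P s" "t \<in> {0..T}" "0 < T" "0 < e"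
  obtains s where "s \<in> {0..T}" "s \<noteq> t" "\<bar>s - t\<bar> < e" "P s"
proof -
  \<comment> \<open>A right neighbourhood of \<open>t\<close> if there is room, otherwise a left
    one: in either case a nondegenerate interval in \<open>[0, T]\<close> that avoids
    \<open>t\<close> and has positive measure.\<close>
  define l where "l = (if t < T then t else max (t - e) 0)"
  define h where "h = (if t < T then min (t + e) T else t)"
  have lh: "l < h" using assms by (auto simp: l_def h_def)
  have sub: "s \<in> {0..T} \<and> s \<noteq> t \<and> \<bar>s - t\<bar> < e" if "s \<in> {l<..<h}" for s
    using that assms(2) by (auto simp: l_def h_def split: if_splits)
  have "\<exists>s. s \<in> {l<..<h} \<and> P s"
  proof (rule ccontr)
    assume no: "\<nexists>s. s \<in> {l<..<h} \<and> P s"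
    have ae: "AE s in lborel. s \<notin> {l<..<h}"
      using assms(1)
    proof eventually_elim
      case (elim s)
      then show ?case using no sub[of s] by blast
    qed
    have eq: "{s \<in> space lborel. \<not> s \<notin> {l<..<h}} = {l<..<h}" by auto
    have "{l<..<h} \<in> sets lborel" by simp
    from iffD1[OF AE_iff_measurable[OF this eq] ae] have "emeasure lborel {l<..<h} = 0" .
    then show False using lh by simp
  qed
  then show ?thesis using that sub by blast
qed

text \<open>The bounds pass from almost every time slice to every one because the distance of \<open>u(t)\<close> to the
  interval \<open>[0,M]\<close> is at most its distance to the slices that satisfy the bounds.\<close>

lemma bounded_slices:
  fixes u :: "(real^'n) \<times> real \<Rightarrow> real"
  assumes K: "compact K" and T: "0 < T" and M: "0 \<le> M"
    and L2: "\<And>t. t \<in> {0..T} \<Longrightarrow> Lq 2 K (\<lambda>x. u (x, t))"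
    and cont: "\<And>t. t \<in> {0..T} \<Longrightarrow>
      ((\<lambda>s. LINT x:K|lebesgue. (u (x, s) - u (x, t))\<^sup>2) \<longlongrightarrow> 0) (at t within {0..T})"
    and bnd: "AE t in lborel. t \<in> {0..T} \<longrightarrow> (AE x in lborel. x \<in> K \<longrightarrow> 0 \<le> u (x, t) \<and> u (x, t) \<le> M)"
  obtains w where "\<And>t. t \<in> {0..T} \<Longrightarrow> w t \<in> borel_measurable borel" "\<And>t x. 0 \<le> w t x" "\<And>t x. w t x \<le> M"
    "\<And>t. t \<in> {0..T} \<Longrightarrow> AE x in lborel. x \<in> K \<longrightarrow> u (x, t) = w t x"
    "\<And>t. t \<in> {0..T} \<Longrightarrow>
      ((\<lambda>s. \<integral>x. indicator K x * (w s x - w t x)\<^sup>2 \<partial>lborel) \<longlongrightarrow> 0) (at t within {0..T})"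
proof -
  have Km: "K \<in> sets borel" using K by (rule borel_compact)
  have "\<forall>t\<in>{0..T}. \<exists>g. g \<in> borel_measurable borel \<and>
      (AE x in lborel. x \<in> K \<longrightarrow> u (x, t) = g x) \<and> (\<forall>x. x \<notin> K \<longrightarrow> g x = 0)"
  proof
    fix t assume t: "t \<in> {0..T}"
    have "(\<lambda>x. indicator K x *\<^sub>R u (x, t)) \<in> borel_measurable lebesgue"
      using L2[OF t] unfolding Lq_def set_borel_measurable_def by blast
    then show "\<exists>g. g \<in> borel_measurable borel \<and>
        (AE x in lborel. x \<in> K \<longrightarrow> u (x, t) = g x) \<and> (\<forall>x. x \<notin> K \<longrightarrow> g x = 0)"
      by (rule lebesgue_borel_representative[OF _ Km]) blast
  qed
  from bchoice[OF this] obtain g where "\<forall>t\<in>{0..T}. g t \<in> borel_measurable borel \<and>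
      (AE x in lborel. x \<in> K \<longrightarrow> u (x, t) = g t x) \<and> (\<forall>x. x \<notin> K \<longrightarrow> g t x = 0)" ..
  then have g: "\<And>t. t \<in> {0..T} \<Longrightarrow> g t \<in> borel_measurable borel"
    "\<And>t. t \<in> {0..T} \<Longrightarrow> AE x in lborel. x \<in> K \<longrightarrow> u (x, t) = g t x"
    "\<And>t x. t \<in> {0..T} \<Longrightarrow> x \<notin> K \<Longrightarrow> g t x = 0" by simp_all
  have g2: "integrable lborel (\<lambda>x. (g t x)\<^sup>2)" if t: "t \<in> {0..T}" for t
  proof (rule integrable_lebesgue_AE_lborel)
    show "integrable lebesgue (\<lambda>x. indicator K x *\<^sub>R \<bar>u (x, t)\<bar> powr 2)"
      using L2[OF t] unfolding Lq_def set_integrable_def by blast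
    show "(\<lambda>x. (g t x)\<^sup>2) \<in> borel_measurable borel" using g(1)[OF t] by measurable
    show "AE x in lborel. indicator K x *\<^sub>R \<bar>u (x, t)\<bar> powr 2 = (g t x)\<^sup>2"
      using g(2)[OF t]
    proof eventually_elim
      case (elim x)
      then show ?case using g(3)[OF t, of x] by (cases "x \<in> K") auto
    qed
  qed
  have gd: "integrable lborel (\<lambda>x. (g s x - g t x)\<^sup>2)" if s: "s \<in> {0..T}" and t: "t \<in> {0..T}" for s t
  proof (rule Bochner_Integration.integrable_bound[OF integrable_mult_right[OF Bochner_Integration.integrable_add[OF g2[OF s] g2[OF t]], of 2]])
    show "(\<lambda>x. (g s x - g t x)\<^sup>2) \<in> borel_measurable lborel" using g(1)[OF s] g(1)[OF t] by measurable
    have "(y - z)\<^sup>2 \<le> 2 * (y\<^sup>2 + z\<^sup>2)" for y z :: real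
      using zero_le_power2[of "y + z"] by (simp add: power2_eq_square algebra_simps)
    then show "AE x in lborel. norm ((g s x - g t x)\<^sup>2) \<le> norm (2 * ((g s x)\<^sup>2 + (g t x)\<^sup>2))" by simp
  qed
  have I: "(LINT x:K|lebesgue. (u (x, s) - u (x, t))\<^sup>2) = (\<integral>x. (g s x - g t x)\<^sup>2 \<partial>lborel)"
    if s: "s \<in> {0..T}" and t: "t \<in> {0..T}" for s t
    unfolding set_lebesgue_integral_def
  proof (rule integral_lebesgue_AE_lborel)
    show "(\<lambda>x. (g s x - g t x)\<^sup>2) \<in> borel_measurable borel" using g(1)[OF s] g(1)[OF t] by measurable
    show "AE x in lborel. indicator K x *\<^sub>R (u (x, s) - u (x, t))\<^sup>2 = (g s x - g t x)\<^sup>2"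
      using g(2)[OF s] g(2)[OF t]
    proof eventually_elim
      case (elim x)
      then show ?case using g(3)[OF t, of x] g(3)[OF s, of x] by (cases "x \<in> K") auto
    qed
  qed
  \<comment> \<open>Clipping is the projection onto \<open>[0, M]\<close>; the value 0 outside the
    time interval makes the bounds unconditional in \<open>t\<close>.\<close>
  define w where "w t x = (if t \<in> {0..T} then max 0 (min M (g t x)) else 0)" for t x
  have gw: "AE x in lborel. g t x = w t x" if t: "t \<in> {0..T}" for t
  proof -
    have wm: "(\<lambda>x. (g t x - w t x)\<^sup>2) \<in> borel_measurable borel"
      using g(1)[OF t] t unfolding w_def by measurable
    have close: "\<bar>g t x - w t x\<bar> \<le> \<bar>g t x\<bar>" for x using M t by (auto simp: w_def max_def min_def)
    have Di: "integrable lborel (\<lambda>x. (g t x - w t x)\<^sup>2)"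
      by (rule Bochner_Integration.integrable_bound[OF g2[OF t]])
        (use wm close in \<open>auto simp: abs_le_square_iff\<close>)
    have "(\<integral>x. (g t x - w t x)\<^sup>2 \<partial>lborel) \<le> 0"
    proof (rule field_le_epsilon)
      fix e :: real assume e: "0 < e"
      have "\<forall>\<^sub>F s in at t within {0..T}. (LINT x:K|lebesgue. (u (x, s) - u (x, t))\<^sup>2) < e"
        using order_tendstoD(2)[OF cont[OF t] e] .
      then obtain \<delta> where \<delta>: "0 < \<delta>" "\<And>s. s \<in> {0..T} \<Longrightarrow> s \<noteq> t \<Longrightarrow> dist s t < \<delta> \<Longrightarrow>
          (LINT x:K|lebesgue. (u (x, s) - u (x, t))\<^sup>2) < e"
        unfolding eventually_at by auto
      obtain s where s: "s \<in> {0..T}" "s \<noteq> t" "\<bar>s - t\<bar> < \<delta>"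
        "AE x in lborel. x \<in> K \<longrightarrow> 0 \<le> u (x, s) \<and> u (x, s) \<le> M"
        by (rule AE_accumulation[OF bnd t T \<delta>(1)]) (rule that)
      have "(\<integral>x. (g t x - w t x)\<^sup>2 \<partial>lborel) \<le> (\<integral>x. (g s x - g t x)\<^sup>2 \<partial>lborel)"
      proof (rule integral_mono_AE[OF Di gd[OF s(1) t]])
        show "AE x in lborel. (g t x - w t x)\<^sup>2 \<le> (g s x - g t x)\<^sup>2"
          using s(4) g(2)[OF s(1)]
        proof eventually_elim
          case (elim x)
          have "0 \<le> g s x \<and> g s x \<le> M"
          proof (cases "x \<in> K")
            case True
            then show ?thesis using elim by simp
          next
            case False
            then show ?thesis using g(3)[OF s(1)] M by simp
          qed
          then have "\<bar>g t x - w t x\<bar> \<le> \<bar>g s x - g t x\<bar>" using t by (auto simp: w_def max_def min_def)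
          then show ?case by (simp add: abs_le_square_iff)
        qed
      qed
      also have "\<dots> < e" using \<delta>(2)[OF s(1,2)] s(3) I[OF s(1) t] by (simp add: dist_real_def)
      finally show "(\<integral>x. (g t x - w t x)\<^sup>2 \<partial>lborel) \<le> 0 + e" by simp
    qed
    moreover have "0 \<le> (\<integral>x. (g t x - w t x)\<^sup>2 \<partial>lborel)" by simp
    ultimately have "(\<integral>x. (g t x - w t x)\<^sup>2 \<partial>lborel) = 0" by linarith
    then have "AE x in lborel. (g t x - w t x)\<^sup>2 = 0"
      by (subst (asm) integral_nonneg_eq_0_iff_AE[OF Di]) auto
    then show ?thesis by eventually_elim simp
  qed
  have wm: "w t \<in> borel_measurable borel" if "t \<in> {0..T}" for t
    using g(1)[OF that] that unfolding w_def[abs_def] by measurable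
  show ?thesis
  proof (rule that[of w])
    show "w t \<in> borel_measurable borel" if "t \<in> {0..T}" for t by (rule wm[OF that])
    show "0 \<le> w t x" "w t x \<le> M" for t x using M by (auto simp: w_def)
    show "AE x in lborel. x \<in> K \<longrightarrow> u (x, t) = w t x" if "t \<in> {0..T}" for t
      using g(2)[OF that] gw[OF that] by eventually_elim auto
    show "((\<lambda>s. \<integral>x. indicator K x * (w s x - w t x)\<^sup>2 \<partial>lborel) \<longlongrightarrow> 0) (at t within {0..T})" if t: "t \<in> {0..T}" for t
    proof (rule Lim_transform_eventually[OF cont[OF t]])
      have "(LINT x:K|lebesgue. (u (x, s) - u (x, t))\<^sup>2) = (\<integral>x. indicator K x * (w s x - w t x)\<^sup>2 \<partial>lborel)"
        if s: "s \<in> {0..T}" for s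
        unfolding I[OF s t]
      proof (rule integral_cong_AE)
        show "(\<lambda>x. (g s x - g t x)\<^sup>2) \<in> borel_measurable lborel" using gd[OF s t] by auto
        have "(\<lambda>x. (w s x - w t x)\<^sup>2) \<in> borel_measurable borel" using wm[OF s] wm[OF t] by measurable
        then show "(\<lambda>x. indicator K x * (w s x - w t x)\<^sup>2) \<in> borel_measurable lborel"
          using Km by (simp add: borel_measurable_times borel_measurable_indicator)
        show "AE x in lborel. (g s x - g t x)\<^sup>2 = indicator K x * (w s x - w t x)\<^sup>2"
          using gw[OF s] gw[OF t]
        proof eventually_elim
          case (elim x)
          then show ?case using g(3)[OF t, of x] g(3)[OF s, of x] by (cases "x \<in> K") auto
        qed
      qed
      then show "\<forall>\<^sub>F s in at t within {0..T}. (LINT x:K|lebesgue. (u (x, s) - u (x, t))\<^sup>2) =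
          (\<integral>x. indicator K x * (w s x - w t x)\<^sup>2 \<partial>lborel)"
        by (simp add: eventually_at_filter)
    qed
  qed
qed

lemma borel_measurable_vec_component:
  fixes f :: "'a \<Rightarrow> real^'n"
  assumes "f \<in> borel_measurable M" shows "(\<lambda>z. f z $ i) \<in> borel_measurable M"
proof -
  have "(\<lambda>z. f z \<bullet> axis i 1) \<in> borel_measurable M" using assms by (intro borel_measurable_inner) auto
  then show ?thesis by (simp add: inner_axis)
qed

lemma borel_measurable_vecI:
  fixes f :: "'a \<Rightarrow> real^'n"
  assumes "\<And>i. (\<lambda>z. f z $ i) \<in> borel_measurable M" shows "f \<in> borel_measurable M"
proof (rule borel_measurable_euclidean_space[THEN iffD2], rule ballI)
  fix c :: "real^'n" assume "c \<in> Basis"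
  then obtain i where "c = axis i 1" by (auto simp: Basis_vec_def)
  then show "(\<lambda>z. f z \<bullet> c) \<in> borel_measurable M" using assms[of i] by (simp add: inner_axis)
qed

text \<open>The data are Lebesgue measurable and satisfy their conditions almost everywhere. Passing
  once to Borel functions that vanish off the compact cylinder gives a setting in which slices,
  products and translations stay measurable.\<close>

lemma solution_representatives:
  fixes \<Omega> :: "(real^'n) set" and p :: "'n \<Rightarrow> real"
  assumes K: "compact K" "K \<subseteq> \<Omega>" and p: "\<And>i. 1 < p i" "\<And>i. p i < 2"
    and C: "0 < C\<^sub>1" "0 \<le> C" and str: "structure_conditions \<Omega> T p C\<^sub>o C\<^sub>1 C A B"
    and spc: "Lp_W1p_loc \<Omega> T p u Du"
    and u0: "AE z\<in>cylinder \<Omega> T in lebesgue. 0 \<le> u z"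
    and M: "0 \<le> M" "AE z\<in>K \<times> {0..T} in lebesgue. \<bar>u z\<bar> \<le> M"
  obtains U V a b where
    "U \<in> borel_measurable borel" "\<And>z. 0 \<le> U z" "\<And>z. U z \<le> M" "\<And>z. z \<notin> K \<times> {0..T} \<Longrightarrow> U z = 0"
    "\<And>i. (\<lambda>z. V z $ i) \<in> borel_measurable borel" "\<And>z. z \<notin> K \<times> {0..T} \<Longrightarrow> V z = 0"
    "\<And>i. integrable lborel (\<lambda>z. \<bar>V z $ i\<bar> powr p i)"
    "\<And>i. (\<lambda>z. a z $ i) \<in> borel_measurable borel" "\<And>z. z \<notin> K \<times> {0..T} \<Longrightarrow> a z = 0"
    "\<And>i. integrable lborel (\<lambda>z. \<bar>a z $ i\<bar> powr (p i / (p i - 1)))"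
    "b \<in> borel_measurable borel" "\<And>z. z \<notin> K \<times> {0..T} \<Longrightarrow> b z = 0" "integrable lborel (\<lambda>z. \<bar>b z\<bar> powr 2)"
    "AE z in lborel. z \<in> K \<times> {0..T} \<longrightarrow>
      U z = u z \<and> V z = Du z \<and> a z = A z (u z) (Du z) \<and> b z = B z (u z) (Du z)"
    "AE z in lborel. z \<in> K \<times> {0..T} \<longrightarrow>
      (\<forall>i. a z $ i * V z $ i \<ge> C\<^sub>o * \<bar>V z $ i\<bar> powr p i - C powr p i) \<and>
      (\<forall>i. \<bar>a z $ i\<bar> \<le> C\<^sub>1 * \<bar>V z $ i\<bar> powr (p i - 1) + C powr (p i - 1)) \<and>
      \<bar>b z\<bar> \<le> (\<Sum>i\<in>UNIV. C * (\<bar>V z $ i\<bar> powr (p i - 1) + C powr (p i - 1)))"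
proof -
  define Q where "Q = K \<times> {0..T}"
  have cQ: "compact Q" unfolding Q_def by (intro compact_Times K(1) compact_Icc)
  have Qm: "Q \<in> sets borel" using cQ by (rule borel_compact)
  have Qcyl: "Q \<subseteq> cylinder \<Omega> T" using K(2) by (auto simp: Q_def)
  have Qi: "integrable lborel (\<lambda>z. indicator Q z * (c::real))" for c
    using emeasure_compact_finite[OF cQ] Qm by (intro integrable_mult_left integrable_real_indicator) auto
  have "Lq 1 Q u" using spc cQ Qcyl unfolding Lp_W1p_loc_def Lq_loc_def by blast
  then have "(\<lambda>z. indicator Q z *\<^sub>R u z) \<in> borel_measurable lebesgue"
    unfolding Lq_def set_borel_measurable_def by blast
  then obtain g where g: "g \<in> borel_measurable borel" "AE z in lborel. z \<in> Q \<longrightarrow> u z = g z" "\<And>z. z \<notin> Q \<Longrightarrow> g z = 0"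
    by (rule lebesgue_borel_representative[OF _ Qm]) (rule that)
  \<comment> \<open>Clipping turns the almost everywhere bounds into bounds at every point.\<close>
  define U where "U z = max 0 (min M (g z))" for z
  have Um: "U \<in> borel_measurable borel" unfolding U_def[abs_def] using g(1) by measurable
  have U0: "U z = 0" if "z \<notin> Q" for z using g(3)[OF that] M(1) by (simp add: U_def)
  have "AE z in lborel. z \<in> cylinder \<Omega> T \<longrightarrow> 0 \<le> u z" using u0 by (simp add: AE_completion_iff)
  moreover have "AE z in lborel. z \<in> Q \<longrightarrow> \<bar>u z\<bar> \<le> M" using M(2) by (simp add: AE_completion_iff Q_def)
  ultimately have Uu: "AE z in lborel. z \<in> Q \<longrightarrow> U z = u z"
    using g(2)
  proof eventually_elim
    case (elim z)
    then show ?case using Qcyl by (auto simp: U_def)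
  qed
  have DuLq: "Lq (p i) Q (\<lambda>z. Du z $ i)" for i
    using spc cQ Qcyl unfolding Lp_W1p_loc_def Lq_loc_def by blast
  have "\<forall>i. \<exists>h. h \<in> borel_measurable borel \<and> (AE z in lborel. z \<in> Q \<longrightarrow> Du z $ i = h z) \<and> (\<forall>z. z \<notin> Q \<longrightarrow> h z = 0)"
  proof
    fix i
    have "(\<lambda>z. indicator Q z *\<^sub>R (Du z $ i)) \<in> borel_measurable lebesgue"
      using DuLq[of i] unfolding Lq_def set_borel_measurable_def by blast
    then show "\<exists>h. h \<in> borel_measurable borel \<and> (AE z in lborel. z \<in> Q \<longrightarrow> Du z $ i = h z) \<and> (\<forall>z. z \<notin> Q \<longrightarrow> h z = 0)"
      by (rule lebesgue_borel_representative[OF _ Qm]) blast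
  qed
  from choice[OF this] obtain h where h: "\<forall>i. h i \<in> borel_measurable borel \<and>
     (AE z in lborel. z \<in> Q \<longrightarrow> Du z $ i = h i z) \<and> (\<forall>z. z \<notin> Q \<longrightarrow> h i z = 0)" ..
  define V where "V z = (\<chi> i. h i z)" for z
  have Vm: "(\<lambda>z. V z $ i) \<in> borel_measurable borel" for i using h by (simp add: V_def)
  have Vm': "V \<in> borel_measurable borel" by (rule borel_measurable_vecI[OF Vm])
  have V0: "V z = 0" if "z \<notin> Q" for z
  proof -
    have "h i z = 0" for i using h that by blast
    then show ?thesis by (simp add: V_def vec_eq_iff)
  qed
  have "AE z in lborel. \<forall>i. z \<in> Q \<longrightarrow> Du z $ i = h i z" unfolding AE_all_countable using h by blast
  then have VDu: "AE z in lborel. z \<in> Q \<longrightarrow> V z = Du z"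
    by eventually_elim (simp add: V_def vec_eq_iff)
  have Vi: "integrable lborel (\<lambda>z. \<bar>V z $ i\<bar> powr p i)" for i
  proof (rule integrable_lebesgue_AE_lborel)
    show "integrable lebesgue (\<lambda>z. indicator Q z *\<^sub>R \<bar>Du z $ i\<bar> powr p i)"
      using DuLq[of i] unfolding Lq_def set_integrable_def by blast
    show "(\<lambda>z. \<bar>V z $ i\<bar> powr p i) \<in> borel_measurable borel" using Vm[of i] by measurable
    show "AE z in lborel. indicator Q z *\<^sub>R \<bar>Du z $ i\<bar> powr p i = \<bar>V z $ i\<bar> powr p i"
      using VDu
    proof eventually_elim
      case (elim z)
      then show ?case using V0[of z] by (cases "z \<in> Q") auto
    qed
  qed
  have car: "Caratheodory (cylinder \<Omega> T) A" "Caratheodory (cylinder \<Omega> T) B"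
    using str unfolding structure_conditions_def by blast+
  have ind: "indicator Q z *\<^sub>R y = indicator Q z *\<^sub>R (indicator (cylinder \<Omega> T) z *\<^sub>R y)" for z and y :: "'c::real_vector"
    using Qcyl by (auto simp: indicator_def)
  have QL: "Q \<in> sets lebesgue" by (rule compact_sets_lebesgue[OF cQ])
  have "\<forall>i. \<exists>k. k \<in> borel_measurable borel \<and> (AE z in lborel. z \<in> Q \<longrightarrow> A z (U z) (V z) $ i = k z) \<and> (\<forall>z. z \<notin> Q \<longrightarrow> k z = 0)"
  proof
    fix i
    have "(\<lambda>z. indicator Q z *\<^sub>R (A z (U z) (V z) $ i)) \<in> borel_measurable lebesgue"
    proof (rule Caratheodory_composition_measurable[OF Qm _ _ Um Vm'])
      fix s \<xi>
      have "(\<lambda>z. indicator (cylinder \<Omega> T) z *\<^sub>R A z s \<xi>) \<in> borel_measurable lebesgue"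
        using car(1) unfolding Caratheodory_def set_borel_measurable_def by blast
      then have "(\<lambda>z. indicator Q z *\<^sub>R (indicator (cylinder \<Omega> T) z *\<^sub>R A z s \<xi>)) \<in> borel_measurable lebesgue"
        by (rule borel_measurable_scaleR[OF borel_measurable_indicator[OF QL]])
      from borel_measurable_vec_component[OF this, of i]
      show "(\<lambda>z. indicator Q z *\<^sub>R (A z s \<xi> $ i)) \<in> borel_measurable lebesgue"
        unfolding ind[symmetric] by simp
      have "AE z in lborel. z \<in> cylinder \<Omega> T \<longrightarrow> continuous_on UNIV (\<lambda>(s, \<xi>). A z s \<xi>)"
        using car(1) unfolding Caratheodory_def AE_completion_iff by blast
      then show "AE z in lborel. z \<in> Q \<longrightarrow> continuous_on UNIV (\<lambda>(s, \<xi>). A z s \<xi> $ i)"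
      proof eventually_elim
        case (elim z)
        show ?case
        proof
          assume "z \<in> Q"
          then have "continuous_on UNIV (\<lambda>(s, \<xi>). A z s \<xi>)" using elim Qcyl by blast
          then have "continuous_on UNIV (\<lambda>y. (case y of (s, \<xi>) \<Rightarrow> A z s \<xi>) $ i)" by (rule continuous_on_component)
          then show "continuous_on UNIV (\<lambda>(s, \<xi>). A z s \<xi> $ i)" by (simp add: case_prod_beta)
        qed
      qed
    qed
    then show "\<exists>k. k \<in> borel_measurable borel \<and> (AE z in lborel. z \<in> Q \<longrightarrow> A z (U z) (V z) $ i = k z) \<and> (\<forall>z. z \<notin> Q \<longrightarrow> k z = 0)"
      by (rule lebesgue_borel_representative[OF _ Qm]) blast
  qed
  from choice[OF this] obtain k where k: "\<forall>i. k i \<in> borel_measurable borel \<and>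
     (AE z in lborel. z \<in> Q \<longrightarrow> A z (U z) (V z) $ i = k i z) \<and> (\<forall>z. z \<notin> Q \<longrightarrow> k i z = 0)" ..
  define a where "a z = (\<chi> i. k i z)" for z
  have am: "(\<lambda>z. a z $ i) \<in> borel_measurable borel" for i using k by (simp add: a_def)
  have a0: "a z = 0" if "z \<notin> Q" for z
  proof -
    have "k i z = 0" for i using k that by blast
    then show ?thesis by (simp add: a_def vec_eq_iff)
  qed
  have "AE z in lborel. \<forall>i. z \<in> Q \<longrightarrow> A z (U z) (V z) $ i = k i z" unfolding AE_all_countable using k by blast
  then have aA: "AE z in lborel. z \<in> Q \<longrightarrow> a z = A z (u z) (Du z)"
    using Uu VDu by eventually_elim (simp add: a_def vec_eq_iff)
  have "(\<lambda>z. indicator Q z *\<^sub>R B z (U z) (V z)) \<in> borel_measurable lebesgue"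
  proof (rule Caratheodory_composition_measurable[OF Qm _ _ Um Vm'])
    fix s \<xi>
    have "(\<lambda>z. indicator (cylinder \<Omega> T) z *\<^sub>R B z s \<xi>) \<in> borel_measurable lebesgue"
      using car(2) unfolding Caratheodory_def set_borel_measurable_def by blast
    then have "(\<lambda>z. indicator Q z *\<^sub>R (indicator (cylinder \<Omega> T) z *\<^sub>R B z s \<xi>)) \<in> borel_measurable lebesgue"
      by (rule borel_measurable_scaleR[OF borel_measurable_indicator[OF QL]])
    then show "(\<lambda>z. indicator Q z *\<^sub>R B z s \<xi>) \<in> borel_measurable lebesgue"
      unfolding ind[symmetric] .
    have "AE z in lborel. z \<in> cylinder \<Omega> T \<longrightarrow> continuous_on UNIV (\<lambda>(s, \<xi>). B z s \<xi>)"
      using car(2) unfolding Caratheodory_def AE_completion_iff by blast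
    then show "AE z in lborel. z \<in> Q \<longrightarrow> continuous_on UNIV (\<lambda>(s, \<xi>). B z s \<xi>)"
      by eventually_elim (use Qcyl in blast)
  qed
  then obtain b where b: "b \<in> borel_measurable borel" "AE z in lborel. z \<in> Q \<longrightarrow> B z (U z) (V z) = b z" "\<And>z. z \<notin> Q \<Longrightarrow> b z = 0"
    by (rule lebesgue_borel_representative[OF _ Qm]) (rule that)
  have bB: "AE z in lborel. z \<in> Q \<longrightarrow> b z = B z (u z) (Du z)"
    using b(2) Uu VDu by eventually_elim simp
  have S0: "AE z in lborel. z \<in> cylinder \<Omega> T \<longrightarrow> (\<forall>s \<xi>.
        (\<forall>i. A z s \<xi> $ i * \<xi> $ i \<ge> C\<^sub>o * \<bar>\<xi> $ i\<bar> powr p i - C powr p i) \<and>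
        (\<forall>i. \<bar>A z s \<xi> $ i\<bar> \<le> C\<^sub>1 * \<bar>\<xi> $ i\<bar> powr (p i - 1) + C powr (p i - 1)) \<and>
        \<bar>B z s \<xi>\<bar> \<le> (\<Sum>i\<in>UNIV. C * (\<bar>\<xi> $ i\<bar> powr (p i - 1) + C powr (p i - 1))))"
    using str unfolding structure_conditions_def AE_completion_iff by blast
  have S: "AE z in lborel. z \<in> Q \<longrightarrow>
      (\<forall>i. a z $ i * V z $ i \<ge> C\<^sub>o * \<bar>V z $ i\<bar> powr p i - C powr p i) \<and>
      (\<forall>i. \<bar>a z $ i\<bar> \<le> C\<^sub>1 * \<bar>V z $ i\<bar> powr (p i - 1) + C powr (p i - 1)) \<and>
      \<bar>b z\<bar> \<le> (\<Sum>i\<in>UNIV. C * (\<bar>V z $ i\<bar> powr (p i - 1) + C powr (p i - 1)))"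
    using S0 aA bB VDu
  proof eventually_elim
    case (elim z)
    show ?case
    proof
      assume z: "z \<in> Q"
      then have "z \<in> cylinder \<Omega> T" using Qcyl by blast
      from elim(1)[rule_format, OF this, of "Du z" "u z"] show "(\<forall>i. a z $ i * V z $ i \<ge> C\<^sub>o * \<bar>V z $ i\<bar> powr p i - C powr p i) \<and>
      (\<forall>i. \<bar>a z $ i\<bar> \<le> C\<^sub>1 * \<bar>V z $ i\<bar> powr (p i - 1) + C powr (p i - 1)) \<and>
      \<bar>b z\<bar> \<le> (\<Sum>i\<in>UNIV. C * (\<bar>V z $ i\<bar> powr (p i - 1) + C powr (p i - 1)))"
        using elim(2-4) z by simp
    qed
  qed
  have ai: "integrable lborel (\<lambda>z. \<bar>a z $ i\<bar> powr (p i / (p i - 1)))" for i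
  proof -
    define q where "q = p i / (p i - 1)"
    \<comment> \<open>The conjugate exponent turns the growth \<open>p i - 1\<close> of the flux
      into \<open>p i\<close>, the integrability of the gradient.\<close>
    have q: "0 < q" "(p i - 1) * q = p i" using p(1)[of i] by (auto simp: q_def)
    have "integrable lborel (\<lambda>z. 2 powr q * (C\<^sub>1 powr q * \<bar>V z $ i\<bar> powr p i + indicator Q z * (C powr p i)))"
      by (intro integrable_mult_right Bochner_Integration.integrable_add Vi Qi)
    then have "integrable lborel (\<lambda>z. \<bar>a z $ i\<bar> powr q)"
    proof (rule Bochner_Integration.integrable_bound)
      show "(\<lambda>z. \<bar>a z $ i\<bar> powr q) \<in> borel_measurable lborel" using am[of i] by measurable
      show "AE z in lborel. norm (\<bar>a z $ i\<bar> powr q) \<le> norm (2 powr q * (C\<^sub>1 powr q * \<bar>V z $ i\<bar> powr p i + indicator Q z * (C powr p i)))"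
        using S
      proof eventually_elim
        case (elim z)
        show ?case
        proof (cases "z \<in> Q")
          case True
          have "\<bar>a z $ i\<bar> powr q \<le> (C\<^sub>1 * \<bar>V z $ i\<bar> powr (p i - 1) + C powr (p i - 1)) powr q"
            using elim True q(1) by (intro powr_mono2) auto
          also have "\<dots> \<le> 2 powr q * ((C\<^sub>1 * \<bar>V z $ i\<bar> powr (p i - 1)) powr q + (C powr (p i - 1)) powr q)"
            using C q(1) by (intro add_powr_le) auto
          also have "\<dots> = 2 powr q * (C\<^sub>1 powr q * \<bar>V z $ i\<bar> powr p i + C powr p i)"
            using q(2) by (simp add: powr_mult powr_powr)
          finally show ?thesis using True by simp
        qed (simp add: a0)
      qed
    qed
    then show ?thesis by (simp add: q_def)
  qed
  have bi: "integrable lborel (\<lambda>z. \<bar>b z\<bar> powr 2)"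
  proof -
    define f where "f i z = C * (\<bar>V z $ i\<bar> powr (p i - 1) + C powr (p i - 1))" for i z
    have "integrable lborel (\<lambda>z. (\<Sum>i\<in>(UNIV::'n set). C\<^sup>2 * (4 * (\<bar>V z $ i\<bar> powr p i + indicator Q z * (1 + (C powr (p i - 1))\<^sup>2)))) * real CARD('n))"
      by (intro integrable_mult_left Bochner_Integration.integrable_sum integrable_mult_right Bochner_Integration.integrable_add Vi Qi)
    then show ?thesis
    proof (rule Bochner_Integration.integrable_bound)
      show "(\<lambda>z. \<bar>b z\<bar> powr 2) \<in> borel_measurable lborel" using b(1) by measurable
      show "AE z in lborel. norm (\<bar>b z\<bar> powr 2) \<le> norm ((\<Sum>i\<in>(UNIV::'n set). C\<^sup>2 * (4 * (\<bar>V z $ i\<bar> powr p i + indicator Q z * (1 + (C powr (p i - 1))\<^sup>2)))) * real CARD('n))"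
        using S
      proof eventually_elim
        case (elim z)
        show ?case
        proof (cases "z \<in> Q")
          case True
          have fi: "(f i z)\<^sup>2 \<le> C\<^sup>2 * (4 * (\<bar>V z $ i\<bar> powr p i + (1 + (C powr (p i - 1))\<^sup>2)))" for i
          proof -
            \<comment> \<open>Here \<open>p i < 2\<close> enters: the squared growth has exponent
              \<open>2 * (p i - 1) < p i\<close>, so \<open>b\<close> is square integrable.\<close>
            have "(\<bar>V z $ i\<bar> powr (p i - 1))\<^sup>2 = \<bar>V z $ i\<bar> powr ((p i - 1) * 2)"
              by (simp add: powr_powr flip: powr_numeral)
            also have "\<dots> \<le> \<bar>V z $ i\<bar> powr p i + 1"
            proof (cases "1 \<le> \<bar>V z $ i\<bar>")
              case True
              then have "\<bar>V z $ i\<bar> powr ((p i - 1) * 2) \<le> \<bar>V z $ i\<bar> powr p i" using p(2)[of i] by (intro powr_mono) auto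
              then show ?thesis by simp
            next
              case False
              then have "\<bar>V z $ i\<bar> powr ((p i - 1) * 2) \<le> 1 powr ((p i - 1) * 2)" using p(1)[of i] by (intro powr_mono2) auto
              then show ?thesis by (simp add: add_increasing)
            qed
            finally have 1: "(\<bar>V z $ i\<bar> powr (p i - 1))\<^sup>2 \<le> \<bar>V z $ i\<bar> powr p i + 1" .
            have 2: "(x + y)\<^sup>2 \<le> 4 * (x\<^sup>2 + y\<^sup>2)" for x y :: real
            proof -
              have "4 * (x\<^sup>2 + y\<^sup>2) - (x + y)\<^sup>2 = (x - y)\<^sup>2 + 2 * (x\<^sup>2 + y\<^sup>2)"
                by (simp add: power2_eq_square algebra_simps)
              moreover have "0 \<le> (x - y)\<^sup>2 + 2 * (x\<^sup>2 + y\<^sup>2)" by simp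
              ultimately show ?thesis by linarith
            qed
            have "(f i z)\<^sup>2 = C\<^sup>2 * (\<bar>V z $ i\<bar> powr (p i - 1) + C powr (p i - 1))\<^sup>2" by (simp add: f_def power_mult_distrib)
            also have "\<dots> \<le> C\<^sup>2 * (4 * ((\<bar>V z $ i\<bar> powr (p i - 1))\<^sup>2 + (C powr (p i - 1))\<^sup>2))"
              by (intro mult_left_mono 2) simp
            also have "\<dots> \<le> C\<^sup>2 * (4 * (\<bar>V z $ i\<bar> powr p i + (1 + (C powr (p i - 1))\<^sup>2)))"
              using 1 by (intro mult_left_mono) auto
            finally show ?thesis .
          qed
          have "\<bar>b z\<bar> \<le> \<bar>\<Sum>i\<in>UNIV. f i z\<bar>" using elim True by (auto simp: f_def)
          then have "\<bar>b z\<bar> powr 2 \<le> (\<Sum>i\<in>UNIV. f i z)\<^sup>2" by (simp add: abs_le_square_iff)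
          also have "\<dots> \<le> (\<Sum>i\<in>UNIV. (f i z)\<^sup>2) * real CARD('n)" by (rule sum_squared_le_sum_of_squares)
          also have "\<dots> \<le> (\<Sum>i\<in>UNIV. C\<^sup>2 * (4 * (\<bar>V z $ i\<bar> powr p i + (1 + (C powr (p i - 1))\<^sup>2)))) * real CARD('n)"
            by (intro mult_right_mono sum_mono fi) simp
          finally show ?thesis using True by simp
        qed (simp add: b(3))
      qed
    qed
  qed
  have R: "AE z in lborel. z \<in> K \<times> {0..T} \<longrightarrow>
      U z = u z \<and> V z = Du z \<and> a z = A z (u z) (Du z) \<and> b z = B z (u z) (Du z)"
    using Uu VDu aA bB unfolding Q_def by eventually_elim simp
  show ?thesis
    by (rule that[OF Um _ _ U0[unfolded Q_def] Vm V0[unfolded Q_def] Vi am a0[unfolded Q_def] ai b(1)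
          b(3)[unfolded Q_def] bi R S[unfolded Q_def]])
      (use M(1) in \<open>simp_all add: U_def\<close>)
qed

section \<open>Algebra of the energy density\<close>

lemma powr_le_add_1: "0 \<le> (x::real) \<Longrightarrow> 0 \<le> e \<Longrightarrow> e \<le> 1 \<Longrightarrow> x powr e \<le> 1 + x"
proof (cases "1 \<le> x")
  case True
  assume "e \<le> 1"
  then have "x powr e \<le> x powr 1" using True by (intro powr_mono) auto
  then show ?thesis using True by simp
next
  case False
  assume "0 \<le> x" "0 \<le> e"
  then have "x powr e \<le> 1 powr e" using False by (intro powr_mono2) auto
  then show ?thesis using \<open>0 \<le> x\<close> by simp
qed

text \<open>Either \<open>c \<le> k * s * \<zeta>\<close>, and the left side is part of the coercive
  term, or \<open>s * \<zeta>\<close> is bounded by \<open>c / k\<close>. In the second case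
  \<open>P - 1 < 1\<close> gives \<open>\<zeta> \<le> \<zeta> powr (P - 1)\<close>, so that only the
  bounded product \<open>s * \<zeta>\<close> enters, at the price of one more power of the
  cutoff.\<close>

lemma gradient_absorption:
  fixes s \<zeta> P c k :: real
  assumes "0 \<le> s" "0 \<le> \<zeta>" "\<zeta> \<le> 1" "1 < P" "P < 2" "0 \<le> c" "0 < k" "2 \<le> m"
  shows "c * s powr (P - 1) * \<zeta> ^ (m - 1) \<le> k * s powr P * \<zeta> ^ m + c * (1 + c / k) * \<zeta> ^ (m - 2)"
proof -
  have m: "\<zeta> ^ m = \<zeta> * \<zeta> ^ (m - 1)" "\<zeta> ^ (m - 1) = \<zeta> * \<zeta> ^ (m - 2)"
    using assms(8) by (auto simp: Suc_diff_Suc numeral_2_eq_2 simp flip: power_Suc)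
  have sP: "s powr P = s * s powr (P - 1)" using assms(1) by (cases "s = 0") (auto simp: powr_mult_base)
  have nn: "0 \<le> k * s powr P * \<zeta> ^ m" "0 \<le> c * (1 + c / k) * \<zeta> ^ (m - 2)" using assms by auto
  show ?thesis
  proof (cases "c \<le> k * s * \<zeta>")
    case True
    then have "c * (s powr (P - 1) * \<zeta> ^ (m - 1)) \<le> (k * s * \<zeta>) * (s powr (P - 1) * \<zeta> ^ (m - 1))"
      using assms(2) by (intro mult_right_mono) auto
    also have "\<dots> = k * s powr P * \<zeta> ^ m" unfolding sP m(1) by (simp add: mult_ac)
    finally show ?thesis using nn(2) by (simp add: mult.assoc)
  next
    case False
    then have sz: "s * \<zeta> \<le> c / k" using assms(7) by (simp add: field_simps)
    have "\<zeta> \<le> \<zeta> powr (P - 1)"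
      using assms(2-5) powr_mono'[of "P - 1" 1 \<zeta>] by (cases "\<zeta> = 0") auto
    then have "s powr (P - 1) * \<zeta> \<le> s powr (P - 1) * \<zeta> powr (P - 1)" by (intro mult_left_mono) auto
    also have "\<dots> = (s * \<zeta>) powr (P - 1)" by (simp add: powr_mult)
    also have "\<dots> \<le> 1 + s * \<zeta>" using assms by (intro powr_le_add_1) auto
    also have "\<dots> \<le> 1 + c / k" using sz by simp
    finally have "(s powr (P - 1) * \<zeta>) * (c * \<zeta> ^ (m - 2)) \<le> (1 + c / k) * (c * \<zeta> ^ (m - 2))"
      using assms by (intro mult_right_mono) auto
    then show ?thesis using nn(1) unfolding m(2) by (simp add: mult_ac)
  qed
qed

text \<open>Young's inequality as a dichotomy. If
  \<open>L \<le> \<epsilon> * v powr e * \<zeta>\<^sup>2\<close>, the left side is absorbed;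
  otherwise \<open>v powr e * \<zeta>\<^sup>2\<close> is at most \<open>L / \<epsilon>\<close>, and
  it is raised to the power \<open>(r - e) / e\<close>. The condition on \<open>m\<close> guarantees
  that \<open>\<zeta> ^ (m - 2)\<close> contains the power of \<zeta> that this consumes.\<close>

lemma power_absorption:
  fixes v \<zeta> e r L \<epsilon> :: real
  assumes "0 < v" "0 \<le> \<zeta>" "\<zeta> \<le> 1" "0 < e" "e < r" "0 < L" "0 < \<epsilon>" "2 + 2 * r / e \<le> real m"
  shows "L * v powr (r - e) * \<zeta> ^ (m - 2) \<le> \<epsilon> * v powr r * \<zeta> ^ m + L * (L / \<epsilon>) powr ((r - e) / e)"
proof -
  have re: "0 < r / e" using assms(4,5) by simp
  then have "0 < 2 * r / e" by simp
  then have "2 < real m" using assms(8) by linarith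
  then have m3: "3 \<le> m" by simp
  have m: "\<zeta> ^ m = \<zeta>\<^sup>2 * \<zeta> ^ (m - 2)" proof -
    have "2 + (m - 2) = m" using m3 by simp
    then show ?thesis by (metis power_add)
  qed
  have vr: "v powr r = v powr e * v powr (r - e)" using assms(1) by (simp flip: powr_add)
  have nn: "0 \<le> \<epsilon> * v powr r * \<zeta> ^ m" "0 \<le> L * (L / \<epsilon>) powr ((r - e) / e)" using assms by auto
  show ?thesis
  proof (cases "L \<le> \<epsilon> * v powr e * \<zeta>\<^sup>2")
    case True
    then have "L * (v powr (r - e) * \<zeta> ^ (m - 2)) \<le> (\<epsilon> * v powr e * \<zeta>\<^sup>2) * (v powr (r - e) * \<zeta> ^ (m - 2))"
      using assms(2) by (intro mult_right_mono) auto
    also have "\<dots> = \<epsilon> * v powr r * \<zeta> ^ m" unfolding vr m by (simp add: mult_ac)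
    finally show ?thesis using nn(2) by (simp add: mult.assoc)
  next
    case False
    show ?thesis
    proof (cases "\<zeta> = 0")
      case True
      then have "\<zeta> ^ (m - 2) = 0" using m3 by (simp add: zero_power)
      then have "L * v powr (r - e) * \<zeta> ^ (m - 2) = 0" by simp
      then show ?thesis using nn by linarith
    next
      case z: False
      then have z0: "0 < \<zeta>" using assms(2) by simp
      have b: "v powr e * \<zeta>\<^sup>2 \<le> L / \<epsilon>" using False assms(7) by (simp add: field_simps)
      let ?q = "(r - e) / e"
      have q: "0 < ?q" using assms(4,5) by simp
      have "\<zeta> ^ (m - 2) = \<zeta> powr real (m - 2)" using z0 by (simp add: powr_realpow)
      also have "\<dots> \<le> \<zeta> powr (2 * ?q)"
      proof (rule powr_mono')
        have "2 * ?q = 2 * r / e - 2" using assms(4) by (simp add: field_simps)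
        then show "2 * ?q \<le> real (m - 2)" using assms(8) m3 by simp
      qed (use z0 assms(3) in auto)
      also have "\<dots> = (\<zeta>\<^sup>2) powr ?q" using z0 by (simp add: powr_powr flip: powr_numeral)
      finally have "v powr (r - e) * \<zeta> ^ (m - 2) \<le> v powr (r - e) * (\<zeta>\<^sup>2) powr ?q" by (intro mult_left_mono) auto
      also have "\<dots> = (v powr e * \<zeta>\<^sup>2) powr ?q" using assms(4) by (simp add: powr_mult powr_powr)
      also have "\<dots> \<le> (L / \<epsilon>) powr ?q" using b q by (intro powr_mono2) auto
      finally have "L * (v powr (r - e) * \<zeta> ^ (m - 2)) \<le> L * (L / \<epsilon>) powr ?q"
        using assms(6) by (intro mult_left_mono) auto
      then show ?thesis using nn(1) by (simp add: mult.assoc)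
    qed
  qed
qed

text \<open>In \<open>c\<close> are collected the coefficients of the lower gradient power, from the
  source and from the derivative of the cutoff; \<open>(r - 1) * C\<^sub>o\<close> is the
  coercivity. Their product term is the residue of \<open>gradient_absorption\<close>, and
  \<open>r + 4 * m\<close> collects the terms without gradient. The growth exponent does not occur,
  so one constant serves all directions.\<close>

definition energy_const :: "real \<Rightarrow> real \<Rightarrow> real \<Rightarrow> nat \<Rightarrow> real" where
  "energy_const C\<^sub>o C\<^sub>1 r m = (let c = 1 + 4 * real m * C\<^sub>1 in
    c * (1 + c / ((r - 1) * C\<^sub>o)) + (r + 4 * real m))"

text \<open>With \<open>s = y R / v\<close> every term is a multiple of \<open>v powr (r + P - 2) * R powr (- P)\<close>.\<close>

lemma energy_density_bound:
  fixes P r C\<^sub>o C\<^sub>1 C R \<nu> v \<zeta> dz :: real and m :: nat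
  assumes P: "1 < P" "P < 2" and r: "1 < r" and C: "0 < C\<^sub>o" "0 < C\<^sub>1" "0 \<le> C"
    and R: "0 < R" "C * R \<le> 1" "C * R \<le> \<nu>" and v: "0 < \<nu>" "\<nu> \<le> v"
    and \<zeta>: "0 \<le> \<zeta>" "\<zeta> \<le> 1" and dz: "\<bar>dz\<bar> \<le> 4 / R" and m: "2 \<le> m"
    and av: "C\<^sub>o * \<bar>y\<bar> powr P - C powr P \<le> ai * y"
    and ai: "\<bar>ai\<bar> \<le> C\<^sub>1 * \<bar>y\<bar> powr (P - 1) + C powr (P - 1)"
  shows "C * (\<bar>y\<bar> powr (P - 1) + C powr (P - 1)) * (v powr (r - 1) * \<zeta> ^ m)
      - ai * ((r - 1) * v powr (r - 1 - 1) * y * \<zeta> ^ m + v powr (r - 1) * (real m * \<zeta> ^ (m - 1) * dz))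
    \<le> energy_const C\<^sub>o C\<^sub>1 r m * (v powr (r + P - 2) * R powr (- P) * \<zeta> ^ (m - 2))"
proof -
  \<comment> \<open>\<open>g\<close> is the natural size of the flux, the value of
    \<open>\<bar>y\<bar> powr (P - 1)\<close> at \<open>s = 1\<close>; \<open>W\<close> is
    \<open>v powr (r + P - 2) * R powr (- P)\<close> in factored form.\<close>
  define g where "g = (v / R) powr (P - 1)"
  define s where "s = \<bar>y\<bar> * R / v"
  define W where "W = v powr (r - 1) * g / R"
  define c where "c = 1 + 4 * real m * C\<^sub>1"
  define k where "k = (r - 1) * C\<^sub>o"
  have v0: "0 < v" using v by simp
  have g0: "0 \<le> g" and s0: "0 \<le> s" and W0: "0 \<le> W" and c0: "0 \<le> c" and k0: "0 < k"
    using v0 R(1) r C by (auto simp: g_def s_def W_def c_def k_def)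
  have yv: "\<bar>y\<bar> = s * (v / R)" using v0 R(1) by (simp add: s_def)
  have gP: "(v / R) powr P = g * (v / R)"
    using v0 R(1) powr_mult_base[of "v / R" "P - 1"] by (simp add: g_def mult.commute)
  have y1: "\<bar>y\<bar> powr (P - 1) = s powr (P - 1) * g" unfolding yv g_def by (rule powr_mult)
  have yP: "\<bar>y\<bar> powr P = s powr P * (g * (v / R))" unfolding yv powr_mult gP ..
  \<comment> \<open>Smallness of \<open>C\<close> is used in two ways: \<open>C \<le> 1 / R\<close>
    for the factor \<open>C\<close> of the source, and \<open>C \<le> v / R\<close>, which rests on
    the shift by \<nu>, for the additive powers of \<open>C\<close>.\<close>
  have CR: "C \<le> 1 / R" "C \<le> v / R" using R v by (auto simp: field_simps)
  have C1: "C powr (P - 1) \<le> g" unfolding g_def using CR(2) C(3) P by (intro powr_mono2) auto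
  have CP: "C powr P \<le> g * (v / R)" unfolding gP[symmetric] using CR(2) C(3) P by (intro powr_mono2) auto
  have vr: "v powr (r - 1) = v powr (r - 1 - 1) * v" using v0 powr_mult_base[of v "r - 1 - 1"] by (simp add: mult.commute)
  have W': "v powr (r - 1 - 1) * (g * (v / R)) = W" unfolding W_def vr by simp
  have Weq: "v powr (r + P - 2) * R powr (- P) = W"
  proof -
    have "v powr (r + P - 2) = v powr (r - 1) * v powr (P - 1)" by (simp flip: powr_add)
    moreover have "R powr (- P) = 1 / (R * R powr (P - 1))"
      using R(1) powr_mult_base[of R "P - 1"] by (simp add: powr_minus_divide)
    ultimately show ?thesis by (simp add: W_def g_def powr_divide mult.commute)
  qed
  have z: "\<zeta> ^ m \<le> \<zeta> ^ (m - 1)" "\<zeta> ^ (m - 1) \<le> \<zeta> ^ (m - 2)" "\<zeta> ^ m \<le> \<zeta> ^ (m - 2)"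
    using \<zeta> by (auto intro!: power_decreasing)
  have zn: "0 \<le> \<zeta> ^ j" for j using \<zeta> by simp
  have T1: "C * (\<bar>y\<bar> powr (P - 1) + C powr (P - 1)) * (v powr (r - 1) * \<zeta> ^ m) \<le> W * (s powr (P - 1) + 1) * \<zeta> ^ m"
  proof -
    have "C * (\<bar>y\<bar> powr (P - 1) + C powr (P - 1)) \<le> 1 / R * (s powr (P - 1) * g + g)"
      unfolding y1 using CR(1) C1 C(3) g0 R(1) by (intro mult_mono add_mono) auto
    then have "C * (\<bar>y\<bar> powr (P - 1) + C powr (P - 1)) * (v powr (r - 1) * \<zeta> ^ m) \<le> (1 / R * (s powr (P - 1) * g + g)) * (v powr (r - 1) * \<zeta> ^ m)"
      using zn by (intro mult_right_mono) auto
    also have "\<dots> = W * (s powr (P - 1) + 1) * \<zeta> ^ m" unfolding W_def by (simp add: algebra_simps add_divide_distrib)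
    finally show ?thesis .
  qed
  \<comment> \<open>Coercivity: the only term with a good sign, it pays for the gradient in the
    source and in the cutoff term.\<close>
  have T2: "- (ai * ((r - 1) * v powr (r - 1 - 1) * y * \<zeta> ^ m)) \<le> - (k * s powr P * \<zeta> ^ m * W) + (r - 1) * W * \<zeta> ^ m"
  proof -
    have "(r - 1) * v powr (r - 1 - 1) * \<zeta> ^ m * (C\<^sub>o * (s powr P * (g * (v / R))) - g * (v / R)) \<le> (r - 1) * v powr (r - 1 - 1) * \<zeta> ^ m * (ai * y)"
    proof (rule mult_left_mono)
      show "C\<^sub>o * (s powr P * (g * (v / R))) - g * (v / R) \<le> ai * y" using av CP unfolding yP by linarith
      show "0 \<le> (r - 1) * v powr (r - 1 - 1) * \<zeta> ^ m" using r zn by simp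
    qed
    moreover have "(r - 1) * v powr (r - 1 - 1) * \<zeta> ^ m * (C\<^sub>o * (s powr P * (g * (v / R))) - g * (v / R)) =
      k * s powr P * \<zeta> ^ m * (v powr (r - 1 - 1) * (g * (v / R))) - (r - 1) * (v powr (r - 1 - 1) * (g * (v / R))) * \<zeta> ^ m"
      unfolding k_def by (simp add: algebra_simps add_divide_distrib diff_divide_distrib)
    ultimately show ?thesis unfolding W' by (simp add: mult_ac)
  qed
  have T3: "- (ai * (v powr (r - 1) * (real m * \<zeta> ^ (m - 1) * dz))) \<le> W * (4 * real m * (C\<^sub>1 * s powr (P - 1) + 1)) * \<zeta> ^ (m - 1)"
  proof -
    have a1: "\<bar>ai\<bar> \<le> C\<^sub>1 * (s powr (P - 1) * g) + g" using ai C1 unfolding y1 by linarith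
    have "- (ai * (v powr (r - 1) * (real m * \<zeta> ^ (m - 1) * dz))) \<le> \<bar>ai * (v powr (r - 1) * (real m * \<zeta> ^ (m - 1) * dz))\<bar>" by simp
    also have "\<dots> = \<bar>ai\<bar> * (v powr (r - 1) * (real m * \<zeta> ^ (m - 1) * \<bar>dz\<bar>))" using zn by (simp add: abs_mult)
    also have "\<dots> \<le> (C\<^sub>1 * (s powr (P - 1) * g) + g) * (v powr (r - 1) * (real m * \<zeta> ^ (m - 1) * (4 / R)))"
      using a1 dz zn C g0 by (intro mult_mono mult_left_mono) auto
    also have "\<dots> = W * (4 * real m * (C\<^sub>1 * s powr (P - 1) + 1)) * \<zeta> ^ (m - 1)"
      unfolding W_def by (simp add: algebra_simps add_divide_distrib)
    finally show ?thesis .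
  qed
  have abs1: "c * s powr (P - 1) * \<zeta> ^ (m - 1) \<le> k * s powr P * \<zeta> ^ m + c * (1 + c / k) * \<zeta> ^ (m - 2)"
    by (rule gradient_absorption[OF s0 \<zeta> P c0 k0 m])
  \<comment> \<open>Without the common factor \<open>W\<close> an inequality in \<open>s\<close> and
    \<zeta> alone remains. The powers of \<zeta> are lowered to \<open>m - 1\<close> for the
    gradient terms and to \<open>m - 2\<close> for the others.\<close>
  have "(s powr (P - 1) + 1) * \<zeta> ^ m - k * s powr P * \<zeta> ^ m + (r - 1) * \<zeta> ^ m + (4 * real m * (C\<^sub>1 * s powr (P - 1) + 1)) * \<zeta> ^ (m - 1)
     \<le> (c * (1 + c / k) + (r + 4 * real m)) * \<zeta> ^ (m - 2)"
  proof -
    have "s powr (P - 1) * \<zeta> ^ m \<le> s powr (P - 1) * \<zeta> ^ (m - 1)" using z(1) by (intro mult_left_mono) auto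
    moreover have "r * \<zeta> ^ m \<le> r * \<zeta> ^ (m - 2)" using z(3) r by (intro mult_left_mono) auto
    moreover have "4 * real m * \<zeta> ^ (m - 1) \<le> 4 * real m * \<zeta> ^ (m - 2)" using z(2) by (intro mult_left_mono) auto
    moreover have "c * s powr (P - 1) * \<zeta> ^ (m - 1) = s powr (P - 1) * \<zeta> ^ (m - 1) + 4 * real m * C\<^sub>1 * s powr (P - 1) * \<zeta> ^ (m - 1)"
      by (simp add: c_def algebra_simps)
    ultimately show ?thesis using abs1 by (simp add: algebra_simps)
  qed
  from mult_left_mono[OF this W0]
  have "W * (s powr (P - 1) + 1) * \<zeta> ^ m + (- (k * s powr P * \<zeta> ^ m * W) + (r - 1) * W * \<zeta> ^ m) + W * (4 * real m * (C\<^sub>1 * s powr (P - 1) + 1)) * \<zeta> ^ (m - 1)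
     \<le> W * ((c * (1 + c / k) + (r + 4 * real m)) * \<zeta> ^ (m - 2))"
    by (simp add: algebra_simps)
  moreover have "energy_const C\<^sub>o C\<^sub>1 r m = c * (1 + c / k) + (r + 4 * real m)"
    by (simp add: energy_const_def Let_def c_def k_def)
  moreover have "ai * ((r - 1) * v powr (r - 1 - 1) * y * \<zeta> ^ m + v powr (r - 1) * (real m * \<zeta> ^ (m - 1) * dz)) =
    ai * ((r - 1) * v powr (r - 1 - 1) * y * \<zeta> ^ m) + ai * (v powr (r - 1) * (real m * \<zeta> ^ (m - 1) * dz))"
    by (rule distrib_left)
  ultimately show ?thesis using T1 T2 T3 unfolding Weq by (simp only: mult_ac)
qed

lemma sum_powr_le:
  fixes x :: "'i \<Rightarrow> real"
  assumes "finite I" "\<And>i. i \<in> I \<Longrightarrow> 0 \<le> x i" "0 < r"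
  shows "(\<Sum>i\<in>I. x i) powr r \<le> real (card I) powr r * (\<Sum>i\<in>I. x i powr r)"
proof (cases "I = {}")
  case False
  define m where "m = Max (x ` I)"
  have m: "\<And>i. i \<in> I \<Longrightarrow> x i \<le> m" "m \<in> x ` I" using assms(1) False by (auto simp: m_def)
  then obtain j where j: "j \<in> I" "m = x j" by auto
  have "(\<Sum>i\<in>I. x i) \<le> real (card I) * m" using sum_bounded_above[of I x m] m(1) by simp
  then have "(\<Sum>i\<in>I. x i) powr r \<le> (real (card I) * m) powr r"
    using assms by (intro powr_mono2 sum_nonneg) auto
  also have "\<dots> = real (card I) powr r * x j powr r" by (simp add: powr_mult j)
  also have "\<dots> \<le> real (card I) powr r * (\<Sum>i\<in>I. x i powr r)"
    using assms(1) j(1) by (intro mult_left_mono member_le_sum) auto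
  finally show ?thesis .
qed simp

section \<open>The local energy estimate\<close>

lemma nn_integral_lebesgue_eq_integral:
  fixes f :: "'a::euclidean_space \<Rightarrow> real"
  assumes "integrable lborel f" "\<And>x. 0 \<le> f x"
  shows "(\<integral>\<^sup>+x. ennreal (f x) \<partial>lebesgue) = ennreal (integral\<^sup>L lborel f)"
proof -
  have "integrable lebesgue f" using assms(1) by (subst integrable_completion) auto
  then have "(\<integral>\<^sup>+x. ennreal (f x) \<partial>lebesgue) = ennreal (integral\<^sup>L lebesgue f)"
    using assms(2) by (intro nn_integral_eq_integral) auto
  also have "integral\<^sup>L lebesgue f = integral\<^sup>L lborel f" using assms(1) by (intro integral_completion) auto
  finally show ?thesis .
qed

lemma powr_le_imp_le:
  fixes x y q :: real
  assumes "x powr q \<le> y powr q" "0 \<le> y" "0 < q"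
  shows "x \<le> y"
  using assms powr_less_mono2[of q y x] by (metis linorder_not_le)

text \<open>Here the abstract energy bound meets the geometry. In the constants, \<beta> is the
  lower bound of the cutoff on the inner cube, \<open>14 / 5\<close> the side of the integration box
  in units of \<open>R i\<close>, \<Gamma> the constant of the pointwise bound, and
  \<open>n powr r\<close> the price for the power of the sum \<nu>. The bound of \<open>u\<close>
  occurs in none of them.\<close>

lemma local_energy_estimate:
  fixes p :: "'n::finite \<Rightarrow> real" and \<Omega> :: "(real^'n) set" and C\<^sub>o C\<^sub>1 C r T t \<rho> :: real and m :: nat
  defines "\<nu> \<equiv> nu_Sigma p t \<rho>" and "\<Gamma> \<equiv> energy_const C\<^sub>o C\<^sub>1 r m"
    and "\<beta> \<equiv> (exp (- 2 / (6 / 5 - 1)) ^ CARD('n)) ^ m" and "n \<equiv> real CARD('n)"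
    and "\<Lambda> \<equiv> \<lambda>i. (t powr r / \<rho> powr lambda_exp p r i) powr (1 / (2 - p i))"
  assumes p: "\<And>i. 1 < p i" "\<And>i. p i < 2" and r: "1 < r"
    and C: "0 < C\<^sub>o" "0 < C\<^sub>1" "0 \<le> C"
    and m: "\<And>i. 2 + 2 * r / (2 - p i) \<le> real m"
    and \<Omega>: "open \<Omega>" and T: "0 < T" and str: "structure_conditions \<Omega> T p C\<^sub>o C\<^sub>1 C A B"
    and sol: "local_weak_subsolution \<Omega> T p A B u"
    and u0: "AE z\<in>cylinder \<Omega> T in lebesgue. 0 \<le> u z"
    and bdd: "locally_bounded (cylinder \<Omega> T) u"
    and t: "0 < t" and \<rho>: "0 < \<rho>" and cube: "aniso_cube p (2 * \<rho>) \<times> {0..t} \<subseteq> cylinder \<Omega> T"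
    and small: "\<And>i. C powr p i * \<rho> powr hmean p \<le> min 1 (\<nu> powr p i)"
    and \<tau>: "\<tau> \<in> {0..t}"
  shows "(\<integral>\<^sup>+x\<in>aniso_cube p \<rho>. ennreal (u (x, \<tau>) powr r) \<partial>lebesgue)
    \<le> ennreal (r / \<beta> * (2 * (2 powr r / r))) * (\<integral>\<^sup>+x\<in>aniso_cube p (2 * \<rho>). ennreal (u (x, 0) powr r) \<partial>lebesgue)
      + ennreal (r / \<beta> * (2 * (2 powr r / r * (n powr r * (14 / 5) ^ CARD('n)) +
          \<Gamma> * (\<Sum>i\<in>UNIV. (2 * n * r * \<Gamma>) powr ((r - (2 - p i)) / (2 - p i))) * (14 / 5) ^ CARD('n))) * (\<Sum>i\<in>UNIV. \<Lambda> i))"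
proof -
  define h where "h = hmean p"
  \<comment> \<open>The half axes of the inner cube; the scaling is such that
    \<open>R i powr p i\<close> does not depend on \<open>i\<close>.\<close>
  define R where "R i = \<rho> powr (h / p i)" for i
  have n: "0 < n" by (simp add: n_def)
  have p0: "0 < p i" for i using p(1)[of i] by simp
  have sp: "0 < (\<Sum>i\<in>UNIV. 1 / p i)" using p0 by (intro sum_pos) auto
  \<comment> \<open>The normalisation of the harmonic mean: it makes the volume of the boxes a
    multiple of \<open>\<rho> powr n\<close>.\<close>
  have hsum: "(\<Sum>i\<in>UNIV. h / p i) = n"
  proof -
    have "(\<Sum>i\<in>UNIV. h / p i) = h * (\<Sum>i\<in>UNIV. 1 / p i)" by (simp add: sum_distrib_left)
    then show ?thesis using sp by (simp add: h_def hmean_def n_def)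
  qed
  have h1: "1 < h"
  proof -
    have "1 / p i < 1" for i using p(1)[of i] by simp
    then have "(\<Sum>i\<in>UNIV. 1 / p i) < (\<Sum>i\<in>(UNIV::'n set). 1)" by (intro sum_strict_mono) auto
    then show ?thesis using sp by (simp add: h_def hmean_def field_simps)
  qed
  have R0: "0 < R i" for i using \<rho> by (simp add: R_def)
  have RP: "R i powr (- p i) = \<rho> powr (- h)" "R i powr p i = \<rho> powr h" for i
    using p0[of i] by (simp_all add: R_def powr_powr)
  \<comment> \<open>Doubling \<rho> stretches an axis by \<open>2 powr (h / p i)\<close>, which may
    be close to the square root of 2, because only \<open>h > 1\<close> and \<open>p i < 2\<close>
    are known. Hence the factors \<open>6 / 5\<close> and \<open>7 / 5\<close> below, which both
    stay under that root.\<close>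
  have R2: "7 / 5 * R i < (2 * \<rho>) powr (h / p i)" for i
  proof -
    have "(7 / 5 :: real) < sqrt 2" by (rule real_less_rsqrt) (simp add: power2_eq_square)
    then have "(7 / 5 :: real) < 2 powr (1 / 2)" by (simp only: powr_half_sqrt zero_le_numeral)
    also have "\<dots> \<le> 2 powr (h / p i)" using h1 p[of i] by (intro powr_mono) (auto simp: field_simps)
    finally show ?thesis using R0[of i] \<rho> by (simp add: powr_mult R_def)
  qed
  \<comment> \<open>\<open>K0\<close> carries the cutoff; \<open>K\<close> is the integration domain
    and leaves a margin for the mollification. The boxes are closed because the equation is tested
    on compact sets.\<close>
  define K where "K = {x::real^'n. \<forall>i. \<bar>x $ i\<bar> \<le> 7 / 5 * R i}"
  define K0 where "K0 = {x::real^'n. \<forall>i. \<bar>x $ i\<bar> \<le> 6 / 5 * R i}"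
  have box: "{x::real^'n. \<forall>i. \<bar>x $ i\<bar> \<le> c * R i} = cbox (\<chi> i. - (c * R i)) (\<chi> i. c * R i)" for c
    by (auto simp: mem_box_cart abs_le_iff minus_le_iff)
  have cK: "compact K" and cK0: "compact K0" unfolding K_def K0_def box by (rule compact_cbox)+
  have Kvol: "measure lborel K = (14 / 5) ^ CARD('n) * \<rho> powr n"
  proof -
    have "cbox (\<chi> i. - (7 / 5 * R i)) (\<chi> i. 7 / 5 * R i) \<noteq> {}"
      using R0 by (auto simp: interval_ne_empty_cart less_imp_le)
    then have "measure lborel K = (\<Prod>i\<in>UNIV. 7 / 5 * R i - - (7 / 5 * R i))"
      unfolding K_def box by (subst content_cbox_cart) auto
    also have "\<dots> = (\<Prod>i\<in>UNIV. 14 / 5 * R i)" by (intro prod.cong) auto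
    also have "\<dots> = (14 / 5) ^ CARD('n) * (\<Prod>i\<in>UNIV. R i)" by (simp only: prod.distrib prod_constant)
    also have "(\<Prod>i\<in>UNIV. R i) = \<rho> powr n"
      unfolding R_def hsum[symmetric] using \<rho> by (subst powr_sum) auto
    finally show ?thesis .
  qed
  have K2: "K \<subseteq> aniso_cube p (2 * \<rho>)"
  proof
    fix x assume x: "x \<in> K"
    have "\<bar>x $ i\<bar> < (2 * \<rho>) powr (hmean p / p i)" for i
    proof (rule le_less_trans)
      show "\<bar>x $ i\<bar> \<le> 7 / 5 * R i" using x by (simp add: K_def)
      show "7 / 5 * R i < (2 * \<rho>) powr (hmean p / p i)" using R2[of i] by (simp only: h_def)
    qed
    then show "x \<in> aniso_cube p (2 * \<rho>)" by (simp add: aniso_cube_def)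
  qed
  have K\<rho>: "\<bar>x $ i\<bar> \<le> R i" if "x \<in> aniso_cube p \<rho>" for x i
    using that by (auto simp: aniso_cube_def R_def h_def intro: less_imp_le)
  have \<rho>K: "aniso_cube p \<rho> \<subseteq> K"
  proof
    fix x assume "x \<in> aniso_cube p \<rho>"
    then have "\<bar>x $ i\<bar> \<le> 7 / 5 * R i" for i using K\<rho>[of x i] R0[of i] by simp
    then show "x \<in> K" by (simp add: K_def)
  qed
  have "(0, t) \<in> aniso_cube p (2 * \<rho>) \<times> {0..t}" using t \<rho> by (simp add: aniso_cube_def)
  from subsetD[OF cube this] have tT: "t \<le> T" by simp
  have K\<Omega>: "K \<subseteq> \<Omega>"
  proof
    fix x assume "x \<in> K"
    then have "(x, 0) \<in> aniso_cube p (2 * \<rho>) \<times> {0..t}" using K2 t by auto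
    from subsetD[OF cube this] show "x \<in> \<Omega>" by simp
  qed
  define \<zeta> where "\<zeta> = box_bump (6 / 5) R"
  \<comment> \<open>The power of the bump is the cutoff handed to the energy argument; its
    derivative keeps \<open>m - 1\<close> factors of \<zeta>.\<close>
  define Z where "Z x = \<zeta> x ^ m" for x
  have m3: "3 \<le> m"
  proof -
    have "0 < 2 * r / (2 - p undefined)" using r p(2)[of undefined] by simp
    then have "2 < real m" using m[of undefined] by linarith
    then show ?thesis by simp
  qed
  have \<zeta>b: "0 \<le> \<zeta> x" "\<zeta> x \<le> 1" for x unfolding \<zeta>_def by (rule box_bump_bounds)+
  have ZC: "Cc_infinity K0 Z"
  proof -
    have "Z x = 0" if x: "x \<notin> K0" for x
    proof -
      obtain i where "6 / 5 * R i \<le> \<bar>x $ i\<bar>" using x by (auto simp: K0_def not_le intro: less_imp_le)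
      then have "\<zeta> x = 0" unfolding \<zeta>_def using R0 by (intro box_bump_eq_0[of _ i]) auto
      then show ?thesis using m3 by (simp add: Z_def)
    qed
    moreover have "Ck k Z" for k unfolding Z_def[abs_def] \<zeta>_def by (intro Ck_power Ck_box_bump)
    ultimately show ?thesis unfolding Cc_infinity_def using cK0 by blast
  qed
  have Z0: "0 \<le> Z x" for x using \<zeta>b by (simp add: Z_def)
  have dZ: "partial_deriv (axis i 1) Z x = real m * \<zeta> x ^ (m - 1) * partial_deriv (axis i 1) \<zeta> x" for i x
  proof -
    have "\<zeta> differentiable (at x)" unfolding \<zeta>_def by (intro Ck_differentiable allI Ck_box_bump)
    moreover have "((\<lambda>y. y ^ m) has_real_derivative real m * \<zeta> x ^ (m - 1)) (at (\<zeta> x))"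
      by (auto intro!: derivative_eq_intros)
    ultimately show ?thesis unfolding Z_def[abs_def] by (rule partial_deriv_compose_real(1))
  qed
  have dzb: "\<bar>partial_deriv (axis i 1) \<zeta> x\<bar> \<le> 4 / R i" for i x
    unfolding \<zeta>_def by (rule box_bump_partial_bound[OF R0])
  have K0K: "K0 \<subseteq> K"
  proof
    fix x assume "x \<in> K0"
    then have "\<bar>x $ i\<bar> \<le> 7 / 5 * R i" for i using R0[of i] by (auto simp: K0_def intro: order_trans)
    then show "x \<in> K" by (simp add: K_def)
  qed
  \<comment> \<open>The margin between the factors \<open>6 / 5\<close> and \<open>7 / 5\<close>
    along the shortest axis.\<close>
  define \<delta> where "\<delta> = Min (range R) / 5"
  have \<delta>0: "0 < \<delta>" using R0 by (simp add: \<delta>_def)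
  have \<delta>K: "cball x \<delta> \<subseteq> K" if x: "x \<in> K0" for x
  proof
    fix y assume y: "y \<in> cball x \<delta>"
    have "\<bar>y $ i\<bar> \<le> 7 / 5 * R i" for i
    proof -
      have "\<bar>(x - y) $ i\<bar> \<le> \<delta>" using component_le_norm_cart[of "x - y" i] y by (simp add: dist_norm)
      moreover have "\<delta> \<le> R i / 5" unfolding \<delta>_def by (intro divide_right_mono Min_le) auto
      moreover have "\<bar>x $ i\<bar> \<le> 6 / 5 * R i" using x by (simp add: K0_def)
      ultimately show ?thesis by simp
    qed
    then show "y \<in> K" by (simp add: K_def)
  qed
  have \<nu>0: "0 < \<nu>"
    unfolding \<nu>_def nu_Sigma_def using t \<rho> by (intro sum_pos) auto
  \<comment> \<open>As \<open>R i powr p i = \<rho> powr h\<close>, the failure of the first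
    alternative says that the power \<open>p i\<close> of \<open>C * R i\<close> is at most
    \<open>1\<close> and at most \<open>\<nu> powr p i\<close>.\<close>
  have CR: "C * R i \<le> 1" "C * R i \<le> \<nu>" for i
  proof -
    have "(C * R i) powr p i \<le> min 1 (\<nu> powr p i)"
      using small[of i] by (simp add: powr_mult RP h_def)
    then have "(C * R i) powr p i \<le> 1 powr p i" "(C * R i) powr p i \<le> \<nu> powr p i" by auto
    then show "C * R i \<le> 1" "C * R i \<le> \<nu>" using p0[of i] \<nu>0 by (auto intro: powr_le_imp_le)
  qed
  have "\<exists>Du. Lp_W1p_loc \<Omega> T p u Du \<and> (\<forall>t\<^sub>1 t\<^sub>2 K. 0 \<le> t\<^sub>1 \<and> t\<^sub>1 \<le> t\<^sub>2 \<and> t\<^sub>2 \<le> T \<and> compact K \<and> K \<subseteq> \<Omega> \<longrightarrow>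
         (\<forall>\<phi> D\<phi> d\<phi>. test_function \<Omega> T p K \<phi> D\<phi> d\<phi> \<longrightarrow>
           weak_lhs A K t\<^sub>1 t\<^sub>2 u Du \<phi> D\<phi> d\<phi> \<le> weak_rhs B K t\<^sub>1 t\<^sub>2 u Du \<phi>))"
    using sol unfolding local_weak_subsolution_def by (rule conjunct2)
  then obtain Du where D: "Lp_W1p_loc \<Omega> T p u Du \<and> (\<forall>t\<^sub>1 t\<^sub>2 K. 0 \<le> t\<^sub>1 \<and> t\<^sub>1 \<le> t\<^sub>2 \<and> t\<^sub>2 \<le> T \<and> compact K \<and> K \<subseteq> \<Omega> \<longrightarrow>
         (\<forall>\<phi> D\<phi> d\<phi>. test_function \<Omega> T p K \<phi> D\<phi> d\<phi> \<longrightarrow>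
           weak_lhs A K t\<^sub>1 t\<^sub>2 u Du \<phi> D\<phi> d\<phi> \<le> weak_rhs B K t\<^sub>1 t\<^sub>2 u Du \<phi>))" ..
  note spc = conjunct1[OF D] and weak = conjunct2[OF D]
  have uC: "C_L2loc \<Omega> T u" using sol unfolding local_weak_subsolution_def by (rule conjunct1)
  have "compact (K \<times> {0..T}) \<and> K \<times> {0..T} \<subseteq> cylinder \<Omega> T" using K\<Omega> compact_Times[OF cK compact_Icc] by auto
  then obtain M0 where "AE z\<in>K \<times> {0..T} in lebesgue. \<bar>u z\<bar> \<le> M0" using bdd unfolding locally_bounded_def by blast
  \<comment> \<open>The maximum with 0 makes the bound nonnegative, as clipping to
    \<open>[0, M]\<close> requires.\<close>
  then have M: "AE z\<in>K \<times> {0..T} in lebesgue. \<bar>u z\<bar> \<le> max M0 0" by (rule eventually_mono) auto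
  obtain U V a b where
    U: "U \<in> borel_measurable borel" "\<And>z. 0 \<le> U z" "\<And>z. U z \<le> max M0 0" "\<And>z. z \<notin> K \<times> {0..T} \<Longrightarrow> U z = 0" and
    V: "\<And>i. (\<lambda>z. V z $ i) \<in> borel_measurable borel" "\<And>z. z \<notin> K \<times> {0..T} \<Longrightarrow> V z = 0"
    "\<And>i. integrable lborel (\<lambda>z. \<bar>V z $ i\<bar> powr p i)" and
    a: "\<And>i. (\<lambda>z. a z $ i) \<in> borel_measurable borel" "\<And>z. z \<notin> K \<times> {0..T} \<Longrightarrow> a z = 0"
    "\<And>i. integrable lborel (\<lambda>z. \<bar>a z $ i\<bar> powr (p i / (p i - 1)))" and
    b: "b \<in> borel_measurable borel" "\<And>z. z \<notin> K \<times> {0..T} \<Longrightarrow> b z = 0" "integrable lborel (\<lambda>z. \<bar>b z\<bar> powr 2)" and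
    rep: "AE z in lborel. z \<in> K \<times> {0..T} \<longrightarrow>
      U z = u z \<and> V z = Du z \<and> a z = A z (u z) (Du z) \<and> b z = B z (u z) (Du z)" and
    S: "AE z in lborel. z \<in> K \<times> {0..T} \<longrightarrow>
      (\<forall>i. a z $ i * V z $ i \<ge> C\<^sub>o * \<bar>V z $ i\<bar> powr p i - C powr p i) \<and>
      (\<forall>i. \<bar>a z $ i\<bar> \<le> C\<^sub>1 * \<bar>V z $ i\<bar> powr (p i - 1) + C powr (p i - 1)) \<and>
      \<bar>b z\<bar> \<le> (\<Sum>i\<in>UNIV. C * (\<bar>V z $ i\<bar> powr (p i - 1) + C powr (p i - 1)))"
    by (rule solution_representatives[OF cK K\<Omega> p C(2,3) str spc u0 _ M]) (simp, rule that)
  have bnd: "AE t in lborel. t \<in> {0..T} \<longrightarrow> (AE x in lborel. x \<in> K \<longrightarrow> 0 \<le> u (x, t) \<and> u (x, t) \<le> max M0 0)"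
    using AE_lborel_prodD[OF rep]
  proof eventually_elim
    case (elim s)
    show ?case
    proof
      assume s: "s \<in> {0..T}"
      show "AE x in lborel. x \<in> K \<longrightarrow> 0 \<le> u (x, s) \<and> u (x, s) \<le> max M0 0"
        using elim
      proof eventually_elim
        case (elim x)
        then show ?case using s U(2,3)[of "(x, s)"] by auto
      qed
    qed
  qed
  have L2: "Lq 2 K (\<lambda>x. u (x, t))" if "t \<in> {0..T}" for t
    using uC that cK K\<Omega> unfolding C_L2loc_def Lq_loc_def by blast
  have L2c: "((\<lambda>s. LINT x:K|lebesgue. (u (x, s) - u (x, t))\<^sup>2) \<longlongrightarrow> 0) (at t within {0..T})" if "t \<in> {0..T}" for t
    using uC that cK K\<Omega> unfolding C_L2loc_def by blast
  obtain w where w: "\<And>t. t \<in> {0..T} \<Longrightarrow> w t \<in> borel_measurable borel" "\<And>t x. 0 \<le> w t x" "\<And>t x. w t x \<le> max M0 0"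
    "\<And>t. t \<in> {0..T} \<Longrightarrow> AE x in lborel. x \<in> K \<longrightarrow> u (x, t) = w t x"
    "\<And>t. t \<in> {0..T} \<Longrightarrow>
      ((\<lambda>s. \<integral>x. indicator K x * (w s x - w t x)\<^sup>2 \<partial>lborel) \<longlongrightarrow> 0) (at t within {0..T})"
    by (rule bounded_slices[OF cK T _ L2 L2c bnd]) (simp, assumption, assumption, rule that)
  have W11: "AE t\<in>{0..T} in lebesgue. W11_loc \<Omega> (\<lambda>x. u (x, t)) (\<lambda>x. Du (x, t))"
    using spc unfolding Lp_W1p_loc_def by blast
  have sub: "weak_lhs A K t\<^sub>1 t\<^sub>2 u Du \<phi> D\<phi> d\<phi> \<le> weak_rhs B K t\<^sub>1 t\<^sub>2 u Du \<phi>"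
    if "0 \<le> t\<^sub>1" "t\<^sub>1 \<le> t\<^sub>2" "t\<^sub>2 \<le> T" "test_function \<Omega> T p K \<phi> D\<phi> d\<phi>" for t\<^sub>1 t\<^sub>2 \<phi> D\<phi> d\<phi>
    by (rule weak[rule_format]) (use that cK K\<Omega> in simp_all)
  interpret cutoff_energy \<Omega> T p A B u Du K "max M0 0" U V a b w K0 Z \<delta> \<nu> r
    by (rule cutoff_energy.intro[OF \<Omega> T p cK K\<Omega> W11 sub U V a b rep w ZC Z0 K0K \<delta>0 \<delta>K \<nu>0 r])
  have \<Gamma>: "0 < \<Gamma>"
  proof -
    define c where "c = 1 + 4 * real m * C\<^sub>1"
    define k where "k = (r - 1) * C\<^sub>o"
    have "0 \<le> c" "0 \<le> k" using C r by (auto simp: c_def k_def)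
    then have "0 \<le> c * (1 + c / k)" by simp
    moreover have "\<Gamma> = c * (1 + c / k) + (r + 4 * real m)"
      by (simp add: \<Gamma>_def energy_const_def Let_def c_def k_def)
    ultimately show ?thesis using r by simp
  qed
  define L where "L = \<rho> powr (- h)"
  \<comment> \<open>Chosen so that the \<open>n\<close> directions together contribute exactly
    \<open>1 / (2 * t)\<close> times the energy density, the share that the maximum in time can
    absorb.\<close>
  define \<epsilon> where "\<epsilon> = 1 / (2 * t * n * r * \<Gamma>)"
  have L0: "0 < L" and \<epsilon>0: "0 < \<epsilon>" using \<rho> t n r \<Gamma> by (auto simp: L_def \<epsilon>_def)
  define c0 where "c0 = (\<Sum>i\<in>UNIV. \<Gamma> * (L * (L / \<epsilon>) powr ((r - (2 - p i)) / (2 - p i))))"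
  have c0: "0 \<le> c0" unfolding c0_def using \<Gamma> L0 by (intro sum_nonneg mult_nonneg_nonneg) auto
  have pt: "AE z in lborel. z \<in> K \<times> {0..t} \<longrightarrow>
      b z * \<phi> z - (\<Sum>i\<in>UNIV. a z $ i * d i z) \<le> c0 + 1 / (2 * t) * ((U z + \<nu>) powr r / r * Z (fst z))"
    using S
  proof eventually_elim
    case (elim z)
    show ?case
    proof
      assume "z \<in> K \<times> {0..t}"
      then have "z \<in> K \<times> {0..T}" using tT by auto
      with elim have s: "\<And>i. C\<^sub>o * \<bar>V z $ i\<bar> powr p i - C powr p i \<le> a z $ i * V z $ i"
        "\<And>i. \<bar>a z $ i\<bar> \<le> C\<^sub>1 * \<bar>V z $ i\<bar> powr (p i - 1) + C powr (p i - 1)"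
        "\<bar>b z\<bar> \<le> (\<Sum>i\<in>UNIV. C * (\<bar>V z $ i\<bar> powr (p i - 1) + C powr (p i - 1)))" by blast+
      define v where "v = U z + \<nu>"
      have v: "\<nu> \<le> v" "0 < v" using U(2)[of z] \<nu>0 by (auto simp: v_def)
      define y where "y = \<zeta> (fst z)"
      \<comment> \<open>The source is bounded by a sum over the directions, so each direction takes
        its own share and is treated separately.\<close>
      have each: "C * (\<bar>V z $ i\<bar> powr (p i - 1) + C powr (p i - 1)) * \<phi> z - a z $ i * d i z
        \<le> 1 / (2 * t * n * r) * (v powr r * y ^ m) + \<Gamma> * (L * (L / \<epsilon>) powr ((r - (2 - p i)) / (2 - p i)))" for i
      proof -
        have \<phi>z: "\<phi> z = v powr (r - 1) * y ^ m" by (simp add: \<phi>_def Z_def v_def y_def)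
        have dz: "d i z = (r - 1) * v powr (r - 1 - 1) * V z $ i * y ^ m +
            v powr (r - 1) * (real m * y ^ (m - 1) * partial_deriv (axis i 1) \<zeta> (fst z))"
          unfolding d_def dZ by (simp add: Z_def v_def y_def)
        have "C * (\<bar>V z $ i\<bar> powr (p i - 1) + C powr (p i - 1)) * \<phi> z - a z $ i * d i z
          \<le> \<Gamma> * (v powr (r + p i - 2) * R i powr (- p i) * y ^ (m - 2))"
          unfolding \<phi>z dz unfolding y_def \<Gamma>_def
          by (rule energy_density_bound[OF p r C R0 CR \<nu>0 v(1) \<zeta>b dzb _ s(1,2)]) (use m3 in simp)
        also have "\<dots> = \<Gamma> * (L * v powr (r - (2 - p i)) * y ^ (m - 2))"
          unfolding RP(1) L_def by (simp add: algebra_simps)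
        also have "\<dots> \<le> \<Gamma> * (\<epsilon> * v powr r * y ^ m + L * (L / \<epsilon>) powr ((r - (2 - p i)) / (2 - p i)))"
          using \<Gamma> v(2) \<zeta>b p(1)[of i] p(2)[of i] r L0 \<epsilon>0 m[of i] unfolding y_def
          by (intro mult_left_mono power_absorption) auto
        also have "\<dots> = 1 / (2 * t * n * r) * (v powr r * y ^ m) + \<Gamma> * (L * (L / \<epsilon>) powr ((r - (2 - p i)) / (2 - p i)))"
          using \<Gamma> by (simp add: distrib_left \<epsilon>_def)
        finally show ?thesis .
      qed
      have "b z * \<phi> z \<le> (\<Sum>i\<in>UNIV. C * (\<bar>V z $ i\<bar> powr (p i - 1) + C powr (p i - 1))) * \<phi> z"
        using s(3) \<phi>_nonneg by (intro mult_right_mono) auto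
      then have "b z * \<phi> z - (\<Sum>i\<in>UNIV. a z $ i * d i z) \<le>
          (\<Sum>i\<in>UNIV. C * (\<bar>V z $ i\<bar> powr (p i - 1) + C powr (p i - 1)) * \<phi> z - a z $ i * d i z)"
        by (simp add: sum_subtractf sum_distrib_right)
      also have "\<dots> \<le> (\<Sum>i\<in>UNIV. 1 / (2 * t * n * r) * (v powr r * y ^ m) + \<Gamma> * (L * (L / \<epsilon>) powr ((r - (2 - p i)) / (2 - p i))))"
        by (intro sum_mono each)
      also have "\<dots> = n * (1 / (2 * t * n * r) * (v powr r * y ^ m)) + c0"
        by (simp add: sum.distrib c0_def n_def)
      also have "\<dots> = c0 + 1 / (2 * t) * ((U z + \<nu>) powr r / r * Z (fst z))"
        using n by (simp add: v_def y_def Z_def)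
      finally show "b z * \<phi> z - (\<Sum>i\<in>UNIV. a z $ i * d i z) \<le> c0 + 1 / (2 * t) * ((U z + \<nu>) powr r / r * Z (fst z))" .
    qed
  qed
  have main: "E \<tau> \<le> 2 * (E 0 + t * c0 * measure lborel K)" by (rule energy_bound[OF t tT c0 pt \<tau>])
  \<comment> \<open>Everything on the right is expressed through \<open>x\<close>: \<nu> is the sum
    of the powers with exponent \<open>1 / (2 - p i)\<close>, and \<open>\<Lambda> i\<close> is the
    \<open>r\<close>-th power of such a summand times the volume scale
    \<open>\<rho> powr n\<close>.\<close>
  define x where "x = t / \<rho> powr h"
  have x: "0 < x" using t \<rho> by (simp add: x_def)
  have \<Lambda>: "\<Lambda> i = x powr (r / (2 - p i)) * \<rho> powr n" for i
  proof -
    have e: "0 < 2 - p i" using p(2)[of i] by simp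
    have "t powr r / \<rho> powr lambda_exp p r i = x powr r * \<rho> powr (n * (2 - p i))"
    proof -
      have "\<rho> powr (h * r) = \<rho> powr lambda_exp p r i * \<rho> powr (n * (2 - p i))"
        by (simp add: lambda_exp_def h_def n_def algebra_simps flip: powr_add)
      then show ?thesis using \<rho> by (simp add: x_def powr_divide powr_powr)
    qed
    then have "\<Lambda> i = (x powr r * \<rho> powr (n * (2 - p i))) powr (1 / (2 - p i))" by (simp add: \<Lambda>_def)
    also have "\<dots> = x powr (r / (2 - p i)) * \<rho> powr n" using e by (simp add: powr_mult powr_powr)
    finally show ?thesis .
  qed
  have \<Lambda>0: "0 \<le> \<Lambda> i" for i by (simp add: \<Lambda>)
  define G where "G i = (2 * n * r * \<Gamma>) powr ((r - (2 - p i)) / (2 - p i))" for i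
  \<comment> \<open>With \<open>e = 2 - p i\<close> the residue of the absorption is a multiple of
    \<open>x powr ((r - e) / e)\<close>. The factor \<open>t * L = x\<close>, produced by the
    integration in time, raises the exponent to \<open>r / e\<close>, which is that of
    \<open>\<Lambda> i\<close>.\<close>
  have c0K: "t * c0 * measure lborel K \<le> \<Gamma> * (\<Sum>i\<in>UNIV. G i) * (14 / 5) ^ CARD('n) * (\<Sum>i\<in>UNIV. \<Lambda> i)"
  proof -
    have each: "t * (\<Gamma> * (L * (L / \<epsilon>) powr ((r - (2 - p i)) / (2 - p i)))) * \<rho> powr n = \<Gamma> * (G i * \<Lambda> i)" for i
    proof -
      have e: "0 < 2 - p i" using p(2)[of i] by simp
      have "L / \<epsilon> = (2 * n * r * \<Gamma>) * x" by (simp add: L_def \<epsilon>_def x_def powr_minus_divide)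
      then have f1: "(L / \<epsilon>) powr ((r - (2 - p i)) / (2 - p i)) = G i * x powr ((r - (2 - p i)) / (2 - p i))"
        by (simp add: powr_mult G_def)
      have f2: "t * L = x" by (simp add: L_def x_def powr_minus_divide)
      have f3: "x * x powr ((r - (2 - p i)) / (2 - p i)) = x powr (r / (2 - p i))"
      proof -
        have "x * x powr ((r - (2 - p i)) / (2 - p i)) = x powr (1 + (r - (2 - p i)) / (2 - p i))"
          using x powr_mult_base[of x "(r - (2 - p i)) / (2 - p i)"] by simp
        also have "1 + (r - (2 - p i)) / (2 - p i) = r / (2 - p i)" using e by (simp add: field_simps)
        finally show ?thesis .
      qed
      have "t * (\<Gamma> * (L * (L / \<epsilon>) powr ((r - (2 - p i)) / (2 - p i)))) * \<rho> powr n =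
          \<Gamma> * (G i * (((t * L) * x powr ((r - (2 - p i)) / (2 - p i))) * \<rho> powr n))"
        unfolding f1 by (simp only: mult_ac)
      also have "\<dots> = \<Gamma> * (G i * \<Lambda> i)" unfolding f2 f3 \<Lambda> ..
      finally show ?thesis .
    qed
    have "t * c0 * measure lborel K = (14 / 5) ^ CARD('n) * (\<Sum>i\<in>UNIV. t * (\<Gamma> * (L * (L / \<epsilon>) powr ((r - (2 - p i)) / (2 - p i)))) * \<rho> powr n)"
      unfolding Kvol c0_def sum_distrib_left sum_distrib_right by (simp add: mult_ac)
    also have "\<dots> = (14 / 5) ^ CARD('n) * (\<Gamma> * (\<Sum>i\<in>UNIV. G i * \<Lambda> i))"
      unfolding each by (simp only: sum_distrib_left)
    also have "\<dots> \<le> (14 / 5) ^ CARD('n) * (\<Gamma> * (\<Sum>i\<in>UNIV. G i * (\<Sum>i\<in>UNIV. \<Lambda> i)))"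
      using \<Gamma> \<Lambda>0 by (intro mult_left_mono sum_mono member_le_sum) (auto simp: G_def)
    also have "\<dots> = \<Gamma> * (\<Sum>i\<in>UNIV. G i) * (14 / 5) ^ CARD('n) * (\<Sum>i\<in>UNIV. \<Lambda> i)"
      unfolding sum_distrib_right[symmetric] by (simp only: mult_ac)
    finally show ?thesis .
  qed
  \<comment> \<open>The shift costs nothing new: up to a constant, the \<open>r\<close>-th power of
    \<nu> is the sum of the \<open>r\<close>-th powers of its summands, and these are the
    \<open>\<Lambda> i\<close> per volume.\<close>
  have \<nu>K: "\<nu> powr r * measure lborel K \<le> n powr r * (14 / 5) ^ CARD('n) * (\<Sum>i\<in>UNIV. \<Lambda> i)"
  proof -
    have "\<nu> powr r \<le> n powr r * (\<Sum>i\<in>UNIV. (x powr (1 / (2 - p i))) powr r)"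
      unfolding \<nu>_def nu_Sigma_def n_def x_def h_def using r by (intro sum_powr_le) auto
    also have "\<dots> = n powr r * (\<Sum>i\<in>UNIV. x powr (r / (2 - p i)))" by (simp add: powr_powr)
    finally have "\<nu> powr r * \<rho> powr n \<le> n powr r * (\<Sum>i\<in>UNIV. x powr (r / (2 - p i))) * \<rho> powr n"
      by (intro mult_right_mono) auto
    also have "\<dots> = n powr r * (\<Sum>i\<in>UNIV. \<Lambda> i)" unfolding \<Lambda> by (simp add: sum_distrib_right mult.assoc)
    finally have "(14 / 5) ^ CARD('n) * (\<nu> powr r * \<rho> powr n) \<le> (14 / 5) ^ CARD('n) * (n powr r * (\<Sum>i\<in>UNIV. \<Lambda> i))"
      by (intro mult_left_mono) auto
    then show ?thesis unfolding Kvol by (simp add: mult_ac)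
  qed
  have T0: "0 \<in> {0..T}" "\<tau> \<in> {0..T}" using T \<tau> tT by auto
  define J where "J = (\<integral>x. indicator K x * w 0 x powr r \<partial>lborel)"
  have Ji: "integrable lborel (\<lambda>x. indicator K x * w 0 x powr r)"
  proof (rule integrable_bounded_compact_support[OF _ cK, of _ "max M0 0 powr r"])
    have "(\<lambda>x. w 0 x powr r) \<in> borel_measurable borel" using w(1)[OF T0(1)] by measurable
    then show "(\<lambda>x. indicator K x * w 0 x powr r) \<in> borel_measurable borel"
      using borel_compact[OF cK] by (intro borel_measurable_times borel_measurable_indicator)
    show "\<bar>indicator K x * w 0 x powr r\<bar> \<le> max M0 0 powr r" for x
      using w(2,3)[of 0 x] r by (auto simp: indicator_def intro!: powr_mono2)
  qed auto
  have J0: "0 \<le> J" unfolding J_def by (intro integral_nonneg_AE AE_I2) simp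
  \<comment> \<open>The initial energy belongs to the shifted function; splitting the power
    separates the initial values from the shift.\<close>
  have E0: "E 0 \<le> 2 powr r / r * (J + \<nu> powr r * measure lborel K)"
  proof -
    have "E 0 \<le> (\<integral>x. 2 powr r / r * (indicator K x * w 0 x powr r + indicator K x * (\<nu> powr r)) \<partial>lborel)"
      unfolding E_def
    proof (rule integral_mono)
      show "integrable lborel (\<lambda>x. (w 0 x + \<nu>) powr r / r * Z x)" by (rule E_integrable[OF T0(1)])
      show "integrable lborel (\<lambda>x. 2 powr r / r * (indicator K x * w 0 x powr r + indicator K x * (\<nu> powr r)))"
        by (intro integrable_mult_right Bochner_Integration.integrable_add Ji indicator_K_integrable)
      show "(w 0 x + \<nu>) powr r / r * Z x \<le> 2 powr r / r * (indicator K x * w 0 x powr r + indicator K x * (\<nu> powr r))" for x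
      proof (cases "x \<in> K")
        case True
        have "Z x \<le> 1" unfolding Z_def using \<zeta>b by (simp add: power_le_one)
        then have "(w 0 x + \<nu>) powr r / r * Z x \<le> (w 0 x + \<nu>) powr r / r"
          using r by (intro mult_left_le) auto
        also have "\<dots> \<le> 2 powr r * (w 0 x powr r + \<nu> powr r) / r"
          using w(2)[of 0 x] \<nu>0 r by (intro divide_right_mono add_powr_le) auto
        finally show ?thesis using True by simp
      qed (simp add: \<zeta>_outside)
    qed
    also have "\<dots> = 2 powr r / r * (\<integral>x. indicator K x * w 0 x powr r + indicator K x * (\<nu> powr r) \<partial>lborel)"
      by (rule integral_mult_right_zero)
    also have "(\<integral>x. indicator K x * w 0 x powr r + indicator K x * (\<nu> powr r) \<partial>lborel) = J + \<nu> powr r * measure lborel K"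
      unfolding J_def using borel_compact[OF cK]
      by (subst Bochner_Integration.integral_add[OF Ji indicator_K_integrable]) (simp add: mult.commute)
    finally show ?thesis .
  qed
  \<comment> \<open>Since \<open>Z\<close> is at least \<beta> on the inner cube, dividing by
    \<beta> compares the integral over that cube with the energy at time \<tau>.\<close>
  have \<beta>: "0 < \<beta>" by (simp add: \<beta>_def)
  have "(\<integral>\<^sup>+x\<in>aniso_cube p \<rho>. ennreal (u (x, \<tau>) powr r) \<partial>lebesgue) \<le> (\<integral>\<^sup>+x. ennreal (r / \<beta> * ((w \<tau> x + \<nu>) powr r / r * Z x)) \<partial>lebesgue)"
  proof (rule nn_integral_mono_AE, rule AE_completion)
    show "AE x in lborel. ennreal (u (x, \<tau>) powr r) * indicator (aniso_cube p \<rho>) x \<le> ennreal (r / \<beta> * ((w \<tau> x + \<nu>) powr r / r * Z x))"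
      using w(4)[OF T0(2)]
    proof eventually_elim
      case (elim x)
      show ?case
      proof (cases "x \<in> aniso_cube p \<rho>")
        case True
        then have u: "u (x, \<tau>) = w \<tau> x" using elim \<rho>K by blast
        have "exp (- 2 / (6 / 5 - 1)) ^ CARD('n) \<le> \<zeta> x"
          unfolding \<zeta>_def by (rule box_bump_lower[OF _ R0 K\<rho>[OF True]]) simp
        then have "\<beta> \<le> Z x" unfolding \<beta>_def Z_def by (intro power_mono) auto
        then have "1 \<le> 1 / \<beta> * Z x" using \<beta> by simp
        moreover have "w \<tau> x powr r \<le> (w \<tau> x + \<nu>) powr r" using w(2)[of \<tau> x] \<nu>0 r by (intro powr_mono2) auto
        ultimately have "1 * w \<tau> x powr r \<le> (1 / \<beta> * Z x) * (w \<tau> x + \<nu>) powr r" by (intro mult_mono) auto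
        also have "\<dots> = r / \<beta> * ((w \<tau> x + \<nu>) powr r / r * Z x)" using r by simp
        finally show ?thesis using True u by (simp add: ennreal_leI)
      qed simp
    qed
  qed
  also have "\<dots> = ennreal (\<integral>x. r / \<beta> * ((w \<tau> x + \<nu>) powr r / r * Z x) \<partial>lborel)"
    using E_integrable[OF T0(2)] \<beta> r Z0
    by (intro nn_integral_lebesgue_eq_integral integrable_mult_right mult_nonneg_nonneg) auto
  also have "(\<integral>x. r / \<beta> * ((w \<tau> x + \<nu>) powr r / r * Z x) \<partial>lborel) = r / \<beta> * E \<tau>"
    unfolding E_def by (rule integral_mult_right_zero)
  also have "ennreal (r / \<beta> * E \<tau>) \<le> ennreal (r / \<beta> * (2 * (2 powr r / r)) * J + r / \<beta> * (2 * (2 powr r / r * (n powr r * (14 / 5) ^ CARD('n)) +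
          \<Gamma> * (\<Sum>i\<in>UNIV. G i) * (14 / 5) ^ CARD('n))) * (\<Sum>i\<in>UNIV. \<Lambda> i))"
  proof (rule ennreal_leI)
    have "2 powr r / r * (J + \<nu> powr r * measure lborel K) \<le> 2 powr r / r * (J + n powr r * (14 / 5) ^ CARD('n) * (\<Sum>i\<in>UNIV. \<Lambda> i))"
      using \<nu>K r by (intro mult_left_mono) auto
    then have "E \<tau> \<le> 2 * (2 powr r / r * (J + n powr r * (14 / 5) ^ CARD('n) * (\<Sum>i\<in>UNIV. \<Lambda> i)) + \<Gamma> * (\<Sum>i\<in>UNIV. G i) * (14 / 5) ^ CARD('n) * (\<Sum>i\<in>UNIV. \<Lambda> i))"
      by (intro order_trans[OF main mult_left_mono[OF add_mono[OF order_trans[OF E0] c0K]]]) auto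
    then have "r / \<beta> * E \<tau> \<le> r / \<beta> * (2 * (2 powr r / r * (J + n powr r * (14 / 5) ^ CARD('n) * (\<Sum>i\<in>UNIV. \<Lambda> i)) + \<Gamma> * (\<Sum>i\<in>UNIV. G i) * (14 / 5) ^ CARD('n) * (\<Sum>i\<in>UNIV. \<Lambda> i)))"
      using r \<beta> by (intro mult_left_mono) auto
    then show "r / \<beta> * E \<tau> \<le> r / \<beta> * (2 * (2 powr r / r)) * J + r / \<beta> * (2 * (2 powr r / r * (n powr r * (14 / 5) ^ CARD('n)) +
          \<Gamma> * (\<Sum>i\<in>UNIV. G i) * (14 / 5) ^ CARD('n))) * (\<Sum>i\<in>UNIV. \<Lambda> i)"
      by (simp only: distrib_left distrib_right mult_ac add_ac)
  qed
  also have "\<dots> = ennreal (r / \<beta> * (2 * (2 powr r / r))) * ennreal J + ennreal (r / \<beta> * (2 * (2 powr r / r * (n powr r * (14 / 5) ^ CARD('n)) +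
          \<Gamma> * (\<Sum>i\<in>UNIV. G i) * (14 / 5) ^ CARD('n))) * (\<Sum>i\<in>UNIV. \<Lambda> i))"
  proof -
    have "0 \<le> (\<Sum>i\<in>UNIV. G i)" "0 \<le> (\<Sum>i\<in>UNIV. \<Lambda> i)" using \<Lambda>0 by (auto simp: G_def intro!: sum_nonneg)
    then have Y: "0 \<le> r / \<beta> * (2 * (2 powr r / r * (n powr r * (14 / 5) ^ CARD('n)) +
          \<Gamma> * (\<Sum>i\<in>UNIV. G i) * (14 / 5) ^ CARD('n))) * (\<Sum>i\<in>UNIV. \<Lambda> i)"
      using r \<beta> \<Gamma> by simp
    have X: "0 \<le> r / \<beta> * (2 * (2 powr r / r))" using r \<beta> by simp
    show ?thesis by (simp only: ennreal_plus[OF mult_nonneg_nonneg[OF X J0] Y] ennreal_mult[OF X J0])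
  qed
  also have "ennreal J \<le> (\<integral>\<^sup>+x\<in>aniso_cube p (2 * \<rho>). ennreal (u (x, 0) powr r) \<partial>lebesgue)"
  proof -
    have "ennreal J = (\<integral>\<^sup>+x. ennreal (indicator K x * w 0 x powr r) \<partial>lebesgue)"
      unfolding J_def by (rule nn_integral_lebesgue_eq_integral[OF Ji, symmetric]) simp
    also have "\<dots> \<le> (\<integral>\<^sup>+x\<in>aniso_cube p (2 * \<rho>). ennreal (u (x, 0) powr r) \<partial>lebesgue)"
    proof (rule nn_integral_mono_AE, rule AE_completion)
      show "AE x in lborel. ennreal (indicator K x * w 0 x powr r) \<le> ennreal (u (x, 0) powr r) * indicator (aniso_cube p (2 * \<rho>)) x"
        using w(4)[OF T0(1)]
      proof eventually_elim
        case (elim x)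
        show ?case using elim K2 by (cases "x \<in> K") auto
      qed
    qed
    finally show ?thesis .
  qed
  finally show ?thesis unfolding G_def by (simp add: add_right_mono mult_left_mono)
qed

theorem theorem5p5:
  fixes p :: "'n::{finite,linorder} \<Rightarrow> real" and C\<^sub>o C\<^sub>1 r :: real
  assumes "\<forall>i. 1 < p i \<and> p i < 2" and "mono p" and "hmean p < real CARD('n)"
    and "0 < C\<^sub>o" and "0 < C\<^sub>1" and "1 < r"
  shows "\<exists>\<gamma>>0. \<forall>(\<Omega> :: (real, 'n) vec set) T C A B u.
    open \<Omega> \<and> bounded \<Omega> \<and> 0 < T \<and> 0 \<le> C \<and>
    structure_conditions \<Omega> T p C\<^sub>o C\<^sub>1 C A B \<and>
    local_weak_solution \<Omega> T p A B u \<and>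
    (AE z\<in>cylinder \<Omega> T in lebesgue. 0 \<le> u z) \<and>
    locally_bounded (cylinder \<Omega> T) u \<and>
    Lq_loc r (cylinder \<Omega> T) u \<longrightarrow>
    (\<forall>t \<rho>. 0 < t \<and> 0 < \<rho> \<and> aniso_cube p (2 * \<rho>) \<times> {0..t} \<subseteq> cylinder \<Omega> T \<longrightarrow>
      (\<exists>i. C powr p i * \<rho> powr hmean p > min 1 (nu_Sigma p t \<rho> powr p i)) \<or>
      (SUP \<tau>\<in>{0..t}. \<integral>\<^sup>+x\<in>aniso_cube p \<rho>. ennreal (u (x, \<tau>) powr r) \<partial>lebesgue)
        \<le> ennreal \<gamma> * (\<integral>\<^sup>+x\<in>aniso_cube p (2 * \<rho>). ennreal (u (x, 0) powr r) \<partial>lebesgue)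
          + ennreal (\<gamma> * (\<Sum>i\<in>UNIV. (t powr r / \<rho> powr lambda_exp p r i) powr (1 / (2 - p i)))))"
proof -
  have p: "\<And>i. 1 < p i" "\<And>i. p i < 2" using assms(1) by auto
  note r = \<open>1 < r\<close>
  \<comment> \<open>The sum of the thresholds bounds each of them, so one exponent serves all
    directions. It depends on \<open>p\<close> and \<open>r\<close> only, so \<gamma> may depend on
    it.\<close>
  obtain m :: nat where m: "(\<Sum>i\<in>UNIV. 2 + 2 * r / (2 - p i)) \<le> real m" using real_arch_simple by blast
  have nonneg: "0 \<le> 2 + 2 * r / (2 - p i)" for i using p(2)[of i] r by simp
  have mi: "2 + 2 * r / (2 - p i) \<le> real m" for i
    by (rule order_trans[OF member_le_sum m]) (auto intro: nonneg)
  define \<Gamma> where "\<Gamma> = energy_const C\<^sub>o C\<^sub>1 r m"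
  define \<beta> :: real where "\<beta> = (exp (- 2 / (6 / 5 - 1)) ^ CARD('n)) ^ m"
  define n where "n = real CARD('n)"
  define \<gamma>\<^sub>1 where "\<gamma>\<^sub>1 = r / \<beta> * (2 * (2 powr r / r))"
  define \<gamma>\<^sub>2 where "\<gamma>\<^sub>2 = r / \<beta> * (2 * (2 powr r / r * (n powr r * (14 / 5) ^ CARD('n)) +
      \<Gamma> * (\<Sum>i\<in>UNIV. (2 * n * r * \<Gamma>) powr ((r - (2 - p i)) / (2 - p i))) * (14 / 5) ^ CARD('n)))"
  have \<beta>: "0 < \<beta>" by (simp add: \<beta>_def)
  have \<gamma>1: "0 < \<gamma>\<^sub>1" using \<beta> r by (simp add: \<gamma>\<^sub>1_def)
  \<comment> \<open>The witness \<open>\<gamma>\<^sub>1 + \<bar>\<gamma>\<^sub>2\<bar>\<close>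
    dominates both constants; the absolute value replaces a discussion of the sign of
    \<open>\<gamma>\<^sub>2\<close>.\<close>
  show ?thesis
  proof (rule exI[of _ "\<gamma>\<^sub>1 + \<bar>\<gamma>\<^sub>2\<bar>"], intro conjI allI impI)
    show "0 < \<gamma>\<^sub>1 + \<bar>\<gamma>\<^sub>2\<bar>" using \<gamma>1 by simp
    fix \<Omega> :: "(real, 'n) vec set" and T C :: real and A B
      and u :: "(real, 'n) vec \<times> real \<Rightarrow> real" and t \<rho> :: real
    let ?I = "\<integral>\<^sup>+x\<in>aniso_cube p (2 * \<rho>). ennreal (u (x, 0) powr r) \<partial>lebesgue"
    let ?\<Lambda> = "\<Sum>i\<in>UNIV. (t powr r / \<rho> powr lambda_exp p r i) powr (1 / (2 - p i))"
    assume sol: "open \<Omega> \<and> bounded \<Omega> \<and> 0 < T \<and> 0 \<le> C \<and>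
      structure_conditions \<Omega> T p C\<^sub>o C\<^sub>1 C A B \<and> local_weak_solution \<Omega> T p A B u \<and>
      (AE z\<in>cylinder \<Omega> T in lebesgue. 0 \<le> u z) \<and>
      locally_bounded (cylinder \<Omega> T) u \<and> Lq_loc r (cylinder \<Omega> T) u"
    assume cyl: "0 < t \<and> 0 < \<rho> \<and> aniso_cube p (2 * \<rho>) \<times> {0..t} \<subseteq> cylinder \<Omega> T"
    have C: "0 \<le> C" and \<Omega>: "open \<Omega>" and T: "0 < T"
      and str: "structure_conditions \<Omega> T p C\<^sub>o C\<^sub>1 C A B" and subsol: "local_weak_subsolution \<Omega> T p A B u"
      and u: "AE z\<in>cylinder \<Omega> T in lebesgue. 0 \<le> u z" "locally_bounded (cylinder \<Omega> T) u"
      using sol unfolding local_weak_solution_def by blast+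
    have t: "0 < t" and \<rho>: "0 < \<rho>" and cube: "aniso_cube p (2 * \<rho>) \<times> {0..t} \<subseteq> cylinder \<Omega> T"
      using cyl by blast+
    show "(\<exists>i. C powr p i * \<rho> powr hmean p > min 1 (nu_Sigma p t \<rho> powr p i)) \<or>
      (SUP \<tau>\<in>{0..t}. \<integral>\<^sup>+x\<in>aniso_cube p \<rho>. ennreal (u (x, \<tau>) powr r) \<partial>lebesgue)
        \<le> ennreal (\<gamma>\<^sub>1 + \<bar>\<gamma>\<^sub>2\<bar>) * ?I + ennreal ((\<gamma>\<^sub>1 + \<bar>\<gamma>\<^sub>2\<bar>) * ?\<Lambda>)"
    proof (cases "\<exists>i. C powr p i * \<rho> powr hmean p > min 1 (nu_Sigma p t \<rho> powr p i)")
      case False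
      then have small: "C powr p i * \<rho> powr hmean p \<le> min 1 (nu_Sigma p t \<rho> powr p i)" for i
        by (simp add: not_less)
      have "(SUP \<tau>\<in>{0..t}. \<integral>\<^sup>+x\<in>aniso_cube p \<rho>. ennreal (u (x, \<tau>) powr r) \<partial>lebesgue)
        \<le> ennreal (\<gamma>\<^sub>1 + \<bar>\<gamma>\<^sub>2\<bar>) * ?I + ennreal ((\<gamma>\<^sub>1 + \<bar>\<gamma>\<^sub>2\<bar>) * ?\<Lambda>)"
      proof (rule SUP_least)
        fix \<tau> assume \<tau>: "\<tau> \<in> {0..t}"
        have "(\<integral>\<^sup>+x\<in>aniso_cube p \<rho>. ennreal (u (x, \<tau>) powr r) \<partial>lebesgue) \<le> ennreal \<gamma>\<^sub>1 * ?I + ennreal (\<gamma>\<^sub>2 * ?\<Lambda>)"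
          unfolding \<gamma>\<^sub>1_def \<gamma>\<^sub>2_def \<Gamma>_def \<beta>_def n_def
          by (rule local_energy_estimate[OF p r assms(4,5) C mi \<Omega> T str subsol u t \<rho> cube small \<tau>])
        also have "\<dots> \<le> ennreal (\<gamma>\<^sub>1 + \<bar>\<gamma>\<^sub>2\<bar>) * ?I + ennreal ((\<gamma>\<^sub>1 + \<bar>\<gamma>\<^sub>2\<bar>) * ?\<Lambda>)"
        proof (intro add_mono mult_right_mono ennreal_leI)
          show "0 \<le> ?\<Lambda>" by (intro sum_nonneg) simp
        qed (use \<gamma>1 in auto)
        finally show "(\<integral>\<^sup>+x\<in>aniso_cube p \<rho>. ennreal (u (x, \<tau>) powr r) \<partial>lebesgue)
          \<le> ennreal (\<gamma>\<^sub>1 + \<bar>\<gamma>\<^sub>2\<bar>) * ?I + ennreal ((\<gamma>\<^sub>1 + \<bar>\<gamma>\<^sub>2\<bar>) * ?\<Lambda>)" .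
      qed
      then show ?thesis by (rule disjI2)
    qed (rule disjI1)
  qed
qed

end
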